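(* Let $X$ be a smooth $S$-scheme, $G$ a flat $S$-group scheme and $\mathcal{P}$ a connected $G$-gerbe on $X$, with a connection $\epsilon$ and a curving $(K,\kappa)$. Let $\coprod_i U_i$ be an open cover of $X$. Consider two sets of local choices $(x_i,\phi_{ij},\gamma_i,\delta_i)$ and $(x'_i,\phi'_{ij},\gamma'_i,\delta'_i)$ as described in the context, with associated local data $(\lambda_{ij},g_{ijk},m_i,\gamma_{ij},B_i,\nu_i,\delta_{ij},\omega_i)$ and $(\lambda'_{ij},g'_{ijk},m'_i,\gamma'_{ij},B'_i,\nu'_i,\delta'_{ij},\omega'_i)$, and let $\chi_i:x_i\to x'_i$ be arrows in $\mathcal{P}_{U_i}$. Let $(r_i,\theta_{ij},e_i,n_i)$ be the comparison data defined in the context. Then the following equations between differential forms hold (written additively): \begin{enumerate} \item $m'_i={}^{r_i}m_i+r_i\,dr_i^{-1}+i(e_i)$; \item $(\gamma'_{ij}-{}^{\theta_{ij}}r_i(\gamma_{ij}))+(\lambda'_{ij}(e_j)-{}^{\theta_{ij}}e_i)=d\theta_{ij}\,\theta_{ij}^{-1}+[m'_i,\theta_{ij}]$; \item $B'_i=r_i(B_i)-d^1_{m'_i}(-e_i)-n_i$; \item $\nu'_i={}^{r_i}\nu_i+i(n_i)$; \item $(\delta'_{ij}-{}^{\theta_{ij}}r_i(\delta_{ij}))+(\lambda'_{ij}(n_j)-{}^{\theta_{ij}}n_i)=[\nu'_i,\theta_{ij}]$; \item $\omega'_i=r_i(\omega_i)+[{}^{r_i}\nu_i,e_i]-d^2_{m'_i}(n_i)$,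 or equivalently $\omega'_i=r_i(\omega_i)+[\nu'_i,e_i]-d^2_{\mu_i}(n_i)$ where $\mu_i:={}^{r_i}m_i+r_i\,dr_i^{-1}$. \end{enumerate}
   Context: Throughout, $2$ and $3$ are invertible on $S$, and $\mathfrak{g}=\mathrm{Lie}(G)$. **Forms.** For an $S$-scheme $X$, $\Delta^n_{X/S}$ is the scheme of $(n+1)$-tuples $(x_0,\dots,x_n)$ of points of $X$ which are pairwise infinitesimally close to first order (each pair $(x_a,x_b)$ lies in the first-order neighbourhood of the diagonal). $p_a$ and $p_{ab}$ denote the projections to $X$ and to $\Delta^1_{X/S}$; a superscript or subscript $ab$ on an object denotes pullback by $p_{ab}$. For $F=G$ or $F=\mathrm{Aut}(G)$ (sheaf of local automorphisms of $G$), an $F$-valued $n$-form ($n\ge1$) on $X$ is a section of $F$ over $\Delta^n_{X/S}$ whose restriction to the degenerate subsimplex is $1$; for $X/S$ smooth this is the same as a relative $n$-form with values in the Lie algebra of $F$. Group multiplication of forms of the same degree corresponds to addition, and additive notation is used. A local automorphism of $G$ acts on $G$-valued forms by applying it to values. $i:G\to\mathrm{Aut}(G)$ is inner conjugation, $i(\gamma)(g)=\gamma g\gamma^{-1}$. For a section $g$ of $G$ and a $G$-valued form $\omega$, ${}^{g}\omega=g\,\omega\,g^{-1}$ ($g$ evaluated at $x_0$). Brackets: for $G$-valued forms (or $\mathrm{Aut}(G)$-valued forms) of degrees $m,n\geq 1$, $[\omega,\omega'](x_0,\dots,x_{m+n})$ is the commutator of $\omega(x_0,\dots,x_m)$ and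 $\omega'(x_m,\dots,x_{m+n})$, where the commutator of $a,b$ is $aba^{-1}b^{-1}$ (classically the bracket of Lie-algebra-valued forms). For an $\mathrm{Aut}(G)$-valued $m$-form $u$ ($m\ge1$) and a $G$-valued $n$-form $g$ ($n\ge 0$, a $0$-form being a section of $G$), $[u,g](x_0,\dots,x_{m+n})=u(x_0,\dots,x_m)(g(x_m,\dots,x_{m+n}))\,g(x_m,\dots,x_{m+n})^{-1}$. Differentials: for an $\mathrm{Aut}(G)$-valued $1$-form $m$ and a $G$-valued form $\omega$, $d^1_m\omega(x_0,x_1,x_2)=\omega(x_0,x_1)\,m(x_0,x_1)(\omega(x_1,x_2))\,\omega(x_0,x_2)^{-1}$, classically $d\omega+\frac12[\omega,\omega]+[m,\omega]$; and for $n\ge2$, $d^n_m\omega=d\omega+[m,\omega]$ with $d$ the usual (linear) de Rham differential. For an $\mathrm{Aut}(G)$-valued $1$-form $m$, $d^1m(x,y,z)=m(x,y)m(y,z)m(z,x)$, classically $dm+\frac12[m,m]$. For a section $g$ of $G$, $dg\,g^{-1}$ is the $1$-form $g(x_1)g(x_0)^{-1}$. For a section $u$ of $\mathrm{Aut}(G)$, $u\,du^{-1}$ is the $1$-form $u(x_0)u(x_1)^{-1}$, and ${}^{u}m=u\,m\,u^{-1}$ ($u$ evaluated at $x_0$) for an $\mathrm{Aut}(G)$-valued form $m$. **Gerbe.** A $G$-gerbe $\mathcal{P}$ on $X$ comes with, for each object $x\in\mathcal{P}_U$, an isomorphism $G_{|U}\simeq\mathrm{Aut}_{\mathcal{P}_U}(x)$,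 used to identify sections of $G$ with automorphisms of the chosen objects (and of their pullbacks). Connected means that any two objects of $\mathcal{P}_U$ are connected by an arrow in $\mathcal{P}_U$. Composition of arrows is written right to left. Choose objects $x_i\in\mathcal{P}_{U_i}$ and arrows $\phi_{ij}:x_j\to x_i$ in $\mathcal{P}_{U_{ij}}$. $\lambda_{ij}\in\Gamma(U_{ij},\mathrm{Aut}(G))$ is defined by $\phi_{ij}\,\gamma=\lambda_{ij}(\gamma)\,\phi_{ij}$ for all sections $\gamma$ of $G$, and $g_{ijk}\in\Gamma(U_{ijk},G)$ by $\phi_{ij}\phi_{jk}=g_{ijk}\phi_{ik}$. **Connection.** A connection on $\mathcal{P}$ is an equivalence of stacks $\epsilon:p_1^*\mathcal{P}\to p_0^*\mathcal{P}$ over $\Delta^1_{X/S}$ together with a natural isomorphism between its restriction to the diagonal and $1_{\mathcal{P}}$. Choose arrows $\gamma_i:\epsilon\,p_1^*x_i\to p_0^*x_i$ over $\Delta^1_{U_i/S}$ restricting to $1_{x_i}$ on the diagonal. The $\mathrm{Aut}(G)$-valued $1$-form $m_i$ on $U_i$ is defined by $\gamma_i\,\epsilon(g)=m_i(g)\,\gamma_i$ for sections $g$ of $p_1^*G$ (with $p_0^*G$, $p_1^*G$ canonically identified). The $G$-valued $1$-form $\gamma_{ij}$ on $U_{ij}$ is defined by $\gamma_i\circ\epsilon(p_1^*\phi_{ij})=\gamma_{ij}\circ p_0^*\phi_{ij}\circ\gamma_j$. **Curving.** A curving of $(\mathcal{P},\epsilon)$ is a natural isomorphism $K:\epsilon_{01}\epsilon_{12}\Rightarrow\kappa\,\epsilon_{02}$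 of functors $p_2^*\mathcal{P}\to p_0^*\mathcal{P}$ over $\Delta^2_{X/S}$, for some morphism $\kappa:p_0^*\mathcal{P}\to p_0^*\mathcal{P}$ (the fake curvature), trivialized on the degenerate subsimplex. Choose arrows $\delta_i:\kappa\,p_0^*x_i\to p_0^*x_i$ over $\Delta^2_{U_i/S}$ restricting to the identity on the degenerate subsimplex. The $G$-valued $2$-form $B_i$ on $U_i$ is defined by $\gamma_i^{01}\circ\epsilon_{01}(\gamma_i^{12})=B_i\circ\delta_i\circ\kappa(\gamma_i^{02})\circ K(p_2^*x_i)$. Further, $\nu_i:=d^1m_i-i(B_i)$, $\delta_{ij}:=\lambda_{ij}(B_j)-B_i-d^1_{m_i}(-\gamma_{ij})$ and $\omega_i:=d^2_{m_i}(B_i)$. The primed data are defined in the same way from choices $(x'_i,\phi'_{ij},\gamma'_i,\delta'_i)$ (with the same $\epsilon,K,\kappa$). **Comparison data.** $r_i\in\Gamma(U_i,\mathrm{Aut}(G))$ is defined by $\chi_i\,u=r_i(u)\,\chi_i$ for sections $u$ of $G$; $\theta_{ij}\in\Gamma(U_{ij},G)$ by $\phi'_{ij}\circ\chi_j=\theta_{ij}\circ\chi_i\circ\phi_{ij}$; the $G$-valued $1$-form $e_i$ on $U_i$ by $\gamma'_i\circ\epsilon(p_1^*\chi_i)=e_i\circ p_0^*\chi_i\circ\gamma_i$; the $G$-valued $2$-form $n_i$ on $U_i$ by $\delta'_i\circ\kappa(p_0^*\chi_i)=n_i\circ p_0^*\chi_i\circ\delta_i$. *)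

theory Defs
  imports "HOL-Algebra.Module" "HOL-Algebra.Ideal" "HOL-Algebra.Bij"
begin

text \<open>
  Schemes are treated by their functors of points (Demazure--Gabriel).  The type \<^typ>\<open>'u\<close>
  bounds the size of the rings: \<^typ>\<open>'u ring\<close> plays the role of the category of commutative rings
  in a fixed universe, and it is assumed infinite where it is used, so that polynomial rings,
  quotients, localisations and tensor products of such rings exist again (up to isomorphism)
  on \<^typ>\<open>'u\<close>.  Geometrically a ring \<open>R\<close> is the affine scheme \<open>Spec R\<close>, and a homomorphism
  \<open>R \<rightarrow> T\<close> is a morphism \<open>Spec T \<rightarrow> Spec R\<close>.
\<close>

section \<open>Functors on rings, sieves and topologies\<close>

text \<open>Homomorphisms are made extensional, so that rings really form a category.\<close>

definition Hom :: "'u ring \<Rightarrow> 'u ring \<Rightarrow> ('u \<Rightarrow> 'u) set" where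
  "Hom R T = ring_hom R T \<inter> extensional (carrier R)"

definition idhom :: "'u ring \<Rightarrow> 'u \<Rightarrow> 'u" where
  "idhom R = (\<lambda>a\<in>carrier R. a)"

definition hcomp :: "'u ring \<Rightarrow> ('u \<Rightarrow> 'u) \<Rightarrow> ('u \<Rightarrow> 'u) \<Rightarrow> 'u \<Rightarrow> 'u" where
  "hcomp R h f = compose (carrier R) h f"

record ('u, 'x) psh =
  pts :: "'u ring \<Rightarrow> 'x set"
  res :: "'u ring \<Rightarrow> 'u ring \<Rightarrow> ('u \<Rightarrow> 'u) \<Rightarrow> 'x \<Rightarrow> 'x"

definition is_psh :: "('u, 'x, 'z) psh_scheme \<Rightarrow> bool" where
  "is_psh F \<longleftrightarrow>
     (\<forall>R T. cring R \<and> cring T \<longrightarrow> (\<forall>f\<in>Hom R T. \<forall>x\<in>pts F R. res F R T f x \<in> pts F T)) \<and>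
     (\<forall>R. cring R \<longrightarrow> (\<forall>x\<in>pts F R. res F R R (idhom R) x = x)) \<and>
     (\<forall>R T W. cring R \<and> cring T \<and> cring W \<longrightarrow>
        (\<forall>f\<in>Hom R T. \<forall>h\<in>Hom T W. \<forall>x\<in>pts F R.
           res F R W (hcomp R h f) x = res F T W h (res F R T f x)))"

text \<open>A sieve on \<open>Spec R\<close>, as a set of pairs \<open>(T, f)\<close> with \<open>f : R \<rightarrow> T\<close>.\<close>

type_synonym 'u sieve = "('u ring \<times> ('u \<Rightarrow> 'u)) set"

definition sieves :: "'u ring \<Rightarrow> 'u sieve set" where
  "sieves R = {C. (\<forall>(T, f)\<in>C. cring T \<and> f \<in> Hom R T) \<and>
     (\<forall>(T, f)\<in>C. \<forall>W. cring W \<longrightarrow> (\<forall>h\<in>Hom T W. (W, hcomp R h f) \<in> C))}"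

definition pullback_sieve :: "'u ring \<Rightarrow> 'u ring \<Rightarrow> ('u \<Rightarrow> 'u) \<Rightarrow> 'u sieve \<Rightarrow> 'u sieve" where
  "pullback_sieve R T f C = {(W, h). cring W \<and> h \<in> Hom T W \<and> (W, hcomp R h f) \<in> C}"

text \<open>
  A homomorphism \<open>R \<rightarrow> T\<close> factors through the localisation \<open>R\<^sub>a\<close> iff it maps \<open>a\<close> to a unit; so the
  sieve generated by the standard open cover of \<open>Spec R\<close> attached to \<open>A \<subseteq> R\<close> generating the unit
  ideal is the set of homomorphisms inverting some \<open>a \<in> A\<close>.
\<close>

definition zariski :: "'u ring \<Rightarrow> 'u sieve set" where
  "zariski R = {C \<in> sieves R. \<exists>A \<subseteq> carrier R. genideal R A = carrier R \<and>
     (\<forall>a\<in>A. \<forall>T. cring T \<longrightarrow> (\<forall>f\<in>Hom R T. f a \<in> Units T \<longrightarrow> (T, f) \<in> C))}"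

definition grothendieck_topology :: "('u ring \<Rightarrow> 'u sieve set) \<Rightarrow> bool" where
  "grothendieck_topology J \<longleftrightarrow> (\<forall>R. cring R \<longrightarrow>
     J R \<subseteq> sieves R \<and>
     {(T, f). cring T \<and> f \<in> Hom R T} \<in> J R \<and>
     (\<forall>C\<in>J R. \<forall>T. cring T \<longrightarrow> (\<forall>f\<in>Hom R T. pullback_sieve R T f C \<in> J T)) \<and>
     (\<forall>C\<in>J R. \<forall>D\<in>sieves R. (\<forall>(T, f)\<in>C. pullback_sieve R T f D \<in> J T) \<longrightarrow> D \<in> J R))"

section \<open>Schemes\<close>

definition zariski_sheaf :: "('u, 'x, 'z) psh_scheme \<Rightarrow> bool" where
  "zariski_sheaf F \<longleftrightarrow> (\<forall>R. cring R \<longrightarrow> (\<forall>C\<in>zariski R. \<forall>s.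
     (\<forall>(T, f)\<in>C. s T f \<in> pts F T \<and>
        (\<forall>W. cring W \<longrightarrow> (\<forall>h\<in>Hom T W. res F T W h (s T f) = s W (hcomp R h f)))) \<longrightarrow>
     (\<exists>!x. x \<in> pts F R \<and> (\<forall>(T, f)\<in>C. res F R T f x = s T f))))"

definition subfunctor :: "('u, 'x, 'z) psh_scheme \<Rightarrow> ('u ring \<Rightarrow> 'x set) \<Rightarrow> bool" where
  "subfunctor F U \<longleftrightarrow> (\<forall>R. cring R \<longrightarrow> U R \<subseteq> pts F R \<and>
     (\<forall>T. cring T \<longrightarrow> (\<forall>f\<in>Hom R T. \<forall>x\<in>U R. res F R T f x \<in> U T)))"

text \<open>
  Over each \<open>Spec R \<rightarrow> F\<close> the subfunctor is the open subscheme of \<open>Spec R\<close> that is the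
  complement of \<open>V(\<aa>)\<close>, whose \<open>T\<close>-points are the \<open>f : R \<rightarrow> T\<close> with \<open>f(\<aa>)T = T\<close>.
\<close>

definition open_sub :: "('u, 'x, 'z) psh_scheme \<Rightarrow> ('u ring \<Rightarrow> 'x set) \<Rightarrow> bool" where
  "open_sub F U \<longleftrightarrow> subfunctor F U \<and>
     (\<forall>R. cring R \<longrightarrow> (\<forall>x\<in>pts F R. \<exists>\<aa>. ideal \<aa> R \<and>
        (\<forall>T. cring T \<longrightarrow> (\<forall>f\<in>Hom R T.
           res F R T f x \<in> U T \<longleftrightarrow> genideal T (f ` \<aa>) = carrier T))))"

text \<open>\<open>U\<close> is represented by the ring \<open>A\<close>, with universal point \<open>u\<close>.\<close>

definition represented :: "('u, 'x, 'z) psh_scheme \<Rightarrow> ('u ring \<Rightarrow> 'x set) \<Rightarrow> 'u ring \<Rightarrow> 'x \<Rightarrow> bool" where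
  "represented F U A u \<longleftrightarrow> cring A \<and> u \<in> U A \<and>
     (\<forall>R. cring R \<longrightarrow> bij_betw (\<lambda>f. res F A R f u) (Hom A R) (U R))"

text \<open>Open subfunctors cover iff they do so on field-valued points.\<close>

definition open_cover :: "('u, 'x, 'z) psh_scheme \<Rightarrow> 'i set \<Rightarrow> ('i \<Rightarrow> 'u ring \<Rightarrow> 'x set) \<Rightarrow> bool" where
  "open_cover F I U \<longleftrightarrow> (\<forall>i\<in>I. open_sub F (U i)) \<and>
     (\<forall>k. field k \<longrightarrow> pts F k \<subseteq> (\<Union>i\<in>I. U i k))"

definition is_scheme :: "('u, 'x, 'z) psh_scheme \<Rightarrow> bool" where
  "is_scheme F \<longleftrightarrow> is_psh F \<and> zariski_sheaf F \<and>
     (\<exists>\<U>. open_cover F \<U> (\<lambda>U. U) \<and> (\<forall>U\<in>\<U>. \<exists>A u. represented F U A u))"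

record ('u, 'x, 's) over_sch = "('u, 'x) psh" +
  str :: "'u ring \<Rightarrow> 'x \<Rightarrow> 's"

definition scheme_over :: "('u, 's) psh \<Rightarrow> ('u, 'x, 's, 'z) over_sch_scheme \<Rightarrow> bool" where
  "scheme_over S X \<longleftrightarrow> is_scheme X \<and>
     (\<forall>R. cring R \<longrightarrow> (\<forall>x\<in>pts X R. str X R x \<in> pts S R \<and>
        (\<forall>T. cring T \<longrightarrow> (\<forall>f\<in>Hom R T. str X T (res X R T f x) = res S R T f (str X R x)))))"

text \<open>
  A property \<open>Q\<close> of ring homomorphisms \<open>B \<rightarrow> A\<close> holds locally on \<open>X\<close>: every point lies in an
  affine open \<open>U = Spec A\<close> mapping into an affine open \<open>V = Spec B\<close> of \<open>S\<close> such that \<open>Q\<close> holds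
  for the comorphism.
\<close>

definition locally_on_source ::
  "('u ring \<Rightarrow> 'u ring \<Rightarrow> ('u \<Rightarrow> 'u) \<Rightarrow> bool) \<Rightarrow> ('u, 's) psh \<Rightarrow> ('u, 'x, 's, 'z) over_sch_scheme \<Rightarrow> bool"
  where
  "locally_on_source Q S X \<longleftrightarrow> (\<forall>k. field k \<longrightarrow> (\<forall>x\<in>pts X k.
     \<exists>U A u V B v \<phi>. x \<in> U k \<and> open_sub X U \<and> represented X U A u \<and>
       open_sub S V \<and> represented S V B v \<and>
       \<phi> \<in> Hom B A \<and> str X A u = res S B A \<phi> v \<and> Q B A \<phi>))"

section \<open>Smoothness and flatness\<close>

text \<open>Polynomial expressions with coefficients in a ring, in variables indexed by \<^typ>\<open>nat\<close>.\<close>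

datatype 'u pexp = PConst 'u | PVar nat | PAdd "'u pexp" "'u pexp" | PMult "'u pexp" "'u pexp"

primrec pexp_over :: "'u ring \<Rightarrow> nat \<Rightarrow> 'u pexp \<Rightarrow> bool" where
  "pexp_over B n (PConst b) \<longleftrightarrow> b \<in> carrier B"
| "pexp_over B n (PVar k) \<longleftrightarrow> k < n"
| "pexp_over B n (PAdd p q) \<longleftrightarrow> pexp_over B n p \<and> pexp_over B n q"
| "pexp_over B n (PMult p q) \<longleftrightarrow> pexp_over B n p \<and> pexp_over B n q"

primrec pexp_eval :: "'u ring \<Rightarrow> ('u \<Rightarrow> 'u) \<Rightarrow> (nat \<Rightarrow> 'u) \<Rightarrow> 'u pexp \<Rightarrow> 'u" where
  "pexp_eval C \<psi> c (PConst b) = \<psi> b"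
| "pexp_eval C \<psi> c (PVar k) = c k"
| "pexp_eval C \<psi> c (PAdd p q) = pexp_eval C \<psi> c p \<oplus>\<^bsub>C\<^esub> pexp_eval C \<psi> c q"
| "pexp_eval C \<psi> c (PMult p q) = pexp_eval C \<psi> c p \<otimes>\<^bsub>C\<^esub> pexp_eval C \<psi> c q"

text \<open>
  \<open>A\<close> is \<open>B[t\<^sub>0, \<dots>, t\<^bsub>n-1\<^esub>]/(E)\<close> with \<open>E\<close> finite and \<open>t\<^sub>k \<mapsto> b k\<close>, expressed by the
  universal property of this quotient among \<open>B\<close>-algebras.
\<close>

definition finitely_presented :: "'u ring \<Rightarrow> 'u ring \<Rightarrow> ('u \<Rightarrow> 'u) \<Rightarrow> bool" where
  "finitely_presented B A \<phi> \<longleftrightarrow> (\<exists>n b E. finite E \<and> (\<forall>p\<in>E. pexp_over B n p) \<and>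
     (\<forall>k<n. b k \<in> carrier A) \<and> (\<forall>p\<in>E. pexp_eval A \<phi> b p = \<zero>\<^bsub>A\<^esub>) \<and>
     (\<forall>C \<psi> c. cring C \<and> \<psi> \<in> Hom B C \<and> (\<forall>k<n. c k \<in> carrier C) \<and>
         (\<forall>p\<in>E. pexp_eval C \<psi> c p = \<zero>\<^bsub>C\<^esub>) \<longrightarrow>
       (\<exists>!h. h \<in> Hom A C \<and> hcomp B h \<phi> = \<psi> \<and> (\<forall>k<n. h (b k) = c k))))"

text \<open>Infinitesimal lifting along \<open>R \<rightarrow> R'\<close> surjective with kernel of square zero.\<close>

definition formally_smooth :: "('u, 's) psh \<Rightarrow> ('u, 'x, 's, 'z) over_sch_scheme \<Rightarrow> bool" where
  "formally_smooth S X \<longleftrightarrow> (\<forall>R R'. cring R \<and> cring R' \<longrightarrow> (\<forall>f\<in>Hom R R'.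
     f ` carrier R = carrier R' \<and>
     (\<forall>a\<in>carrier R. \<forall>b\<in>carrier R. f a = \<zero>\<^bsub>R'\<^esub> \<and> f b = \<zero>\<^bsub>R'\<^esub> \<longrightarrow> a \<otimes>\<^bsub>R\<^esub> b = \<zero>\<^bsub>R\<^esub>) \<longrightarrow>
     (\<forall>s\<in>pts S R. \<forall>x'\<in>pts X R'. str X R' x' = res S R R' f s \<longrightarrow>
        (\<exists>x\<in>pts X R. str X R x = s \<and> res X R R' f x = x'))))"

definition smooth_scheme :: "('u, 's) psh \<Rightarrow> ('u, 'x, 's, 'z) over_sch_scheme \<Rightarrow> bool" where
  "smooth_scheme S X \<longleftrightarrow> scheme_over S X \<and> locally_on_source finitely_presented S X \<and>
     formally_smooth S X"

definition module_map :: "'u ring \<Rightarrow> ('u, 'u) module \<Rightarrow> ('u, 'u) module \<Rightarrow> ('u \<Rightarrow> 'u) \<Rightarrow> bool" where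
  "module_map B N N' h \<longleftrightarrow> h \<in> carrier N \<rightarrow> carrier N' \<and>
     (\<forall>x\<in>carrier N. \<forall>y\<in>carrier N. h (x \<oplus>\<^bsub>N\<^esub> y) = h x \<oplus>\<^bsub>N'\<^esub> h y) \<and>
     (\<forall>b\<in>carrier B. \<forall>x\<in>carrier N. h (b \<odot>\<^bsub>N\<^esub> x) = b \<odot>\<^bsub>N'\<^esub> h x)"

definition bilinear_map ::
  "'u ring \<Rightarrow> ('u, 'u) module \<Rightarrow> ('u, 'u) module \<Rightarrow> ('u, 'u) module \<Rightarrow> ('u \<Rightarrow> 'u \<Rightarrow> 'u) \<Rightarrow> bool" where
  "bilinear_map B N M T t \<longleftrightarrow>
     (\<forall>x\<in>carrier N. module_map B M T (t x)) \<and> (\<forall>y\<in>carrier M. module_map B N T (\<lambda>x. t x y))"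

definition tensor_product ::
  "'u ring \<Rightarrow> ('u, 'u) module \<Rightarrow> ('u, 'u) module \<Rightarrow> ('u, 'u) module \<Rightarrow> ('u \<Rightarrow> 'u \<Rightarrow> 'u) \<Rightarrow> bool" where
  "tensor_product B N M T t \<longleftrightarrow> module B T \<and> bilinear_map B N M T t \<and>
     (\<forall>L l. module B L \<and> bilinear_map B N M L l \<longrightarrow>
        (\<exists>!h. h \<in> extensional (carrier T) \<and> module_map B T L h \<and>
              (\<forall>x\<in>carrier N. \<forall>y\<in>carrier M. h (t x y) = l x y)))"

definition flat_module :: "'u ring \<Rightarrow> ('u, 'u) module \<Rightarrow> bool" where
  "flat_module B M \<longleftrightarrow> module B M \<and>
     (\<forall>N N' h T t T' t' k. module B N \<and> module B N' \<and> module_map B N N' h \<and>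
        inj_on h (carrier N) \<and>
        tensor_product B N M T t \<and> tensor_product B N' M T' t' \<and> module_map B T T' k \<and>
        (\<forall>x\<in>carrier N. \<forall>y\<in>carrier M. k (t x y) = t' (h x) y) \<longrightarrow> inj_on k (carrier T))"

definition restrict_scalars :: "'u ring \<Rightarrow> ('u \<Rightarrow> 'u) \<Rightarrow> ('u, 'u) module" where
  "restrict_scalars A \<phi> =
     \<lparr>carrier = carrier A, mult = mult A, one = one A, zero = zero A, add = add A,
      smult = (\<lambda>b a. \<phi> b \<otimes>\<^bsub>A\<^esub> a)\<rparr>"

definition flat_hom :: "'u ring \<Rightarrow> 'u ring \<Rightarrow> ('u \<Rightarrow> 'u) \<Rightarrow> bool" where
  "flat_hom B A \<phi> \<longleftrightarrow> flat_module B (restrict_scalars A \<phi>)"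

section \<open>Group schemes\<close>

record ('u, 'g, 's) group_sch = "('u, 'g, 's) over_sch" +
  gmult :: "'u ring \<Rightarrow> 'g \<Rightarrow> 'g \<Rightarrow> 'g"
  gunit :: "'u ring \<Rightarrow> 's \<Rightarrow> 'g"

text \<open>The group of sections of \<open>G\<close> over \<open>s : Spec R \<rightarrow> S\<close>.\<close>

definition grp :: "('u, 'g, 's) group_sch \<Rightarrow> 'u ring \<Rightarrow> 's \<Rightarrow> 'g monoid" where
  "grp G R s = \<lparr>carrier = {g \<in> pts G R. str G R g = s}, mult = gmult G R, one = gunit G R s\<rparr>"

definition group_scheme :: "('u, 's) psh \<Rightarrow> ('u, 'g, 's) group_sch \<Rightarrow> bool" where
  "group_scheme S G \<longleftrightarrow> scheme_over S G \<and>
     (\<forall>R. cring R \<longrightarrow> (\<forall>s\<in>pts S R. group (grp G R s) \<and>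
        (\<forall>T. cring T \<longrightarrow> (\<forall>f\<in>Hom R T. res G R T f \<in> hom (grp G R s) (grp G T (res S R T f s))))))"

definition flat_group_scheme :: "('u, 's) psh \<Rightarrow> ('u, 'g, 's) group_sch \<Rightarrow> bool" where
  "flat_group_scheme S G \<longleftrightarrow> group_scheme S G \<and> locally_on_source flat_hom S G"

definition two_three_invertible :: "('u, 's) psh \<Rightarrow> bool" where
  "two_three_invertible S \<longleftrightarrow> (\<forall>R. cring R \<and> pts S R \<noteq> {} \<longrightarrow>
     \<one>\<^bsub>R\<^esub> \<oplus>\<^bsub>R\<^esub> \<one>\<^bsub>R\<^esub> \<in> Units R \<and> \<one>\<^bsub>R\<^esub> \<oplus>\<^bsub>R\<^esub> \<one>\<^bsub>R\<^esub> \<oplus>\<^bsub>R\<^esub> \<one>\<^bsub>R\<^esub> \<in> Units R)"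

section \<open>Infinitesimal simplices\<close>

text \<open>
  \<open>(x, y) : Spec R \<rightarrow> X \<times>\<^sub>S X\<close> factors through the first-order neighbourhood of the diagonal: the
  inverse image of the diagonal under \<open>(x, y)\<close> is a closed subscheme \<open>V(\<nn>)\<close> of \<open>Spec R\<close> with
  \<open>\<nn>\<^sup>2 = 0\<close>; here \<open>\<nn>\<close> is generated by the pullback of the ideal of the diagonal.
\<close>

definition near :: "('u, 'x, 's, 'z) over_sch_scheme \<Rightarrow> 'u ring \<Rightarrow> 'x \<Rightarrow> 'x \<Rightarrow> bool" where
  "near X R x y \<longleftrightarrow> str X R x = str X R y \<and>
     (\<exists>\<nn>. ideal \<nn> R \<and> (\<forall>a\<in>\<nn>. \<forall>b\<in>\<nn>. a \<otimes>\<^bsub>R\<^esub> b = \<zero>\<^bsub>R\<^esub>) \<and>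
        (\<forall>T. cring T \<longrightarrow> (\<forall>f\<in>Hom R T.
           res X R T f x = res X R T f y \<longleftrightarrow> f ` \<nn> \<subseteq> {\<zero>\<^bsub>T\<^esub>})))"

text \<open>
  A subfunctor \<open>U\<close> as a functor, the functor \<open>\<Delta>\<^sup>n\<close> of \<open>U\<close> over \<open>S\<close>, and its degenerate subsimplex,
  the union of the images of the degeneracies.  Simplices are lists \<open>[x\<^sub>0, \<dots>, x\<^sub>n]\<close>.
  The union is taken on points.  For \<open>X\<close> smooth and \<open>G\<close> flat this makes no difference: a section
  of \<open>G\<close> or \<open>Aut(G)\<close> is \<open>1\<close> on the scheme-theoretic union iff it is \<open>1\<close> on the image of each
  degeneracy.
\<close>

definition sub :: "('u, 'x, 'z) psh_scheme \<Rightarrow> ('u ring \<Rightarrow> 'x set) \<Rightarrow> ('u, 'x) psh" where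
  "sub X U = \<lparr>pts = U, res = res X\<rparr>"

definition simplex ::
  "('u, 'x, 's, 'z) over_sch_scheme \<Rightarrow> nat \<Rightarrow> ('u ring \<Rightarrow> 'x set) \<Rightarrow> ('u, 'x list) psh" where
  "simplex X n U =
     \<lparr>pts = (\<lambda>R. {xs. length xs = Suc n \<and> set xs \<subseteq> U R \<and> (\<forall>x\<in>set xs. \<forall>y\<in>set xs. near X R x y)}),
      res = (\<lambda>R T f. map (res X R T f))\<rparr>"

definition degenerate :: "'x list \<Rightarrow> bool" where
  "degenerate xs \<longleftrightarrow> (\<exists>a. Suc a < length xs \<and> xs ! a = xs ! Suc a)"

definition degen_simplex ::
  "('u, 'x, 's, 'z) over_sch_scheme \<Rightarrow> nat \<Rightarrow> ('u ring \<Rightarrow> 'x set) \<Rightarrow> ('u, 'x list) psh" where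
  "degen_simplex X n U =
     \<lparr>pts = (\<lambda>R. {xs \<in> pts (simplex X n U) R. degenerate xs}), res = res (simplex X n U)\<rparr>"

section \<open>Sections and forms with values in \<open>G\<close> and \<open>Aut(G)\<close>\<close>

definition G_at :: "('u, 'x, 's) over_sch \<Rightarrow> ('u, 'g, 's) group_sch \<Rightarrow> 'u ring \<Rightarrow> 'x \<Rightarrow> 'g monoid" where
  "G_at X G R x = grp G R (str X R x)"

text \<open>
  Sections over a functor \<open>Y\<close> mapping to \<open>X\<close> by \<open>q\<close>.  By Yoneda, a section of the sheaf of local
  automorphisms of \<open>G\<close> over \<open>Y\<close> is a natural family of automorphisms of the groups \<open>G(R)\<close> attached
  to the points \<open>Spec R \<rightarrow> Y\<close>.
\<close>

definition G_section ::
  "('u, 'x, 's) over_sch \<Rightarrow> ('u, 'g, 's) group_sch \<Rightarrow> ('u, 'y) psh \<Rightarrow> ('y \<Rightarrow> 'x) \<Rightarrow>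
   ('u ring \<Rightarrow> 'y \<Rightarrow> 'g) \<Rightarrow> bool" where
  "G_section X G Y q g \<longleftrightarrow> (\<forall>R. cring R \<longrightarrow> (\<forall>y\<in>pts Y R.
     g R y \<in> carrier (G_at X G R (q y)) \<and>
     (\<forall>T. cring T \<longrightarrow> (\<forall>f\<in>Hom R T. res G R T f (g R y) = g T (res Y R T f y)))))"

definition Aut_section ::
  "('u, 'x, 's) over_sch \<Rightarrow> ('u, 'g, 's) group_sch \<Rightarrow> ('u, 'y) psh \<Rightarrow> ('y \<Rightarrow> 'x) \<Rightarrow>
   ('u ring \<Rightarrow> 'y \<Rightarrow> 'g \<Rightarrow> 'g) \<Rightarrow> bool" where
  "Aut_section X G Y q u \<longleftrightarrow> (\<forall>R. cring R \<longrightarrow> (\<forall>y\<in>pts Y R.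
     u R y \<in> carrier (AutoGroup (G_at X G R (q y))) \<and>
     (\<forall>T. cring T \<longrightarrow> (\<forall>f\<in>Hom R T. \<forall>h\<in>carrier (G_at X G R (q y)).
        res G R T f (u R y h) = u T (res Y R T f y) (res G R T f h)))))"

text \<open>
  The groups in which the values of \<open>G\<close>- and \<open>Aut(G)\<close>-valued forms at a simplex lie; all vertices
  of a simplex have the same image in \<open>S\<close>.
\<close>

definition G_val :: "('u, 'x, 's) over_sch \<Rightarrow> ('u, 'g, 's) group_sch \<Rightarrow> 'u ring \<Rightarrow> 'x list \<Rightarrow> 'g monoid" where
  "G_val X G R xs = G_at X G R (hd xs)"

definition Aut_val ::
  "('u, 'x, 's) over_sch \<Rightarrow> ('u, 'g, 's) group_sch \<Rightarrow> 'u ring \<Rightarrow> 'x list \<Rightarrow> ('g \<Rightarrow> 'g) monoid" where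
  "Aut_val X G R xs = AutoGroup (G_at X G R (hd xs))"

definition vanishes_on_degenerate ::
  "('u, 'x, 's) over_sch \<Rightarrow> nat \<Rightarrow> ('u ring \<Rightarrow> 'x set) \<Rightarrow> ('u ring \<Rightarrow> 'x list \<Rightarrow> 'v monoid) \<Rightarrow>
   ('u ring \<Rightarrow> 'x list \<Rightarrow> 'v) \<Rightarrow> bool" where
  "vanishes_on_degenerate X n U M \<omega> \<longleftrightarrow>
     (\<forall>R. cring R \<longrightarrow> (\<forall>xs\<in>pts (degen_simplex X n U) R. \<omega> R xs = \<one>\<^bsub>M R xs\<^esub>))"

definition G_form ::
  "('u, 'x, 's) over_sch \<Rightarrow> ('u, 'g, 's) group_sch \<Rightarrow> nat \<Rightarrow> ('u ring \<Rightarrow> 'x set) \<Rightarrow>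
   ('u ring \<Rightarrow> 'x list \<Rightarrow> 'g) \<Rightarrow> bool" where
  "G_form X G n U \<omega> \<longleftrightarrow>
     G_section X G (simplex X n U) hd \<omega> \<and> vanishes_on_degenerate X n U (G_val X G) \<omega>"

definition Aut_form ::
  "('u, 'x, 's) over_sch \<Rightarrow> ('u, 'g, 's) group_sch \<Rightarrow> nat \<Rightarrow> ('u ring \<Rightarrow> 'x set) \<Rightarrow>
   ('u ring \<Rightarrow> 'x list \<Rightarrow> 'g \<Rightarrow> 'g) \<Rightarrow> bool" where
  "Aut_form X G n U \<omega> \<longleftrightarrow>
     Aut_section X G (simplex X n U) hd \<omega> \<and> vanishes_on_degenerate X n U (Aut_val X G) \<omega>"

definition form_eq ::
  "('u, 'x, 's) over_sch \<Rightarrow> nat \<Rightarrow> ('u ring \<Rightarrow> 'x set) \<Rightarrow>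
   ('u ring \<Rightarrow> 'x list \<Rightarrow> 'v) \<Rightarrow> ('u ring \<Rightarrow> 'x list \<Rightarrow> 'v) \<Rightarrow> bool" where
  "form_eq X n U \<omega> \<omega>' \<longleftrightarrow> (\<forall>R. cring R \<longrightarrow> (\<forall>xs\<in>pts (simplex X n U) R. \<omega> R xs = \<omega>' R xs))"

section \<open>Operations on forms\<close>

text \<open>
  In what follows \<open>M\<close> is \<^const>\<open>G_val\<close> or \<^const>\<open>Aut_val\<close>; the additive notation stands for the
  group law on values.
\<close>

definition fadd ::
  "('u ring \<Rightarrow> 'x list \<Rightarrow> 'v monoid) \<Rightarrow> ('u ring \<Rightarrow> 'x list \<Rightarrow> 'v) \<Rightarrow> ('u ring \<Rightarrow> 'x list \<Rightarrow> 'v) \<Rightarrow>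
   'u ring \<Rightarrow> 'x list \<Rightarrow> 'v" (infixl \<open>\<boxplus>\<index>\<close> 65) where
  "fadd M \<omega> \<omega>' = (\<lambda>R xs. \<omega> R xs \<otimes>\<^bsub>M R xs\<^esub> \<omega>' R xs)"

definition fneg ::
  "('u ring \<Rightarrow> 'x list \<Rightarrow> 'v monoid) \<Rightarrow> ('u ring \<Rightarrow> 'x list \<Rightarrow> 'v) \<Rightarrow> 'u ring \<Rightarrow> 'x list \<Rightarrow> 'v" where
  "fneg M \<omega> = (\<lambda>R xs. inv\<^bsub>M R xs\<^esub> (\<omega> R xs))"

definition fsub ::
  "('u ring \<Rightarrow> 'x list \<Rightarrow> 'v monoid) \<Rightarrow> ('u ring \<Rightarrow> 'x list \<Rightarrow> 'v) \<Rightarrow> ('u ring \<Rightarrow> 'x list \<Rightarrow> 'v) \<Rightarrow>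
   'u ring \<Rightarrow> 'x list \<Rightarrow> 'v" (infixl \<open>\<boxminus>\<index>\<close> 65) where
  "fsub M \<omega> \<omega>' = fadd M \<omega> (fneg M \<omega>')"

text \<open>\<open>\<^sup>g\<omega> = g \<omega> g\<^sup>-\<^sup>1\<close> for a section \<open>g\<close>.\<close>

definition conj_form ::
  "('u ring \<Rightarrow> 'x list \<Rightarrow> 'v monoid) \<Rightarrow> ('u ring \<Rightarrow> 'x \<Rightarrow> 'v) \<Rightarrow> ('u ring \<Rightarrow> 'x list \<Rightarrow> 'v) \<Rightarrow>
   'u ring \<Rightarrow> 'x list \<Rightarrow> 'v" where
  "conj_form M g \<omega> =
     (\<lambda>R xs. g R (hd xs) \<otimes>\<^bsub>M R xs\<^esub> \<omega> R xs \<otimes>\<^bsub>M R xs\<^esub> inv\<^bsub>M R xs\<^esub> (g R (hd xs)))"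

text \<open>The action \<open>u(\<omega>)\<close> of a section \<open>u\<close> of \<open>Aut(G)\<close>.\<close>

definition act_form ::
  "('u ring \<Rightarrow> 'x \<Rightarrow> 'g \<Rightarrow> 'g) \<Rightarrow> ('u ring \<Rightarrow> 'x list \<Rightarrow> 'g) \<Rightarrow> 'u ring \<Rightarrow> 'x list \<Rightarrow> 'g" where
  "act_form u \<omega> = (\<lambda>R xs. u R (hd xs) (\<omega> R xs))"

text \<open>\<open>i(\<omega>)\<close> for inner conjugation \<open>i : G \<rightarrow> Aut(G)\<close>.\<close>

definition inner_form ::
  "('u ring \<Rightarrow> 'x list \<Rightarrow> 'g monoid) \<Rightarrow> ('u ring \<Rightarrow> 'x list \<Rightarrow> 'g) \<Rightarrow> 'u ring \<Rightarrow> 'x list \<Rightarrow> 'g \<Rightarrow> 'g" where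
  "inner_form M \<omega> = (\<lambda>R xs. \<lambda>h\<in>carrier (M R xs).
     \<omega> R xs \<otimes>\<^bsub>M R xs\<^esub> h \<otimes>\<^bsub>M R xs\<^esub> inv\<^bsub>M R xs\<^esub> (\<omega> R xs))"

text \<open>A section of \<open>G\<close> as a form of degree \<open>0\<close>.\<close>

definition zero_form :: "('u ring \<Rightarrow> 'x \<Rightarrow> 'v) \<Rightarrow> 'u ring \<Rightarrow> 'x list \<Rightarrow> 'v" where
  "zero_form g = (\<lambda>R xs. g R (hd xs))"

text \<open>
  \<open>[u, \<omega>]\<close> for an \<open>Aut(G)\<close>-valued form \<open>u\<close> of degree \<open>k\<close> and a \<open>G\<close>-valued form \<open>\<omega>\<close>.
\<close>

definition bracket ::
  "('u ring \<Rightarrow> 'x list \<Rightarrow> 'g monoid) \<Rightarrow> nat \<Rightarrow> ('u ring \<Rightarrow> 'x list \<Rightarrow> 'g \<Rightarrow> 'g) \<Rightarrow>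
   ('u ring \<Rightarrow> 'x list \<Rightarrow> 'g) \<Rightarrow> 'u ring \<Rightarrow> 'x list \<Rightarrow> 'g" where
  "bracket M k u \<omega> = (\<lambda>R xs. u R (take (Suc k) xs) (\<omega> R (drop k xs))
     \<otimes>\<^bsub>M R xs\<^esub> inv\<^bsub>M R xs\<^esub> (\<omega> R (drop k xs)))"

text \<open>
  The linear de Rham differential in degree \<open>n\<close>: under the identification of combinatorial with
  classical forms (for which the cup product is the wedge product) it is the alternating sum over
  the faces.
\<close>

definition face :: "nat \<Rightarrow> 'x list \<Rightarrow> 'x list" where
  "face a xs = take a xs @ drop (Suc a) xs"

definition de_rham ::
  "('u ring \<Rightarrow> 'x list \<Rightarrow> 'v monoid) \<Rightarrow> nat \<Rightarrow> ('u ring \<Rightarrow> 'x list \<Rightarrow> 'v) \<Rightarrow> 'u ring \<Rightarrow> 'x list \<Rightarrow> 'v" where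
  "de_rham M n \<omega> = (\<lambda>R xs. foldr (\<lambda>a t.
      (if even a then \<omega> R (face a xs) else inv\<^bsub>M R xs\<^esub> (\<omega> R (face a xs))) \<otimes>\<^bsub>M R xs\<^esub> t)
      [0..<n + 2] \<one>\<^bsub>M R xs\<^esub>)"

text \<open>\<open>d\<^sup>1\<^sub>m \<omega>\<close>, and \<open>d\<^sup>n\<^sub>m \<omega>\<close> for \<open>n \<ge> 2\<close>.\<close>

definition twisted_d1 ::
  "('u ring \<Rightarrow> 'x list \<Rightarrow> 'g monoid) \<Rightarrow> ('u ring \<Rightarrow> 'x list \<Rightarrow> 'g \<Rightarrow> 'g) \<Rightarrow>
   ('u ring \<Rightarrow> 'x list \<Rightarrow> 'g) \<Rightarrow> 'u ring \<Rightarrow> 'x list \<Rightarrow> 'g" where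
  "twisted_d1 M m \<omega> = (\<lambda>R xs. \<omega> R [xs ! 0, xs ! 1]
     \<otimes>\<^bsub>M R xs\<^esub> m R [xs ! 0, xs ! 1] (\<omega> R [xs ! 1, xs ! 2])
     \<otimes>\<^bsub>M R xs\<^esub> inv\<^bsub>M R xs\<^esub> (\<omega> R [xs ! 0, xs ! 2]))"

definition twisted_d ::
  "('u ring \<Rightarrow> 'x list \<Rightarrow> 'g monoid) \<Rightarrow> nat \<Rightarrow> ('u ring \<Rightarrow> 'x list \<Rightarrow> 'g \<Rightarrow> 'g) \<Rightarrow>
   ('u ring \<Rightarrow> 'x list \<Rightarrow> 'g) \<Rightarrow> 'u ring \<Rightarrow> 'x list \<Rightarrow> 'g" where
  "twisted_d M n m \<omega> = de_rham M n \<omega> \<boxplus>\<^bsub>M\<^esub> bracket M 1 m \<omega>"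

text \<open>\<open>d\<^sup>1 m\<close> for an \<open>Aut(G)\<close>-valued \<open>1\<close>-form.\<close>

definition curvature ::
  "('u ring \<Rightarrow> 'x list \<Rightarrow> 'v monoid) \<Rightarrow> ('u ring \<Rightarrow> 'x list \<Rightarrow> 'v) \<Rightarrow> 'u ring \<Rightarrow> 'x list \<Rightarrow> 'v" where
  "curvature A m = (\<lambda>R xs. m R [xs ! 0, xs ! 1] \<otimes>\<^bsub>A R xs\<^esub> m R [xs ! 1, xs ! 2]
     \<otimes>\<^bsub>A R xs\<^esub> m R [xs ! 2, xs ! 0])"

text \<open>The \<open>1\<close>-forms \<open>dg g\<^sup>-\<^sup>1\<close> and \<open>u du\<^sup>-\<^sup>1\<close>.\<close>

definition dlog_right ::
  "('u ring \<Rightarrow> 'x list \<Rightarrow> 'v monoid) \<Rightarrow> ('u ring \<Rightarrow> 'x \<Rightarrow> 'v) \<Rightarrow> 'u ring \<Rightarrow> 'x list \<Rightarrow> 'v" where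
  "dlog_right M g = (\<lambda>R xs. g R (xs ! 1) \<otimes>\<^bsub>M R xs\<^esub> inv\<^bsub>M R xs\<^esub> (g R (xs ! 0)))"

definition u_du_inv ::
  "('u ring \<Rightarrow> 'x list \<Rightarrow> 'v monoid) \<Rightarrow> ('u ring \<Rightarrow> 'x \<Rightarrow> 'v) \<Rightarrow> 'u ring \<Rightarrow> 'x list \<Rightarrow> 'v" where
  "u_du_inv A u = (\<lambda>R xs. u R (xs ! 0) \<otimes>\<^bsub>A R xs\<^esub> inv\<^bsub>A R xs\<^esub> (u R (xs ! 1)))"

section \<open>Stacks in groupoids over \<open>X\<close>\<close>

text \<open>
  A category fibred in groupoids over the category of affine schemes over \<open>X\<close>.  An object \<open>y\<close> lies
  over the point \<open>Pt y\<close> of \<open>X\<close> with values in \<open>Rng y\<close>; an arrow \<open>a : z \<rightarrow> y\<close> lies over the morphism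
  \<open>Spec (Rng z) \<rightarrow> Spec (Rng y)\<close> with comorphism \<open>Rhom a : Rng y \<rightarrow> Rng z\<close>.
  \<open>Comp P a b\<close> is \<open>a\<close> after \<open>b\<close>.
\<close>

record ('u, 'x, 'o, 'a) fibcat =
  Obj :: "'o set"
  Arr :: "'a set"
  Dom :: "'a \<Rightarrow> 'o"
  Cod :: "'a \<Rightarrow> 'o"
  Comp :: "'a \<Rightarrow> 'a \<Rightarrow> 'a"
  Ident :: "'o \<Rightarrow> 'a"
  Rng :: "'o \<Rightarrow> 'u ring"
  Pt :: "'o \<Rightarrow> 'x"
  Rhom :: "'a \<Rightarrow> 'u \<Rightarrow> 'u"

definition arrow_over ::
  "('u, 'x, 'o, 'a) fibcat \<Rightarrow> ('u \<Rightarrow> 'u) \<Rightarrow> 'o \<Rightarrow> 'o \<Rightarrow> 'a \<Rightarrow> bool" where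
  "arrow_over P f z y a \<longleftrightarrow> a \<in> Arr P \<and> Dom P a = z \<and> Cod P a = y \<and> Rhom P a = f"

text \<open>Arrows of the fibre categories.\<close>

definition vertical :: "('u, 'x, 'o, 'a) fibcat \<Rightarrow> 'o \<Rightarrow> 'o \<Rightarrow> 'a \<Rightarrow> bool" where
  "vertical P z y a \<longleftrightarrow>
     Rng P z = Rng P y \<and> Pt P z = Pt P y \<and> arrow_over P (idhom (Rng P y)) z y a"

definition category_over :: "('u, 'x, 'z) psh_scheme \<Rightarrow> ('u, 'x, 'o, 'a) fibcat \<Rightarrow> bool" where
  "category_over X P \<longleftrightarrow>
     (\<forall>y\<in>Obj P. cring (Rng P y) \<and> Pt P y \<in> pts X (Rng P y) \<and> vertical P y y (Ident P y)) \<and>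
     (\<forall>a\<in>Arr P. Dom P a \<in> Obj P \<and> Cod P a \<in> Obj P \<and>
        Rhom P a \<in> Hom (Rng P (Cod P a)) (Rng P (Dom P a)) \<and>
        Pt P (Dom P a) = res X (Rng P (Cod P a)) (Rng P (Dom P a)) (Rhom P a) (Pt P (Cod P a)) \<and>
        Comp P a (Ident P (Dom P a)) = a \<and> Comp P (Ident P (Cod P a)) a = a) \<and>
     (\<forall>a\<in>Arr P. \<forall>b\<in>Arr P. Dom P a = Cod P b \<longrightarrow>
        arrow_over P (hcomp (Rng P (Cod P a)) (Rhom P b) (Rhom P a)) (Dom P b) (Cod P a) (Comp P a b)) \<and>
     (\<forall>a\<in>Arr P. \<forall>b\<in>Arr P. \<forall>c\<in>Arr P. Dom P a = Cod P b \<and> Dom P b = Cod P c \<longrightarrow>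
        Comp P (Comp P a b) c = Comp P a (Comp P b c))"

definition fibred_in_groupoids :: "('u, 'x, 'z) psh_scheme \<Rightarrow> ('u, 'x, 'o, 'a) fibcat \<Rightarrow> bool" where
  "fibred_in_groupoids X P \<longleftrightarrow> category_over X P \<and>
     (\<forall>y\<in>Obj P. \<forall>T. cring T \<longrightarrow> (\<forall>f\<in>Hom (Rng P y) T. \<exists>z a. Rng P z = T \<and> arrow_over P f z y a)) \<and>
     (\<forall>a\<in>Arr P. \<forall>b\<in>Arr P. Cod P a = Cod P b \<longrightarrow>
        (\<forall>h\<in>Hom (Rng P (Dom P a)) (Rng P (Dom P b)).
           Rhom P b = hcomp (Rng P (Cod P a)) h (Rhom P a) \<longrightarrow>
           (\<exists>!c. arrow_over P h (Dom P b) (Dom P a) c \<and> Comp P a c = b)))"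

text \<open>
  A descent datum on a sieve is a (cartesian) functor from the sieve to \<open>P\<close>; it is
  effective if it has a cocone.  That the arrow between two cocones exists and is unique says
  that arrows form a sheaf.
\<close>

definition descent_datum ::
  "('u, 'x, 'z) psh_scheme \<Rightarrow> ('u, 'x, 'o, 'a) fibcat \<Rightarrow> 'u ring \<Rightarrow> 'x \<Rightarrow> 'u sieve \<Rightarrow>
   ('u ring \<Rightarrow> ('u \<Rightarrow> 'u) \<Rightarrow> 'o) \<Rightarrow> ('u ring \<Rightarrow> ('u \<Rightarrow> 'u) \<Rightarrow> 'u ring \<Rightarrow> ('u \<Rightarrow> 'u) \<Rightarrow> 'a) \<Rightarrow> bool" where
  "descent_datum X P R x C D \<rho> \<longleftrightarrow> (\<forall>(T, f)\<in>C.
     D T f \<in> Obj P \<and> Rng P (D T f) = T \<and> Pt P (D T f) = res X R T f x \<and>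
     \<rho> T f T (idhom T) = Ident P (D T f) \<and>
     (\<forall>W. cring W \<longrightarrow> (\<forall>h\<in>Hom T W. arrow_over P h (D W (hcomp R h f)) (D T f) (\<rho> T f W h) \<and>
        (\<forall>V. cring V \<longrightarrow> (\<forall>k\<in>Hom W V.
           \<rho> T f V (hcomp T k h) = Comp P (\<rho> T f W h) (\<rho> W (hcomp R h f) V k))))))"

definition cocone ::
  "('u, 'x, 'o, 'a) fibcat \<Rightarrow> 'u ring \<Rightarrow> 'x \<Rightarrow> 'u sieve \<Rightarrow>
   ('u ring \<Rightarrow> ('u \<Rightarrow> 'u) \<Rightarrow> 'o) \<Rightarrow> ('u ring \<Rightarrow> ('u \<Rightarrow> 'u) \<Rightarrow> 'u ring \<Rightarrow> ('u \<Rightarrow> 'u) \<Rightarrow> 'a) \<Rightarrow>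
   'o \<Rightarrow> ('u ring \<Rightarrow> ('u \<Rightarrow> 'u) \<Rightarrow> 'a) \<Rightarrow> bool" where
  "cocone P R x C D \<rho> y e \<longleftrightarrow> y \<in> Obj P \<and> Rng P y = R \<and> Pt P y = x \<and>
     (\<forall>(T, f)\<in>C. arrow_over P f (D T f) y (e T f) \<and>
        (\<forall>W. cring W \<longrightarrow> (\<forall>h\<in>Hom T W. Comp P (e T f) (\<rho> T f W h) = e W (hcomp R h f))))"

definition stack ::
  "('u ring \<Rightarrow> 'u sieve set) \<Rightarrow> ('u, 'x, 'z) psh_scheme \<Rightarrow> ('u, 'x, 'o, 'a) fibcat \<Rightarrow> bool" where
  "stack J X P \<longleftrightarrow> fibred_in_groupoids X P \<and>
     (\<forall>R. cring R \<longrightarrow> (\<forall>x\<in>pts X R. \<forall>C\<in>J R. \<forall>D \<rho>. descent_datum X P R x C D \<rho> \<longrightarrow>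
        (\<exists>y e. cocone P R x C D \<rho> y e) \<and>
        (\<forall>y e z e'. cocone P R x C D \<rho> y e \<and> cocone P R x C D \<rho> z e' \<longrightarrow>
           (\<exists>!c. vertical P y z c \<and> (\<forall>(T, f)\<in>C. Comp P c (e T f) = e' T f)))))"

text \<open>
  Objects over a functor \<open>Y\<close> that need not be affine are cartesian sections: objects \<open>fst \<sigma> R y\<close>
  over all \<open>y : Spec R \<rightarrow> Y\<close>, together with transition arrows \<open>snd \<sigma> R T f y\<close> over all \<open>f : R \<rightarrow> T\<close>.
\<close>

type_synonym ('u, 'y, 'o, 'a) sect =
  "('u ring \<Rightarrow> 'y \<Rightarrow> 'o) \<times> ('u ring \<Rightarrow> 'u ring \<Rightarrow> ('u \<Rightarrow> 'u) \<Rightarrow> 'y \<Rightarrow> 'a)"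

definition sect_obj ::
  "('u, 'x, 'o, 'a) fibcat \<Rightarrow> ('u, 'y) psh \<Rightarrow> ('y \<Rightarrow> 'x) \<Rightarrow> ('u, 'y, 'o, 'a) sect \<Rightarrow> bool" where
  "sect_obj P Y q \<sigma> \<longleftrightarrow> (\<forall>R. cring R \<longrightarrow> (\<forall>y\<in>pts Y R.
     fst \<sigma> R y \<in> Obj P \<and> Rng P (fst \<sigma> R y) = R \<and> Pt P (fst \<sigma> R y) = q y \<and>
     snd \<sigma> R R (idhom R) y = Ident P (fst \<sigma> R y) \<and>
     (\<forall>T. cring T \<longrightarrow> (\<forall>f\<in>Hom R T.
        arrow_over P f (fst \<sigma> T (res Y R T f y)) (fst \<sigma> R y) (snd \<sigma> R T f y) \<and>
        (\<forall>W. cring W \<longrightarrow> (\<forall>h\<in>Hom T W.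
           snd \<sigma> R W (hcomp R h f) y = Comp P (snd \<sigma> R T f y) (snd \<sigma> T W h (res Y R T f y))))))))"

definition sect_arrow ::
  "('u, 'x, 'o, 'a) fibcat \<Rightarrow> ('u, 'y) psh \<Rightarrow> ('u, 'y, 'o, 'a) sect \<Rightarrow> ('u, 'y, 'o, 'a) sect \<Rightarrow>
   ('u ring \<Rightarrow> 'y \<Rightarrow> 'a) \<Rightarrow> bool" where
  "sect_arrow P Y \<sigma> \<sigma>' \<alpha> \<longleftrightarrow> (\<forall>R. cring R \<longrightarrow> (\<forall>y\<in>pts Y R.
     vertical P (fst \<sigma> R y) (fst \<sigma>' R y) (\<alpha> R y) \<and>
     (\<forall>T. cring T \<longrightarrow> (\<forall>f\<in>Hom R T.
        Comp P (\<alpha> R y) (snd \<sigma> R T f y) = Comp P (snd \<sigma>' R T f y) (\<alpha> T (res Y R T f y))))))"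

definition sect_pull :: "('y \<Rightarrow> 'x) \<Rightarrow> ('u, 'x, 'o, 'a) sect \<Rightarrow> ('u, 'y, 'o, 'a) sect" where
  "sect_pull q \<sigma> = ((\<lambda>R y. fst \<sigma> R (q y)), (\<lambda>R T f y. snd \<sigma> R T f (q y)))"

section \<open>Gerbes\<close>

definition Aut_grp :: "('u, 'x, 'o, 'a) fibcat \<Rightarrow> 'o \<Rightarrow> 'a monoid" where
  "Aut_grp P y = \<lparr>carrier = {a. vertical P y y a}, mult = Comp P, one = Ident P y\<rparr>"

text \<open>
  An isomorphism between \<open>G\<close> (restricted to \<open>Spec R\<close>) and the sheaf \<open>Aut(y)\<close>, for \<open>y\<close> over
  \<open>Spec R\<close>.  The sections of \<open>Aut(y)\<close> over \<open>Spec T \<rightarrow> Spec R\<close> are the automorphisms of any inverse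
  image \<open>a : z \<rightarrow> y\<close> of \<open>y\<close>, whence the indexing by \<open>a\<close>.
\<close>

definition Aut_iso_affine ::
  "('u, 'x, 's) over_sch \<Rightarrow> ('u, 'g, 's) group_sch \<Rightarrow> ('u, 'x, 'o, 'a) fibcat \<Rightarrow> 'o \<Rightarrow>
   ('a \<Rightarrow> 'g \<Rightarrow> 'a) \<Rightarrow> bool" where
  "Aut_iso_affine X G P y j \<longleftrightarrow> (\<forall>a\<in>Arr P. Cod P a = y \<longrightarrow>
     j a \<in> iso (G_at X G (Rng P (Dom P a)) (Pt P (Dom P a))) (Aut_grp P (Dom P a)) \<and>
     (\<forall>b\<in>Arr P. Cod P b = Dom P a \<longrightarrow>
        (\<forall>g\<in>carrier (G_at X G (Rng P (Dom P a)) (Pt P (Dom P a))).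
           Comp P (j a g) b =
           Comp P b (j (Comp P a b) (res G (Rng P (Dom P a)) (Rng P (Dom P b)) (Rhom P b) g)))))"

text \<open>An isomorphism between \<open>G\<close> restricted to \<open>Y\<close> and \<open>Aut(\<sigma>)\<close>, for an object \<open>\<sigma>\<close> over \<open>Y\<close>.\<close>

definition Aut_iso ::
  "('u, 'x, 's) over_sch \<Rightarrow> ('u, 'g, 's) group_sch \<Rightarrow> ('u, 'x, 'o, 'a) fibcat \<Rightarrow>
   ('u, 'y) psh \<Rightarrow> ('y \<Rightarrow> 'x) \<Rightarrow> ('u, 'y, 'o, 'a) sect \<Rightarrow> ('u ring \<Rightarrow> 'y \<Rightarrow> 'g \<Rightarrow> 'a) \<Rightarrow> bool" where
  "Aut_iso X G P Y q \<sigma> j \<longleftrightarrow> (\<forall>R. cring R \<longrightarrow> (\<forall>y\<in>pts Y R.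
     j R y \<in> iso (G_at X G R (q y)) (Aut_grp P (fst \<sigma> R y)) \<and>
     (\<forall>T. cring T \<longrightarrow> (\<forall>f\<in>Hom R T. \<forall>g\<in>carrier (G_at X G R (q y)).
        Comp P (j R y g) (snd \<sigma> R T f y) =
        Comp P (snd \<sigma> R T f y) (j T (res Y R T f y) (res G R T f g))))))"

text \<open>
  \<open>iota U \<sigma>\<close> is the identification of \<open>G\<close> with \<open>Aut(\<sigma>)\<close> that comes with the gerbe, for an object
  \<open>\<sigma>\<close> over an open subscheme \<open>U\<close> of \<open>X\<close>.  It is not required to be compatible with arrows between
  different objects.
\<close>

definition gerbe ::
  "('u ring \<Rightarrow> 'u sieve set) \<Rightarrow> ('u, 'x, 's) over_sch \<Rightarrow> ('u, 'g, 's) group_sch \<Rightarrow>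
   ('u, 'x, 'o, 'a) fibcat \<Rightarrow>
   (('u ring \<Rightarrow> 'x set) \<Rightarrow> ('u, 'x, 'o, 'a) sect \<Rightarrow> 'u ring \<Rightarrow> 'x \<Rightarrow> 'g \<Rightarrow> 'a) \<Rightarrow> bool" where
  "gerbe J X G P iota \<longleftrightarrow> stack J X P \<and>
     (\<forall>R. cring R \<longrightarrow> (\<forall>x\<in>pts X R.
        {(T, f). cring T \<and> f \<in> Hom R T \<and>
           (\<exists>y\<in>Obj P. Rng P y = T \<and> Pt P y = res X R T f x)} \<in> J R)) \<and>
     (\<forall>y\<in>Obj P. \<forall>z\<in>Obj P. Rng P y = Rng P z \<and> Pt P y = Pt P z \<longrightarrow>
        {(T, f). cring T \<and> f \<in> Hom (Rng P y) T \<and>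
           (\<exists>w b c. Rng P w = T \<and> arrow_over P f w y b \<and> arrow_over P f w z c)} \<in> J (Rng P y)) \<and>
     (\<forall>y\<in>Obj P. \<exists>j. Aut_iso_affine X G P y j) \<and>
     (\<forall>U \<sigma>. open_sub X U \<and> sect_obj P (sub X U) (\<lambda>x. x) \<sigma> \<longrightarrow>
        Aut_iso X G P (sub X U) (\<lambda>x. x) \<sigma> (iota U \<sigma>))"

text \<open>Connectedness is asked for objects over open subschemes of \<open>X\<close> only.\<close>

definition connected_gerbe ::
  "('u ring \<Rightarrow> 'u sieve set) \<Rightarrow> ('u, 'x, 's) over_sch \<Rightarrow> ('u, 'g, 's) group_sch \<Rightarrow>
   ('u, 'x, 'o, 'a) fibcat \<Rightarrow>
   (('u ring \<Rightarrow> 'x set) \<Rightarrow> ('u, 'x, 'o, 'a) sect \<Rightarrow> 'u ring \<Rightarrow> 'x \<Rightarrow> 'g \<Rightarrow> 'a) \<Rightarrow> bool" where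
  "connected_gerbe J X G P iota \<longleftrightarrow> gerbe J X G P iota \<and>
     (\<forall>U \<sigma> \<sigma>'. open_sub X U \<and> sect_obj P (sub X U) (\<lambda>x. x) \<sigma> \<and> sect_obj P (sub X U) (\<lambda>x. x) \<sigma>' \<longrightarrow>
        (\<exists>\<alpha>. sect_arrow P (sub X U) \<sigma> \<sigma>' \<alpha>))"

section \<open>Morphisms between inverse images of a stack\<close>

text \<open>
  A morphism \<open>F : q\<^sup>*P \<rightarrow> q'\<^sup>*P\<close> over \<open>Y\<close>, where \<open>q\<close> and \<open>q'\<close> map \<open>Y\<close> to \<open>X\<close>.  The fibre of \<open>q\<^sup>*P\<close>
  at \<open>y\<close> is the fibre of \<open>P\<close> at \<open>q y\<close>; \<open>fst F y\<close> is the action on its objects, and \<open>snd F y\<close> the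
  action on the arrows whose codomain lies in it.
\<close>

type_synonym ('y, 'o, 'a) fmor = "('y \<Rightarrow> 'o \<Rightarrow> 'o) \<times> ('y \<Rightarrow> 'a \<Rightarrow> 'a)"

definition stack_mor ::
  "('u, 'x, 'o, 'a) fibcat \<Rightarrow> ('u, 'y) psh \<Rightarrow> ('y \<Rightarrow> 'x) \<Rightarrow> ('y \<Rightarrow> 'x) \<Rightarrow> ('y, 'o, 'a) fmor \<Rightarrow> bool" where
  "stack_mor P Y q q' F \<longleftrightarrow>
     (\<forall>z\<in>Obj P. \<forall>y\<in>pts Y (Rng P z). q y = Pt P z \<longrightarrow>
        fst F y z \<in> Obj P \<and> Rng P (fst F y z) = Rng P z \<and> Pt P (fst F y z) = q' y \<and>
        snd F y (Ident P z) = Ident P (fst F y z)) \<and>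
     (\<forall>a\<in>Arr P. \<forall>y\<in>pts Y (Rng P (Cod P a)). q y = Pt P (Cod P a) \<longrightarrow>
        (let y' = res Y (Rng P (Cod P a)) (Rng P (Dom P a)) (Rhom P a) y in
           arrow_over P (Rhom P a) (fst F y' (Dom P a)) (fst F y (Cod P a)) (snd F y a) \<and>
           (\<forall>b\<in>Arr P. Cod P b = Dom P a \<longrightarrow>
              snd F y (Comp P a b) = Comp P (snd F y a) (snd F y' b))))"

definition mor_id :: "('y, 'o, 'a) fmor" where
  "mor_id = ((\<lambda>y z. z), (\<lambda>y a. a))"

definition mor_comp :: "('y, 'o, 'a) fmor \<Rightarrow> ('y, 'o, 'a) fmor \<Rightarrow> ('y, 'o, 'a) fmor" where
  "mor_comp F F' = ((\<lambda>y z. fst F y (fst F' y z)), (\<lambda>y a. snd F y (snd F' y a)))"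

definition mor_pull :: "('w \<Rightarrow> 'y) \<Rightarrow> ('y, 'o, 'a) fmor \<Rightarrow> ('w, 'o, 'a) fmor" where
  "mor_pull p F = ((\<lambda>w. fst F (p w)), (\<lambda>w. snd F (p w)))"

text \<open>The image of an object over \<open>Y\<close> under a morphism.\<close>

definition mor_app :: "('y, 'o, 'a) fmor \<Rightarrow> ('u, 'y, 'o, 'a) sect \<Rightarrow> ('u, 'y, 'o, 'a) sect" where
  "mor_app F \<sigma> = ((\<lambda>R y. fst F y (fst \<sigma> R y)), (\<lambda>R T f y. snd F y (snd \<sigma> R T f y)))"

text \<open>
  Natural transformations \<open>F \<Rightarrow> F'\<close> of morphisms out of \<open>q\<^sup>*P\<close>; they are isomorphisms, the fibres
  being groupoids.
\<close>

definition nat_iso ::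
  "('u, 'x, 'o, 'a) fibcat \<Rightarrow> ('u, 'y) psh \<Rightarrow> ('y \<Rightarrow> 'x) \<Rightarrow> ('y, 'o, 'a) fmor \<Rightarrow> ('y, 'o, 'a) fmor \<Rightarrow>
   ('y \<Rightarrow> 'o \<Rightarrow> 'a) \<Rightarrow> bool" where
  "nat_iso P Y q F F' N \<longleftrightarrow>
     (\<forall>z\<in>Obj P. \<forall>y\<in>pts Y (Rng P z). q y = Pt P z \<longrightarrow>
        vertical P (fst F y z) (fst F' y z) (N y z)) \<and>
     (\<forall>a\<in>Arr P. \<forall>y\<in>pts Y (Rng P (Cod P a)). q y = Pt P (Cod P a) \<longrightarrow>
        Comp P (N y (Cod P a)) (snd F y a) =
        Comp P (snd F' y a)
          (N (res Y (Rng P (Cod P a)) (Rng P (Dom P a)) (Rhom P a) y) (Dom P a)))"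

definition stack_equiv ::
  "('u, 'x, 'o, 'a) fibcat \<Rightarrow> ('u, 'y) psh \<Rightarrow> ('y \<Rightarrow> 'x) \<Rightarrow> ('y \<Rightarrow> 'x) \<Rightarrow> ('y, 'o, 'a) fmor \<Rightarrow> bool" where
  "stack_equiv P Y q q' F \<longleftrightarrow> stack_mor P Y q q' F \<and>
     (\<exists>F' N N'. stack_mor P Y q' q F' \<and>
        nat_iso P Y q (mor_comp F' F) mor_id N \<and> nat_iso P Y q' (mor_comp F F') mor_id N')"

section \<open>Connections and curvings\<close>

text \<open>
  \<open>eta\<close> is the natural isomorphism between the restriction of \<open>eps\<close> to the diagonal and the
  identity of \<open>P\<close>.
\<close>

definition connection ::
  "('u, 'x, 's) over_sch \<Rightarrow> ('u, 'x, 'o, 'a) fibcat \<Rightarrow> ('x list, 'o, 'a) fmor \<Rightarrow> ('x \<Rightarrow> 'o \<Rightarrow> 'a) \<Rightarrow> bool" where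
  "connection X P eps eta \<longleftrightarrow>
     stack_equiv P (simplex X 1 (pts X)) (\<lambda>xs. xs ! 1) (\<lambda>xs. xs ! 0) eps \<and>
     nat_iso P (sub X (pts X)) (\<lambda>x. x) (mor_pull (\<lambda>x. [x, x]) eps) mor_id eta"

definition eps_ab :: "('x list, 'o, 'a) fmor \<Rightarrow> nat \<Rightarrow> nat \<Rightarrow> ('x list, 'o, 'a) fmor" where
  "eps_ab eps a b = mor_pull (\<lambda>xs. [xs ! a, xs ! b]) eps"

text \<open>
  The trivialisation of \<open>(K, kappa)\<close> on the degenerate subsimplex consists of an isomorphism \<open>tau\<close>
  from the restriction of \<open>kappa\<close> to the identity, under which \<open>K\<close> becomes the
  canonical isomorphism \<open>\<epsilon>\<^sub>0\<^sub>1 \<epsilon>\<^sub>1\<^sub>2 \<Rightarrow> \<epsilon>\<^sub>0\<^sub>2\<close> given by \<open>eta\<close> where \<open>x\<^sub>0 = x\<^sub>1\<close> or \<open>x\<^sub>1 = x\<^sub>2\<close>.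
\<close>

definition curving ::
  "('u, 'x, 's) over_sch \<Rightarrow> ('u, 'x, 'o, 'a) fibcat \<Rightarrow> ('x list, 'o, 'a) fmor \<Rightarrow> ('x \<Rightarrow> 'o \<Rightarrow> 'a) \<Rightarrow>
   ('x list \<Rightarrow> 'o \<Rightarrow> 'a) \<Rightarrow> ('x list, 'o, 'a) fmor \<Rightarrow> ('x list \<Rightarrow> 'o \<Rightarrow> 'a) \<Rightarrow> bool" where
  "curving X P eps eta K kappa tau \<longleftrightarrow>
     stack_mor P (simplex X 2 (pts X)) (\<lambda>xs. xs ! 0) (\<lambda>xs. xs ! 0) kappa \<and>
     nat_iso P (simplex X 2 (pts X)) (\<lambda>xs. xs ! 2)
       (mor_comp (eps_ab eps 0 1) (eps_ab eps 1 2)) (mor_comp kappa (eps_ab eps 0 2)) K \<and>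
     nat_iso P (degen_simplex X 2 (pts X)) (\<lambda>xs. xs ! 0) kappa mor_id tau \<and>
     (\<forall>z\<in>Obj P. \<forall>xs\<in>pts (simplex X 2 (pts X)) (Rng P z). xs ! 2 = Pt P z \<longrightarrow>
        (xs ! 0 = xs ! 1 \<longrightarrow>
           Comp P (tau xs (fst eps [xs ! 0, xs ! 2] z)) (K xs z) =
           eta (xs ! 0) (fst eps [xs ! 1, xs ! 2] z)) \<and>
        (xs ! 1 = xs ! 2 \<longrightarrow>
           Comp P (tau xs (fst eps [xs ! 0, xs ! 2] z)) (K xs z) =
           snd eps [xs ! 0, xs ! 1] (eta (xs ! 2) z)))"

section \<open>Local choices, local data and comparison data\<close>

definition inter2 :: "('i \<Rightarrow> 'u ring \<Rightarrow> 'x set) \<Rightarrow> 'i \<Rightarrow> 'i \<Rightarrow> 'u ring \<Rightarrow> 'x set" where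
  "inter2 U i j = (\<lambda>R. U i R \<inter> U j R)"

definition inter3 :: "('i \<Rightarrow> 'u ring \<Rightarrow> 'x set) \<Rightarrow> 'i \<Rightarrow> 'i \<Rightarrow> 'i \<Rightarrow> 'u ring \<Rightarrow> 'x set" where
  "inter3 U i j k = (\<lambda>R. U i R \<inter> U j R \<inter> U k R)"

definition local_choices ::
  "('u, 'x, 's) over_sch \<Rightarrow> ('u, 'x, 'o, 'a) fibcat \<Rightarrow>
   ('x list, 'o, 'a) fmor \<Rightarrow> ('x \<Rightarrow> 'o \<Rightarrow> 'a) \<Rightarrow> ('x list, 'o, 'a) fmor \<Rightarrow> ('x list \<Rightarrow> 'o \<Rightarrow> 'a) \<Rightarrow>
   'i set \<Rightarrow> ('i \<Rightarrow> 'u ring \<Rightarrow> 'x set) \<Rightarrow>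
   ('i \<Rightarrow> ('u, 'x, 'o, 'a) sect) \<Rightarrow> ('i \<Rightarrow> 'i \<Rightarrow> 'u ring \<Rightarrow> 'x \<Rightarrow> 'a) \<Rightarrow>
   ('i \<Rightarrow> 'u ring \<Rightarrow> 'x list \<Rightarrow> 'a) \<Rightarrow> ('i \<Rightarrow> 'u ring \<Rightarrow> 'x list \<Rightarrow> 'a) \<Rightarrow> bool" where
  "local_choices X P eps eta kappa tau I U x phi gam del \<longleftrightarrow>
     (\<forall>i\<in>I. sect_obj P (sub X (U i)) (\<lambda>p. p) (x i)) \<and>
     (\<forall>i\<in>I. \<forall>j\<in>I. sect_arrow P (sub X (inter2 U i j)) (x j) (x i) (phi i j)) \<and>
     (\<forall>i\<in>I. sect_arrow P (simplex X 1 (U i))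
        (mor_app eps (sect_pull (\<lambda>xs. xs ! 1) (x i))) (sect_pull (\<lambda>xs. xs ! 0) (x i)) (gam i)) \<and>
     (\<forall>i\<in>I. \<forall>R. cring R \<longrightarrow> (\<forall>p\<in>U i R. gam i R [p, p] = eta p (fst (x i) R p))) \<and>
     (\<forall>i\<in>I. sect_arrow P (simplex X 2 (U i))
        (mor_app kappa (sect_pull (\<lambda>xs. xs ! 0) (x i))) (sect_pull (\<lambda>xs. xs ! 0) (x i)) (del i)) \<and>
     (\<forall>i\<in>I. \<forall>R. cring R \<longrightarrow> (\<forall>xs\<in>pts (degen_simplex X 2 (U i)) R.
        del i R xs = tau xs (fst (x i) R (xs ! 0))))"

text \<open>
  The local data \<open>\<lambda>\<^sub>i\<^sub>j, g\<^sub>i\<^sub>j\<^sub>k, m\<^sub>i, \<gamma>\<^sub>i\<^sub>j, B\<^sub>i, \<nu>\<^sub>i, \<delta>\<^sub>i\<^sub>j, \<omega>\<^sub>i\<close> attached to local choices; \<open>j i\<close> is the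
  identification of \<open>G\<close> with \<open>Aut(x\<^sub>i)\<close>.  The defining equations determine the data.
\<close>

definition local_data ::
  "('u, 'x, 's) over_sch \<Rightarrow> ('u, 'g, 's) group_sch \<Rightarrow> ('u, 'x, 'o, 'a) fibcat \<Rightarrow>
   ('x list, 'o, 'a) fmor \<Rightarrow> ('x list \<Rightarrow> 'o \<Rightarrow> 'a) \<Rightarrow> ('x list, 'o, 'a) fmor \<Rightarrow>
   'i set \<Rightarrow> ('i \<Rightarrow> 'u ring \<Rightarrow> 'x set) \<Rightarrow> ('i \<Rightarrow> 'u ring \<Rightarrow> 'x \<Rightarrow> 'g \<Rightarrow> 'a) \<Rightarrow>
   ('i \<Rightarrow> ('u, 'x, 'o, 'a) sect) \<Rightarrow> ('i \<Rightarrow> 'i \<Rightarrow> 'u ring \<Rightarrow> 'x \<Rightarrow> 'a) \<Rightarrow>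
   ('i \<Rightarrow> 'u ring \<Rightarrow> 'x list \<Rightarrow> 'a) \<Rightarrow> ('i \<Rightarrow> 'u ring \<Rightarrow> 'x list \<Rightarrow> 'a) \<Rightarrow>
   ('i \<Rightarrow> 'i \<Rightarrow> 'u ring \<Rightarrow> 'x \<Rightarrow> 'g \<Rightarrow> 'g) \<Rightarrow> ('i \<Rightarrow> 'i \<Rightarrow> 'i \<Rightarrow> 'u ring \<Rightarrow> 'x \<Rightarrow> 'g) \<Rightarrow>
   ('i \<Rightarrow> 'u ring \<Rightarrow> 'x list \<Rightarrow> 'g \<Rightarrow> 'g) \<Rightarrow> ('i \<Rightarrow> 'i \<Rightarrow> 'u ring \<Rightarrow> 'x list \<Rightarrow> 'g) \<Rightarrow>
   ('i \<Rightarrow> 'u ring \<Rightarrow> 'x list \<Rightarrow> 'g) \<Rightarrow>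
   ('i \<Rightarrow> 'u ring \<Rightarrow> 'x list \<Rightarrow> 'g \<Rightarrow> 'g) \<Rightarrow> ('i \<Rightarrow> 'i \<Rightarrow> 'u ring \<Rightarrow> 'x list \<Rightarrow> 'g) \<Rightarrow>
   ('i \<Rightarrow> 'u ring \<Rightarrow> 'x list \<Rightarrow> 'g) \<Rightarrow> bool" where
  "local_data X G P eps K kappa I U j x phi gam del lam g m gamma B nu delta omega \<longleftrightarrow>
     (let M = G_val X G; A = Aut_val X G in
     (\<forall>i\<in>I. \<forall>l\<in>I. Aut_section X G (sub X (inter2 U i l)) (\<lambda>p. p) (lam i l) \<and>
        (\<forall>R. cring R \<longrightarrow> (\<forall>p\<in>inter2 U i l R. \<forall>h\<in>carrier (G_at X G R p).
           Comp P (phi i l R p) (j l R p h) = Comp P (j i R p (lam i l R p h)) (phi i l R p)))) \<and>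
     (\<forall>i\<in>I. \<forall>l\<in>I. \<forall>k\<in>I. G_section X G (sub X (inter3 U i l k)) (\<lambda>p. p) (g i l k) \<and>
        (\<forall>R. cring R \<longrightarrow> (\<forall>p\<in>inter3 U i l k R.
           Comp P (phi i l R p) (phi l k R p) = Comp P (j i R p (g i l k R p)) (phi i k R p)))) \<and>
     (\<forall>i\<in>I. Aut_form X G 1 (U i) (m i) \<and>
        (\<forall>R. cring R \<longrightarrow> (\<forall>xs\<in>pts (simplex X 1 (U i)) R. \<forall>h\<in>carrier (G_at X G R (xs ! 1)).
           Comp P (gam i R xs) (snd eps xs (j i R (xs ! 1) h)) =
           Comp P (j i R (xs ! 0) (m i R xs h)) (gam i R xs)))) \<and>
     (\<forall>i\<in>I. \<forall>l\<in>I. G_form X G 1 (inter2 U i l) (gamma i l) \<and>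
        (\<forall>R. cring R \<longrightarrow> (\<forall>xs\<in>pts (simplex X 1 (inter2 U i l)) R.
           Comp P (gam i R xs) (snd eps xs (phi i l R (xs ! 1))) =
           Comp P (j i R (xs ! 0) (gamma i l R xs)) (Comp P (phi i l R (xs ! 0)) (gam l R xs))))) \<and>
     (\<forall>i\<in>I. G_form X G 2 (U i) (B i) \<and>
        (\<forall>R. cring R \<longrightarrow> (\<forall>xs\<in>pts (simplex X 2 (U i)) R.
           Comp P (gam i R [xs ! 0, xs ! 1]) (snd eps [xs ! 0, xs ! 1] (gam i R [xs ! 1, xs ! 2])) =
           Comp P (j i R (xs ! 0) (B i R xs)) (Comp P (del i R xs)
             (Comp P (snd kappa xs (gam i R [xs ! 0, xs ! 2])) (K xs (fst (x i) R (xs ! 2)))))))) \<and>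
     (\<forall>i\<in>I. nu i = curvature A (m i) \<boxminus>\<^bsub>A\<^esub> inner_form M (B i)) \<and>
     (\<forall>i\<in>I. \<forall>l\<in>I. delta i l =
        act_form (lam i l) (B l) \<boxminus>\<^bsub>M\<^esub> B i \<boxminus>\<^bsub>M\<^esub> twisted_d1 M (m i) (fneg M (gamma i l))) \<and>
     (\<forall>i\<in>I. omega i = twisted_d M 2 (m i) (B i)))"

text \<open>
  The data \<open>r\<^sub>i, \<theta>\<^sub>i\<^sub>j, e\<^sub>i, n\<^sub>i\<close> attached to arrows \<open>\<chi>\<^sub>i : x\<^sub>i \<rightarrow> x'\<^sub>i\<close>; here \<open>j i\<close> and \<open>j' i\<close> are the
  identifications of \<open>G\<close> with \<open>Aut(x\<^sub>i)\<close> and \<open>Aut(x'\<^sub>i)\<close>.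
\<close>

definition comparison_data ::
  "('u, 'x, 's) over_sch \<Rightarrow> ('u, 'g, 's) group_sch \<Rightarrow> ('u, 'x, 'o, 'a) fibcat \<Rightarrow>
   ('x list, 'o, 'a) fmor \<Rightarrow> ('x list, 'o, 'a) fmor \<Rightarrow>
   'i set \<Rightarrow> ('i \<Rightarrow> 'u ring \<Rightarrow> 'x set) \<Rightarrow>
   ('i \<Rightarrow> 'u ring \<Rightarrow> 'x \<Rightarrow> 'g \<Rightarrow> 'a) \<Rightarrow> ('i \<Rightarrow> 'i \<Rightarrow> 'u ring \<Rightarrow> 'x \<Rightarrow> 'a) \<Rightarrow>
   ('i \<Rightarrow> 'u ring \<Rightarrow> 'x list \<Rightarrow> 'a) \<Rightarrow> ('i \<Rightarrow> 'u ring \<Rightarrow> 'x list \<Rightarrow> 'a) \<Rightarrow>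
   ('i \<Rightarrow> 'u ring \<Rightarrow> 'x \<Rightarrow> 'g \<Rightarrow> 'a) \<Rightarrow> ('i \<Rightarrow> 'i \<Rightarrow> 'u ring \<Rightarrow> 'x \<Rightarrow> 'a) \<Rightarrow>
   ('i \<Rightarrow> 'u ring \<Rightarrow> 'x list \<Rightarrow> 'a) \<Rightarrow> ('i \<Rightarrow> 'u ring \<Rightarrow> 'x list \<Rightarrow> 'a) \<Rightarrow>
   ('i \<Rightarrow> 'u ring \<Rightarrow> 'x \<Rightarrow> 'a) \<Rightarrow>
   ('i \<Rightarrow> 'u ring \<Rightarrow> 'x \<Rightarrow> 'g \<Rightarrow> 'g) \<Rightarrow> ('i \<Rightarrow> 'i \<Rightarrow> 'u ring \<Rightarrow> 'x \<Rightarrow> 'g) \<Rightarrow>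
   ('i \<Rightarrow> 'u ring \<Rightarrow> 'x list \<Rightarrow> 'g) \<Rightarrow> ('i \<Rightarrow> 'u ring \<Rightarrow> 'x list \<Rightarrow> 'g) \<Rightarrow> bool" where
  "comparison_data X G P eps kappa I U j phi gam del j' phi' gam' del' chi r theta e n \<longleftrightarrow>
     (\<forall>i\<in>I. Aut_section X G (sub X (U i)) (\<lambda>p. p) (r i) \<and>
        (\<forall>R. cring R \<longrightarrow> (\<forall>p\<in>U i R. \<forall>h\<in>carrier (G_at X G R p).
           Comp P (chi i R p) (j i R p h) = Comp P (j' i R p (r i R p h)) (chi i R p)))) \<and>
     (\<forall>i\<in>I. \<forall>l\<in>I. G_section X G (sub X (inter2 U i l)) (\<lambda>p. p) (theta i l) \<and>
        (\<forall>R. cring R \<longrightarrow> (\<forall>p\<in>inter2 U i l R.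
           Comp P (phi' i l R p) (chi l R p) =
           Comp P (j' i R p (theta i l R p)) (Comp P (chi i R p) (phi i l R p))))) \<and>
     (\<forall>i\<in>I. G_form X G 1 (U i) (e i) \<and>
        (\<forall>R. cring R \<longrightarrow> (\<forall>xs\<in>pts (simplex X 1 (U i)) R.
           Comp P (gam' i R xs) (snd eps xs (chi i R (xs ! 1))) =
           Comp P (j' i R (xs ! 0) (e i R xs)) (Comp P (chi i R (xs ! 0)) (gam i R xs))))) \<and>
     (\<forall>i\<in>I. G_form X G 2 (U i) (n i) \<and>
        (\<forall>R. cring R \<longrightarrow> (\<forall>xs\<in>pts (simplex X 2 (U i)) R.
           Comp P (del' i R xs) (snd kappa xs (chi i R (xs ! 0))) =
           Comp P (j' i R (xs ! 0) (n i R xs)) (Comp P (chi i R (xs ! 0)) (del i R xs)))))"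

end

theory Submission
  imports Defs "HOL-Algebra.Weak_Morphisms"
begin

text \<open>
  All forms are evaluated on a tuple of pairwise close points \<open>x\<^sub>0, \<dots>, x\<^sub>n\<close> with values in one ring \<open>R\<close>.
  Two close points \<open>x, y\<close> become equal modulo an ideal \<open>\<nn>\<close> of square zero, and the kernel \<open>K\<^sub>x\<^sub>y\<close> of the
  restriction \<open>G(R) \<rightarrow> G(R/\<nn>)\<close> is a normal commutative subgroup on which every natural automorphism that is
  trivial modulo \<open>\<nn>\<close> acts trivially: over \<open>R \<oplus> \<epsilon>\<nn>\<close> one can interpolate between two points that agree
  modulo \<open>\<nn>\<close>.  The same interpolation shows that forms are alternating, so that the value of a form
  lies in the kernels attached to all edges of the simplex.

  Evaluating the defining relations of the data on the arrows \<open>\<chi>\<^sub>i\<close> gives exact identities in \<open>G(R)\<close>, and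
  these become the additive equations once the factors are known to lie in kernels of edges and hence to
  commute.  The equation for \<open>\<delta>\<^sub>i\<^sub>j\<close> uses that \<open>\<phi>\<^sub>i\<^sub>j\<close> is itself a comparison arrow, with \<open>\<lambda>\<^sub>i\<^sub>j, \<gamma>\<^sub>i\<^sub>j, \<delta>\<^sub>i\<^sub>j\<close> in the
  roles of \<open>r\<^sub>i, e\<^sub>i, n\<^sub>i\<close>.  The equation for \<open>\<omega>\<^sub>i\<close> compares the relations for the four faces of a tetrahedron.
\<close>

section \<open>Square-zero extensions\<close>

text \<open>Why equality at \<open>\<epsilon> = 0\<close> can be concluded: in the double of
  \<open>R\<close> the ideal of the end \<open>\<epsilon> = 1\<close> meets the constant copy of
  \<open>\<nn>\<close> only in zero, so two points in one affine open that agree at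
  \<open>\<epsilon> = 1\<close> and modulo \<open>\<nn>\<close> agree on the whole double.
  \<open>Aut(G)\<close> is not given as a scheme; an identity between automorphisms is therefore
  tested on the restrictions of one section \<open>h\<close> of \<open>G\<close>, and smallness of
  an automorphism is a property of a natural family rather than of a single map on
  \<open>G(R)\<close>. The obstacle in the algebra is that kernels of different edges need not
  commute with each other: values of 1-forms on different edges have to be kept in their order until
  they are grouped into an element of a single kernel. The two versions of the last equation differ
  by commutators of values of \<open>n\<close> and \<open>e\<close> on complementary parts of the
  tetrahedron. To see that these cancel, both are rewritten as commutators with the value of
  \<open>e\<close> on the long edge from the first to the last vertex.\<close>

lemma Hom_cring: "f \<in> Hom R T \<Longrightarrow> cring R \<Longrightarrow> cring T \<Longrightarrow> ring_hom_cring R T f"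
  by (simp add: Hom_def ring_hom_cring.intro ring_hom_cring_axioms.intro)

lemma restrict_Hom: "cring R \<Longrightarrow> f \<in> ring_hom R T \<Longrightarrow> restrict f (carrier R) \<in> Hom R T"
  using cring.axioms(1)[of R]
  by (auto simp: Hom_def ring_hom_def ring.ring_simprules)

lemma idhom_Hom: "cring R \<Longrightarrow> idhom R \<in> Hom R R"
  unfolding idhom_def by (rule restrict_Hom) (auto simp: ring_hom_def)

lemma hcomp_Hom:
  assumes "cring R" "f \<in> Hom R T" "h \<in> Hom T W"
  shows "hcomp R h f \<in> Hom R W"
proof -
  have "h \<circ> f \<in> ring_hom R W"
    using assms(2,3) by (auto simp: Hom_def intro: ring_hom_trans)
  from restrict_Hom[OF assms(1) this] show ?thesis
    by (simp add: hcomp_def compose_def comp_def)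
qed

lemma hcomp_apply: "a \<in> carrier R \<Longrightarrow> hcomp R h f a = h (f a)"
  by (simp add: hcomp_def compose_def)

lemma Hom_closed: "f \<in> Hom R T \<Longrightarrow> a \<in> carrier R \<Longrightarrow> f a \<in> carrier T"
  by (auto simp: Hom_def ring_hom_def)

lemma Hom_ext:
  assumes "f \<in> Hom R T" "g \<in> Hom R T" "\<And>a. a \<in> carrier R \<Longrightarrow> f a = g a"
  shows "f = g"
  using assms by (auto simp: Hom_def intro: extensionalityI)

lemma hcomp_idhom: "f \<in> Hom R T \<Longrightarrow> hcomp R f (idhom R) = f"
  by (rule ext) (auto simp: hcomp_def compose_def idhom_def Hom_def extensional_def)

lemma idhom_hcomp: "f \<in> Hom R T \<Longrightarrow> hcomp R (idhom T) f = f"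
  by (rule ext) (auto simp: hcomp_def compose_def idhom_def Hom_def extensional_def ring_hom_def)

lemma hcomp_assoc:
  "f \<in> Hom R T \<Longrightarrow> hcomp R k (hcomp R h f) = hcomp R (hcomp T k h) f"
  by (rule ext) (auto simp: hcomp_def compose_def Hom_def ring_hom_def)

text \<open>The quotient is carried by representatives of the cosets, so that it lives on the given type.\<close>

lemma quotient_point:
  fixes R :: "'u ring" (structure)
  assumes R: "cring R" and I: "ideal I R"
  obtains T :: "'u ring" and f where "cring T" "f \<in> Hom R T"
    "\<And>a. a \<in> carrier R \<Longrightarrow> f a = \<zero>\<^bsub>T\<^esub> \<longleftrightarrow> a \<in> I" "maximalideal I R \<Longrightarrow> field T"
proof -
  interpret cring R by fact
  interpret ideal I R by fact
  define rep where "rep = (\<lambda>c::'u set. SOME a. a \<in> c)"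
  have rep_in: "rep c \<in> c \<and> rep c \<in> carrier R \<and> c = I +> rep c" if "c \<in> carrier (R Quot I)" for c
  proof -
    from that obtain a where a: "a \<in> carrier R" "c = I +> a"
      by (auto simp: FactRing_def A_RCOSETS_def')
    have "a \<in> c" using a a_rcos_self by simp
    then have c: "rep c \<in> c" unfolding rep_def by (rule someI)
    with a have "rep c \<in> carrier R"
      using a_r_coset_subset_G a_subset by blast
    with c show ?thesis
      using a a_repr_independence a_subgroup by metis
  qed
  have inj: "inj_on rep (carrier (R Quot I))"
    by (rule inj_onI) (metis rep_in)
  have Q: "cring (R Quot I)" using R by (rule quotient_is_cring)
  interpret Q: cring "R Quot I" by (rule Q)
  define T where "T = image_ring rep (R Quot I)"
  have iso: "rep \<in> ring_iso (R Quot I) T"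
    unfolding T_def by (rule inj_imp_image_ring_iso[OF inj])
  have T: "cring T" using Q.ring_iso_imp_img_cring[OF iso]
    by (simp add: T_def image_ring_def image_group_def monoid.defs)
  have fld: "field T" if "maximalideal I R"
  proof -
    interpret field "R Quot I" using that R by (rule maximalideal.quotient_is_field)
    show ?thesis unfolding T_def by (rule inj_imp_image_ring_is_field[OF inj])
  qed
  have hom: "rep \<circ> (+>) I \<in> ring_hom R T"
    using rcos_ring_hom iso ring_hom_trans ring_iso_def by blast
  have zero: "(rep \<circ> (+>) I) a = \<zero>\<^bsub>T\<^esub> \<longleftrightarrow> a \<in> I" if "a \<in> carrier R" for a
  proof -
    have "I +> a \<in> carrier (R Quot I)" using that by (auto simp: FactRing_def A_RCOSETS_def')
    then have "(rep \<circ> (+>) I) a = \<zero>\<^bsub>T\<^esub> \<longleftrightarrow> I +> a = \<zero>\<^bsub>R Quot I\<^esub>"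
      using inj by (auto simp: T_def image_ring_zero inj_on_def)
    also have "\<dots> \<longleftrightarrow> a \<in> I"
      using that a_rcos_self[of a] a_coset_join2[OF that a_subgroup] by (auto simp: FactRing_def)
    finally show ?thesis .
  qed
  show thesis
    by (rule that[OF T restrict_Hom[OF R hom] _ fld]) (use zero in auto)
qed

text \<open>Zorn's lemma for the ideals containing \<open>I\<close>, with properness expressed by
  \<open>\<one> \<notin> J\<close> because that condition passes to unions of chains.\<close>

lemma maximal_ideal_exists:
  fixes R (structure)
  assumes R: "cring R" and I: "ideal I R" "I \<noteq> carrier R"
  obtains M where "maximalideal M R" "I \<subseteq> M"
proof -
  interpret cring R by fact
  define \<A> where "\<A> = {J. ideal J R \<and> I \<subseteq> J \<and> \<one> \<notin> J}"
  have "\<one> \<notin> I" using I ideal.one_imp_carrier by blast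
  then have ne: "\<A> \<noteq> {}" using I by (auto simp: \<A>_def)
  have chain: "\<Union>\<C> \<in> \<A>" if "\<C> \<noteq> {}" "subset.chain \<A> \<C>" for \<C>
  proof -
    have id: "ideal J R" if "J \<in> \<C>" for J
      using that \<open>subset.chain \<A> \<C>\<close> by (auto simp: \<A>_def subset_chain_def)
    have cmp: "J \<subseteq> J' \<or> J' \<subseteq> J" if "J \<in> \<C>" "J' \<in> \<C>" for J J'
      using that \<open>subset.chain \<A> \<C>\<close> by (auto simp: subset_chain_def)
    have "ideal (\<Union>\<C>) R"
    proof (rule idealI)
      show "ring R" ..
      show "subgroup (\<Union>\<C>) (add_monoid R)"
      proof (rule add.subgroupI)
        show "\<Union>\<C> \<subseteq> carrier R" using id ideal.Icarr by fastforce
        obtain J where J: "J \<in> \<C>" using \<open>\<C> \<noteq> {}\<close> by auto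
        then have "\<zero> \<in> J" using id additive_subgroup.zero_closed ideal.axioms(1) by blast
        with J show "\<Union>\<C> \<noteq> {}" by blast
      next
        fix a assume "a \<in> \<Union>\<C>"
        then obtain J where J: "J \<in> \<C>" "a \<in> J" by auto
        then have "\<ominus> a \<in> J"
          by (intro additive_subgroup.a_inv_closed ideal.axioms(1) id)
        with J show "\<ominus> a \<in> \<Union>\<C>" by auto
      next
        fix a b assume "a \<in> \<Union>\<C>" "b \<in> \<Union>\<C>"
        then obtain J J' where J: "J \<in> \<C>" "J' \<in> \<C>" "a \<in> J" "b \<in> J'" by auto
        then obtain K where K: "K \<in> \<C>" "a \<in> K" "b \<in> K" using cmp[of J J'] by blast
        then have "a \<oplus> b \<in> K"
          by (intro additive_subgroup.a_closed ideal.axioms(1) id)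
        with K show "a \<oplus> b \<in> \<Union>\<C>" by auto
      qed
    next
      fix a x assume a: "a \<in> \<Union>\<C>" "x \<in> carrier R"
      then obtain J where J: "J \<in> \<C>" "a \<in> J" by auto
      then have "x \<otimes> a \<in> J" "a \<otimes> x \<in> J"
        using ideal.I_l_closed[OF id] ideal.I_r_closed[OF id] a by auto
      with J show "x \<otimes> a \<in> \<Union>\<C>" "a \<otimes> x \<in> \<Union>\<C>" by auto
    qed
    moreover have "I \<subseteq> J \<and> \<one> \<notin> J" if "J \<in> \<C>" for J
      using that \<open>subset.chain \<A> \<C>\<close> by (auto simp: \<A>_def subset_chain_def)
    then have "I \<subseteq> \<Union>\<C>" "\<one> \<notin> \<Union>\<C>"
      using \<open>\<C> \<noteq> {}\<close> by blast+
    ultimately show ?thesis by (simp add: \<A>_def)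
  qed
  obtain M where M: "M \<in> \<A>" and max: "\<And>J. J \<in> \<A> \<Longrightarrow> M \<subseteq> J \<Longrightarrow> J = M"
    using subset_Zorn_nonempty[OF ne chain] by blast
  have "maximalideal M R"
  proof (rule maximalidealI)
    show "ideal M R" using M by (simp add: \<A>_def)
    show "carrier R \<noteq> M" using M by (auto simp: \<A>_def)
    fix J assume J: "ideal J R" "M \<subseteq> J" "J \<subseteq> carrier R"
    show "J = M \<or> J = carrier R"
    proof (cases "\<one> \<in> J")
      case True then show ?thesis using J ideal.one_imp_carrier by blast
    next
      case False then show ?thesis using max[of J] J M by (auto simp: \<A>_def)
    qed
  qed
  then show thesis using M by (intro that) (auto simp: \<A>_def)
qed

text \<open>Open covers of functors are tested on field-valued points, so a proper ideal has to be
  turned into a field-valued point at which it vanishes.\<close>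

lemma field_point:
  fixes R :: "'u ring"
  assumes R: "cring R" and I: "ideal I R" "I \<noteq> carrier R"
  obtains k :: "'u ring" and f where "field k" "cring k" "f \<in> Hom R k" "\<forall>a\<in>I. f a = \<zero>\<^bsub>k\<^esub>"
proof -
  obtain M where M: "maximalideal M R" "I \<subseteq> M" using maximal_ideal_exists[OF assms] .
  have "ideal M R" using M(1) by (rule maximalideal.axioms(1))
  then obtain k :: "'u ring" and f where k: "cring k" "f \<in> Hom R k"
      "\<And>a. a \<in> carrier R \<Longrightarrow> f a = \<zero>\<^bsub>k\<^esub> \<longleftrightarrow> a \<in> M" "maximalideal M R \<Longrightarrow> field k"
    using quotient_point[OF R] by blast
  then show thesis using M I by (intro that[of k f]) (auto dest: ideal.Icarr)
qed

text \<open>The fibre product of two copies of \<open>R\<close> over \<open>R/\<nn>\<close>; the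
  pair \<open>(a, b)\<close> stands for \<open>b + \<epsilon>(a - b)\<close>. With pairs the ring
  laws are componentwise, and the work lies in closure under the operations.\<close>

definition double_ring :: "'a ring \<Rightarrow> 'a set \<Rightarrow> ('a \<times> 'a) ring" where
  "double_ring R \<nn> =
     \<lparr>carrier = {(a, b). a \<in> carrier R \<and> b \<in> carrier R \<and> a \<ominus>\<^bsub>R\<^esub> b \<in> \<nn>},
      mult = (\<lambda>(a, b) (c, d). (a \<otimes>\<^bsub>R\<^esub> c, b \<otimes>\<^bsub>R\<^esub> d)), one = (\<one>\<^bsub>R\<^esub>, \<one>\<^bsub>R\<^esub>),
      zero = (\<zero>\<^bsub>R\<^esub>, \<zero>\<^bsub>R\<^esub>), add = (\<lambda>(a, b) (c, d). (a \<oplus>\<^bsub>R\<^esub> c, b \<oplus>\<^bsub>R\<^esub> d))\<rparr>"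

lemma double_ring_cring:
  assumes R: "cring R" and I: "ideal \<nn> R"
  shows "cring (double_ring R \<nn>)"
proof -
  interpret cring R by fact
  interpret ideal \<nn> R by fact
  have m: "a \<otimes>\<^bsub>R\<^esub> c \<ominus>\<^bsub>R\<^esub> b \<otimes>\<^bsub>R\<^esub> d \<in> \<nn>"
    if "a \<in> carrier R" "b \<in> carrier R" "c \<in> carrier R" "d \<in> carrier R" "a \<ominus>\<^bsub>R\<^esub> b \<in> \<nn>" "c \<ominus>\<^bsub>R\<^esub> d \<in> \<nn>"
    for a b c d
  proof -
    have "a \<otimes>\<^bsub>R\<^esub> c \<ominus>\<^bsub>R\<^esub> b \<otimes>\<^bsub>R\<^esub> d = a \<otimes>\<^bsub>R\<^esub> (c \<ominus>\<^bsub>R\<^esub> d) \<oplus>\<^bsub>R\<^esub> (a \<ominus>\<^bsub>R\<^esub> b) \<otimes>\<^bsub>R\<^esub> d"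
      using that(1-4) by algebra
    then show ?thesis using that by (auto intro: a_closed I_l_closed I_r_closed)
  qed
  have s: "(a \<oplus>\<^bsub>R\<^esub> c) \<ominus>\<^bsub>R\<^esub> (b \<oplus>\<^bsub>R\<^esub> d) \<in> \<nn>"
    if "a \<in> carrier R" "b \<in> carrier R" "c \<in> carrier R" "d \<in> carrier R" "a \<ominus>\<^bsub>R\<^esub> b \<in> \<nn>" "c \<ominus>\<^bsub>R\<^esub> d \<in> \<nn>"
    for a b c d
  proof -
    have "(a \<oplus>\<^bsub>R\<^esub> c) \<ominus>\<^bsub>R\<^esub> (b \<oplus>\<^bsub>R\<^esub> d) = (a \<ominus>\<^bsub>R\<^esub> b) \<oplus>\<^bsub>R\<^esub> (c \<ominus>\<^bsub>R\<^esub> d)"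
      using that(1-4) by algebra
    then show ?thesis using that by (auto intro: a_closed)
  qed
  have n: "\<ominus>\<^bsub>R\<^esub> a \<ominus>\<^bsub>R\<^esub> (\<ominus>\<^bsub>R\<^esub> b) \<in> \<nn>" if "a \<in> carrier R" "b \<in> carrier R" "a \<ominus>\<^bsub>R\<^esub> b \<in> \<nn>" for a b
  proof -
    have "\<ominus>\<^bsub>R\<^esub> a \<ominus>\<^bsub>R\<^esub> (\<ominus>\<^bsub>R\<^esub> b) = \<ominus>\<^bsub>R\<^esub> (a \<ominus>\<^bsub>R\<^esub> b)"
      using that(1,2) by algebra
    then show ?thesis using that by (auto intro: a_inv_closed)
  qed
  have z: "a \<ominus>\<^bsub>R\<^esub> a \<in> \<nn>" if "a \<in> carrier R" for a
    using that r_neg zero_closed by (simp add: a_minus_def)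
  show ?thesis
  proof (rule cringI)
    show "abelian_group (double_ring R \<nn>)"
    proof (rule abelian_groupI)
      fix x assume "x \<in> carrier (double_ring R \<nn>)"
      then show "\<exists>y\<in>carrier (double_ring R \<nn>). y \<oplus>\<^bsub>double_ring R \<nn>\<^esub> x = \<zero>\<^bsub>double_ring R \<nn>\<^esub>"
        using n by (intro bexI[of _ "(\<ominus>\<^bsub>R\<^esub> fst x, \<ominus>\<^bsub>R\<^esub> snd x)"])
          (auto simp: double_ring_def l_neg)
    qed (auto simp: double_ring_def s z a_ac)
    show "comm_monoid (double_ring R \<nn>)"
      by (rule comm_monoidI) (auto simp: double_ring_def m z m_ac)
  qed (auto simp: double_ring_def l_distr)
qed

text \<open>
  For \<open>\<nn>\<^sup>2 = 0\<close> the ring \<open>Q\<close> is the trivial extension \<open>R \<oplus> \<epsilon>\<nn>\<close>; the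
  homomorphisms \<open>p\<close> and \<open>q\<close> are \<open>\<epsilon> \<mapsto> 1\<close> and \<open>\<epsilon> \<mapsto> 0\<close>.
\<close>

definition is_double ::
  "'u ring \<Rightarrow> 'u set \<Rightarrow> 'u ring \<Rightarrow> ('u \<Rightarrow> 'u) \<Rightarrow> ('u \<Rightarrow> 'u) \<Rightarrow> ('u \<Rightarrow> 'u) \<Rightarrow> bool" where
  "is_double R \<nn> Q p q d \<longleftrightarrow> cring Q \<and> p \<in> Hom Q R \<and> q \<in> Hom Q R \<and> d \<in> Hom R Q \<and>
     hcomp R p d = idhom R \<and> hcomp R q d = idhom R \<and>
     (\<forall>a\<in>carrier Q. \<forall>b\<in>carrier Q. p a = p b \<and> q a = q b \<longrightarrow> a = b) \<and>
     (\<forall>a\<in>carrier Q. p a \<ominus>\<^bsub>R\<^esub> q a \<in> \<nn>) \<and>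
     (\<forall>A. cring A \<longrightarrow> (\<forall>\<phi>\<in>Hom A R. \<forall>\<psi>\<in>Hom A R. (\<forall>a\<in>carrier A. \<phi> a \<ominus>\<^bsub>R\<^esub> \<psi> a \<in> \<nn>) \<longrightarrow>
        (\<exists>\<chi>\<in>Hom A Q. hcomp A p \<chi> = \<phi> \<and> hcomp A q \<chi> = \<psi>)))"

text \<open>\<open>double_ring\<close> lives on pairs. An infinite type is equinumerous with its
  square, so the ring can be carried back to the given type along an injection \<open>enc\<close>;
  this is the point where infinitude of the universe enters.\<close>

lemma double_exists:
  fixes R :: "'u ring"
  assumes inf: "infinite (UNIV :: 'u set)" and R: "cring R" and I: "ideal \<nn> R"
  obtains Q p q d where "is_double R \<nn> Q p q d"
proof -
  interpret cring R by fact
  interpret ideal \<nn> R by fact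
  have "\<exists>enc :: 'u \<times> 'u \<Rightarrow> 'u. inj_on enc (UNIV \<times> UNIV) \<and> enc ` (UNIV \<times> UNIV) \<subseteq> UNIV"
    unfolding card_of_ordLeq by (rule ordIso_imp_ordLeq[OF card_of_Times_same_infinite[OF inf]])
  then obtain enc :: "'u \<times> 'u \<Rightarrow> 'u" where enc: "inj enc"
    by auto
  define Q0 where "Q0 = double_ring R \<nn>"
  interpret Q0: cring Q0 unfolding Q0_def by (rule double_ring_cring[OF R I])
  have inj: "inj_on enc (carrier Q0)" using enc by (rule inj_on_subset) simp
  define Q where "Q = image_ring enc Q0"
  have iso: "enc \<in> ring_iso Q0 Q" unfolding Q_def by (rule inj_imp_image_ring_iso[OF inj])
  have iso': "Hilbert_Choice.inv enc \<in> ring_iso Q Q0"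
    unfolding Q_def by (rule inj_imp_image_ring_inv_iso[OF enc])
  have Q: "cring Q" using Q0.ring_iso_imp_img_cring[OF iso]
    by (simp add: Q_def image_ring_def image_group_def monoid.defs)
  have car: "carrier Q = enc ` carrier Q0" by (simp add: Q_def image_ring_carrier)
  let ?dec = "Hilbert_Choice.inv enc"
  have fs: "fst \<in> ring_hom Q0 R" "snd \<in> ring_hom Q0 R"
    by (auto simp: ring_hom_def Q0_def double_ring_def)
  define p where "p = restrict (fst \<circ> ?dec) (carrier Q)"
  define q where "q = restrict (snd \<circ> ?dec) (carrier Q)"
  have p: "p \<in> Hom Q R" and q: "q \<in> Hom Q R"
    unfolding p_def q_def using fs iso' Q
    by (auto intro!: restrict_Hom ring_hom_trans[of ?dec Q Q0] simp: ring_iso_def)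
  have pair: "\<exists>\<chi>\<in>Hom A Q. hcomp A p \<chi> = \<phi> \<and> hcomp A q \<chi> = \<psi>"
    if A: "cring A" and h: "\<phi> \<in> Hom A R" "\<psi> \<in> Hom A R" "\<forall>a\<in>carrier A. \<phi> a \<ominus>\<^bsub>R\<^esub> \<psi> a \<in> \<nn>"
    for A :: "'u ring" and \<phi> \<psi>
  proof -
    have "(\<lambda>a. (\<phi> a, \<psi> a)) \<in> ring_hom A Q0"
      using h by (auto simp: Hom_def ring_hom_def Q0_def double_ring_def)
    then have "enc \<circ> (\<lambda>a. (\<phi> a, \<psi> a)) \<in> ring_hom A Q"
      using iso by (auto simp: ring_iso_def intro: ring_hom_trans)
    then have \<chi>: "restrict (enc \<circ> (\<lambda>a. (\<phi> a, \<psi> a))) (carrier A) \<in> Hom A Q" (is "?\<chi> \<in> _")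
      by (rule restrict_Hom[OF A])
    have "hcomp A p ?\<chi> = \<phi>"
      by (rule Hom_ext[OF hcomp_Hom[OF A \<chi> p] h(1)])
        (use Hom_closed[OF \<chi>] enc in \<open>simp add: hcomp_apply p_def\<close>)
    moreover have "hcomp A q ?\<chi> = \<psi>"
      by (rule Hom_ext[OF hcomp_Hom[OF A \<chi> q] h(2)])
        (use Hom_closed[OF \<chi>] enc in \<open>simp add: hcomp_apply q_def\<close>)
    ultimately show ?thesis using \<chi> by blast
  qed
  \<comment> \<open>The constant embedding \<open>d\<close> is the homomorphism induced by the pair
    of identities.\<close>
  have "\<forall>a\<in>carrier R. idhom R a \<ominus>\<^bsub>R\<^esub> idhom R a \<in> \<nn>"
    by (simp add: idhom_def a_minus_def r_neg)
  with pair[OF R idhom_Hom[OF R] idhom_Hom[OF R]]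
  obtain d where d: "d \<in> Hom R Q" "hcomp R p d = idhom R" "hcomp R q d = idhom R" by blast
  have "a = b" if "a \<in> carrier Q" "b \<in> carrier Q" "p a = p b" "q a = q b" for a b
    using that enc by (auto simp: car p_def q_def)
  moreover have "p a \<ominus>\<^bsub>R\<^esub> q a \<in> \<nn>" if "a \<in> carrier Q" for a
    using that enc by (auto simp: car p_def q_def Q0_def double_ring_def)
  ultimately show thesis
    using p q d pair Q by (intro that[of Q p q d]) (simp add: is_double_def)
qed

section \<open>Points of schemes and square-zero extensions\<close>

lemma psh_closed:
  "is_psh F \<Longrightarrow> cring R \<Longrightarrow> cring T \<Longrightarrow> f \<in> Hom R T \<Longrightarrow> x \<in> pts F R \<Longrightarrow> res F R T f x \<in> pts F T"
  by (simp add: is_psh_def)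

lemma psh_id: "is_psh F \<Longrightarrow> cring R \<Longrightarrow> x \<in> pts F R \<Longrightarrow> res F R R (idhom R) x = x"
  by (simp add: is_psh_def)

lemma psh_comp:
  "is_psh F \<Longrightarrow> cring R \<Longrightarrow> cring T \<Longrightarrow> cring W \<Longrightarrow> f \<in> Hom R T \<Longrightarrow> h \<in> Hom T W \<Longrightarrow> x \<in> pts F R \<Longrightarrow>
   res F R W (hcomp R h f) x = res F T W h (res F R T f x)"
  by (simp add: is_psh_def)

definition square_zero :: "'u ring \<Rightarrow> 'u set \<Rightarrow> bool" where
  "square_zero R \<nn> \<longleftrightarrow> ideal \<nn> R \<and> (\<forall>a\<in>\<nn>. \<forall>b\<in>\<nn>. a \<otimes>\<^bsub>R\<^esub> b = \<zero>\<^bsub>R\<^esub>)"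

text \<open>Equality of \<open>x\<close> and \<open>y\<close> on the closed subscheme of
  \<open>Spec R\<close> cut out by \<open>\<nn>\<close>, tested on all its points. No quotient ring
  is fixed, so agreement passes to base changes by composing homomorphisms.\<close>

definition agree :: "('u, 'x, 'z) psh_scheme \<Rightarrow> 'u ring \<Rightarrow> 'u set \<Rightarrow> 'x \<Rightarrow> 'x \<Rightarrow> bool" where
  "agree F R \<nn> x y \<longleftrightarrow> (\<forall>T. cring T \<longrightarrow> (\<forall>f\<in>Hom R T. (\<forall>a\<in>\<nn>. f a = \<zero>\<^bsub>T\<^esub>) \<longrightarrow>
     res F R T f x = res F R T f y))"

definition affine_point :: "('u, 'x, 'z) psh_scheme \<Rightarrow> 'u ring \<Rightarrow> 'x \<Rightarrow> bool" where
  "affine_point F R x \<longleftrightarrow> (\<exists>U A u. open_sub F U \<and> represented F U A u \<and> x \<in> U R)"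

lemma agree_sym: "agree F R \<nn> x y \<Longrightarrow> agree F R \<nn> y x"
  by (simp add: agree_def)

lemma (in cring) diff_eq_zero_iff:
  assumes "a \<in> carrier R" "b \<in> carrier R"
  shows "a \<ominus> b = \<zero> \<longleftrightarrow> a = b"
  using assms minus_equality[of a "\<ominus> b"] by (auto simp: minus_eq r_neg)

lemma Hom_kernel_ideal:
  assumes R: "cring R" and T: "cring T" and f: "f \<in> Hom R T"
  shows "ideal {a \<in> carrier R. f a = \<zero>\<^bsub>T\<^esub>} R"
proof -
  have "ring_hom_ring R T f"
    using assms by (intro ring_hom_ringI2 cring.axioms(1)) (simp_all add: Hom_def)
  then have "ideal (a_kernel R T f) R" by (rule ring_hom_ring.kernel_is_ideal)
  then show ?thesis by (simp add: a_kernel_def')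
qed

lemma Hom_kills_genideal:
  assumes R: "cring R" and T: "cring T" and f: "f \<in> Hom R T" and D: "D \<subseteq> carrier R"
    and z: "\<forall>a\<in>D. f a = \<zero>\<^bsub>T\<^esub>"
  shows "\<forall>a\<in>genideal R D. f a = \<zero>\<^bsub>T\<^esub>"
proof -
  interpret cring R by fact
  have "genideal R D \<subseteq> {a \<in> carrier R. f a = \<zero>\<^bsub>T\<^esub>}"
    using D z by (intro genideal_minimal Hom_kernel_ideal[OF R T f]) auto
  then show ?thesis by auto
qed

lemma genideal_zero_ne:
  assumes "field k" "A \<subseteq> {\<zero>\<^bsub>k\<^esub>}"
  shows "genideal k A \<noteq> carrier k"
proof -
  interpret field k by fact
  have "genideal k A \<subseteq> {\<zero>\<^bsub>k\<^esub>}" by (rule genideal_minimal[OF zeroideal assms(2)])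
  then show ?thesis using one_not_zero one_closed by blast
qed

lemma square_zero_killed:
  assumes R: "cring R" and k: "field k" and f: "f \<in> Hom R k" and n: "square_zero R \<nn>" and a: "a \<in> \<nn>"
  shows "f a = \<zero>\<^bsub>k\<^esub>"
proof -
  interpret k: field k by fact
  interpret ring_hom_cring R k f by (rule Hom_cring[OF f R]) (rule k.is_cring)
  have "a \<in> carrier R" using n a by (auto simp: square_zero_def dest: ideal.Icarr)
  moreover have "a \<otimes>\<^bsub>R\<^esub> a = \<zero>\<^bsub>R\<^esub>" using n a by (simp add: square_zero_def)
  ultimately have "f a \<otimes>\<^bsub>k\<^esub> f a = \<zero>\<^bsub>k\<^esub>" by (metis hom_mult hom_zero)
  then show ?thesis using \<open>a \<in> carrier R\<close> k.integral by auto
qed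

lemma open_sub_sub: "open_sub F U \<Longrightarrow> subfunctor F U"
  by (simp add: open_sub_def)

lemma subfunctor_res:
  "subfunctor F U \<Longrightarrow> cring R \<Longrightarrow> cring T \<Longrightarrow> f \<in> Hom R T \<Longrightarrow> x \<in> U R \<Longrightarrow> res F R T f x \<in> U T"
  by (simp add: subfunctor_def)

lemma subfunctor_pts: "subfunctor F U \<Longrightarrow> cring R \<Longrightarrow> x \<in> U R \<Longrightarrow> x \<in> pts F R"
  by (auto simp: subfunctor_def)

lemma affine_point_res:
  "affine_point F R x \<Longrightarrow> cring R \<Longrightarrow> cring T \<Longrightarrow> f \<in> Hom R T \<Longrightarrow> affine_point F T (res F R T f x)"
  unfolding affine_point_def using subfunctor_res[OF open_sub_sub] by meson

text \<open>An open subscheme contains a point as soon as it contains it on residue fields, which do not see nilpotents.\<close>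

lemma open_sub_square_zero:
  assumes F: "is_psh F" and U: "open_sub F U" and R: "cring R" and n: "square_zero R \<nn>"
    and xy: "agree F R \<nn> x y" and x: "x \<in> U R" and y: "y \<in> pts F R"
  shows "y \<in> U R"
proof -
  interpret cring R by fact
  obtain \<aa> where id: "ideal \<aa> R" and iff: "\<And>T f. cring T \<Longrightarrow> f \<in> Hom R T \<Longrightarrow>
      res F R T f y \<in> U T \<longleftrightarrow> genideal T (f ` \<aa>) = carrier T"
    using U R y unfolding open_sub_def by meson
  have sub: "\<aa> \<subseteq> carrier R" using id ideal.Icarr by fast
  \<comment> \<open>At a field-valued point where \<open>\<aa>\<close> vanishes, \<open>y\<close>
    would lie outside \<open>U\<close>. But fields kill \<open>\<nn>\<close>, so there
    \<open>y\<close> equals \<open>x\<close>, which lies inside.\<close>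
  have "\<aa> = carrier R"
  proof (rule ccontr)
    assume "\<aa> \<noteq> carrier R"
    then obtain k :: "'a ring" and f where k: "field k" "cring k" "f \<in> Hom R k" "\<forall>a\<in>\<aa>. f a = \<zero>\<^bsub>k\<^esub>"
      using field_point[OF R id] by metis
    have "res F R k f y = res F R k f x"
      using xy k square_zero_killed[OF R k(1,3) n] by (simp add: agree_def)
    also have "\<dots> \<in> U k" using subfunctor_res[OF open_sub_sub[OF U] R k(2,3) x] .
    finally have "genideal k (f ` \<aa>) = carrier k" using iff[OF k(2,3)] by simp
    moreover have "f ` \<aa> \<subseteq> {\<zero>\<^bsub>k\<^esub>}" using k by auto
    ultimately show False using genideal_zero_ne[OF k(1)] by blast
  qed
  then have "genideal R (idhom R ` \<aa>) = carrier R"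
    using genideal_self[of "carrier R"] genideal_ideal[of "carrier R"]
    by (auto simp: idhom_def dest: ideal.Icarr)
  then show ?thesis using iff[OF R idhom_Hom[OF R]] psh_id[OF F R y] by simp
qed

text \<open>The base changes that put \<open>x\<close> into an affine open form a covering sieve,
  and the Zariski sheaf \<open>H\<close> is separated for it. This reduces equalities of points to a
  situation where comorphisms of affine schemes can be compared.\<close>

lemma scheme_local:
  fixes R :: "'u ring"
  assumes F: "is_scheme F" and H: "is_scheme H" and R: "cring R" and x: "x \<in> pts F R"
    and p: "p \<in> pts H R" and q: "q \<in> pts H R"
    and loc: "\<And>T f. cring T \<Longrightarrow> f \<in> Hom R T \<Longrightarrow> affine_point F T (res F R T f x) \<Longrightarrow>
      res H R T f p = res H R T f q"
  shows "p = q"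
proof -
  interpret cring R by fact
  have Fp: "is_psh F" and Hp: "is_psh H" using F H by (simp_all add: is_scheme_def)
  obtain \<U> where cov: "open_cover F \<U> (\<lambda>U. U)" and rep: "\<forall>U\<in>\<U>. \<exists>A u. represented F U A u"
    using F by (auto simp: is_scheme_def)
  define C where "C = {(T, f). cring T \<and> f \<in> Hom R T \<and> affine_point F T (res F R T f x)}"
  have sieve: "C \<in> sieves R"
  proof -
    have "(W, hcomp R h f) \<in> C" if T: "(T, f) \<in> C" and W: "cring W" "h \<in> Hom T W" for T f W h
    proof -
      have *: "cring T" "f \<in> Hom R T" "affine_point F T (res F R T f x)" using T by (auto simp: C_def)
      have "affine_point F W (res F T W h (res F R T f x))"
        by (rule affine_point_res[OF *(3,1) W])
      then show ?thesis
        using W hcomp_Hom[OF R *(2) W(2)] psh_comp[OF Fp R *(1) W(1) *(2) W(2) x] by (simp add: C_def)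
    qed
    then show ?thesis by (auto simp: sieves_def C_def)
  qed
  \<comment> \<open>The largest set of candidates: all elements whose inversion forces membership in
    \<open>C\<close>. It generates the unit ideal, since a residue field killing it would also kill
    the ideal of a member of the cover that contains the point there.\<close>
  define A where "A = {a \<in> carrier R. \<forall>T. cring T \<longrightarrow> (\<forall>f\<in>Hom R T. f a \<in> Units T \<longrightarrow> (T, f) \<in> C)}"
  have A: "A \<subseteq> carrier R" by (auto simp: A_def)
  have "genideal R A = carrier R"
  proof (rule ccontr)
    assume ne: "genideal R A \<noteq> carrier R"
    obtain k :: "'u ring" and f where k: "field k" "cring k" "f \<in> Hom R k"
        "\<forall>a\<in>genideal R A. f a = \<zero>\<^bsub>k\<^esub>"
      using field_point[OF R genideal_ideal[OF A] ne] by metis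
    have "res F R k f x \<in> pts F k" by (rule psh_closed[OF Fp R k(2,3) x])
    then obtain U where U: "U \<in> \<U>" "res F R k f x \<in> U k" using cov k(1) unfolding open_cover_def by blast
    have oU: "open_sub F U" using cov U by (simp add: open_cover_def)
    obtain \<aa> where id: "ideal \<aa> R" and iff: "\<And>T f. cring T \<Longrightarrow> f \<in> Hom R T \<Longrightarrow>
        res F R T f x \<in> U T \<longleftrightarrow> genideal T (f ` \<aa>) = carrier T"
      using oU R x unfolding open_sub_def by meson
    have sub: "\<aa> \<subseteq> carrier R" using id ideal.Icarr by fast
    have "\<aa> \<subseteq> A"
    proof
      fix a assume a: "a \<in> \<aa>"
      have "(T, g) \<in> C" if T: "cring T" and g: "g \<in> Hom R T" and u: "g a \<in> Units T" for T g
      proof -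
        interpret T: cring T by fact
        have im: "g ` \<aa> \<subseteq> carrier T" using sub Hom_closed[OF g] by auto
        interpret J: ideal "genideal T (g ` \<aa>)" T using im by (rule T.genideal_ideal)
        have "g a \<in> genideal T (g ` \<aa>)" using T.genideal_self[OF im] a by blast
        then have "inv\<^bsub>T\<^esub> (g a) \<otimes>\<^bsub>T\<^esub> g a \<in> genideal T (g ` \<aa>)"
          using u by (intro J.I_l_closed) auto
        then have "genideal T (g ` \<aa>) = carrier T"
          using u J.one_imp_carrier by simp
        then have "res F R T g x \<in> U T" using iff[OF T g] by simp
        then show ?thesis using T g oU rep U(1) by (auto simp: C_def affine_point_def)
      qed
      then show "a \<in> A" using a sub by (auto simp: A_def)
    qed
    then have "f ` \<aa> \<subseteq> {\<zero>\<^bsub>k\<^esub>}" using k(4) genideal_self[OF A] by auto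
    then show False using genideal_zero_ne[OF k(1)] iff[OF k(2,3)] U(2) by blast
  qed
  moreover have "\<forall>a\<in>A. \<forall>T. cring T \<longrightarrow> (\<forall>f\<in>Hom R T. f a \<in> Units T \<longrightarrow> (T, f) \<in> C)"
    by (simp add: A_def)
  ultimately have C: "C \<in> zariski R"
    unfolding zariski_def using sieve A by blast
  define s where "s = (\<lambda>T f. res H R T f p)"
  have "\<exists>!z. z \<in> pts H R \<and> (\<forall>(T, f)\<in>C. res H R T f z = s T f)"
  proof -
    have "s T f \<in> pts H T \<and>
        (\<forall>W. cring W \<longrightarrow> (\<forall>h\<in>Hom T W. res H T W h (s T f) = s W (hcomp R h f)))"
      if "(T, f) \<in> C" for T f
    proof -
      have T: "cring T" "f \<in> Hom R T" using that by (auto simp: C_def)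
      show ?thesis
        using psh_closed[OF Hp R T p] psh_comp[OF Hp R T(1) _ T(2) _ p] by (simp add: s_def)
    qed
    then have "\<forall>(T, f)\<in>C. s T f \<in> pts H T \<and>
        (\<forall>W. cring W \<longrightarrow> (\<forall>h\<in>Hom T W. res H T W h (s T f) = s W (hcomp R h f)))"
      by blast
    then show ?thesis using H R C by (simp add: is_scheme_def zariski_sheaf_def)
  qed
  moreover have "\<forall>(T, f)\<in>C. res H R T f p = s T f" "\<forall>(T, f)\<in>C. res H R T f q = s T f"
    using loc by (auto simp: s_def C_def)
  ultimately show ?thesis using p q by blast
qed

lemma represented_inj:
  assumes "represented F U A u" "cring R" "\<phi> \<in> Hom A R" "\<psi> \<in> Hom A R" "res F A R \<phi> u = res F A R \<psi> u"
  shows "\<phi> = \<psi>"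
  using assms by (auto simp: represented_def bij_betw_def inj_on_def)

lemma represented_obtain:
  assumes "represented F U A u" "cring R" "x \<in> U R"
  obtains \<phi> where "\<phi> \<in> Hom A R" "x = res F A R \<phi> u"
  using assms by (auto simp: represented_def bij_betw_def)

text \<open>Agreement is tested on the particular quotient \<open>R/\<nn>\<close>. There both points
  come from the one universal point \<open>u\<close>, so their comorphisms coincide, which is
  congruence modulo \<open>\<nn>\<close>.\<close>

lemma represented_agree_diff:
  fixes R :: "'u ring"
  assumes F: "is_psh F" and U: "represented F U A u" "u \<in> pts F A" and R: "cring R" and I: "ideal \<nn> R"
    and h: "\<phi> \<in> Hom A R" "\<psi> \<in> Hom A R"
    and ag: "agree F R \<nn> (res F A R \<phi> u) (res F A R \<psi> u)" and a: "a \<in> carrier A"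
  shows "\<phi> a \<ominus>\<^bsub>R\<^esub> \<psi> a \<in> \<nn>"
proof -
  have A: "cring A" using U by (simp add: represented_def)
  obtain T :: "'u ring" and f where T: "cring T" "f \<in> Hom R T"
    "\<And>a. a \<in> carrier R \<Longrightarrow> f a = \<zero>\<^bsub>T\<^esub> \<longleftrightarrow> a \<in> \<nn>"
    using quotient_point[OF R I] by metis
  have "res F R T f (res F A R \<phi> u) = res F R T f (res F A R \<psi> u)"
    using ag T ideal.Icarr[OF I] by (simp add: agree_def)
  then have "res F A T (hcomp A f \<phi>) u = res F A T (hcomp A f \<psi>) u"
    using psh_comp[OF F A R T(1) _ T(2) U(2)] h by simp
  then have "hcomp A f \<phi> = hcomp A f \<psi>"
    using represented_inj[OF U(1) T(1)] hcomp_Hom[OF A _ T(2)] h by blast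
  then have eq: "f (\<phi> a) = f (\<psi> a)" using hcomp_apply[OF a] by metis
  interpret ring_hom_cring R T f by (rule Hom_cring[OF T(2) R T(1)])
  have c: "\<phi> a \<in> carrier R" "\<psi> a \<in> carrier R" using h a Hom_closed by fast+
  then have "f (\<phi> a \<ominus>\<^bsub>R\<^esub> \<psi> a) = \<zero>\<^bsub>T\<^esub>"
    using eq by (simp add: R.minus_eq S.r_neg)
  then show ?thesis using T(3) c by simp
qed

text \<open>Each coordinate of \<open>x\<close> differs from the corresponding one of
  \<open>y\<close> by an element of \<open>I \<inter> I'\<close>, hence not at all.\<close>

lemma affine_separated:
  assumes F: "is_psh F" and U: "open_sub F U" "represented F U A u" and R: "cring R"
    and I: "ideal I R" "ideal I' R" "I \<inter> I' \<subseteq> {\<zero>\<^bsub>R\<^esub>}"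
    and x: "x \<in> U R" and y: "y \<in> U R" and ag: "agree F R I x y" "agree F R I' x y"
  shows "x = y"
proof -
  interpret cring R by fact
  have u: "u \<in> pts F A" using U by (auto simp: represented_def intro: subfunctor_pts[OF open_sub_sub])
  obtain \<phi> where p: "\<phi> \<in> Hom A R" "x = res F A R \<phi> u" by (rule represented_obtain[OF U(2) R x])
  obtain \<psi> where q: "\<psi> \<in> Hom A R" "y = res F A R \<psi> u" by (rule represented_obtain[OF U(2) R y])
  have "\<phi> a = \<psi> a" if a: "a \<in> carrier A" for a
  proof -
    have "\<phi> a \<ominus>\<^bsub>R\<^esub> \<psi> a \<in> I \<inter> I'"
      using represented_agree_diff[OF F U(2) u R _ p(1) q(1) _ a] I ag p(2) q(2) by simp
    then have "\<phi> a \<ominus>\<^bsub>R\<^esub> \<psi> a = \<zero>\<^bsub>R\<^esub>" using I(3) by auto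
    then show ?thesis using Hom_closed[OF p(1) a] Hom_closed[OF q(1) a] diff_eq_zero_iff by auto
  qed
  then have "\<phi> = \<psi>" using Hom_ext[OF p(1) q(1)] by blast
  then show ?thesis using p q by simp
qed

section \<open>Points with values in the double of a square-zero extension\<close>

lemma is_double_simps:
  assumes "is_double R \<nn> Q p q d" "cring R"
  shows "cring Q" "p \<in> Hom Q R" "q \<in> Hom Q R" "d \<in> Hom R Q"
    "hcomp R p d = idhom R" "hcomp R q d = idhom R"
    "\<And>a. a \<in> carrier R \<Longrightarrow> p (d a) = a" "\<And>a. a \<in> carrier R \<Longrightarrow> q (d a) = a"
    "\<And>a b. a \<in> carrier Q \<Longrightarrow> b \<in> carrier Q \<Longrightarrow> p a = p b \<Longrightarrow> q a = q b \<Longrightarrow> a = b"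
    "\<And>a. a \<in> carrier Q \<Longrightarrow> p a \<ominus>\<^bsub>R\<^esub> q a \<in> \<nn>"
proof -
  show "hcomp R p d = idhom R" "hcomp R q d = idhom R" using assms by (auto simp: is_double_def)
  then show "p (d a) = a" "q (d a) = a" if "a \<in> carrier R" for a
    using that hcomp_apply[of a R p d] hcomp_apply[of a R q d] by (simp_all add: idhom_def)
qed (use assms in \<open>simp_all add: is_double_def\<close>)

text \<open>\<open>I\<close> and \<open>I'\<close> are the ideals of the two ends
  \<open>\<epsilon> = 1\<close> and \<open>\<epsilon> = 0\<close>, and \<open>J\<close> is the
  constant copy of \<open>\<nn>\<close>. The trivial intersections allow a point to be tested at one
  end and modulo \<open>\<nn>\<close>, or at both ends.\<close>

lemma is_double_kernels:
  assumes D: "is_double R \<nn> Q p q d" and R: "cring R" and n: "square_zero R \<nn>"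
  defines "I \<equiv> {a \<in> carrier Q. p a = \<zero>\<^bsub>R\<^esub>}" and "I' \<equiv> {a \<in> carrier Q. q a = \<zero>\<^bsub>R\<^esub>}"
    and "J \<equiv> {a \<in> carrier Q. p a = q a \<and> p a \<in> \<nn>}"
  shows "square_zero Q I" "square_zero Q I'" "ideal J Q" "I \<inter> J \<subseteq> {\<zero>\<^bsub>Q\<^esub>}" "I \<inter> I' \<subseteq> {\<zero>\<^bsub>Q\<^esub>}"
proof -
  interpret cring R by fact
  note D' = is_double_simps[OF D R]
  interpret Q: cring Q by (rule D')
  interpret p: ring_hom_cring Q R p by (rule Hom_cring[OF D'(2,1) R])
  interpret q: ring_hom_cring Q R q by (rule Hom_cring[OF D'(3,1) R])
  interpret n: ideal \<nn> R using n by (simp add: square_zero_def)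
  have n0: "a \<otimes>\<^bsub>R\<^esub> b = \<zero>\<^bsub>R\<^esub>" if "a \<in> \<nn>" "b \<in> \<nn>" for a b
    using n that by (simp add: square_zero_def)
  have eq0: "a = \<zero>\<^bsub>Q\<^esub>" if "a \<in> carrier Q" "p a = \<zero>\<^bsub>R\<^esub>" "q a = \<zero>\<^bsub>R\<^esub>" for a
    using D'(9)[of a "\<zero>\<^bsub>Q\<^esub>"] that by simp
  have inn: "p a \<in> \<nn>" if "a \<in> carrier Q" "q a = \<zero>\<^bsub>R\<^esub>" for a
    using D'(10)[of a] that by (simp add: minus_eq)
  have inn': "q a \<in> \<nn>" if "a \<in> carrier Q" "p a = \<zero>\<^bsub>R\<^esub>" for a
  proof -
    have "\<ominus>\<^bsub>R\<^esub> (q a) \<in> \<nn>" using D'(10)[of a] that by (simp add: minus_eq)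
    then have "\<ominus>\<^bsub>R\<^esub> (\<ominus>\<^bsub>R\<^esub> (q a)) \<in> \<nn>" by (rule n.a_inv_closed)
    then show ?thesis using that by simp
  qed
  show "square_zero Q I'"
    unfolding square_zero_def I'_def using Hom_kernel_ideal[OF D'(1) R D'(3)]
    by (auto intro!: eq0 n0 inn)
  show "square_zero Q I"
    unfolding square_zero_def I_def using Hom_kernel_ideal[OF D'(1) R D'(2)]
    by (auto intro!: eq0 n0 inn')
  show "I \<inter> I' \<subseteq> {\<zero>\<^bsub>Q\<^esub>}" by (auto simp: I_def I'_def intro: eq0)
  show "I \<inter> J \<subseteq> {\<zero>\<^bsub>Q\<^esub>}" by (auto simp: I_def J_def intro: eq0)
  \<comment> \<open>\<open>J\<close> is an ideal because \<open>p c\<close> and \<open>q c\<close>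
    differ by an element of \<open>\<nn>\<close>, which annihilates
    \<open>p a \<in> \<nn>\<close>.\<close>
  have m: "p c \<otimes>\<^bsub>R\<^esub> p a = q c \<otimes>\<^bsub>R\<^esub> q a" if "a \<in> J" "c \<in> carrier Q" for a c
  proof -
    have a: "a \<in> carrier Q" "p a = q a" "p a \<in> \<nn>" using that by (auto simp: J_def)
    have "p c \<otimes>\<^bsub>R\<^esub> p a = (p c \<ominus>\<^bsub>R\<^esub> q c) \<otimes>\<^bsub>R\<^esub> p a \<oplus>\<^bsub>R\<^esub> q c \<otimes>\<^bsub>R\<^esub> p a"
      using p.hom_closed[OF a(1)] p.hom_closed[OF that(2)] q.hom_closed[OF that(2)] by algebra
    then show ?thesis
      using n0[OF D'(10)[OF that(2)] a(3)] a that(2) by simp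
  qed
  show "ideal J Q"
  proof (rule idealI)
    show "ring Q" ..
    show "subgroup J (add_monoid Q)"
    proof (rule Q.add.subgroupI)
      show "J \<noteq> {}" using n.zero_closed by (auto simp: J_def intro!: exI[of _ "\<zero>\<^bsub>Q\<^esub>"])
    qed (auto simp: J_def)
    fix a c assume a: "a \<in> J" and c: "c \<in> carrier Q"
    have "a \<in> carrier Q" "p a = q a" "p a \<in> \<nn>" using a by (auto simp: J_def)
    then have "c \<otimes>\<^bsub>Q\<^esub> a \<in> J" using m[OF a c] c by (simp add: J_def n.I_l_closed)
    then show "c \<otimes>\<^bsub>Q\<^esub> a \<in> J" "a \<otimes>\<^bsub>Q\<^esub> c \<in> J"
      using Q.m_comm[OF c, of a] a by (auto simp: J_def)
  qed
qed

text \<open>Modulo the kernel of \<open>p\<close> every element \<open>a\<close> equals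
  \<open>d (p a)\<close>, so a homomorphism \<open>f\<close> that kills this kernel factors through
  \<open>p\<close> as \<open>f d\<close> after \<open>p\<close>. The same holds for
  \<open>q\<close>.\<close>

lemma is_double_agree:
  assumes D: "is_double R \<nn> Q p q d" and R: "cring R" and F: "is_psh F" and z: "z \<in> pts F Q"
  shows "agree F Q {a \<in> carrier Q. p a = \<zero>\<^bsub>R\<^esub>} z (res F R Q d (res F Q R p z))"
    "agree F Q {a \<in> carrier Q. q a = \<zero>\<^bsub>R\<^esub>} z (res F R Q d (res F Q R q z))"
proof -
  note D' = is_double_simps[OF D R]
  interpret Q: cring Q by (rule D')
  interpret R: cring R by fact
  have *: "agree F Q {a \<in> carrier Q. r a = \<zero>\<^bsub>R\<^esub>} z (res F R Q d (res F Q R r z))"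
    if r: "r \<in> Hom Q R" and rd: "\<And>a. a \<in> carrier R \<Longrightarrow> r (d a) = a" for r
    unfolding agree_def
  proof (intro allI impI ballI)
    fix T f assume T: "cring T" and f: "f \<in> Hom Q T"
      and k: "\<forall>a\<in>{a \<in> carrier Q. r a = \<zero>\<^bsub>R\<^esub>}. f a = \<zero>\<^bsub>T\<^esub>"
    interpret r: ring_hom_cring Q R r by (rule Hom_cring[OF r D'(1) R])
    interpret f: ring_hom_cring Q T f by (rule Hom_cring[OF f D'(1) T])
    have "f a = f (d (r a))" if a: "a \<in> carrier Q" for a
    proof -
      have c: "r a \<in> carrier R" using a by simp
      then have c: "d (r a) \<in> carrier Q" "r a \<in> carrier R" using Hom_closed[OF D'(4)] by auto
      then have "r (a \<ominus>\<^bsub>Q\<^esub> d (r a)) = \<zero>\<^bsub>R\<^esub>" using a rd by (simp add: Q.minus_eq R.r_neg)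
      then have "f (a \<ominus>\<^bsub>Q\<^esub> d (r a)) = \<zero>\<^bsub>T\<^esub>" using k a c by simp
      then have "f a \<ominus>\<^bsub>T\<^esub> f (d (r a)) = \<zero>\<^bsub>T\<^esub>" using a c by (simp add: Q.minus_eq f.S.minus_eq)
      then show ?thesis using a c by (simp add: f.S.diff_eq_zero_iff)
    qed
    then have "f = hcomp Q (hcomp R f d) r"
      using Hom_closed[OF r]
      by (intro Hom_ext[OF f hcomp_Hom[OF D'(1) r hcomp_Hom[OF R D'(4) f]]]) (simp add: hcomp_apply)
    then show "res F Q T f z = res F Q T f (res F R Q d (res F Q R r z))"
      using psh_comp[OF F D'(1) R T r _ z, of "hcomp R f d"] hcomp_Hom[OF R D'(4) f]
        psh_comp[OF F R D'(1) T D'(4) f psh_closed[OF F D'(1) R r z]] by simp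
  qed
  show "agree F Q {a \<in> carrier Q. p a = \<zero>\<^bsub>R\<^esub>} z (res F R Q d (res F Q R p z))"
    "agree F Q {a \<in> carrier Q. q a = \<zero>\<^bsub>R\<^esub>} z (res F R Q d (res F Q R q z))"
    using *[OF D'(2,7)] *[OF D'(3,8)] by simp_all
qed

text \<open>An open set containing the end \<open>q z'\<close> contains the constant point at it,
  hence \<open>z'\<close>, and then \<open>z\<close>: each passage is a congruence modulo a
  square-zero ideal, which open sets do not notice.\<close>

lemma is_double_affine:
  assumes D: "is_double R \<nn> Q p q d" and R: "cring R" and n: "square_zero R \<nn>" and F: "is_psh F"
    and z: "z \<in> pts F Q" and z': "z' \<in> pts F Q" and pz: "res F Q R p z = res F Q R p z'"
    and U: "open_sub F U" and qz: "res F Q R q z' \<in> U R"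
  shows "z \<in> U Q" "z' \<in> U Q"
proof -
  note D' = is_double_simps[OF D R]
  note k = is_double_kernels[OF D R n]
  have "res F R Q d (res F Q R q z') \<in> U Q"
    by (rule subfunctor_res[OF open_sub_sub[OF U] R D'(1,4) qz])
  then show z'U: "z' \<in> U Q"
    using open_sub_square_zero[OF F U D'(1) k(2) agree_sym[OF is_double_agree(2)[OF D R F z']] _ z'] by blast
  have "agree F Q {a \<in> carrier Q. p a = \<zero>\<^bsub>R\<^esub>} z' z"
    using is_double_agree(1)[OF D R F z] is_double_agree(1)[OF D R F z'] pz
    by (simp add: agree_def)
  then show "z \<in> U Q"
    using open_sub_square_zero[OF F U D'(1) k(1) _ z'U z] by blast
qed

text \<open>Agreement at \<open>\<epsilon> = 1\<close> and modulo \<open>\<nn>\<close> makes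
  coordinates congruent modulo \<open>I\<close> and modulo \<open>J\<close>, which meet in zero. The
  end \<open>\<epsilon> = 0\<close> follows, and this is how a value at \<open>x\<close> is reached
  from a value at \<open>y\<close>.\<close>

lemma is_double_separated:
  assumes D: "is_double R \<nn> Q p q d" and R: "cring R" and n: "square_zero R \<nn>" and F: "is_psh F"
    and z: "z \<in> pts F Q" and z': "z' \<in> pts F Q" and pz: "res F Q R p z = res F Q R p z'"
    and aff: "affine_point F R (res F Q R q z')"
    and ag: "\<And>T f. cring T \<Longrightarrow> f \<in> Hom Q T \<Longrightarrow> (\<forall>a\<in>\<nn>. f (d a) = \<zero>\<^bsub>T\<^esub>) \<Longrightarrow> res F Q T f z = res F Q T f z'"
  shows "z = z'"
proof -
  note D' = is_double_simps[OF D R]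
  note k = is_double_kernels[OF D R n]
  obtain U A u where U: "open_sub F U" "represented F U A u" "res F Q R q z' \<in> U R"
    using aff by (auto simp: affine_point_def)
  have 1: "agree F Q {a \<in> carrier Q. p a = \<zero>\<^bsub>R\<^esub>} z z'"
    using is_double_agree(1)[OF D R F z] is_double_agree(1)[OF D R F z'] pz
    by (simp add: agree_def)
  have 2: "agree F Q {a \<in> carrier Q. p a = q a \<and> p a \<in> \<nn>} z z'"
    unfolding agree_def
  proof (intro allI impI ballI)
    fix T f assume T: "cring T" "f \<in> Hom Q T"
      and f: "\<forall>a\<in>{a \<in> carrier Q. p a = q a \<and> p a \<in> \<nn>}. f a = \<zero>\<^bsub>T\<^esub>"
    have "\<nn> \<subseteq> carrier R" using n by (auto simp: square_zero_def dest: ideal.Icarr)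
    then have "\<forall>a\<in>\<nn>. f (d a) = \<zero>\<^bsub>T\<^esub>" using f D' Hom_closed[OF D'(4)] by auto
    then show "res F Q T f z = res F Q T f z'" by (rule ag[OF T])
  qed
  have "ideal {a \<in> carrier Q. p a = \<zero>\<^bsub>R\<^esub>} Q" using k(1) by (simp only: square_zero_def)
  then show ?thesis
    by (rule affine_separated[OF F U(1,2) D'(1) _ k(3,4) is_double_affine[OF D R n F z z' pz U(1,3)] 1 2])
qed

text \<open>An element of the double is determined by its values at both ends. The lemma serves to
  show that the image in \<open>S\<close> of an interpolating point is constant.\<close>

lemma is_double_jointly_injective:
  assumes D: "is_double R \<nn> Q p q d" and R: "cring R" and n: "square_zero R \<nn>" and F: "is_psh F"
    and z: "z \<in> pts F Q" and z': "z' \<in> pts F Q" and pz: "res F Q R p z = res F Q R p z'"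
    and qz: "res F Q R q z = res F Q R q z'" and aff: "affine_point F R (res F Q R q z')"
  shows "z = z'"
proof -
  note D' = is_double_simps[OF D R]
  note k = is_double_kernels[OF D R n]
  obtain U A u where U: "open_sub F U" "represented F U A u" "res F Q R q z' \<in> U R"
    using aff by (auto simp: affine_point_def)
  have 1: "agree F Q {a \<in> carrier Q. p a = \<zero>\<^bsub>R\<^esub>} z z'" "agree F Q {a \<in> carrier Q. q a = \<zero>\<^bsub>R\<^esub>} z z'"
    using is_double_agree[OF D R F z] is_double_agree[OF D R F z'] pz qz
    by (simp_all add: agree_def)
  have "ideal {a \<in> carrier Q. p a = \<zero>\<^bsub>R\<^esub>} Q" "ideal {a \<in> carrier Q. q a = \<zero>\<^bsub>R\<^esub>} Q"
    using k(1,2) by (simp_all only: square_zero_def)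
  then show ?thesis
    by (rule affine_separated[OF F U(1,2) D'(1) _ _ k(5) is_double_affine[OF D R n F z z' pz U(1,3)] 1])
qed

text \<open>The comorphisms of \<open>y\<close> and \<open>x\<close> are congruent modulo
  \<open>\<nn>\<close>, so together they form one homomorphism into the double; \<open>w\<close> is
  the image of the universal point under it.\<close>

lemma is_double_interpolate:
  assumes D: "is_double R \<nn> Q p q d" and R: "cring R" and n: "square_zero R \<nn>" and F: "is_psh F"
    and x: "x \<in> pts F R" and y: "y \<in> pts F R" and ag: "agree F R \<nn> x y" and aff: "affine_point F R x"
  obtains w where "w \<in> pts F Q" "res F Q R p w = y" "res F Q R q w = x"
proof -
  note D' = is_double_simps[OF D R]
  obtain U A u where U: "open_sub F U" "represented F U A u" "x \<in> U R"
    using aff by (auto simp: affine_point_def)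
  have yU: "y \<in> U R" by (rule open_sub_square_zero[OF F U(1) R n ag U(3) y])
  have A: "cring A" and u: "u \<in> pts F A"
    using U by (auto simp: represented_def intro: subfunctor_pts[OF open_sub_sub])
  obtain \<phi> where \<phi>: "\<phi> \<in> Hom A R" "x = res F A R \<phi> u" by (rule represented_obtain[OF U(2) R U(3)])
  obtain \<psi> where \<psi>: "\<psi> \<in> Hom A R" "y = res F A R \<psi> u" by (rule represented_obtain[OF U(2) R yU])
  have "\<forall>a\<in>carrier A. \<psi> a \<ominus>\<^bsub>R\<^esub> \<phi> a \<in> \<nn>"
    using represented_agree_diff[OF F U(2) u R _ \<psi>(1) \<phi>(1)] agree_sym[OF ag] n \<phi> \<psi>
    by (simp add: square_zero_def)
  then obtain \<chi> where \<chi>: "\<chi> \<in> Hom A Q" "hcomp A p \<chi> = \<psi>" "hcomp A q \<chi> = \<phi>"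
    using D A \<phi>(1) \<psi>(1) unfolding is_double_def by blast
  show thesis
  proof (rule that[of "res F A Q \<chi> u"])
    show "res F A Q \<chi> u \<in> pts F Q" by (rule psh_closed[OF F A D'(1) \<chi>(1) u])
    show "res F Q R p (res F A Q \<chi> u) = y" "res F Q R q (res F A Q \<chi> u) = x"
      using psh_comp[OF F A D'(1) R \<chi>(1) D'(2) u] psh_comp[OF F A D'(1) R \<chi>(1) D'(3) u] \<chi> \<phi> \<psi>
      by simp_all
  qed
qed

section \<open>Close points and their behaviour under base change\<close>

lemma near_iff:
  "near X R x y \<longleftrightarrow> str X R x = str X R y \<and> (\<exists>\<nn>. square_zero R \<nn> \<and>
     (\<forall>T. cring T \<longrightarrow> (\<forall>f\<in>Hom R T. res X R T f x = res X R T f y \<longleftrightarrow> (\<forall>a\<in>\<nn>. f a = \<zero>\<^bsub>T\<^esub>))))"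
  by (simp add: near_def square_zero_def image_subset_iff conj_assoc)

lemma near_obtain:
  assumes "near X R x y"
  obtains \<nn> where "square_zero R \<nn>" "agree X R \<nn> x y"
    "\<And>T f. cring T \<Longrightarrow> f \<in> Hom R T \<Longrightarrow> res X R T f x = res X R T f y \<Longrightarrow> (\<forall>a\<in>\<nn>. f a = \<zero>\<^bsub>T\<^esub>)"
proof -
  obtain \<nn> where n: "square_zero R \<nn>" and iff: "\<forall>T. cring T \<longrightarrow> (\<forall>f\<in>Hom R T.
      res X R T f x = res X R T f y \<longleftrightarrow> (\<forall>a\<in>\<nn>. f a = \<zero>\<^bsub>T\<^esub>))"
    using assms unfolding near_iff by blast
  show thesis
  proof (rule that[OF n])
    show "agree X R \<nn> x y" using iff by (simp add: agree_def)
    show "\<forall>a\<in>\<nn>. f a = \<zero>\<^bsub>T\<^esub>" if "cring T" "f \<in> Hom R T" "res X R T f x = res X R T f y" for T f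
      using iff[rule_format, OF that(1,2)] that(3) by simp
  qed
qed

lemma nearI:
  assumes "str X R x = str X R y" "square_zero R \<nn>"
    "\<And>T f. cring T \<Longrightarrow> f \<in> Hom R T \<Longrightarrow> res X R T f x = res X R T f y \<longleftrightarrow> (\<forall>a\<in>\<nn>. f a = \<zero>\<^bsub>T\<^esub>)"
  shows "near X R x y"
  unfolding near_iff using assms by (intro conjI exI[of _ \<nn>] allI impI ballI) auto

lemma near_sym: "near X R x y \<Longrightarrow> near X R y x"
  by (simp add: near_iff eq_commute[of "res X R _ _ x"] eq_commute[of "str X R x"])

lemma near_refl:
  assumes "cring R"
  shows "near X R x x"
proof -
  interpret cring R by fact
  have "f \<zero>\<^bsub>R\<^esub> = \<zero>\<^bsub>T\<^esub>" if "cring T" "f \<in> Hom R T" for T f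
  proof -
    interpret ring_hom_cring R T f by (rule Hom_cring[OF that(2) assms that(1)])
    show ?thesis by simp
  qed
  then show ?thesis
    using zeroideal by (intro nearI[of _ _ _ _ "{\<zero>\<^bsub>R\<^esub>}"]) (auto simp: square_zero_def)
qed

text \<open>The annihilator of a set is an ideal, so the vanishing of products spreads from the
  generators to the generated ideal in one factor and then in the other.\<close>

lemma square_zero_genideal:
  assumes R: "cring R" and D: "D \<subseteq> carrier R" and z: "\<And>a b. a \<in> D \<Longrightarrow> b \<in> D \<Longrightarrow> a \<otimes>\<^bsub>R\<^esub> b = \<zero>\<^bsub>R\<^esub>"
  shows "square_zero R (genideal R D)"
proof -
  interpret cring R by fact
  have ann: "ideal {a \<in> carrier R. \<forall>b\<in>E. a \<otimes>\<^bsub>R\<^esub> b = \<zero>\<^bsub>R\<^esub>} R" (is "ideal ?N R") if E: "E \<subseteq> carrier R" for E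
  proof (rule idealI)
    show "ring R" ..
    show "subgroup ?N (add_monoid R)"
      using E by (intro add.subgroupI) (auto simp: l_distr l_minus subset_iff intro!: exI[of _ "\<zero>\<^bsub>R\<^esub>"])
    fix a c assume a: "a \<in> ?N" and c: "c \<in> carrier R"
    have "c \<otimes>\<^bsub>R\<^esub> a \<otimes>\<^bsub>R\<^esub> b = \<zero>\<^bsub>R\<^esub>" if "b \<in> E" for b
      using a c that E by (auto simp: m_assoc subset_iff)
    then show "c \<otimes>\<^bsub>R\<^esub> a \<in> ?N" "a \<otimes>\<^bsub>R\<^esub> c \<in> ?N" using a c m_comm[of a c] by auto
  qed
  have 1: "genideal R D \<subseteq> {a \<in> carrier R. \<forall>b\<in>D. a \<otimes>\<^bsub>R\<^esub> b = \<zero>\<^bsub>R\<^esub>}"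
    using D z by (intro genideal_minimal ann) auto
  have G: "genideal R D \<subseteq> carrier R" using genideal_ideal[OF D] by (auto dest: ideal.Icarr)
  have "D \<subseteq> {a \<in> carrier R. \<forall>b\<in>genideal R D. a \<otimes>\<^bsub>R\<^esub> b = \<zero>\<^bsub>R\<^esub>}"
  proof
    fix a assume a: "a \<in> D"
    have "a \<otimes>\<^bsub>R\<^esub> b = \<zero>\<^bsub>R\<^esub>" if "b \<in> genideal R D" for b
      using subsetD[OF 1 that] subsetD[OF D a] subsetD[OF G that] a m_comm[of a b] by simp
    then show "a \<in> {a \<in> carrier R. \<forall>b\<in>genideal R D. a \<otimes>\<^bsub>R\<^esub> b = \<zero>\<^bsub>R\<^esub>}" using a D by auto
  qed
  then have "genideal R D \<subseteq> {a \<in> carrier R. \<forall>b\<in>genideal R D. a \<otimes>\<^bsub>R\<^esub> b = \<zero>\<^bsub>R\<^esub>}"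
    by (intro genideal_minimal ann G)
  then show ?thesis using genideal_ideal[OF D] by (auto simp: square_zero_def)
qed

lemma square_zero_extend:
  assumes R: "cring R" and T: "cring T" and f: "f \<in> Hom R T" and n: "square_zero R \<nn>"
  shows "square_zero T (genideal T (f ` \<nn>))"
    "\<And>W g. cring W \<Longrightarrow> g \<in> Hom T W \<Longrightarrow>
      (\<forall>a\<in>genideal T (f ` \<nn>). g a = \<zero>\<^bsub>W\<^esub>) \<longleftrightarrow> (\<forall>a\<in>\<nn>. hcomp R g f a = \<zero>\<^bsub>W\<^esub>)"
proof -
  interpret T: cring T by fact
  interpret ring_hom_cring R T f by (rule Hom_cring[OF f R T])
  have sub: "\<nn> \<subseteq> carrier R" using n by (auto simp: square_zero_def dest: ideal.Icarr)
  then have im: "f ` \<nn> \<subseteq> carrier T" by auto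
  show "square_zero T (genideal T (f ` \<nn>))"
  proof (rule square_zero_genideal[OF T im])
    fix a b assume "a \<in> f ` \<nn>" "b \<in> f ` \<nn>"
    then obtain a' b' where ab: "a = f a'" "b = f b'" "a' \<in> \<nn>" "b' \<in> \<nn>" by auto
    then have "a \<otimes>\<^bsub>T\<^esub> b = f (a' \<otimes>\<^bsub>R\<^esub> b')" using sub by (auto simp: subset_iff)
    then show "a \<otimes>\<^bsub>T\<^esub> b = \<zero>\<^bsub>T\<^esub>" using ab n by (simp add: square_zero_def)
  qed
  fix W g assume W: "cring W" and g: "g \<in> Hom T W"
  show "(\<forall>a\<in>genideal T (f ` \<nn>). g a = \<zero>\<^bsub>W\<^esub>) \<longleftrightarrow> (\<forall>a\<in>\<nn>. hcomp R g f a = \<zero>\<^bsub>W\<^esub>)"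
  proof
    assume "\<forall>a\<in>genideal T (f ` \<nn>). g a = \<zero>\<^bsub>W\<^esub>"
    then show "\<forall>a\<in>\<nn>. hcomp R g f a = \<zero>\<^bsub>W\<^esub>"
      using T.genideal_self[OF im] sub by (auto simp: hcomp_apply subset_iff)
  next
    assume "\<forall>a\<in>\<nn>. hcomp R g f a = \<zero>\<^bsub>W\<^esub>"
    then have "\<forall>a\<in>f ` \<nn>. g a = \<zero>\<^bsub>W\<^esub>" using sub by (auto simp: hcomp_apply subset_iff)
    then show "\<forall>a\<in>genideal T (f ` \<nn>). g a = \<zero>\<^bsub>W\<^esub>" by (rule Hom_kills_genideal[OF T W g im])
  qed
qed

lemma agree_extend:
  assumes F: "is_psh F" and R: "cring R" and T: "cring T" and f: "f \<in> Hom R T" and n: "square_zero R \<nn>"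
    and x: "x \<in> pts F R" and y: "y \<in> pts F R" and ag: "agree F R \<nn> x y"
  shows "agree F T (genideal T (f ` \<nn>)) (res F R T f x) (res F R T f y)"
  unfolding agree_def
proof (intro allI impI ballI)
  fix W g assume W: "cring W" "g \<in> Hom T W" and k: "\<forall>a\<in>genideal T (f ` \<nn>). g a = \<zero>\<^bsub>W\<^esub>"
  have "\<forall>a\<in>\<nn>. hcomp R g f a = \<zero>\<^bsub>W\<^esub>" using square_zero_extend(2)[OF R T f n W] k by simp
  then have "res F R W (hcomp R g f) x = res F R W (hcomp R g f) y"
    using ag W(1) hcomp_Hom[OF R f W(2)] by (simp add: agree_def)
  then show "res F T W g (res F R T f x) = res F T W g (res F R T f y)"
    using psh_comp[OF F R T W(1) f W(2)] x y by simp
qed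

lemma scheme_over_str:
  assumes "scheme_over S X" "cring R" "x \<in> pts X R"
  shows "str X R x \<in> pts S R"
    "\<And>T f. cring T \<Longrightarrow> f \<in> Hom R T \<Longrightarrow> str X T (res X R T f x) = res S R T f (str X R x)"
  using assms by (auto simp: scheme_over_def)

lemma scheme_over_psh: "scheme_over S X \<Longrightarrow> is_psh X"
  by (simp add: scheme_over_def is_scheme_def)

lemma near_res:
  assumes X: "scheme_over S X" and R: "cring R" and T: "cring T" and f: "f \<in> Hom R T"
    and x: "x \<in> pts X R" and y: "y \<in> pts X R" and xy: "near X R x y"
  shows "near X T (res X R T f x) (res X R T f y)"
proof -
  obtain \<nn> where n: "square_zero R \<nn>" "agree X R \<nn> x y"
    "\<And>T f. cring T \<Longrightarrow> f \<in> Hom R T \<Longrightarrow> res X R T f x = res X R T f y \<Longrightarrow> (\<forall>a\<in>\<nn>. f a = \<zero>\<^bsub>T\<^esub>)"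
    using near_obtain[OF xy] by metis
  note Xp = scheme_over_psh[OF X]
  have "str X R x = str X R y" using xy by (simp add: near_def)
  then have s: "str X T (res X R T f x) = str X T (res X R T f y)"
    using scheme_over_str(2)[OF X R _ T f] x y by simp
  show ?thesis
  proof (rule nearI[OF s square_zero_extend(1)[OF R T f n(1)]])
    fix W g assume W: "cring W" and g: "g \<in> Hom T W"
    have "res X T W g (res X R T f x) = res X T W g (res X R T f y) \<longleftrightarrow>
      res X R W (hcomp R g f) x = res X R W (hcomp R g f) y"
      using psh_comp[OF Xp R T W f g] x y by simp
    also have "\<dots> \<longleftrightarrow> (\<forall>a\<in>\<nn>. hcomp R g f a = \<zero>\<^bsub>W\<^esub>)"
      using n(2,3) W hcomp_Hom[OF R f g] unfolding agree_def by blast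
    also have "\<dots> \<longleftrightarrow> (\<forall>a\<in>genideal T (f ` \<nn>). g a = \<zero>\<^bsub>W\<^esub>)"
      using square_zero_extend(2)[OF R T f n(1) W g] by simp
    finally show "res X T W g (res X R T f x) = res X T W g (res X R T f y) \<longleftrightarrow>
      (\<forall>a\<in>genideal T (f ` \<nn>). g a = \<zero>\<^bsub>W\<^esub>)" .
  qed
qed

text \<open>
  The interpolating point \<open>w = x + \<epsilon>(y - x)\<close> stays near every point \<open>z\<close> that is near \<open>x\<close> and \<open>y\<close>:
  the ideal of \<open>{z = w}\<close> is generated by the differences of coordinates, whose projections to \<open>R\<close> lie
  in the square-zero ideals of \<open>{z = y}\<close> and \<open>{z = x}\<close>.
\<close>

lemma near_interpolate:
  assumes X: "scheme_over S X" and S: "is_psh S"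
    and D: "is_double R \<nn> Q p q d" and R: "cring R" and n: "square_zero R \<nn>"
    and x: "x \<in> pts X R" and y: "y \<in> pts X R" and aff: "affine_point X R x" "affine_point S R (str X R x)"
    and w: "w \<in> pts X Q" "res X Q R p w = y" "res X Q R q w = x"
    and z: "z \<in> pts X R" "near X R z x" "near X R z y"
  shows "near X Q (res X R Q d z) w"
proof -
  note Xp = scheme_over_psh[OF X]
  note D' = is_double_simps[OF D R]
  have dz: "res X R Q d z \<in> pts X Q" by (rule psh_closed[OF Xp R D'(1,4) z(1)])
  obtain U A u where U: "open_sub X U" "represented X U A u" "x \<in> U R"
    using aff by (auto simp: affine_point_def)
  have A: "cring A" and u: "u \<in> pts X A"
    using U by (auto simp: represented_def intro: subfunctor_pts[OF open_sub_sub])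
  obtain N where N: "square_zero R N" "agree X R N z x" using near_obtain[OF z(2)] by metis
  obtain N' where N': "square_zero R N'" "agree X R N' z y" using near_obtain[OF z(3)] by metis
  have zU: "z \<in> U R" by (rule open_sub_square_zero[OF Xp U(1) R N(1) agree_sym[OF N(2)] U(3) z(1)])
  have yU: "y \<in> U R" by (rule open_sub_square_zero[OF Xp U(1) R N'(1) N'(2) zU y])
  have wU: "w \<in> U Q" by (rule is_double_affine(2)[OF D R n Xp w(1) w(1) refl U(1)]) (use w U in simp)
  obtain \<phi> where \<phi>: "\<phi> \<in> Hom A R" "x = res X A R \<phi> u" by (rule represented_obtain[OF U(2) R U(3)])
  obtain \<psi> where \<psi>: "\<psi> \<in> Hom A R" "y = res X A R \<psi> u" by (rule represented_obtain[OF U(2) R yU])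
  obtain \<zeta> where \<zeta>: "\<zeta> \<in> Hom A R" "z = res X A R \<zeta> u" by (rule represented_obtain[OF U(2) R zU])
  obtain \<chi> where \<chi>: "\<chi> \<in> Hom A Q" "w = res X A Q \<chi> u" by (rule represented_obtain[OF U(2) D'(1) wU])
  have p: "hcomp A p \<chi> = \<psi>"
    by (rule represented_inj[OF U(2) R hcomp_Hom[OF A \<chi>(1) D'(2)] \<psi>(1)])
      (use psh_comp[OF Xp A D'(1) R \<chi>(1) D'(2) u] w \<chi> \<psi> in simp)
  have q: "hcomp A q \<chi> = \<phi>"
    by (rule represented_inj[OF U(2) R hcomp_Hom[OF A \<chi>(1) D'(3)] \<phi>(1)])
      (use psh_comp[OF Xp A D'(1) R \<chi>(1) D'(3) u] w \<chi> \<phi> in simp)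
  interpret R: cring R by fact
  interpret Q: cring Q by (rule D')
  interpret p: ring_hom_cring Q R p by (rule Hom_cring[OF D'(2,1) R])
  interpret q: ring_hom_cring Q R q by (rule Hom_cring[OF D'(3,1) R])
  have d: "d a \<in> carrier Q" if "a \<in> carrier R" for a using that Hom_closed[OF D'(4)] by simp
  define E where "E = (\<lambda>a. d (\<zeta> a) \<ominus>\<^bsub>Q\<^esub> \<chi> a) ` carrier A"
  have c: "\<zeta> a \<in> carrier R" "\<chi> a \<in> carrier Q" if "a \<in> carrier A" for a
    using that Hom_closed[OF \<zeta>(1)] Hom_closed[OF \<chi>(1)] by auto
  have E: "E \<subseteq> carrier Q" using c d by (auto simp: E_def)
  have pE: "p a \<in> N'" if aE: "a \<in> E" for a
  proof -
    obtain b where b: "b \<in> carrier A" "a = d (\<zeta> b) \<ominus>\<^bsub>Q\<^esub> \<chi> b" using aE by (auto simp: E_def)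
    have "p a = \<zeta> b \<ominus>\<^bsub>R\<^esub> \<psi> b"
      using b c[OF b(1)] d[OF c(1)[OF b(1)]] p D'(7) hcomp_apply[OF b(1), of p \<chi>] by (simp add: Q.minus_eq R.minus_eq)
    then show ?thesis
      using represented_agree_diff[OF Xp U(2) u R _ \<zeta>(1) \<psi>(1) _ b(1)] N' \<zeta> \<psi>
      by (simp add: square_zero_def)
  qed
  have qE: "q a \<in> N" if aE: "a \<in> E" for a
  proof -
    obtain b where b: "b \<in> carrier A" "a = d (\<zeta> b) \<ominus>\<^bsub>Q\<^esub> \<chi> b" using aE by (auto simp: E_def)
    have "q a = \<zeta> b \<ominus>\<^bsub>R\<^esub> \<phi> b"
      using b c[OF b(1)] d[OF c(1)[OF b(1)]] q D'(8) hcomp_apply[OF b(1), of q \<chi>] by (simp add: Q.minus_eq R.minus_eq)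
    then show ?thesis
      using represented_agree_diff[OF Xp U(2) u R _ \<zeta>(1) \<phi>(1) _ b(1)] N \<zeta> \<phi>
      by (simp add: square_zero_def)
  qed
  have sq: "square_zero Q (genideal Q E)"
  proof (rule square_zero_genideal[OF D'(1) E])
    fix a b assume ab: "a \<in> E" "b \<in> E"
    then have "p (a \<otimes>\<^bsub>Q\<^esub> b) = \<zero>\<^bsub>R\<^esub>" "q (a \<otimes>\<^bsub>Q\<^esub> b) = \<zero>\<^bsub>R\<^esub>"
      using E pE qE N(1) N'(1) by (auto simp: square_zero_def subset_iff)
    then show "a \<otimes>\<^bsub>Q\<^esub> b = \<zero>\<^bsub>Q\<^esub>"
      using D'(9)[of "a \<otimes>\<^bsub>Q\<^esub> b" "\<zero>\<^bsub>Q\<^esub>"] ab E by (auto simp: subset_iff)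
  qed
  \<comment> \<open>Closeness includes equality of the images in \<open>S\<close>. These are
    compared at both ends of the double, where they are the images of \<open>z, y\<close> and of
    \<open>z, x\<close>.\<close>
  have s: "str X Q (res X R Q d z) = str X Q w"
  proof (rule is_double_jointly_injective[OF D R n S])
    show "str X Q (res X R Q d z) \<in> pts S Q" "str X Q w \<in> pts S Q"
      using scheme_over_str(1)[OF X D'(1)] dz w by auto
    have zz: "str X R z = str X R x" "str X R z = str X R y" using z by (auto simp: near_def)
    have idz: "res X Q R p (res X R Q d z) = z" "res X Q R q (res X R Q d z) = z"
      using psh_comp[OF Xp R D'(1) R D'(4,2) z(1)] psh_comp[OF Xp R D'(1) R D'(4,3) z(1)] D'(5,6)
        psh_id[OF Xp R z(1)] by simp_all
    show "res S Q R p (str X Q (res X R Q d z)) = res S Q R p (str X Q w)"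
      "res S Q R q (str X Q (res X R Q d z)) = res S Q R q (str X Q w)"
      using scheme_over_str(2)[OF X D'(1) dz R] scheme_over_str(2)[OF X D'(1) w(1) R] D'(2,3) idz zz w by metis+
    show "affine_point S R (res S Q R q (str X Q w))"
      using scheme_over_str(2)[OF X D'(1) w(1) R D'(3)] w aff by simp
  qed
  show ?thesis
  proof (rule nearI[OF s sq])
    fix T f assume T: "cring T" and f: "f \<in> Hom Q T"
    interpret f: ring_hom_cring Q T f by (rule Hom_cring[OF f D'(1) T])
    have h: "hcomp A d \<zeta> \<in> Hom A Q" by (rule hcomp_Hom[OF A \<zeta>(1) D'(4)])
    have "res X Q T f (res X R Q d z) = res X A T (hcomp A f (hcomp A d \<zeta>)) u"
      using psh_comp[OF Xp A D'(1) T h f u] psh_comp[OF Xp A R D'(1) \<zeta>(1) D'(4) u] \<zeta> by simp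
    moreover have "res X Q T f w = res X A T (hcomp A f \<chi>) u"
      using psh_comp[OF Xp A D'(1) T \<chi>(1) f u] \<chi> by simp
    ultimately have "res X Q T f (res X R Q d z) = res X Q T f w \<longleftrightarrow> hcomp A f (hcomp A d \<zeta>) = hcomp A f \<chi>"
      using represented_inj[OF U(2) T hcomp_Hom[OF A h f] hcomp_Hom[OF A \<chi>(1) f]] by auto
    also have "\<dots> \<longleftrightarrow> (\<forall>a\<in>carrier A. f (d (\<zeta> a)) = f (\<chi> a))"
    proof
      assume "hcomp A f (hcomp A d \<zeta>) = hcomp A f \<chi>"
      then show "\<forall>a\<in>carrier A. f (d (\<zeta> a)) = f (\<chi> a)" by (metis hcomp_apply)
    next
      assume "\<forall>a\<in>carrier A. f (d (\<zeta> a)) = f (\<chi> a)"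
      then show "hcomp A f (hcomp A d \<zeta>) = hcomp A f \<chi>"
        by (intro Hom_ext[OF hcomp_Hom[OF A h f] hcomp_Hom[OF A \<chi>(1) f]]) (simp add: hcomp_apply)
    qed
    also have "\<dots> \<longleftrightarrow> (\<forall>a\<in>E. f a = \<zero>\<^bsub>T\<^esub>)"
    proof -
      have "f (d (\<zeta> a)) = f (\<chi> a) \<longleftrightarrow> f (d (\<zeta> a) \<ominus>\<^bsub>Q\<^esub> \<chi> a) = \<zero>\<^bsub>T\<^esub>" if "a \<in> carrier A" for a
        using c[OF that] d[OF c(1)[OF that]] f.S.diff_eq_zero_iff[of "f (d (\<zeta> a))" "f (\<chi> a)"]
        by (simp add: Q.minus_eq f.S.minus_eq)
      then show ?thesis by (auto simp: E_def)
    qed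
    also have "\<dots> \<longleftrightarrow> (\<forall>a\<in>genideal Q E. f a = \<zero>\<^bsub>T\<^esub>)"
      using Hom_kills_genideal[OF D'(1) T f E] Q.genideal_self[OF E] by blast
    finally show "res X Q T f (res X R Q d z) = res X Q T f w \<longleftrightarrow> (\<forall>a\<in>genideal Q E. f a = \<zero>\<^bsub>T\<^esub>)" .
  qed
qed

section \<open>Interpolation between close points\<close>

text \<open>The property of an open subscheme that interpolation uses: the moving point cannot leave
  \<open>U\<close>. It is visibly preserved by intersections and so applies to the overlaps
  \<open>inter2 U i j\<close>.\<close>

definition infinitesimally_stable :: "('u, 'x, 'z) psh_scheme \<Rightarrow> ('u ring \<Rightarrow> 'x set) \<Rightarrow> bool" where
  "infinitesimally_stable X U \<longleftrightarrow> subfunctor X U \<and>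
     (\<forall>R \<nn> x y. cring R \<and> square_zero R \<nn> \<and> agree X R \<nn> x y \<and> x \<in> U R \<and> y \<in> pts X R \<longrightarrow> y \<in> U R)"

lemma open_sub_stable: "is_psh X \<Longrightarrow> open_sub X U \<Longrightarrow> infinitesimally_stable X U"
  unfolding infinitesimally_stable_def
  by (intro conjI allI impI; (elim conjE)?) (rule open_sub_sub open_sub_square_zero; assumption)+

text \<open>The range of the moving vertex \<open>w\<close>. Forms are evaluated only on pairwise
  close points, so \<open>w\<close> has to stay close to all fixed vertices \<open>Z\<close>, pulled
  back to \<open>T\<close>.\<close>

definition near_all ::
  "('u, 'x, 's, 'z) over_sch_scheme \<Rightarrow> ('u ring \<Rightarrow> 'x set) \<Rightarrow> 'u ring \<Rightarrow> 'x set \<Rightarrow>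
   'u ring \<Rightarrow> ('u \<Rightarrow> 'u) \<Rightarrow> 'x \<Rightarrow> bool" where
  "near_all X U R Z T f w \<longleftrightarrow> w \<in> U T \<and> (\<forall>z\<in>Z. near X T (res X R T f z) w)"

text \<open>Interpolation compares coordinates in three places at once: at the moving point in
  \<open>X\<close>, at its image in \<open>S\<close> and at the value in \<open>H\<close>. Three
  nested localisations make all of them affine.\<close>

lemma scheme_local3:
  fixes R :: "'u ring"
  assumes F: "is_scheme F" "is_scheme F'" and H: "is_scheme H" and R: "cring R"
    and x: "x \<in> pts F R" and x': "x' \<in> pts F' R"
    and p: "p \<in> pts H R" and q: "q \<in> pts H R"
    and loc: "\<And>T f. cring T \<Longrightarrow> f \<in> Hom R T \<Longrightarrow> affine_point F T (res F R T f x) \<Longrightarrow>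
      affine_point F' T (res F' R T f x') \<Longrightarrow> affine_point H T (res H R T f q) \<Longrightarrow>
      res H R T f p = res H R T f q"
  shows "p = q"
proof (rule scheme_local[OF F(1) H R x p q])
  have psh: "is_psh F" "is_psh F'" "is_psh H" using F H by (simp_all add: is_scheme_def)
  fix T f assume T: "cring T" and f: "f \<in> Hom R T" and a: "affine_point F T (res F R T f x)"
  show "res H R T f p = res H R T f q"
  proof (rule scheme_local[OF F(2) H T psh_closed[OF psh(2) R T f x'] psh_closed[OF psh(3) R T f p]
        psh_closed[OF psh(3) R T f q]])
    fix T' f' assume T': "cring T'" and f': "f' \<in> Hom T T'"
      and a': "affine_point F' T' (res F' T T' f' (res F' R T f x'))"
    let ?g = "hcomp R f' f"
    have g: "?g \<in> Hom R T'" by (rule hcomp_Hom[OF R f f'])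
    have "res H R T' ?g p = res H R T' ?g q"
    proof (rule scheme_local[OF H H T' psh_closed[OF psh(3) R T' g q] psh_closed[OF psh(3) R T' g p]
          psh_closed[OF psh(3) R T' g q]])
      fix W h assume W: "cring W" and h: "h \<in> Hom T' W"
        and b: "affine_point H W (res H T' W h (res H R T' ?g q))"
      have "affine_point F T' (res F R T' ?g x)" "affine_point F' T' (res F' R T' ?g x')"
        using affine_point_res[OF a T T' f'] a' psh_comp[OF psh(1) R T T' f f' x]
          psh_comp[OF psh(2) R T T' f f' x'] by simp_all
      then have "affine_point F W (res F T' W h (res F R T' ?g x))"
          "affine_point F' W (res F' T' W h (res F' R T' ?g x'))"
        by (auto intro: affine_point_res[OF _ T' W h])
      with b show "res H T' W h (res H R T' ?g p) = res H T' W h (res H R T' ?g q)"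
        using loc[OF W hcomp_Hom[OF R g h]] psh_comp[OF psh(1) R T' W g h x]
          psh_comp[OF psh(2) R T' W g h x'] psh_comp[OF psh(3) R T' W g h p]
          psh_comp[OF psh(3) R T' W g h q] by simp
    qed
    then show "res H T T' f' (res H R T f p) = res H T T' f' (res H R T f q)"
      using psh_comp[OF psh(3) R T T' f f' p] psh_comp[OF psh(3) R T T' f f' q] by simp
  qed
qed

lemma near_all_hcomp:
  assumes "is_psh X" "cring R" "cring T" "f \<in> Hom R T" "cring T'" "g \<in> Hom T T'" "Z \<subseteq> pts X R"
  shows "near_all X U T (res X R T f ` Z) T' g w \<longleftrightarrow> near_all X U R Z T' (hcomp R g f) w"
  using assms psh_comp[of X R T T' f g] by (auto simp: near_all_def subset_iff)

text \<open>
  Two functions of a point \<open>w\<close> that agree at \<open>w = y\<close>, and identically once \<open>x = y\<close>, agree at \<open>w = x\<close>: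
  on the double \<open>R \<oplus> \<epsilon>\<nn>\<close> compare them at \<open>w = x + \<epsilon>(y - x)\<close>; their difference vanishes for
  \<open>\<epsilon> = 1\<close> and modulo \<open>\<nn>\<close>, hence identically, in particular for \<open>\<epsilon> = 0\<close>.
\<close>

lemma interpolation_affine:
  fixes R :: "'u ring"
  assumes inf: "infinite (UNIV :: 'u set)" and S: "is_psh S" and X: "scheme_over S X" and H: "is_psh H"
    and U: "infinitesimally_stable X U" and R: "cring R"
    and xy: "x \<in> Z" "y \<in> Z" and Z: "Z \<subseteq> U R" "\<And>z. z \<in> Z \<Longrightarrow> near X R z x \<and> near X R z y"
    and aff: "affine_point X R x" "affine_point S R (str X R x)" "affine_point H R (\<Psi>' R (idhom R) x)"
    and pts: "\<And>T f w. cring T \<Longrightarrow> f \<in> Hom R T \<Longrightarrow> near_all X U R Z T f w \<Longrightarrow>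
      \<Psi> T f w \<in> pts H T \<and> \<Psi>' T f w \<in> pts H T"
    and nat: "\<And>T f w W k. cring T \<Longrightarrow> f \<in> Hom R T \<Longrightarrow> near_all X U R Z T f w \<Longrightarrow>
      cring W \<Longrightarrow> k \<in> Hom T W \<Longrightarrow>
      res H T W k (\<Psi> T f w) = \<Psi> W (hcomp R k f) (res X T W k w) \<and>
      res H T W k (\<Psi>' T f w) = \<Psi>' W (hcomp R k f) (res X T W k w)"
    and y: "\<Psi> R (idhom R) y = \<Psi>' R (idhom R) y"
    and deg: "\<And>T f w. cring T \<Longrightarrow> f \<in> Hom R T \<Longrightarrow> near_all X U R Z T f w \<Longrightarrow>
      res X R T f x = res X R T f y \<Longrightarrow> \<Psi> T f w = \<Psi>' T f w"
  shows "\<Psi> R (idhom R) x = \<Psi>' R (idhom R) x"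
proof -
  note Xp = scheme_over_psh[OF X]
  have sub: "subfunctor X U" using U by (simp add: infinitesimally_stable_def)
  have xyU: "x \<in> U R" "y \<in> U R" using xy Z by auto
  have xyp: "x \<in> pts X R" "y \<in> pts X R" using subfunctor_pts[OF sub R] xyU by auto
  have nxy: "near X R x y" using Z(2)[OF xy(1)] by simp
  obtain \<nn> where n: "square_zero R \<nn>" "agree X R \<nn> x y" using near_obtain[OF nxy] by metis
  have "ideal \<nn> R" using n by (simp add: square_zero_def)
  then obtain Q p q d where D: "is_double R \<nn> Q p q d" by (rule double_exists[OF inf R])
  note D' = is_double_simps[OF D R]
  obtain w where w: "w \<in> pts X Q" "res X Q R p w = y" "res X Q R q w = x"
    by (rule is_double_interpolate[OF D R n(1) Xp xyp n(2) aff(1)])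
  have dx: "res X R Q d x \<in> U Q" by (rule subfunctor_res[OF sub R D'(1,4) xyU(1)])
  have "agree X Q {a \<in> carrier Q. q a = \<zero>\<^bsub>R\<^esub>} (res X R Q d x) w"
    using is_double_agree(2)[OF D R Xp w(1)] w(3) by (simp add: agree_sym)
  then have wU: "w \<in> U Q"
    using U D'(1) is_double_kernels(2)[OF D R n(1)] dx w(1) unfolding infinitesimally_stable_def by blast
  have nearw: "near X Q (res X R Q d z) w" if "z \<in> Z" for z
  proof (rule near_interpolate[OF X S D R n(1) xyp aff(1,2) w])
    show "z \<in> pts X R" using that Z subfunctor_pts[OF sub R] by auto
  qed (use Z(2)[OF that] in auto)
  then have A: "near_all X U R Z Q d w" using wU by (simp add: near_all_def)
  have proj: "res H Q R p (\<Psi> Q d w) = \<Psi> R (idhom R) y" "res H Q R p (\<Psi>' Q d w) = \<Psi>' R (idhom R) y"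
    "res H Q R q (\<Psi> Q d w) = \<Psi> R (idhom R) x" "res H Q R q (\<Psi>' Q d w) = \<Psi>' R (idhom R) x"
    using nat[OF D'(1,4) A R] D' w by simp_all
  have "\<Psi> Q d w = \<Psi>' Q d w"
  proof (rule is_double_separated[OF D R n(1) H])
    show "\<Psi> Q d w \<in> pts H Q" "\<Psi>' Q d w \<in> pts H Q" using pts[OF D'(1,4) A] by auto
    show "res H Q R p (\<Psi> Q d w) = res H Q R p (\<Psi>' Q d w)" using proj y by simp
    show "affine_point H R (res H Q R q (\<Psi>' Q d w))" using proj aff(3) by simp
    fix T f assume T: "cring T" and f: "f \<in> Hom Q T" and k: "\<forall>a\<in>\<nn>. f (d a) = \<zero>\<^bsub>T\<^esub>"
    let ?g = "hcomp R f d"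
    have g: "?g \<in> Hom R T" by (rule hcomp_Hom[OF R D'(4) f])
    have "a \<in> carrier R" if "a \<in> \<nn>" for a using n(1) that by (auto simp: square_zero_def dest: ideal.Icarr)
    then have "\<forall>a\<in>\<nn>. ?g a = \<zero>\<^bsub>T\<^esub>" using k by (simp add: hcomp_apply)
    then have eq: "res X R T ?g x = res X R T ?g y" using n(2) T g by (simp add: agree_def)
    have "near X T (res X R T ?g z) (res X Q T f w)" if "z \<in> Z" for z
    proof -
      have z: "z \<in> pts X R" using that Z subfunctor_pts[OF sub R] by auto
      show ?thesis
        using near_res[OF X D'(1) T f psh_closed[OF Xp R D'(1,4) z] w(1) nearw[OF that]]
          psh_comp[OF Xp R D'(1) T D'(4) f z] by simp
    qed
    then have "near_all X U R Z T ?g (res X Q T f w)"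
      using subfunctor_res[OF sub D'(1) T f wU] by (simp add: near_all_def)
    then have "\<Psi> T ?g (res X Q T f w) = \<Psi>' T ?g (res X Q T f w)" by (rule deg[OF T g _ eq])
    then show "res H Q T f (\<Psi> Q d w) = res H Q T f (\<Psi>' Q d w)"
      using nat[OF D'(1,4) A T f] by simp
  qed
  then show ?thesis using proj by simp
qed

text \<open>Naturality carries both functions to a base change \<open>f\<close>, where they are
  viewed as functions on homomorphisms out of \<open>T\<close> by composition with \<open>f\<close>.
  The affine case applies there, and equality descends because it can be checked locally.\<close>

lemma interpolation:
  fixes R :: "'u ring"
  assumes inf: "infinite (UNIV :: 'u set)" and S: "is_scheme S" and X: "scheme_over S X" and H: "is_scheme H"
    and U: "infinitesimally_stable X U" and R: "cring R"
    and xy: "x \<in> Z" "y \<in> Z" and Z: "Z \<subseteq> U R" "\<And>z. z \<in> Z \<Longrightarrow> near X R z x \<and> near X R z y"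
    and pts: "\<And>T f w. cring T \<Longrightarrow> f \<in> Hom R T \<Longrightarrow> near_all X U R Z T f w \<Longrightarrow>
      \<Psi> T f w \<in> pts H T \<and> \<Psi>' T f w \<in> pts H T"
    and nat: "\<And>T f w W k. cring T \<Longrightarrow> f \<in> Hom R T \<Longrightarrow> near_all X U R Z T f w \<Longrightarrow>
      cring W \<Longrightarrow> k \<in> Hom T W \<Longrightarrow>
      res H T W k (\<Psi> T f w) = \<Psi> W (hcomp R k f) (res X T W k w) \<and>
      res H T W k (\<Psi>' T f w) = \<Psi>' W (hcomp R k f) (res X T W k w)"
    and y: "\<Psi> R (idhom R) y = \<Psi>' R (idhom R) y"
    and deg: "\<And>T f w. cring T \<Longrightarrow> f \<in> Hom R T \<Longrightarrow> near_all X U R Z T f w \<Longrightarrow>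
      res X R T f x = res X R T f y \<Longrightarrow> \<Psi> T f w = \<Psi>' T f w"
  shows "\<Psi> R (idhom R) x = \<Psi>' R (idhom R) x"
proof -
  note Xp = scheme_over_psh[OF X]
  have Sp: "is_psh S" and Hp: "is_psh H" and Xs: "is_scheme X"
    using S H X by (simp_all add: is_scheme_def scheme_over_def)
  have sub: "subfunctor X U" using U by (simp add: infinitesimally_stable_def)
  have xyU: "x \<in> U R" "y \<in> U R" using xy Z by auto
  have Zp: "Z \<subseteq> pts X R" using subfunctor_pts[OF sub R] Z by auto
  have xyp: "x \<in> pts X R" "y \<in> pts X R" using Zp xy by auto
  have A: "near_all X U R Z R (idhom R) x" "near_all X U R Z R (idhom R) y"
    using xyU Z psh_id[OF Xp R] Zp by (auto simp: near_all_def)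
  note i = idhom_Hom[OF R]
  show ?thesis
  proof (rule scheme_local3[OF Xs S H R xyp(1) scheme_over_str(1)[OF X R xyp(1)]])
    show "\<Psi> R (idhom R) x \<in> pts H R" "\<Psi>' R (idhom R) x \<in> pts H R" using pts[OF R i A(1)] by auto
    fix T f assume T: "cring T" and f: "f \<in> Hom R T"
      and a: "affine_point X T (res X R T f x)" "affine_point S T (res S R T f (str X R x))"
        "affine_point H T (res H R T f (\<Psi>' R (idhom R) x))"
    have e: "res H R T f (\<Psi> R (idhom R) w) = \<Psi> T f (res X R T f w)"
      "res H R T f (\<Psi>' R (idhom R) w) = \<Psi>' T f (res X R T f w)" if "near_all X U R Z R (idhom R) w" for w
      using nat[OF R i that T f] hcomp_idhom[OF f] by simp_all
    note na = near_all_hcomp[OF Xp R T f _ _ Zp]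
    have "\<Psi> T (hcomp R (idhom T) f) (res X R T f x) = \<Psi>' T (hcomp R (idhom T) f) (res X R T f x)"
    proof (rule interpolation_affine[OF inf Sp X Hp U T, of _ "res X R T f ` Z" "res X R T f y"
          "\<lambda>T' g. \<Psi>' T' (hcomp R g f)" "\<lambda>T' g. \<Psi> T' (hcomp R g f)"])
      show "res X R T f x \<in> res X R T f ` Z" "res X R T f y \<in> res X R T f ` Z" using xy by auto
      show "res X R T f ` Z \<subseteq> U T" using Z subfunctor_res[OF sub R T f] by auto
      show "near X T z (res X R T f x) \<and> near X T z (res X R T f y)" if "z \<in> res X R T f ` Z" for z
        using that Z(2) Zp xyp near_res[OF X R T f] by blast
      show "affine_point S T (str X T (res X R T f x))"
        using a(2) scheme_over_str(2)[OF X R xyp(1) T f] by simp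
      show "affine_point H T (\<Psi>' T (hcomp R (idhom T) f) (res X R T f x))"
        using a(3) e[OF A(1)] idhom_hcomp[OF f] by simp
      show "\<Psi> T (hcomp R (idhom T) f) (res X R T f y) = \<Psi>' T (hcomp R (idhom T) f) (res X R T f y)"
        using e[OF A(2)] idhom_hcomp[OF f] y by simp
    next
      fix T' g w assume T': "cring T'" and g: "g \<in> Hom T T'"
        and "near_all X U T (res X R T f ` Z) T' g w"
      then have w: "near_all X U R Z T' (hcomp R g f) w" using na[OF T' g] by simp
      note gf = hcomp_Hom[OF R f g]
      show "\<Psi> T' (hcomp R g f) w \<in> pts H T' \<and> \<Psi>' T' (hcomp R g f) w \<in> pts H T'" by (rule pts[OF T' gf w])
      show "\<Psi> T' (hcomp R g f) w = \<Psi>' T' (hcomp R g f) w"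
        if "res X T T' g (res X R T f x) = res X T T' g (res X R T f y)"
        using deg[OF T' gf w] that psh_comp[OF Xp R T T' f g] xyp by simp
      fix W k assume W: "cring W" and k: "k \<in> Hom T' W"
      show "res H T' W k (\<Psi> T' (hcomp R g f) w) = \<Psi> W (hcomp R (hcomp T k g) f) (res X T' W k w) \<and>
        res H T' W k (\<Psi>' T' (hcomp R g f) w) = \<Psi>' W (hcomp R (hcomp T k g) f) (res X T' W k w)"
        using nat[OF T' gf w W k] hcomp_assoc[OF f, of k g] by simp
    qed (fact a)
    then show "res H R T f (\<Psi> R (idhom R) x) = res H R T f (\<Psi>' R (idhom R) x)"
      using e[OF A(1)] idhom_hcomp[OF f] by simp
  qed
qed

text \<open>
  Apply the natural map to the point \<open>w = e\<^sub>0 + \<epsilon>(e - e\<^sub>0)\<close> of the double: its image agrees with \<open>w\<close>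
  for \<open>\<epsilon> = 0\<close> and modulo \<open>\<nn>\<close>, hence everywhere, in particular for \<open>\<epsilon> = 1\<close>.
\<close>

lemma natural_map_fixes_affine:
  fixes R :: "'u ring"
  assumes inf: "infinite (UNIV :: 'u set)" and S: "is_psh S" and H: "scheme_over S H" and R: "cring R"
    and n: "square_zero R \<nn>" and e: "e \<in> pts H R" and e0: "e0 \<in> pts H R" and se: "str H R e = str H R e0"
    and ag: "agree H R \<nn> e e0"
    and aff: "affine_point H R e" "affine_point S R (str H R e)"
    and nat: "\<And>T f h W k. cring T \<Longrightarrow> f \<in> Hom R T \<Longrightarrow> h \<in> pts H T \<Longrightarrow> str H T h = res S R T f (str H R e) \<Longrightarrow>
      cring W \<Longrightarrow> k \<in> Hom T W \<Longrightarrow>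
      \<Phi> T f h \<in> pts H T \<and> res H T W k (\<Phi> T f h) = \<Phi> W (hcomp R k f) (res H T W k h)"
    and y: "\<Phi> R (idhom R) e0 = e0"
    and deg: "\<And>T f h. cring T \<Longrightarrow> f \<in> Hom R T \<Longrightarrow> h \<in> pts H T \<Longrightarrow> str H T h = res S R T f (str H R e) \<Longrightarrow>
      (\<forall>a\<in>\<nn>. f a = \<zero>\<^bsub>T\<^esub>) \<Longrightarrow> \<Phi> T f h = h"
  shows "\<Phi> R (idhom R) e = e"
proof -
  note Hp = scheme_over_psh[OF H]
  have "ideal \<nn> R" using n by (simp add: square_zero_def)
  then obtain Q p q d where D: "is_double R \<nn> Q p q d" by (rule double_exists[OF inf R])
  note D' = is_double_simps[OF D R]
  obtain w where w: "w \<in> pts H Q" "res H Q R p w = e0" "res H Q R q w = e"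
    by (rule is_double_interpolate[OF D R n Hp e e0 ag aff(1)])
  let ?s = "str H R e"
  have s: "?s \<in> pts S R" by (rule scheme_over_str(1)[OF H R e])
  have ds: "res S R Q d ?s \<in> pts S Q" by (rule psh_closed[OF S R D'(1,4) s])
  have pd: "res S Q R p (res S R Q d ?s) = ?s" "res S Q R q (res S R Q d ?s) = ?s"
    using psh_comp[OF S R D'(1) R D'(4,2) s] psh_comp[OF S R D'(1) R D'(4,3) s] D'(5,6)
      psh_id[OF S R s] by simp_all
  \<comment> \<open>The map \<open>\<Phi>\<close> is controlled only on points over the given point
    of \<open>S\<close>. The interpolating point lies over the constant extension of that point
    because it does so at both ends.\<close>
  have sw: "str H Q w = res S R Q d ?s"
  proof (rule is_double_jointly_injective[OF D R n S scheme_over_str(1)[OF H D'(1) w(1)] ds])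
    show "affine_point S R (res S Q R q (res S R Q d ?s))" using pd aff by simp
    show "res S Q R p (str H Q w) = res S Q R p (res S R Q d ?s)"
      using scheme_over_str(2)[OF H D'(1) w(1) R D'(2)] w pd se by simp
    show "res S Q R q (str H Q w) = res S Q R q (res S R Q d ?s)"
      using scheme_over_str(2)[OF H D'(1) w(1) R D'(3)] w pd by simp
  qed
  have proj: "res H Q R p (\<Phi> Q d w) = \<Phi> R (idhom R) e0" "res H Q R q (\<Phi> Q d w) = \<Phi> R (idhom R) e"
    using nat[OF D'(1,4) w(1) sw R] D' w by simp_all
  have "\<Phi> Q d w = w"
  proof (rule is_double_separated[OF D R n Hp])
    show "\<Phi> Q d w \<in> pts H Q" using nat[OF D'(1,4) w(1) sw R D'(2)] by simp
    show "w \<in> pts H Q" by fact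
    show "res H Q R p (\<Phi> Q d w) = res H Q R p w" using proj y w by simp
    show "affine_point H R (res H Q R q w)" using w aff by simp
    fix T f assume T: "cring T" and f: "f \<in> Hom Q T" and k: "\<forall>a\<in>\<nn>. f (d a) = \<zero>\<^bsub>T\<^esub>"
    let ?g = "hcomp R f d"
    have g: "?g \<in> Hom R T" by (rule hcomp_Hom[OF R D'(4) f])
    have "a \<in> carrier R" if "a \<in> \<nn>" for a using n that by (auto simp: square_zero_def dest: ideal.Icarr)
    then have kg: "\<forall>a\<in>\<nn>. ?g a = \<zero>\<^bsub>T\<^esub>" using k by (simp add: hcomp_apply)
    have "str H T (res H Q T f w) = res S R T ?g ?s"
      using scheme_over_str(2)[OF H D'(1) w(1) T f] sw psh_comp[OF S R D'(1) T D'(4) f s] by simp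
    then show "res H Q T f (\<Phi> Q d w) = res H Q T f w"
      using nat[OF D'(1,4) w(1) sw T f] deg[OF T g psh_closed[OF Hp D'(1) T f w(1)] _ kg] by simp
  qed
  then show ?thesis using proj w by simp
qed

text \<open>After a base change to \<open>T\<close> the thickening is given by the extended ideal
  and the hypotheses persist, so equality may be checked where \<open>e\<close> and its image in
  \<open>S\<close> are affine points.\<close>

lemma natural_map_fixes:
  fixes R :: "'u ring"
  assumes inf: "infinite (UNIV :: 'u set)" and S: "is_scheme S" and H: "scheme_over S H" and R: "cring R"
    and n: "square_zero R \<nn>" and e: "e \<in> pts H R" and e0: "e0 \<in> pts H R" and se: "str H R e = str H R e0"
    and ag: "agree H R \<nn> e e0"
    and nat: "\<And>T f h W k. cring T \<Longrightarrow> f \<in> Hom R T \<Longrightarrow> h \<in> pts H T \<Longrightarrow> str H T h = res S R T f (str H R e) \<Longrightarrow>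
      cring W \<Longrightarrow> k \<in> Hom T W \<Longrightarrow>
      \<Phi> T f h \<in> pts H T \<and> res H T W k (\<Phi> T f h) = \<Phi> W (hcomp R k f) (res H T W k h)"
    and y: "\<Phi> R (idhom R) e0 = e0"
    and deg: "\<And>T f h. cring T \<Longrightarrow> f \<in> Hom R T \<Longrightarrow> h \<in> pts H T \<Longrightarrow> str H T h = res S R T f (str H R e) \<Longrightarrow>
      (\<forall>a\<in>\<nn>. f a = \<zero>\<^bsub>T\<^esub>) \<Longrightarrow> \<Phi> T f h = h"
  shows "\<Phi> R (idhom R) e = e"
proof -
  note Hp = scheme_over_psh[OF H]
  have Sp: "is_psh S" and Hs: "is_scheme H"
    using S H by (simp_all add: is_scheme_def scheme_over_def)
  note i = idhom_Hom[OF R]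
  let ?s = "str H R e"
  have s: "?s \<in> pts S R" by (rule scheme_over_str(1)[OF H R e])
  have si: "str H R h = res S R R (idhom R) ?s" if "str H R h = ?s" for h
    using psh_id[OF Sp R s] that by simp
  show ?thesis
  proof (rule scheme_local3[OF S S Hs R s s])
    show "\<Phi> R (idhom R) e \<in> pts H R" using nat[OF R i e si[OF refl] R i] by simp
    fix T f assume T: "cring T" and f: "f \<in> Hom R T"
      and a: "affine_point S T (res S R T f ?s)" "affine_point H T (res H R T f e)"
    note st = scheme_over_str(2)[OF H R _ T f]
    have tr: "\<Phi> T f (res H R T f h) = res H R T f (\<Phi> R (idhom R) h)" if "h \<in> pts H R" "str H R h = ?s" for h
      using nat[OF R i that(1) si[OF that(2)] T f] hcomp_idhom[OF f] by simp
    have "\<Phi> T (hcomp R (idhom T) f) (res H R T f e) = res H R T f e"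
    proof (rule natural_map_fixes_affine[OF inf Sp H T square_zero_extend(1)[OF R T f n], of _ "res H R T f e0"
          "\<lambda>T' g. \<Phi> T' (hcomp R g f)"])
      show "res H R T f e \<in> pts H T" "res H R T f e0 \<in> pts H T"
        using psh_closed[OF Hp R T f] e e0 by auto
      show "str H T (res H R T f e) = str H T (res H R T f e0)" using st e e0 se by simp
      show "agree H T (genideal T (f ` \<nn>)) (res H R T f e) (res H R T f e0)"
        by (rule agree_extend[OF Hp R T f n e e0 ag])
      show "affine_point S T (str H T (res H R T f e))" using a(1) st[OF e] by simp
      show "\<Phi> T (hcomp R (idhom T) f) (res H R T f e0) = res H R T f e0"
        using tr[OF e0] se y idhom_hcomp[OF f] by simp
    next
      fix T' g h assume T': "cring T'" and g: "g \<in> Hom T T'" and h: "h \<in> pts H T'"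
        and sh: "str H T' h = res S T T' g (str H T (res H R T f e))"
      note gf = hcomp_Hom[OF R f g]
      have sh': "str H T' h = res S R T' (hcomp R g f) ?s"
        using sh st[OF e] psh_comp[OF Sp R T T' f g s] by simp
      show "\<Phi> T' (hcomp R g f) h = h" if "\<forall>a\<in>genideal T (f ` \<nn>). g a = \<zero>\<^bsub>T'\<^esub>"
        using deg[OF T' gf h sh'] square_zero_extend(2)[OF R T f n T' g] that by simp
      fix W k assume W: "cring W" and k: "k \<in> Hom T' W"
      show "\<Phi> T' (hcomp R g f) h \<in> pts H T' \<and>
        res H T' W k (\<Phi> T' (hcomp R g f) h) = \<Phi> W (hcomp R (hcomp T k g) f) (res H T' W k h)"
        using nat[OF T' gf h sh' W k] hcomp_assoc[OF f, of k g] by simp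
    qed (fact a)
    then show "res H R T f (\<Phi> R (idhom R) e) = res H R T f e"
      using tr[OF e refl] idhom_hcomp[OF f] by simp
  qed (fact e)
qed

section \<open>Kernels of restriction and natural automorphisms\<close>

lemma AutoGroup_carrier: "u \<in> carrier (AutoGroup G) \<longleftrightarrow>
    u \<in> extensional (carrier G) \<and> bij_betw u (carrier G) (carrier G) \<and>
    (\<forall>a\<in>carrier G. \<forall>b\<in>carrier G. u (a \<otimes>\<^bsub>G\<^esub> b) = u a \<otimes>\<^bsub>G\<^esub> u b)"
  by (auto simp: AutoGroup_def auto_def Bij_def hom_def bij_betw_def)

lemma AutoGroup_one: "\<one>\<^bsub>AutoGroup G\<^esub> = (\<lambda>h\<in>carrier G. h)"
  by (simp add: AutoGroup_def BijGroup_def)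

lemma AutoGroup_one_apply: "h \<in> carrier G \<Longrightarrow> \<one>\<^bsub>AutoGroup G\<^esub> h = h"
  by (simp add: AutoGroup_one)

context group
begin

abbreviation "Aut \<equiv> AutoGroup G"

lemma Aut_group: "group Aut" by (rule AutoGroup)

lemma Aut_closed: "u \<in> carrier Aut \<Longrightarrow> h \<in> carrier G \<Longrightarrow> u h \<in> carrier G"
  by (auto simp: AutoGroup_carrier bij_betw_def)

lemma Aut_mult: "u \<in> carrier Aut \<Longrightarrow> a \<in> carrier G \<Longrightarrow> b \<in> carrier G \<Longrightarrow> u (a \<otimes> b) = u a \<otimes> u b"
  by (simp add: AutoGroup_carrier)

lemma Aut_hom: "u \<in> carrier Aut \<Longrightarrow> group_hom G G u"
  by (simp add: group_hom_def group_hom_axioms_def hom_def Aut_mult Aut_closed)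

lemma Aut_map_one: "u \<in> carrier Aut \<Longrightarrow> u \<one> = \<one>"
  by (rule group_hom.hom_one[OF Aut_hom])

lemma Aut_map_inv: "u \<in> carrier Aut \<Longrightarrow> h \<in> carrier G \<Longrightarrow> u (inv h) = inv (u h)"
  by (rule group_hom.hom_inv[OF Aut_hom])

lemma Aut_comp: "u \<in> carrier Aut \<Longrightarrow> v \<in> carrier Aut \<Longrightarrow> h \<in> carrier G \<Longrightarrow> (u \<otimes>\<^bsub>Aut\<^esub> v) h = u (v h)"
  by (simp add: AutoGroup_def BijGroup_def auto_def compose_def)

lemma Aut_eqI:
  "u \<in> carrier Aut \<Longrightarrow> v \<in> carrier Aut \<Longrightarrow> (\<And>h. h \<in> carrier G \<Longrightarrow> u h = v h) \<Longrightarrow> u = v"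
  by (auto simp: AutoGroup_carrier intro: extensionalityI)

lemma Aut_inv_apply:
  assumes "u \<in> carrier Aut" "h \<in> carrier G"
  shows "u ((inv\<^bsub>Aut\<^esub> u) h) = h" "(inv\<^bsub>Aut\<^esub> u) (u h) = h"
proof -
  interpret A: group Aut by (rule Aut_group)
  show "u ((inv\<^bsub>Aut\<^esub> u) h) = h" "(inv\<^bsub>Aut\<^esub> u) (u h) = h"
    using assms Aut_comp[of u "inv\<^bsub>Aut\<^esub> u" h] Aut_comp[of "inv\<^bsub>Aut\<^esub> u" u h] by (simp_all add: AutoGroup_one)
qed

definition inner :: "'a \<Rightarrow> 'a \<Rightarrow> 'a" where
  "inner g = (\<lambda>h\<in>carrier G. g \<otimes> h \<otimes> inv g)"

lemma inv_mult_cancel: "x \<in> carrier G \<Longrightarrow> y \<in> carrier G \<Longrightarrow> inv x \<otimes> (x \<otimes> y) = y"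
  by (simp add: m_assoc[symmetric])

lemma mult_inv_cancel: "x \<in> carrier G \<Longrightarrow> y \<in> carrier G \<Longrightarrow> x \<otimes> (inv x \<otimes> y) = y"
  by (simp add: m_assoc[symmetric])

lemmas group_simps = m_assoc inv_mult_group inv_mult_cancel mult_inv_cancel

lemma inner_Aut: "g \<in> carrier G \<Longrightarrow> inner g \<in> carrier Aut"
proof -
  assume g: "g \<in> carrier G"
  have "bij_betw (inner g) (carrier G) (carrier G)"
    using g by (intro bij_betw_byWitness[of _ "inner (inv g)"]) (auto simp: inner_def group_simps)
  then show ?thesis using g by (auto simp: AutoGroup_carrier inner_def group_simps)
qed

lemma inner_apply: "h \<in> carrier G \<Longrightarrow> inner g h = g \<otimes> h \<otimes> inv g"
  by (simp add: inner_def)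

end

section \<open>Sections of a group scheme that are trivial where two points coincide\<close>

locale group_scheme_over =
  fixes S :: "('u, 's) psh" and X :: "('u, 'x, 's) over_sch" and G :: "('u, 'g, 's) group_sch"
  assumes infinite_univ: "infinite (UNIV :: 'u set)"
    and base_scheme: "is_scheme S" and X_over: "scheme_over S X" and G_group: "group_scheme S G"
begin

abbreviation Gam :: "'u ring \<Rightarrow> 's \<Rightarrow> 'g monoid" where "Gam R s \<equiv> grp G R s"

lemma G_over: "scheme_over S G" using G_group by (simp add: group_scheme_def)
lemma G_psh: "is_psh G" by (rule scheme_over_psh[OF G_over])
lemma X_psh: "is_psh X" by (rule scheme_over_psh[OF X_over])
lemma S_psh: "is_psh S" using base_scheme by (simp add: is_scheme_def)
lemma Gam_group: "cring R \<Longrightarrow> s \<in> pts S R \<Longrightarrow> group (Gam R s)"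
  using G_group by (simp add: group_scheme_def)
lemma res_hom: "cring R \<Longrightarrow> s \<in> pts S R \<Longrightarrow> cring T \<Longrightarrow> f \<in> Hom R T \<Longrightarrow>
    group_hom (Gam R s) (Gam T (res S R T f s)) (res G R T f)"
  using G_group psh_closed[OF S_psh, of R T f s]
  by (simp add: group_scheme_def group_hom_def group_hom_axioms_def)
lemma Gam_carrier: "g \<in> carrier (Gam R s) \<longleftrightarrow> g \<in> pts G R \<and> str G R g = s"
  by (simp add: grp_def)

text \<open>Triviality is tested on every base change that identifies \<open>x\<close> and
  \<open>y\<close>. For close points this amounts to reduction modulo the ideal of
  \<open>{x = y}\<close>, without choosing that ideal.\<close>

definition kern :: "'u ring \<Rightarrow> 's \<Rightarrow> 'x \<Rightarrow> 'x \<Rightarrow> 'g set" where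
  "kern R s x y = {g \<in> carrier (Gam R s). \<forall>T. cring T \<longrightarrow> (\<forall>f\<in>Hom R T.
     res X R T f x = res X R T f y \<longrightarrow> res G R T f g = \<one>\<^bsub>Gam T (res S R T f s)\<^esub>)}"

definition natural_aut :: "'u ring \<Rightarrow> 's \<Rightarrow> ('u ring \<Rightarrow> ('u \<Rightarrow> 'u) \<Rightarrow> 'g \<Rightarrow> 'g) \<Rightarrow> bool" where
  "natural_aut R s v \<longleftrightarrow> (\<forall>T. cring T \<longrightarrow> (\<forall>f\<in>Hom R T.
     v T f \<in> carrier (AutoGroup (Gam T (res S R T f s))) \<and>
     (\<forall>W. cring W \<longrightarrow> (\<forall>k\<in>Hom T W. \<forall>h\<in>carrier (Gam T (res S R T f s)).
        res G T W k (v T f h) = v W (hcomp R k f) (res G T W k h)))))"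

definition NA :: "'u ring \<Rightarrow> 's \<Rightarrow> ('g \<Rightarrow> 'g) set" where
  "NA R s = {u. \<exists>v. natural_aut R s v \<and> u = v R (idhom R)}"

text \<open>A natural family extending \<open>u\<close> is asked to be trivial wherever
  \<open>x\<close> and \<open>y\<close> coincide. The single map \<open>u\<close> would not do:
  sections over a base change need not lift to \<open>R\<close>, so \<open>u\<close> does not
  determine its restrictions.\<close>

definition NT :: "'u ring \<Rightarrow> 's \<Rightarrow> 'x \<Rightarrow> 'x \<Rightarrow> ('g \<Rightarrow> 'g) set" where
  "NT R s x y = {u. \<exists>v. natural_aut R s v \<and> u = v R (idhom R) \<and> (\<forall>T. cring T \<longrightarrow> (\<forall>f\<in>Hom R T.
     res X R T f x = res X R T f y \<longrightarrow> v T f = \<one>\<^bsub>AutoGroup (Gam T (res S R T f s))\<^esub>))}"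

lemma natural_autD:
  assumes "natural_aut R s v" "cring T" "f \<in> Hom R T"
  shows "v T f \<in> carrier (AutoGroup (Gam T (res S R T f s)))"
    "\<And>W k h. cring W \<Longrightarrow> k \<in> Hom T W \<Longrightarrow> h \<in> carrier (Gam T (res S R T f s)) \<Longrightarrow>
        res G T W k (v T f h) = v W (hcomp R k f) (res G T W k h)"
  using assms by (auto simp: natural_aut_def)

context
  fixes R s
  assumes R: "cring R" and s: "s \<in> pts S R"
begin

lemma Tgroup: "cring T \<Longrightarrow> f \<in> Hom R T \<Longrightarrow> group (Gam T (res S R T f s))"
  by (intro Gam_group psh_closed[OF S_psh R _ _ s])

lemma Tres: "cring T \<Longrightarrow> f \<in> Hom R T \<Longrightarrow> cring W \<Longrightarrow> k \<in> Hom T W \<Longrightarrow>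
    group_hom (Gam T (res S R T f s)) (Gam W (res S R W (hcomp R k f) s)) (res G T W k)"
  using res_hom[OF _ psh_closed[OF S_psh R _ _ s]] psh_comp[OF S_psh R _ _ _ _ s] by simp

lemma sid: "res S R R (idhom R) s = s"
  by (rule psh_id[OF S_psh R s])

interpretation \<Gamma>: group "Gam R s" by (rule Gam_group[OF R s])
interpretation A: group "AutoGroup (Gam R s)" by (rule \<Gamma>.AutoGroup)

lemma kern_closed: "g \<in> kern R s x y \<Longrightarrow> g \<in> carrier (Gam R s)"
  by (simp add: kern_def)

lemma kern_subgroup: "subgroup (kern R s x y) (Gam R s)"
proof
  show "kern R s x y \<subseteq> carrier (Gam R s)" by (auto simp: kern_def)
  show "\<one>\<^bsub>Gam R s\<^esub> \<in> kern R s x y"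
    by (simp add: kern_def group_hom.hom_one[OF res_hom[OF R s]])
next
  fix g h assume g: "g \<in> kern R s x y" and h: "h \<in> kern R s x y"
  have "res G R T f (g \<otimes>\<^bsub>Gam R s\<^esub> h) = \<one>\<^bsub>Gam T (res S R T f s)\<^esub>"
    if T: "cring T" "f \<in> Hom R T" "res X R T f x = res X R T f y" for T f
  proof -
    interpret group_hom "Gam R s" "Gam T (res S R T f s)" "res G R T f" by (rule res_hom[OF R s T(1,2)])
    show ?thesis using g h T by (simp add: kern_def)
  qed
  then show "g \<otimes>\<^bsub>Gam R s\<^esub> h \<in> kern R s x y" using g h by (simp add: kern_def)
next
  fix g assume g: "g \<in> kern R s x y"
  have "res G R T f (inv\<^bsub>Gam R s\<^esub> g) = \<one>\<^bsub>Gam T (res S R T f s)\<^esub>"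
    if T: "cring T" "f \<in> Hom R T" "res X R T f x = res X R T f y" for T f
  proof -
    interpret group_hom "Gam R s" "Gam T (res S R T f s)" "res G R T f" by (rule res_hom[OF R s T(1,2)])
    show ?thesis using g T by (simp add: kern_def)
  qed
  then show "inv\<^bsub>Gam R s\<^esub> g \<in> kern R s x y" using g by (simp add: kern_def)
qed

lemma kern_conj:
  assumes g: "g \<in> kern R s x y" and h: "h \<in> carrier (Gam R s)"
  shows "h \<otimes>\<^bsub>Gam R s\<^esub> g \<otimes>\<^bsub>Gam R s\<^esub> inv\<^bsub>Gam R s\<^esub> h \<in> kern R s x y"
proof -
  have "res G R T f (h \<otimes>\<^bsub>Gam R s\<^esub> g \<otimes>\<^bsub>Gam R s\<^esub> inv\<^bsub>Gam R s\<^esub> h) = \<one>\<^bsub>Gam T (res S R T f s)\<^esub>"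
    if T: "cring T" "f \<in> Hom R T" "res X R T f x = res X R T f y" for T f
  proof -
    interpret group_hom "Gam R s" "Gam T (res S R T f s)" "res G R T f" by (rule res_hom[OF R s T(1,2)])
    have "res G R T f g = \<one>\<^bsub>Gam T (res S R T f s)\<^esub>" using g T by (simp add: kern_def)
    then show ?thesis using g h by (simp add: kern_def)
  qed
  then show ?thesis using g h by (simp add: kern_def)
qed

lemma NA_Aut: "u \<in> NA R s \<Longrightarrow> u \<in> carrier (AutoGroup (Gam R s))"
  unfolding NA_def using natural_autD(1)[of R s _ R "idhom R", OF _ R idhom_Hom[OF R]] by (force simp: sid)

lemma NA_I: "natural_aut R s v \<Longrightarrow> v R (idhom R) = u \<Longrightarrow> u \<in> NA R s"
  by (auto simp: NA_def)

lemma NT_I: "natural_aut R s v \<Longrightarrow> v R (idhom R) = u \<Longrightarrow>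
    (\<And>T f. cring T \<Longrightarrow> f \<in> Hom R T \<Longrightarrow> res X R T f x = res X R T f y \<Longrightarrow>
      v T f = \<one>\<^bsub>AutoGroup (Gam T (res S R T f s))\<^esub>) \<Longrightarrow> u \<in> NT R s x y"
  unfolding NT_def by blast

lemma NT_E:
  assumes "u \<in> NT R s x y"
  obtains v where "natural_aut R s v" "v R (idhom R) = u"
    "\<forall>T f. cring T \<longrightarrow> f \<in> Hom R T \<longrightarrow> res X R T f x = res X R T f y \<longrightarrow>
      v T f = \<one>\<^bsub>AutoGroup (Gam T (res S R T f s))\<^esub>"
  using assms unfolding NT_def by blast

lemma NT_NA: "u \<in> NT R s x y \<Longrightarrow> u \<in> NA R s"
  by (auto simp: NT_def NA_def)

lemma natural_aut_res:
  assumes v: "natural_aut R s v" and T: "cring T" "f \<in> Hom R T" and h: "h \<in> carrier (Gam R s)"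
  shows "res G R T f (v R (idhom R) h) = v T f (res G R T f h)"
  using natural_autD(2)[OF v R idhom_Hom[OF R] T] h sid hcomp_idhom[OF T(2)] by simp

lemma NA_kern:
  assumes u: "u \<in> NA R s" and g: "g \<in> kern R s x y"
  shows "u g \<in> kern R s x y"
proof -
  obtain v where v: "natural_aut R s v" "u = v R (idhom R)" using u by (auto simp: NA_def)
  have gc: "g \<in> carrier (Gam R s)" using g by (simp add: kern_def)
  have "res G R T f (u g) = \<one>\<^bsub>Gam T (res S R T f s)\<^esub>"
    if T: "cring T" "f \<in> Hom R T" "res X R T f x = res X R T f y" for T f
  proof -
    have "res G R T f g = \<one>\<^bsub>Gam T (res S R T f s)\<^esub>" using g T by (simp add: kern_def)
    then show ?thesis
      using natural_aut_res[OF v(1) T(1,2) gc] v(2) group.Aut_map_one[OF Tgroup natural_autD(1)[OF v(1)]] T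
      by simp
  qed
  then show ?thesis using \<Gamma>.Aut_closed[OF NA_Aut[OF u] gc] by (simp add: kern_def)
qed

text \<open>The kernel of reduction along a square-zero thickening is an additive object, on which \<open>u - 1\<close> acts by zero.\<close>

lemma NT_fixes:
  assumes xy: "near X R x y" and u: "u \<in> NT R s x y" and g: "g \<in> kern R s x y"
  shows "u g = g"
proof -
  obtain v where v: "natural_aut R s v" "v R (idhom R) = u"
    "\<forall>T f. cring T \<longrightarrow> f \<in> Hom R T \<longrightarrow> res X R T f x = res X R T f y \<longrightarrow>
      v T f = \<one>\<^bsub>AutoGroup (Gam T (res S R T f s))\<^esub>"
    by (rule NT_E[OF u])
  obtain \<nn> where n: "square_zero R \<nn>" "agree X R \<nn> x y" using near_obtain[OF xy] .
  have g': "g \<in> pts G R" "str G R g = s" using g by (simp_all add: kern_def Gam_carrier)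
  have e: "\<one>\<^bsub>Gam R s\<^esub> \<in> pts G R" "str G R \<one>\<^bsub>Gam R s\<^esub> = s" using \<Gamma>.one_closed by (simp_all only: Gam_carrier)
  have "v R (idhom R) g = g"
  proof (rule natural_map_fixes[OF infinite_univ base_scheme G_over R n(1) g'(1) e(1)])
    show "str G R g = str G R \<one>\<^bsub>Gam R s\<^esub>" using g' e by simp
    show "agree G R \<nn> g \<one>\<^bsub>Gam R s\<^esub>"
      unfolding agree_def
    proof (intro allI ballI impI)
      fix T f assume T: "cring T" "f \<in> Hom R T" and k: "\<forall>a\<in>\<nn>. f a = \<zero>\<^bsub>T\<^esub>"
      have "res X R T f x = res X R T f y" using n(2) T k by (simp add: agree_def)
      then show "res G R T f g = res G R T f \<one>\<^bsub>Gam R s\<^esub>"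
        using g T group_hom.hom_one[OF res_hom[OF R s T]] by (simp add: kern_def)
    qed
    show "v R (idhom R) \<one>\<^bsub>Gam R s\<^esub> = \<one>\<^bsub>Gam R s\<^esub>"
      using \<Gamma>.Aut_map_one natural_autD(1)[OF v(1) R idhom_Hom[OF R]] sid by simp
  next
    fix T f h assume T: "cring T" and f: "f \<in> Hom R T" and "h \<in> pts G T" "str G T h = res S R T f (str G R g)"
    then have h: "h \<in> carrier (Gam T (res S R T f s))" using g' by (simp add: Gam_carrier)
    show "v T f h = h" if "\<forall>a\<in>\<nn>. f a = \<zero>\<^bsub>T\<^esub>"
      using v(3)[rule_format, OF T f] n(2) T f that h by (simp add: agree_def AutoGroup_one)
    fix W k assume "cring W" "k \<in> Hom T W"
    then show "v T f h \<in> pts G T \<and> res G T W k (v T f h) = v W (hcomp R k f) (res G T W k h)"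
      using natural_autD[OF v(1) T f] h group.Aut_closed[OF Tgroup[OF T f], of "v T f" h]
      by (simp add: Gam_carrier)
  qed
  then show ?thesis using v(2) by simp
qed

text \<open>Where \<open>x\<close> and \<open>y\<close> coincide, \<open>u\<close> is the identity
  and the quotient of \<open>u h\<close> by \<open>h\<close> becomes trivial. This is what puts
  values of brackets into edge kernels.\<close>

lemma NT_displacement:
  assumes u: "u \<in> NT R s x y" and h: "h \<in> carrier (Gam R s)"
  shows "u h \<otimes>\<^bsub>Gam R s\<^esub> inv\<^bsub>Gam R s\<^esub> h \<in> kern R s x y"
proof -
  obtain v where v: "natural_aut R s v" "v R (idhom R) = u"
    "\<forall>T f. cring T \<longrightarrow> f \<in> Hom R T \<longrightarrow> res X R T f x = res X R T f y \<longrightarrow>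
      v T f = \<one>\<^bsub>AutoGroup (Gam T (res S R T f s))\<^esub>"
    by (rule NT_E[OF u])
  have uh: "u h \<in> carrier (Gam R s)" using \<Gamma>.Aut_closed[OF NA_Aut[OF NT_NA[OF u]] h] .
  have "res G R T f (u h \<otimes>\<^bsub>Gam R s\<^esub> inv\<^bsub>Gam R s\<^esub> h) = \<one>\<^bsub>Gam T (res S R T f s)\<^esub>"
    if T: "cring T" "f \<in> Hom R T" "res X R T f x = res X R T f y" for T f
  proof -
    interpret group_hom "Gam R s" "Gam T (res S R T f s)" "res G R T f" by (rule res_hom[OF R s T(1,2)])
    have "res G R T f (u h) = res G R T f h"
      using natural_aut_res[OF v(1) T(1,2) h] v(2) v(3)[rule_format, OF T] h by (simp add: AutoGroup_one)
    then show ?thesis using uh h by simp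
  qed
  then show ?thesis using uh h by (simp add: kern_def)
qed

lemma natural_aut_mult:
  assumes "natural_aut R s v" "natural_aut R s v'"
  shows "natural_aut R s (\<lambda>T f. v T f \<otimes>\<^bsub>AutoGroup (Gam T (res S R T f s))\<^esub> v' T f)"
  unfolding natural_aut_def
proof (intro allI impI ballI conjI)
  fix T f assume T: "cring T" and f: "f \<in> Hom R T"
  interpret g: group "Gam T (res S R T f s)" by (rule Tgroup[OF T f])
  interpret a: group g.Aut by (rule g.Aut_group)
  note d = natural_autD[OF assms(1) T f] natural_autD[OF assms(2) T f]
  show "v T f \<otimes>\<^bsub>g.Aut\<^esub> v' T f \<in> carrier g.Aut" using d by simp
  fix W k h assume W: "cring W" and k: "k \<in> Hom T W" and h: "h \<in> carrier (Gam T (res S R T f s))"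
  interpret w: group "Gam W (res S R W (hcomp R k f) s)" by (rule Tgroup[OF W hcomp_Hom[OF R f k]])
  have "res G T W k h \<in> carrier (Gam W (res S R W (hcomp R k f) s))"
    by (rule group_hom.hom_closed[OF Tres[OF T f W k] h])
  then show "res G T W k ((v T f \<otimes>\<^bsub>g.Aut\<^esub> v' T f) h) =
      (v W (hcomp R k f) \<otimes>\<^bsub>w.Aut\<^esub> v' W (hcomp R k f)) (res G T W k h)"
    using h d(2)[OF W k] d(4)[OF W k h] d(1,3) natural_autD(1)[OF assms(1) W hcomp_Hom[OF R f k]]
      natural_autD(1)[OF assms(2) W hcomp_Hom[OF R f k]]
    by (simp add: g.Aut_comp w.Aut_comp g.Aut_closed)
qed

lemma natural_aut_inv:
  assumes "natural_aut R s v"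
  shows "natural_aut R s (\<lambda>T f. inv\<^bsub>AutoGroup (Gam T (res S R T f s))\<^esub> v T f)"
  unfolding natural_aut_def
proof (intro allI impI ballI conjI)
  fix T f assume T: "cring T" and f: "f \<in> Hom R T"
  interpret g: group "Gam T (res S R T f s)" by (rule Tgroup[OF T f])
  interpret a: group g.Aut by (rule g.Aut_group)
  note d = natural_autD[OF assms(1) T f]
  show i: "inv\<^bsub>g.Aut\<^esub> v T f \<in> carrier g.Aut" using d by simp
  fix W k h assume W: "cring W" and k: "k \<in> Hom T W" and h: "h \<in> carrier (Gam T (res S R T f s))"
  interpret w: group "Gam W (res S R W (hcomp R k f) s)" by (rule Tgroup[OF W hcomp_Hom[OF R f k]])
  let ?h = "(inv\<^bsub>g.Aut\<^esub> v T f) h"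
  have h': "?h \<in> carrier (Gam T (res S R T f s))" by (rule g.Aut_closed[OF i h])
  have "res G T W k ?h \<in> carrier (Gam W (res S R W (hcomp R k f) s))"
    by (rule group_hom.hom_closed[OF Tres[OF T f W k] h'])
  moreover have "res G T W k h = v W (hcomp R k f) (res G T W k ?h)"
    using d(2)[OF W k h'] g.Aut_inv_apply(1)[OF d(1) h] by simp
  ultimately show "res G T W k ?h = (inv\<^bsub>w.Aut\<^esub> v W (hcomp R k f)) (res G T W k h)"
    using w.Aut_inv_apply(2)[OF natural_autD(1)[OF assms(1) W hcomp_Hom[OF R f k]]] by simp
qed

lemma natural_aut_inner:
  assumes g: "g \<in> carrier (Gam R s)"
  shows "natural_aut R s (\<lambda>T f. group.inner (Gam T (res S R T f s)) (res G R T f g))"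
  unfolding natural_aut_def
proof (intro allI impI ballI conjI)
  fix T f assume T: "cring T" and f: "f \<in> Hom R T"
  interpret t: group_hom "Gam R s" "Gam T (res S R T f s)" "res G R T f" by (rule res_hom[OF R s T f])
  show "t.H.inner (res G R T f g) \<in> carrier t.H.Aut" using g by (simp add: t.H.inner_Aut)
  fix W k h assume W: "cring W" and k: "k \<in> Hom T W" and h: "h \<in> carrier (Gam T (res S R T f s))"
  interpret w: group_hom "Gam T (res S R T f s)" "Gam W (res S R W (hcomp R k f) s)" "res G T W k"
    by (rule Tres[OF T f W k])
  have "res G R W (hcomp R k f) g = res G T W k (res G R T f g)"
    using psh_comp[OF G_psh R T W f k] g by (simp add: Gam_carrier)
  then show "res G T W k (t.H.inner (res G R T f g) h) =
      w.H.inner (res G R W (hcomp R k f) g) (res G T W k h)"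
    using g h by (simp add: t.H.inner_apply w.H.inner_apply)
qed

lemma res_id_G: "g \<in> carrier (Gam R s) \<Longrightarrow> res G R R (idhom R) g = g"
  using psh_id[OF G_psh R] by (simp add: Gam_carrier)

lemma NA_mult:
  assumes "u \<in> NA R s" "v \<in> NA R s"
  shows "u \<otimes>\<^bsub>AutoGroup (Gam R s)\<^esub> v \<in> NA R s"
proof -
  obtain u' v' where u: "natural_aut R s u'" "u = u' R (idhom R)" "natural_aut R s v'" "v = v' R (idhom R)"
    using assms unfolding NA_def by blast
  show ?thesis by (rule NA_I[OF natural_aut_mult[OF u(1,3)]]) (simp add: sid u)
qed

lemma NA_inv:
  assumes "u \<in> NA R s"
  shows "inv\<^bsub>AutoGroup (Gam R s)\<^esub> u \<in> NA R s"
proof -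
  obtain u' where u: "natural_aut R s u'" "u = u' R (idhom R)"
    using assms unfolding NA_def by blast
  show ?thesis by (rule NA_I[OF natural_aut_inv[OF u(1)]]) (simp add: sid u)
qed

lemma T_Aut_group: "cring T \<Longrightarrow> f \<in> Hom R T \<Longrightarrow> group (AutoGroup (Gam T (res S R T f s)))"
  by (rule group.AutoGroup[OF Tgroup])

lemma NT_mult:
  assumes "u \<in> NT R s x y" "v \<in> NT R s x y"
  shows "u \<otimes>\<^bsub>AutoGroup (Gam R s)\<^esub> v \<in> NT R s x y"
proof -
  obtain u' where u: "natural_aut R s u'" "u' R (idhom R) = u"
    "\<forall>T f. cring T \<longrightarrow> f \<in> Hom R T \<longrightarrow> res X R T f x = res X R T f y \<longrightarrow>
      u' T f = \<one>\<^bsub>AutoGroup (Gam T (res S R T f s))\<^esub>" by (rule NT_E[OF assms(1)])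
  obtain v' where v: "natural_aut R s v'" "v' R (idhom R) = v"
    "\<forall>T f. cring T \<longrightarrow> f \<in> Hom R T \<longrightarrow> res X R T f x = res X R T f y \<longrightarrow>
      v' T f = \<one>\<^bsub>AutoGroup (Gam T (res S R T f s))\<^esub>" by (rule NT_E[OF assms(2)])
  show ?thesis
  proof (rule NT_I[OF natural_aut_mult[OF u(1) v(1)]])
    fix T f assume T: "cring T" "f \<in> Hom R T" "res X R T f x = res X R T f y"
    interpret a: group "AutoGroup (Gam T (res S R T f s))" by (rule T_Aut_group[OF T(1,2)])
    show "u' T f \<otimes>\<^bsub>AutoGroup (Gam T (res S R T f s))\<^esub> v' T f = \<one>\<^bsub>AutoGroup (Gam T (res S R T f s))\<^esub>"
      using u(3)[rule_format, OF T] v(3)[rule_format, OF T] by simp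
  qed (simp add: sid u v)
qed

lemma NT_inv:
  assumes "u \<in> NT R s x y"
  shows "inv\<^bsub>AutoGroup (Gam R s)\<^esub> u \<in> NT R s x y"
proof -
  obtain u' where u: "natural_aut R s u'" "u' R (idhom R) = u"
    "\<forall>T f. cring T \<longrightarrow> f \<in> Hom R T \<longrightarrow> res X R T f x = res X R T f y \<longrightarrow>
      u' T f = \<one>\<^bsub>AutoGroup (Gam T (res S R T f s))\<^esub>" by (rule NT_E[OF assms(1)])
  show ?thesis
  proof (rule NT_I[OF natural_aut_inv[OF u(1)]])
    fix T f assume T: "cring T" "f \<in> Hom R T" "res X R T f x = res X R T f y"
    interpret a: group "AutoGroup (Gam T (res S R T f s))" by (rule T_Aut_group[OF T(1,2)])
    show "inv\<^bsub>AutoGroup (Gam T (res S R T f s))\<^esub> u' T f = \<one>\<^bsub>AutoGroup (Gam T (res S R T f s))\<^esub>"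
      using u(3)[rule_format, OF T] by simp
  qed (simp add: sid u)
qed

lemma NT_inner:
  assumes "g \<in> kern R s x y"
  shows "\<Gamma>.inner g \<in> NT R s x y"
proof -
  have g: "g \<in> carrier (Gam R s)" using assms by (rule kern_closed)
  show ?thesis
  proof (rule NT_I[OF natural_aut_inner[OF g]])
    fix T f assume T: "cring T" "f \<in> Hom R T" "res X R T f x = res X R T f y"
    interpret t: group "Gam T (res S R T f s)" by (rule Tgroup[OF T(1,2)])
    have "res G R T f g = \<one>\<^bsub>Gam T (res S R T f s)\<^esub>" using assms T by (simp add: kern_def)
    then show "t.inner (res G R T f g) = \<one>\<^bsub>AutoGroup (Gam T (res S R T f s))\<^esub>"
      by (simp add: t.inner_def AutoGroup_one cong: restrict_cong)
  qed (simp add: sid res_id_G[OF g])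
qed

text \<open>Conjugation by \<open>g\<close> is trivial wherever \<open>g\<close> is, so it is one of
  the automorphisms that fix the kernel pointwise.\<close>

lemma kern_commute:
  assumes xy: "near X R x y" and g: "g \<in> kern R s x y" and h: "h \<in> kern R s x y"
  shows "g \<otimes>\<^bsub>Gam R s\<^esub> h = h \<otimes>\<^bsub>Gam R s\<^esub> g"
proof -
  have c: "g \<in> carrier (Gam R s)" "h \<in> carrier (Gam R s)" using g h kern_closed by auto
  have "\<Gamma>.inner g h = h" by (rule NT_fixes[OF xy NT_inner[OF g] h])
  then have "g \<otimes>\<^bsub>Gam R s\<^esub> h \<otimes>\<^bsub>Gam R s\<^esub> inv\<^bsub>Gam R s\<^esub> g = h" using c by (simp add: \<Gamma>.inner_apply)
  then show ?thesis using c \<Gamma>.inv_solve_right' by simp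
qed

end

end

section \<open>Values of combinatorial forms\<close>

lemma degenerate_simps [simp]:
  "degenerate [x, y] \<longleftrightarrow> x = y"
  "degenerate [x, y, z] \<longleftrightarrow> x = y \<or> y = z"
  by (auto simp: degenerate_def less_Suc_eq_0_disj)

lemma simplex_iff:
  "xs \<in> pts (simplex X n U) R \<longleftrightarrow>
     length xs = Suc n \<and> set xs \<subseteq> U R \<and> (\<forall>x\<in>set xs. \<forall>y\<in>set xs. near X R x y)"
  by (simp add: simplex_def)

context group_scheme_over
begin

text \<open>Vertices are collected in a set, so that one hypothesis serves every simplex on these
  points, whatever the order and repetitions of its vertices. \<open>s\<close> is their common image
  in \<open>S\<close>.\<close>

definition nearby :: "('u ring \<Rightarrow> 'x set) \<Rightarrow> 'u ring \<Rightarrow> 's \<Rightarrow> 'x set \<Rightarrow> bool" where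
  "nearby U R s A \<longleftrightarrow> A \<subseteq> U R \<and> (\<forall>x\<in>A. \<forall>y\<in>A. near X R x y) \<and> (\<forall>x\<in>A. str X R x = s)"

lemma nearby_mono: "nearby U R s A \<Longrightarrow> B \<subseteq> A \<Longrightarrow> nearby U R s B"
  unfolding nearby_def by blast

lemma nearbyD:
  assumes "nearby U R s A"
  shows "x \<in> A \<Longrightarrow> x \<in> U R" "x \<in> A \<Longrightarrow> y \<in> A \<Longrightarrow> near X R x y" "x \<in> A \<Longrightarrow> str X R x = s"
  using assms by (auto simp: nearby_def)

lemma simplex_nearby: "nearby U R s A \<Longrightarrow> set xs \<subseteq> A \<Longrightarrow> length xs = Suc n \<Longrightarrow> xs \<in> pts (simplex X n U) R"
  unfolding simplex_iff nearby_def by blast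

lemma nearby_res:
  assumes U: "subfunctor X U" and R: "cring R" and T: "cring T" "f \<in> Hom R T" and A: "nearby U R s A"
  shows "nearby U T (res S R T f s) (res X R T f ` A)"
proof -
  have p: "x \<in> pts X R" if "x \<in> A" for x using subfunctor_pts[OF U R] A that by (auto simp: nearby_def)
  show ?thesis
    unfolding nearby_def
  proof (intro conjI ballI)
    show "res X R T f ` A \<subseteq> U T" using A subfunctor_res[OF U R T] by (auto simp: nearby_def)
    fix x' assume "x' \<in> res X R T f ` A"
    then obtain x where x: "x \<in> A" "x' = res X R T f x" by auto
    show "str X T x' = res S R T f s"
      using scheme_over_str(2)[OF X_over R p[OF x(1)] T] x nearbyD(3)[OF A] by simp
    fix y' assume "y' \<in> res X R T f ` A"
    then obtain y where y: "y \<in> A" "y' = res X R T f y" by auto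
    show "near X T x' y'"
      using near_res[OF X_over R T p[OF x(1)] p[OF y(1)] nearbyD(2)[OF A x(1) y(1)]] x y by simp
  qed
qed

lemma G_form_value:
  assumes w: "G_form X G n U \<omega>" and R: "cring R" and A: "nearby U R s A" and xs: "set xs \<subseteq> A" "length xs = Suc n"
  shows "\<omega> R xs \<in> carrier (Gam R s)"
    "\<And>T f. cring T \<Longrightarrow> f \<in> Hom R T \<Longrightarrow> res G R T f (\<omega> R xs) = \<omega> T (map (res X R T f) xs)"
    "degenerate xs \<Longrightarrow> \<omega> R xs = \<one>\<^bsub>Gam R s\<^esub>"
proof -
  have x: "xs \<in> pts (simplex X n U) R" using simplex_nearby[OF A xs] .
  have "hd xs \<in> A" using xs by (cases xs) auto
  then have s: "str X R (hd xs) = s" using A by (simp add: nearby_def)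
  show "\<omega> R xs \<in> carrier (Gam R s)"
    "\<And>T f. cring T \<Longrightarrow> f \<in> Hom R T \<Longrightarrow> res G R T f (\<omega> R xs) = \<omega> T (map (res X R T f) xs)"
    using w x R s unfolding G_form_def G_section_def by (auto simp: G_at_def simplex_def)
  show "degenerate xs \<Longrightarrow> \<omega> R xs = \<one>\<^bsub>Gam R s\<^esub>"
    using w x R s unfolding G_form_def vanishes_on_degenerate_def
    by (auto simp: G_at_def G_val_def degen_simplex_def)
qed

lemma Aut_form_value:
  assumes w: "Aut_form X G n U \<omega>" and R: "cring R" and A: "nearby U R s A" and xs: "set xs \<subseteq> A" "length xs = Suc n"
  shows "\<omega> R xs \<in> carrier (AutoGroup (Gam R s))"
    "\<And>T f h. cring T \<Longrightarrow> f \<in> Hom R T \<Longrightarrow> h \<in> carrier (Gam R s) \<Longrightarrow>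
       res G R T f (\<omega> R xs h) = \<omega> T (map (res X R T f) xs) (res G R T f h)"
    "degenerate xs \<Longrightarrow> \<omega> R xs = \<one>\<^bsub>AutoGroup (Gam R s)\<^esub>"
proof -
  have x: "xs \<in> pts (simplex X n U) R" using simplex_nearby[OF A xs] .
  have "hd xs \<in> A" using xs by (cases xs) auto
  then have s: "str X R (hd xs) = s" using A by (simp add: nearby_def)
  show "\<omega> R xs \<in> carrier (AutoGroup (Gam R s))"
    "\<And>T f h. cring T \<Longrightarrow> f \<in> Hom R T \<Longrightarrow> h \<in> carrier (Gam R s) \<Longrightarrow>
       res G R T f (\<omega> R xs h) = \<omega> T (map (res X R T f) xs) (res G R T f h)"
    using w x R s unfolding Aut_form_def Aut_section_def by (auto simp: G_at_def simplex_def)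
  show "degenerate xs \<Longrightarrow> \<omega> R xs = \<one>\<^bsub>AutoGroup (Gam R s)\<^esub>"
    using w x R s unfolding Aut_form_def vanishes_on_degenerate_def
    by (auto simp: G_at_def Aut_val_def degen_simplex_def)
qed

text \<open>Natural functions of a point \<open>w\<close> near the points of \<open>Z\<close>; \<open>None\<close> marks the vertex \<open>w\<close> of a simplex.\<close>

definition nat_fun ::
  "('u ring \<Rightarrow> 'x set) \<Rightarrow> 'u ring \<Rightarrow> 's \<Rightarrow> 'x set \<Rightarrow> ('u ring \<Rightarrow> ('u \<Rightarrow> 'u) \<Rightarrow> 'x \<Rightarrow> 'g) \<Rightarrow> bool" where
  "nat_fun U R s Z \<Psi> \<longleftrightarrow> (\<forall>T f w. cring T \<longrightarrow> f \<in> Hom R T \<longrightarrow> near_all X U R Z T f w \<longrightarrow>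
     \<Psi> T f w \<in> carrier (Gam T (res S R T f s)) \<and>
     (\<forall>W k. cring W \<longrightarrow> k \<in> Hom T W \<longrightarrow> res G T W k (\<Psi> T f w) = \<Psi> W (hcomp R k f) (res X T W k w)))"

definition vertex :: "'u ring \<Rightarrow> 'u ring \<Rightarrow> ('u \<Rightarrow> 'u) \<Rightarrow> 'x \<Rightarrow> 'x option \<Rightarrow> 'x" where
  "vertex R T f w v = (case v of None \<Rightarrow> w | Some z \<Rightarrow> res X R T f z)"

lemma vertex_simps [simp]: "vertex R T f w None = w" "vertex R T f w (Some z) = res X R T f z"
  by (simp_all add: vertex_def)

context
  fixes U R s Z
  assumes U: "infinitesimally_stable X U" and R: "cring R" and s: "s \<in> pts S R" and Z: "nearby U R s Z"
    and Zne: "Z \<noteq> {}"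
begin

lemma U_sub: "subfunctor X U" using U by (simp add: infinitesimally_stable_def)

lemma Z_pts: "z \<in> Z \<Longrightarrow> z \<in> pts X R"
  using subfunctor_pts[OF U_sub R] nearbyD(1)[OF Z] by blast

lemma near_all_nearby:
  assumes T: "cring T" "f \<in> Hom R T" and w: "near_all X U R Z T f w"
  shows "nearby U T (res S R T f s) (insert w (res X R T f ` Z))"
proof -
  have n: "nearby U T (res S R T f s) (res X R T f ` Z)" by (rule nearby_res[OF U_sub R T Z])
  obtain z where "z \<in> Z" using Zne by auto
  then have "str X T w = res S R T f s" using w nearbyD(3)[OF n] by (fastforce simp: near_all_def near_def)
  then show ?thesis
    using n w near_refl[OF T(1)] near_sym[of X T] by (auto simp: nearby_def near_all_def)
qed

lemma nat_funD:
  assumes "nat_fun U R s Z \<Psi>" "cring T" "f \<in> Hom R T" "near_all X U R Z T f w"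
  shows "\<Psi> T f w \<in> carrier (Gam T (res S R T f s))"
    "\<And>W k. cring W \<Longrightarrow> k \<in> Hom T W \<Longrightarrow> res G T W k (\<Psi> T f w) = \<Psi> W (hcomp R k f) (res X T W k w)"
  using assms unfolding nat_fun_def by blast+

lemma map_vertex_res:
  assumes "cring T" "f \<in> Hom R T" "cring W" "k \<in> Hom T W" "\<forall>z. Some z \<in> set vs \<longrightarrow> z \<in> Z"
  shows "map (res X T W k) (map (vertex R T f w) vs) = map (vertex R W (hcomp R k f) (res X T W k w)) vs"
  using assms(5) psh_comp[OF X_psh R assms(1,3,2,4) Z_pts] by (auto simp: vertex_def split: option.splits)

lemma nat_fun_form:
  assumes w: "G_form X G n U \<omega>" and vs: "\<forall>z. Some z \<in> set vs \<longrightarrow> z \<in> Z" "length vs = Suc n"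
  shows "nat_fun U R s Z (\<lambda>T f w. \<omega> T (map (vertex R T f w) vs))"
  unfolding nat_fun_def
proof (intro allI impI conjI)
  fix T f w assume T: "cring T" "f \<in> Hom R T" and a: "near_all X U R Z T f w"
  have sub: "set (map (vertex R T f w) vs) \<subseteq> insert w (res X R T f ` Z)"
    using vs(1) by (auto simp: vertex_def split: option.splits)
  note v = G_form_value[OF assms(1) T(1) near_all_nearby[OF T a] sub]
  show "\<omega> T (map (vertex R T f w) vs) \<in> carrier (Gam T (res S R T f s))" using v(1) vs by simp
  fix W k assume W: "cring W" "k \<in> Hom T W"
  show "res G T W k (\<omega> T (map (vertex R T f w) vs)) =
      \<omega> W (map (vertex R W (hcomp R k f) (res X T W k w)) vs)"
    using v(2)[OF _ W] vs(2) unfolding map_vertex_res[OF T W vs(1), of w] by simp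
qed

lemma nat_fun_apply:
  assumes m: "Aut_form X G n U m" and vs: "\<forall>z. Some z \<in> set vs \<longrightarrow> z \<in> Z" "length vs = Suc n"
    and P: "nat_fun U R s Z \<Psi>"
  shows "nat_fun U R s Z (\<lambda>T f w. m T (map (vertex R T f w) vs) (\<Psi> T f w))"
  unfolding nat_fun_def
proof (intro allI impI conjI)
  fix T f w assume T: "cring T" "f \<in> Hom R T" and a: "near_all X U R Z T f w"
  have sub: "set (map (vertex R T f w) vs) \<subseteq> insert w (res X R T f ` Z)"
    using vs(1) by (auto simp: vertex_def split: option.splits)
  note v = Aut_form_value[OF assms(1) T(1) near_all_nearby[OF T a] sub]
  note P' = nat_funD[OF P T a]
  interpret group "Gam T (res S R T f s)" by (rule Tgroup[OF R s T])
  show "m T (map (vertex R T f w) vs) (\<Psi> T f w) \<in> carrier (Gam T (res S R T f s))"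
    using v(1) vs Aut_closed P'(1) by simp
  fix W k assume W: "cring W" "k \<in> Hom T W"
  show "res G T W k (m T (map (vertex R T f w) vs) (\<Psi> T f w)) =
      m W (map (vertex R W (hcomp R k f) (res X T W k w)) vs) (\<Psi> W (hcomp R k f) (res X T W k w))"
    using v(2)[OF _ W P'(1)] vs(2) P'(2)[OF W] unfolding map_vertex_res[OF T W vs(1), of w] by simp
qed

lemma nat_fun_const:
  assumes h: "h \<in> carrier (Gam R s)"
  shows "nat_fun U R s Z (\<lambda>T f w. res G R T f h)"
  unfolding nat_fun_def
proof (intro allI impI conjI)
  fix T f assume T: "cring T" "f \<in> Hom R T"
  show "res G R T f h \<in> carrier (Gam T (res S R T f s))" by (rule group_hom.hom_closed[OF res_hom[OF R s T] h])
  fix W k assume W: "cring W" "k \<in> Hom T W"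
  show "res G T W k (res G R T f h) = res G R W (hcomp R k f) h"
    using psh_comp[OF G_psh R T(1) W(1) T(2) W(2)] h by (simp add: Gam_carrier)
qed

lemma nat_fun_mult:
  assumes P: "nat_fun U R s Z \<Psi>" "nat_fun U R s Z \<Psi>'"
  shows "nat_fun U R s Z (\<lambda>T f w. \<Psi> T f w \<otimes>\<^bsub>Gam T (res S R T f s)\<^esub> \<Psi>' T f w)"
  unfolding nat_fun_def
proof (intro allI impI conjI)
  fix T f w assume T: "cring T" "f \<in> Hom R T" and a: "near_all X U R Z T f w"
  interpret group "Gam T (res S R T f s)" by (rule Tgroup[OF R s T])
  note P' = nat_funD[OF P(1) T a] nat_funD[OF P(2) T a]
  show "\<Psi> T f w \<otimes>\<^bsub>Gam T (res S R T f s)\<^esub> \<Psi>' T f w \<in> carrier (Gam T (res S R T f s))" using P' by simp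
  fix W k assume W: "cring W" "k \<in> Hom T W"
  interpret k: group_hom "Gam T (res S R T f s)" "Gam W (res S R W (hcomp R k f) s)" "res G T W k"
    by (rule Tres[OF R s T W])
  show "res G T W k (\<Psi> T f w \<otimes>\<^bsub>Gam T (res S R T f s)\<^esub> \<Psi>' T f w) =
      \<Psi> W (hcomp R k f) (res X T W k w) \<otimes>\<^bsub>Gam W (res S R W (hcomp R k f) s)\<^esub> \<Psi>' W (hcomp R k f) (res X T W k w)"
    using P'(1,3) P'(2,4)[OF W] by simp
qed

lemma nat_fun_inv:
  assumes P: "nat_fun U R s Z \<Psi>"
  shows "nat_fun U R s Z (\<lambda>T f w. inv\<^bsub>Gam T (res S R T f s)\<^esub> \<Psi> T f w)"
  unfolding nat_fun_def
proof (intro allI impI conjI)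
  fix T f w assume T: "cring T" "f \<in> Hom R T" and a: "near_all X U R Z T f w"
  interpret group "Gam T (res S R T f s)" by (rule Tgroup[OF R s T])
  note P' = nat_funD[OF P T a]
  show "inv\<^bsub>Gam T (res S R T f s)\<^esub> \<Psi> T f w \<in> carrier (Gam T (res S R T f s))" using P' by simp
  fix W k assume W: "cring W" "k \<in> Hom T W"
  interpret k: group_hom "Gam T (res S R T f s)" "Gam W (res S R W (hcomp R k f) s)" "res G T W k"
    by (rule Tres[OF R s T W])
  show "res G T W k (inv\<^bsub>Gam T (res S R T f s)\<^esub> \<Psi> T f w) =
      inv\<^bsub>Gam W (res S R W (hcomp R k f) s)\<^esub> \<Psi> W (hcomp R k f) (res X T W k w)"
    using P'(1) P'(2)[OF W] by simp
qed

text \<open>The form in which interpolation is applied: the functions are products of form values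
  with a moving vertex \<open>w\<close>, often compared with the constant 1, and \<open>w\<close>
  moves from \<open>y\<close> to \<open>x\<close>.\<close>

lemma nat_fun_interpolation:
  assumes xy: "x \<in> Z" "y \<in> Z" and P: "nat_fun U R s Z \<Psi>" "nat_fun U R s Z \<Psi>'"
    and y: "\<Psi> R (idhom R) y = \<Psi>' R (idhom R) y"
    and deg: "\<And>T f w. cring T \<Longrightarrow> f \<in> Hom R T \<Longrightarrow> near_all X U R Z T f w \<Longrightarrow>
      res X R T f x = res X R T f y \<Longrightarrow> \<Psi> T f w = \<Psi>' T f w"
  shows "\<Psi> R (idhom R) x = \<Psi>' R (idhom R) x"
proof (rule interpolation[OF infinite_univ base_scheme X_over _ U R xy, of G])
  show "is_scheme G" using G_over by (simp add: scheme_over_def)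
  show "Z \<subseteq> U R" using Z by (simp add: nearby_def)
  show "near X R z x \<and> near X R z y" if "z \<in> Z" for z using Z that xy by (simp add: nearby_def)
  fix T f w assume T: "cring T" "f \<in> Hom R T" and a: "near_all X U R Z T f w"
  show "\<Psi> T f w \<in> pts G T \<and> \<Psi>' T f w \<in> pts G T"
    using nat_funD(1)[OF P(1) T a] nat_funD(1)[OF P(2) T a] by (simp add: Gam_carrier)
  fix W k assume W: "cring W" "k \<in> Hom T W"
  show "res G T W k (\<Psi> T f w) = \<Psi> W (hcomp R k f) (res X T W k w) \<and>
      res G T W k (\<Psi>' T f w) = \<Psi>' W (hcomp R k f) (res X T W k w)"
    using nat_funD(2)[OF P(1) T a W] nat_funD(2)[OF P(2) T a W] by simp
qed (fact y deg)+

lemma Z_id: "z \<in> Z \<Longrightarrow> res X R R (idhom R) z = z"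
  by (rule psh_id[OF X_psh R Z_pts])

end

end

section \<open>Forms are alternating\<close>

context group_scheme_over
begin

context
  fixes U R s
  assumes U: "infinitesimally_stable X U" and R: "cring R" and s: "s \<in> pts S R"
begin

interpretation \<Gamma>: group "Gam R s" by (rule Gam_group[OF R s])

lemma usub: "subfunctor X U" using U by (simp add: infinitesimally_stable_def)

lemma form_one_kern:
  assumes e: "G_form X G 1 U e" and A: "nearby U R s {x, y}"
  shows "e R [x, y] \<in> kern R s x y"
proof -
  have "res G R T f (e R [x, y]) = \<one>\<^bsub>Gam T (res S R T f s)\<^esub>"
    if T: "cring T" "f \<in> Hom R T" "res X R T f x = res X R T f y" for T f
    using G_form_value(2)[OF e R A, of "[x, y]", OF _ _ T(1,2)] T(3)
      G_form_value(3)[OF e T(1) nearby_res[OF usub R T(1,2) A], of "[res X R T f x, res X R T f y]"] by simp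
  then show ?thesis using G_form_value(1)[OF e R A, of "[x, y]"] by (simp add: kern_def)
qed

lemma form_two_kern_adjacent:
  assumes b: "G_form X G 2 U b" and A: "nearby U R s {x, y, z}"
  shows "b R [x, y, z] \<in> kern R s x y" "b R [x, y, z] \<in> kern R s y z"
proof -
  have "res G R T f (b R [x, y, z]) = \<one>\<^bsub>Gam T (res S R T f s)\<^esub>"
    if T: "cring T" "f \<in> Hom R T" "res X R T f x = res X R T f y \<or> res X R T f y = res X R T f z" for T f
    using G_form_value(2)[OF b R A, of "[x, y, z]", OF _ _ T(1,2)] T(3)
      G_form_value(3)[OF b T(1) nearby_res[OF usub R T(1,2) A], of "[res X R T f x, res X R T f y, res X R T f z]"]
    by auto
  then show "b R [x, y, z] \<in> kern R s x y" "b R [x, y, z] \<in> kern R s y z"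
    using G_form_value(1)[OF b R A, of "[x, y, z]"] by (simp_all add: kern_def)
qed

text \<open>Move the last vertex of \<open>b(x, y, w)\<close> from \<open>y\<close> to
  \<open>x\<close>: the simplex is degenerate at \<open>w = y\<close>, and it is degenerate wherever
  \<open>x = y\<close>.\<close>

lemma form_two_return:
  assumes b: "G_form X G 2 U b" and A: "nearby U R s {x, y}"
  shows "b R [x, y, x] = \<one>\<^bsub>Gam R s\<^esub>"
proof -
  have ne: "{x, y} \<noteq> {}" by simp
  note N = nat_fun_form[OF U R s A ne b, of "[Some x, Some y, None]", simplified]
    nat_fun_const[OF U R s A ne \<Gamma>.one_closed]
  have "b R [res X R R (idhom R) x, res X R R (idhom R) y, x] = res G R R (idhom R) \<one>\<^bsub>Gam R s\<^esub>"
  proof (rule nat_fun_interpolation[OF U R s A ne _ _ N, of x y])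
    show "b R [res X R R (idhom R) x, res X R R (idhom R) y, y] = res G R R (idhom R) \<one>\<^bsub>Gam R s\<^esub>"
      using G_form_value(3)[OF b R A, of "[x, y, y]"] Z_id[OF U R s A ne] res_id_G[OF R s \<Gamma>.one_closed] by simp
    fix T f w assume T: "cring T" "f \<in> Hom R T" and w: "near_all X U R {x, y} T f w"
      and eq: "res X R T f x = res X R T f y"
    show "b T [res X R T f x, res X R T f y, w] = res G R T f \<one>\<^bsub>Gam R s\<^esub>"
      using G_form_value(3)[OF b T(1) near_all_nearby[OF U R s A ne T w],
          of "[res X R T f x, res X R T f y, w]"] eq group_hom.hom_one[OF res_hom[OF R s T]] by simp
  qed simp_all
  then show ?thesis using Z_id[OF U R s A ne] res_id_G[OF R s \<Gamma>.one_closed] by simp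
qed

end

context
  fixes U
  assumes U: "infinitesimally_stable X U"
begin

text \<open>\<open>degenerate\<close> concerns consecutive vertices. The outer edge needs
  \<open>form_two_return\<close>, applied after a base change that identifies \<open>x\<close> and
  \<open>z\<close>.\<close>

lemma form_two_kern:
  assumes R: "cring R" and s: "s \<in> pts S R" and b: "G_form X G 2 U b" and A: "nearby U R s {x, y, z}"
  shows "b R [x, y, z] \<in> kern R s x y" "b R [x, y, z] \<in> kern R s y z" "b R [x, y, z] \<in> kern R s x z"
proof -
  show "b R [x, y, z] \<in> kern R s x y" "b R [x, y, z] \<in> kern R s y z"
    using form_two_kern_adjacent[OF U R s b A] by auto
  have "res G R T f (b R [x, y, z]) = \<one>\<^bsub>Gam T (res S R T f s)\<^esub>"
    if T: "cring T" "f \<in> Hom R T" "res X R T f x = res X R T f z" for T f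
  proof -
    have "nearby U T (res S R T f s) {res X R T f x, res X R T f y}"
      using nearby_mono[OF nearby_res[OF usub[OF U R s] R T(1,2) A]] by simp
    then have "b T [res X R T f x, res X R T f y, res X R T f x] = \<one>\<^bsub>Gam T (res S R T f s)\<^esub>"
      by (rule form_two_return[OF U T(1) psh_closed[OF S_psh R T(1,2) s] b])
    then show ?thesis
      using G_form_value(2)[OF b R A, of "[x, y, z]", OF _ _ T(1,2)] T(3) by simp
  qed
  then show "b R [x, y, z] \<in> kern R s x z"
    using G_form_value(1)[OF b R A, of "[x, y, z]"] by (simp add: kern_def)
qed

text \<open>Move \<open>w\<close> from \<open>y\<close> to \<open>x\<close> in the equation
  \<open>m(x, y) m(y, w) = m(x, w)\<close>, applied to \<open>h\<close>. It holds at
  \<open>w = y\<close> and wherever \<open>x = y\<close>; for an arbitrary third point the curvature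
  of \<open>m\<close> obstructs it.\<close>

lemma Aut_form_one_return:
  assumes R: "cring R" and s: "s \<in> pts S R" and m: "Aut_form X G 1 U m" and A: "nearby U R s {x, y}"
    and h: "h \<in> carrier (Gam R s)"
  shows "m R [x, y] (m R [y, x] h) = h"
proof -
  interpret \<Gamma>: group "Gam R s" by (rule Gam_group[OF R s])
  have ne: "{x, y} \<noteq> {}" by simp
  note C = nat_fun_const[OF U R s A ne h]
  note N = nat_fun_apply[OF U R s A ne m _ _ nat_fun_apply[OF U R s A ne m _ _ C, of "[Some y, None]"],
      of "[Some x, Some y]", simplified] nat_fun_apply[OF U R s A ne m _ _ C, of "[Some x, None]", simplified]
  have one: "m T' [v, v] g = g" if "cring T'" "s' \<in> pts S T'" "nearby U T' s' A'" "v \<in> A'" "g \<in> carrier (Gam T' s')"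
    for T' s' A' v g
    using Aut_form_value(3)[OF m that(1,3), of "[v, v]"] that(4,5) by (simp add: AutoGroup_one)
  note zid = Z_id[OF U R s A ne] res_id_G[OF R s h]
  have "m R [res X R R (idhom R) x, res X R R (idhom R) y] (m R [res X R R (idhom R) y, x] (res G R R (idhom R) h)) =
     m R [res X R R (idhom R) x, x] (res G R R (idhom R) h)"
  proof (rule nat_fun_interpolation[OF U R s A ne _ _ N, of x y])
    show "m R [res X R R (idhom R) x, res X R R (idhom R) y] (m R [res X R R (idhom R) y, y] (res G R R (idhom R) h)) =
     m R [res X R R (idhom R) x, y] (res G R R (idhom R) h)"
      using one[OF R s A _ h] zid by simp
    fix T f w assume T: "cring T" "f \<in> Hom R T" and w: "near_all X U R {x, y} T f w"
      and eq: "res X R T f x = res X R T f y"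
    note A' = near_all_nearby[OF U R s A ne T w]
    interpret t: group "Gam T (res S R T f s)" by (rule Tgroup[OF R s T])
    have hT: "res G R T f h \<in> carrier (Gam T (res S R T f s))" by (rule group_hom.hom_closed[OF res_hom[OF R s T] h])
    have "m T [res X R T f y, w] (res G R T f h) \<in> carrier (Gam T (res S R T f s))"
      by (rule t.Aut_closed[OF Aut_form_value(1)[OF m T(1) A'] hT]) simp_all
    then show "m T [res X R T f x, res X R T f y] (m T [res X R T f y, w] (res G R T f h)) =
        m T [res X R T f x, w] (res G R T f h)"
      using one[OF T(1) psh_closed[OF S_psh R T s] A', of "res X R T f y"] eq by simp
  qed simp_all
  then show ?thesis using zid one[OF R s A _ h, of x] by simp
qed

text \<open>The test function is the alternating product of \<open>b\<close> over the faces of the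
  tetrahedron \<open>(x, y, w, z)\<close>. It is trivial at \<open>w = y\<close> and wherever
  \<open>x = y\<close>; at \<open>w = x\<close> the factors \<open>b(x, x, z)\<close> and
  \<open>b(x, y, x)\<close> drop out and leave the claim.\<close>

lemma form_two_antisymmetric:
  assumes R: "cring R" and s: "s \<in> pts S R" and b: "G_form X G 2 U b" and A: "nearby U R s {x, y, z}"
  shows "b R [y, x, z] \<otimes>\<^bsub>Gam R s\<^esub> b R [x, y, z] = \<one>\<^bsub>Gam R s\<^esub>"
proof -
  interpret \<Gamma>: group "Gam R s" by (rule Gam_group[OF R s])
  have ne: "{x, y, z} \<noteq> {}" by simp
  note F = nat_fun_form[OF U R s A ne b]
  note M = nat_fun_mult[OF U R s A ne]
  note I = nat_fun_inv[OF U R s A ne]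
  note N = M[OF M[OF F[of "[Some y, None, Some z]"] I[OF F[of "[Some x, None, Some z]"]]]
      M[OF F[of "[Some x, Some y, Some z]"] I[OF F[of "[Some x, Some y, None]"]]], simplified]
    nat_fun_const[OF U R s A ne \<Gamma>.one_closed]
  note zid = Z_id[OF U R s A ne] res_id_G[OF R s \<Gamma>.one_closed]
  have val: "b R [u, v, w] \<in> carrier (Gam R s)" if "u \<in> {x, y, z}" "v \<in> {x, y, z}" "w \<in> {x, y, z}" for u v w
    using G_form_value(1)[OF b R A, of "[u, v, w]"] that by simp
  have deg: "b R [u, v, w] = \<one>\<^bsub>Gam R s\<^esub>"
    if "u \<in> {x, y, z}" "v \<in> {x, y, z}" "w \<in> {x, y, z}" "u = v \<or> v = w" for u v w
    using G_form_value(3)[OF b R A, of "[u, v, w]"] that by auto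
  have "(b R [res X R R (idhom R) y, x, res X R R (idhom R) z] \<otimes>\<^bsub>Gam R (res S R R (idhom R) s)\<^esub>
      inv\<^bsub>Gam R (res S R R (idhom R) s)\<^esub> b R [res X R R (idhom R) x, x, res X R R (idhom R) z]) \<otimes>\<^bsub>Gam R (res S R R (idhom R) s)\<^esub>
     (b R [res X R R (idhom R) x, res X R R (idhom R) y, res X R R (idhom R) z] \<otimes>\<^bsub>Gam R (res S R R (idhom R) s)\<^esub>
      inv\<^bsub>Gam R (res S R R (idhom R) s)\<^esub> b R [res X R R (idhom R) x, res X R R (idhom R) y, x]) =
     res G R R (idhom R) \<one>\<^bsub>Gam R s\<^esub>"
  proof (rule nat_fun_interpolation[OF U R s A ne _ _ N, of x y])
    show "(b R [res X R R (idhom R) y, y, res X R R (idhom R) z] \<otimes>\<^bsub>Gam R (res S R R (idhom R) s)\<^esub>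
      inv\<^bsub>Gam R (res S R R (idhom R) s)\<^esub> b R [res X R R (idhom R) x, y, res X R R (idhom R) z]) \<otimes>\<^bsub>Gam R (res S R R (idhom R) s)\<^esub>
     (b R [res X R R (idhom R) x, res X R R (idhom R) y, res X R R (idhom R) z] \<otimes>\<^bsub>Gam R (res S R R (idhom R) s)\<^esub>
      inv\<^bsub>Gam R (res S R R (idhom R) s)\<^esub> b R [res X R R (idhom R) x, res X R R (idhom R) y, y]) =
     res G R R (idhom R) \<one>\<^bsub>Gam R s\<^esub>"
      using zid val deg by (simp add: sid[OF R s])
    fix T f w assume T: "cring T" "f \<in> Hom R T" and w: "near_all X U R {x, y, z} T f w"
      and eq: "res X R T f x = res X R T f y"
    note A' = near_all_nearby[OF U R s A ne T w]
    interpret t: group "Gam T (res S R T f s)" by (rule Tgroup[OF R s T])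
    have "b T [res X R T f y, w, res X R T f z] \<in> carrier (Gam T (res S R T f s))"
      by (rule G_form_value(1)[OF b T(1) A']) simp_all
    moreover have "b T [res X R T f y, res X R T f y, v] = \<one>\<^bsub>Gam T (res S R T f s)\<^esub>"
      if "v \<in> {w, res X R T f z}" for v
      by (rule G_form_value(3)[OF b T(1) A']) (use that in auto)
    ultimately show "(b T [res X R T f y, w, res X R T f z] \<otimes>\<^bsub>Gam T (res S R T f s)\<^esub>
       inv\<^bsub>Gam T (res S R T f s)\<^esub> b T [res X R T f x, w, res X R T f z]) \<otimes>\<^bsub>Gam T (res S R T f s)\<^esub>
      (b T [res X R T f x, res X R T f y, res X R T f z] \<otimes>\<^bsub>Gam T (res S R T f s)\<^esub>
       inv\<^bsub>Gam T (res S R T f s)\<^esub> b T [res X R T f x, res X R T f y, w]) =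
      res G R T f \<one>\<^bsub>Gam R s\<^esub>"
      using eq group_hom.hom_one[OF res_hom[OF R s T]] by simp
  qed simp_all
  moreover have "b R [x, y, x] = \<one>\<^bsub>Gam R s\<^esub>"
    by (rule form_two_return[OF U R s b nearby_mono[OF A]]) auto
  ultimately show ?thesis using zid val deg by (simp add: sid[OF R s])
qed

text \<open>Again the alternating product over faces, now of \<open>(x, y, z, w)\<close> with
  \<open>w\<close> moving from \<open>z\<close> to \<open>x\<close>. Where \<open>x = z\<close> it
  is trivial by \<open>form_two_antisymmetric\<close> and \<open>form_two_return\<close>, which is
  why antisymmetry comes first.\<close>

lemma form_two_cyclic:
  assumes R: "cring R" and s: "s \<in> pts S R" and b: "G_form X G 2 U b" and A: "nearby U R s {x, y, z}"
  shows "b R [y, z, x] = b R [x, y, z]"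
proof -
  interpret \<Gamma>: group "Gam R s" by (rule Gam_group[OF R s])
  have ne: "{x, y, z} \<noteq> {}" by simp
  note F = nat_fun_form[OF U R s A ne b]
  note M = nat_fun_mult[OF U R s A ne]
  note I = nat_fun_inv[OF U R s A ne]
  note N = M[OF M[OF F[of "[Some y, Some z, None]"] I[OF F[of "[Some x, Some z, None]"]]]
      M[OF F[of "[Some x, Some y, None]"] I[OF F[of "[Some x, Some y, Some z]"]]], simplified]
    nat_fun_const[OF U R s A ne \<Gamma>.one_closed]
  note zid = Z_id[OF U R s A ne] res_id_G[OF R s \<Gamma>.one_closed]
  have val: "b R [u, v, w] \<in> carrier (Gam R s)" if "u \<in> {x, y, z}" "v \<in> {x, y, z}" "w \<in> {x, y, z}" for u v w
    using G_form_value(1)[OF b R A, of "[u, v, w]"] that by simp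
  have deg: "b R [u, v, w] = \<one>\<^bsub>Gam R s\<^esub>"
    if "u \<in> {x, y, z}" "v \<in> {x, y, z}" "w \<in> {x, y, z}" "u = v \<or> v = w" for u v w
    using G_form_value(3)[OF b R A, of "[u, v, w]"] that by auto
  have "(b R [res X R R (idhom R) y, res X R R (idhom R) z, x] \<otimes>\<^bsub>Gam R (res S R R (idhom R) s)\<^esub>
      inv\<^bsub>Gam R (res S R R (idhom R) s)\<^esub> b R [res X R R (idhom R) x, res X R R (idhom R) z, x]) \<otimes>\<^bsub>Gam R (res S R R (idhom R) s)\<^esub>
     (b R [res X R R (idhom R) x, res X R R (idhom R) y, x] \<otimes>\<^bsub>Gam R (res S R R (idhom R) s)\<^esub>
      inv\<^bsub>Gam R (res S R R (idhom R) s)\<^esub> b R [res X R R (idhom R) x, res X R R (idhom R) y, res X R R (idhom R) z]) =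
     res G R R (idhom R) \<one>\<^bsub>Gam R s\<^esub>"
  proof (rule nat_fun_interpolation[OF U R s A ne _ _ N, of x z])
    show "(b R [res X R R (idhom R) y, res X R R (idhom R) z, z] \<otimes>\<^bsub>Gam R (res S R R (idhom R) s)\<^esub>
      inv\<^bsub>Gam R (res S R R (idhom R) s)\<^esub> b R [res X R R (idhom R) x, res X R R (idhom R) z, z]) \<otimes>\<^bsub>Gam R (res S R R (idhom R) s)\<^esub>
     (b R [res X R R (idhom R) x, res X R R (idhom R) y, z] \<otimes>\<^bsub>Gam R (res S R R (idhom R) s)\<^esub>
      inv\<^bsub>Gam R (res S R R (idhom R) s)\<^esub> b R [res X R R (idhom R) x, res X R R (idhom R) y, res X R R (idhom R) z]) =
     res G R R (idhom R) \<one>\<^bsub>Gam R s\<^esub>"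
      using zid val deg by (simp add: sid[OF R s])
    fix T f w assume T: "cring T" "f \<in> Hom R T" and w: "near_all X U R {x, y, z} T f w"
      and eq: "res X R T f x = res X R T f z"
    note A' = near_all_nearby[OF U R s A ne T w]
    have sT: "res S R T f s \<in> pts S T" by (rule psh_closed[OF S_psh R T s])
    interpret t: group "Gam T (res S R T f s)" by (rule Tgroup[OF R s T])
    let ?x = "res X R T f x" and ?y = "res X R T f y"
    have c: "b T [?x, ?y, w] \<in> carrier (Gam T (res S R T f s))" "b T [?y, ?x, w] \<in> carrier (Gam T (res S R T f s))"
      by (rule G_form_value(1)[OF b T(1) A']; simp)+
    have 1: "b T [?x, ?x, w] = \<one>\<^bsub>Gam T (res S R T f s)\<^esub>"
      by (rule G_form_value(3)[OF b T(1) A']) simp_all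
    have 2: "b T [?y, ?x, w] \<otimes>\<^bsub>Gam T (res S R T f s)\<^esub> b T [?x, ?y, w] = \<one>\<^bsub>Gam T (res S R T f s)\<^esub>"
      by (rule form_two_antisymmetric[OF T(1) sT b nearby_mono[OF A']]) auto
    have 3: "b T [?x, ?y, ?x] = \<one>\<^bsub>Gam T (res S R T f s)\<^esub>"
      by (rule form_two_return[OF U T(1) sT b nearby_mono[OF A']]) auto
    show "(b T [?y, res X R T f z, w] \<otimes>\<^bsub>Gam T (res S R T f s)\<^esub>
       inv\<^bsub>Gam T (res S R T f s)\<^esub> b T [?x, res X R T f z, w]) \<otimes>\<^bsub>Gam T (res S R T f s)\<^esub>
      (b T [?x, ?y, w] \<otimes>\<^bsub>Gam T (res S R T f s)\<^esub>
       inv\<^bsub>Gam T (res S R T f s)\<^esub> b T [?x, ?y, res X R T f z]) =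
      res G R T f \<one>\<^bsub>Gam R s\<^esub>"
      using eq[symmetric] 1 2 3 c group_hom.hom_one[OF res_hom[OF R s T]] by simp
  qed simp_all
  moreover have "b R [x, y, x] = \<one>\<^bsub>Gam R s\<^esub>" "b R [x, z, x] = \<one>\<^bsub>Gam R s\<^esub>"
    by (rule form_two_return[OF U R s b nearby_mono[OF A]]; auto)+
  ultimately have "b R [y, z, x] \<otimes>\<^bsub>Gam R s\<^esub> inv\<^bsub>Gam R s\<^esub> b R [x, y, z] = \<one>\<^bsub>Gam R s\<^esub>"
    using zid val deg by (simp add: sid[OF R s])
  then show ?thesis using val \<Gamma>.inv_solve_right' by simp
qed

end

end

section \<open>Natural automorphisms and kernel elements attached to forms and sections\<close>

context group_scheme_over
begin

lemma natural_aut_form: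
  assumes U: "subfunctor X U" and R: "cring R" and m: "Aut_form X G n U m" and A: "nearby U R s A"
    and xs: "set xs \<subseteq> A" "length xs = Suc n"
  shows "natural_aut R s (\<lambda>T f. m T (map (res X R T f) xs))"
  unfolding natural_aut_def
proof (intro allI impI ballI conjI)
  fix T f assume T: "cring T" "f \<in> Hom R T"
  have xs': "set (map (res X R T f) xs) \<subseteq> res X R T f ` A" "length (map (res X R T f) xs) = Suc n"
    using xs by auto
  note v = Aut_form_value[OF m T(1) nearby_res[OF U R T A] xs']
  show "m T (map (res X R T f) xs) \<in> carrier (AutoGroup (Gam T (res S R T f s)))" by (rule v(1))
  fix W k h assume W: "cring W" "k \<in> Hom T W" and h: "h \<in> carrier (Gam T (res S R T f s))"
  have "x \<in> pts X R" if "x \<in> set xs" for x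
    using that xs nearbyD(1)[OF A] subfunctor_pts[OF U R] by blast
  then have eq: "map (res X T W k) (map (res X R T f) xs) = map (res X R W (hcomp R k f)) xs"
    using psh_comp[OF X_psh R T(1) W(1) T(2) W(2)] by simp
  show "res G T W k (m T (map (res X R T f) xs) h) = m W (map (res X R W (hcomp R k f)) xs) (res G T W k h)"
    using v(2)[OF W h] unfolding eq .
qed

lemma map_res_id:
  assumes U: "subfunctor X U" and R: "cring R" and xs: "set xs \<subseteq> U R"
  shows "map (res X R R (idhom R)) xs = xs"
  using xs psh_id[OF X_psh R] subfunctor_pts[OF U R] by (auto intro!: map_idI)

lemma Aut_form_NA:
  assumes U: "subfunctor X U" and R: "cring R" and s: "s \<in> pts S R" and m: "Aut_form X G n U m" and A: "nearby U R s A"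
    and xs: "set xs \<subseteq> A" "length xs = Suc n"
  shows "m R xs \<in> NA R s"
proof -
  have "set xs \<subseteq> U R" using xs nearbyD(1)[OF A] by blast
  then show ?thesis
    using NA_I[OF R s natural_aut_form[OF U R m A xs], of "m R xs"] map_res_id[OF U R] by simp
qed

lemma Aut_form_one_NT:
  assumes U: "subfunctor X U" and R: "cring R" and s: "s \<in> pts S R"
    and m: "Aut_form X G 1 U m" and A: "nearby U R s {x, y}"
  shows "m R [x, y] \<in> NT R s x y"
proof (rule NT_I[OF R s natural_aut_form[OF U R m A, of "[x, y]"]])
  show "m R (map (res X R R (idhom R)) [x, y]) = m R [x, y]"
    using map_res_id[OF U R, of "[x, y]"] nearbyD(1)[OF A] by simp
  fix T f assume T: "cring T" "f \<in> Hom R T" "res X R T f x = res X R T f y"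
  show "m T (map (res X R T f) [x, y]) = \<one>\<^bsub>AutoGroup (Gam T (res S R T f s))\<^esub>"
    using Aut_form_value(3)[OF m T(1) nearby_res[OF U R T(1,2) A], of "map (res X R T f) [x, y]"] T(3) by simp
qed simp_all

lemma Aut_form_one_inv:
  assumes U: "infinitesimally_stable X U" and R: "cring R" and s: "s \<in> pts S R"
    and m: "Aut_form X G 1 U m" and A: "nearby U R s {x, y}"
  shows "m R [x, y] \<otimes>\<^bsub>AutoGroup (Gam R s)\<^esub> m R [y, x] = \<one>\<^bsub>AutoGroup (Gam R s)\<^esub>"
proof -
  interpret \<Gamma>: group "Gam R s" by (rule Gam_group[OF R s])
  interpret A: group "AutoGroup (Gam R s)" by (rule \<Gamma>.AutoGroup)
  have c: "m R [x, y] \<in> carrier \<Gamma>.Aut" "m R [y, x] \<in> carrier \<Gamma>.Aut"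
    using Aut_form_value(1)[OF m R A] by simp_all
  show ?thesis
    by (rule \<Gamma>.Aut_eqI)
      (use c Aut_form_one_return[OF U R s m A] in \<open>simp_all add: \<Gamma>.Aut_comp AutoGroup_one_apply\<close>)
qed

text \<open>As soon as two of the vertices coincide the loop of parallel transports collapses, by
  \<open>m(u, u) = 1\<close> and \<open>m(u, v) m(v, u) = 1\<close>. Hence the curvature is small
  along all three edges.\<close>

lemma curvature_NT:
  assumes U: "infinitesimally_stable X U" and R: "cring R" and s: "s \<in> pts S R"
    and m: "Aut_form X G 1 U m" and A: "nearby U R s {x, y, z}"
  defines "F \<equiv> m R [x, y] \<otimes>\<^bsub>AutoGroup (Gam R s)\<^esub> m R [y, z] \<otimes>\<^bsub>AutoGroup (Gam R s)\<^esub> m R [z, x]"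
  shows "F \<in> NT R s x y" "F \<in> NT R s y z" "F \<in> NT R s x z"
proof -
  have sub: "subfunctor X U" using U by (simp add: infinitesimally_stable_def)
  note N = natural_aut_mult[OF R s natural_aut_mult[OF R s natural_aut_form[OF sub R m A, of "[x, y]"]
      natural_aut_form[OF sub R m A, of "[y, z]"]] natural_aut_form[OF sub R m A, of "[z, x]"], simplified]
  have id: "res X R R (idhom R) v = v" if "v \<in> {x, y, z}" for v
    using map_res_id[OF sub R, of "[v]"] nearbyD(1)[OF A] that by auto
  have *: "m T [x', y'] \<otimes>\<^bsub>AutoGroup (Gam T s')\<^esub> m T [y', z'] \<otimes>\<^bsub>AutoGroup (Gam T s')\<^esub> m T [z', x'] =
      \<one>\<^bsub>AutoGroup (Gam T s')\<^esub>"
    if T: "cring T" and s': "s' \<in> pts S T" and A': "nearby U T s' {x', y', z'}" and eq: "x' = y' \<or> y' = z' \<or> x' = z'"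
    for T s' x' y' z'
  proof -
    interpret \<Gamma>: group "Gam T s'" by (rule Gam_group[OF T s'])
    interpret A: group "AutoGroup (Gam T s')" by (rule \<Gamma>.AutoGroup)
    have c: "m T [u, v] \<in> carrier \<Gamma>.Aut" if "u \<in> {x', y', z'}" "v \<in> {x', y', z'}" for u v
      using Aut_form_value(1)[OF m T A', of "[u, v]"] that by simp
    have d: "m T [u, u] = \<one>\<^bsub>\<Gamma>.Aut\<^esub>" if "u \<in> {x', y', z'}" for u
      using Aut_form_value(3)[OF m T A', of "[u, u]"] that by simp
    have i: "m T [u, v] \<otimes>\<^bsub>\<Gamma>.Aut\<^esub> m T [v, u] = \<one>\<^bsub>\<Gamma>.Aut\<^esub>" if "u \<in> {x', y', z'}" "v \<in> {x', y', z'}" for u v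
      by (rule Aut_form_one_inv[OF U T s' m nearby_mono[OF A']]) (use that in auto)
    show ?thesis using eq c d i[of x' y'] i[of y' z'] i[of x' z'] by auto
  qed
  have t: "m T [res X R T f x, res X R T f y] \<otimes>\<^bsub>AutoGroup (Gam T (res S R T f s))\<^esub>
      m T [res X R T f y, res X R T f z] \<otimes>\<^bsub>AutoGroup (Gam T (res S R T f s))\<^esub>
      m T [res X R T f z, res X R T f x] = \<one>\<^bsub>AutoGroup (Gam T (res S R T f s))\<^esub>"
    if T: "cring T" "f \<in> Hom R T" and eq: "res X R T f x = res X R T f y \<or> res X R T f y = res X R T f z \<or>
      res X R T f x = res X R T f z" for T f
    using *[OF T(1) psh_closed[OF S_psh R T s] _ eq] nearby_res[OF sub R T A] by simp
  have "F \<in> NT R s u v"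
    if e: "\<And>T f. res X R T f u = res X R T f v \<Longrightarrow> res X R T f x = res X R T f y \<or>
      res X R T f y = res X R T f z \<or> res X R T f x = res X R T f z" for u v
    unfolding F_def
  proof (rule NT_I[OF R s N])
    fix T f assume T: "cring T" "f \<in> Hom R T" "res X R T f u = res X R T f v"
    show "m T [res X R T f x, res X R T f y] \<otimes>\<^bsub>AutoGroup (Gam T (res S R T f s))\<^esub>
      m T [res X R T f y, res X R T f z] \<otimes>\<^bsub>AutoGroup (Gam T (res S R T f s))\<^esub>
      m T [res X R T f z, res X R T f x] = \<one>\<^bsub>AutoGroup (Gam T (res S R T f s))\<^esub>"
      by (rule t[OF T(1,2) e[OF T(3)]])
  qed (simp add: id sid[OF R s])
  then show "F \<in> NT R s x y" "F \<in> NT R s y z" "F \<in> NT R s x z" by simp_all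
qed

lemma G_section_value:
  assumes g: "G_section X G (sub X U) (\<lambda>p. p) g" and U: "subfunctor X U" and R: "cring R" and s: "s \<in> pts S R"
    and A: "nearby U R s {x, y}"
  shows "g R x \<in> carrier (Gam R s)" "g R y \<otimes>\<^bsub>Gam R s\<^esub> inv\<^bsub>Gam R s\<^esub> g R x \<in> kern R s x y"
proof -
  have v: "g R v \<in> carrier (Gam R s)"
    "\<And>T f. cring T \<Longrightarrow> f \<in> Hom R T \<Longrightarrow> res G R T f (g R v) = g T (res X R T f v)" if "v \<in> {x, y}" for v
    using g R nearbyD(1,3)[OF A that] unfolding G_section_def by (auto simp: sub_def G_at_def)
  show "g R x \<in> carrier (Gam R s)" using v by simp
  interpret \<Gamma>: group "Gam R s" by (rule Gam_group[OF R s])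
  have "res G R T f (g R y \<otimes>\<^bsub>Gam R s\<^esub> inv\<^bsub>Gam R s\<^esub> g R x) = \<one>\<^bsub>Gam T (res S R T f s)\<^esub>"
    if T: "cring T" "f \<in> Hom R T" "res X R T f x = res X R T f y" for T f
  proof -
    interpret group_hom "Gam R s" "Gam T (res S R T f s)" "res G R T f" by (rule res_hom[OF R s T(1,2)])
    have "res G R T f (g R y) = res G R T f (g R x)" using v(2) T by simp
    then show ?thesis using v(1) by simp
  qed
  then show "g R y \<otimes>\<^bsub>Gam R s\<^esub> inv\<^bsub>Gam R s\<^esub> g R x \<in> kern R s x y" using v(1) by (simp add: kern_def)
qed

lemma Aut_section_NA:
  assumes u: "Aut_section X G (sub X U) (\<lambda>p. p) u" and U: "subfunctor X U" and R: "cring R" and s: "s \<in> pts S R"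
    and x: "x \<in> U R" "str X R x = s"
  shows "u R x \<in> NA R s"
proof (rule NA_I[where v = "\<lambda>T f. u T (res X R T f x)", OF R s])
  have xp: "x \<in> pts X R" by (rule subfunctor_pts[OF U R x(1)])
  show "u R (res X R R (idhom R) x) = u R x" using psh_id[OF X_psh R xp] by simp
  show "natural_aut R s (\<lambda>T f. u T (res X R T f x))"
    unfolding natural_aut_def
  proof (intro allI impI ballI conjI)
    fix T f assume T: "cring T" "f \<in> Hom R T"
    have fx: "res X R T f x \<in> U T" by (rule subfunctor_res[OF U R T x(1)])
    have sx: "str X T (res X R T f x) = res S R T f s" using scheme_over_str(2)[OF X_over R xp T] x by simp
    have uT: "u T (res X R T f x) \<in> carrier (AutoGroup (G_at X G T (res X R T f x))) \<and>
        (\<forall>W. cring W \<longrightarrow> (\<forall>k\<in>Hom T W. \<forall>h\<in>carrier (G_at X G T (res X R T f x)).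
          res G T W k (u T (res X R T f x) h) = u W (res (sub X U) T W k (res X R T f x)) (res G T W k h)))"
      using u[unfolded Aut_section_def, THEN spec, THEN mp, OF T(1), THEN bspec, of "res X R T f x"] fx
      by (simp add: sub_def)
    show "u T (res X R T f x) \<in> carrier (AutoGroup (Gam T (res S R T f s)))"
      using uT by (simp add: G_at_def sx)
    fix W k h assume W: "cring W" "k \<in> Hom T W" and h: "h \<in> carrier (Gam T (res S R T f s))"
    show "res G T W k (u T (res X R T f x) h) = u W (res X R W (hcomp R k f) x) (res G T W k h)"
      using uT W h psh_comp[OF X_psh R T(1) W(1) T(2) W(2) xp] by (simp add: sub_def G_at_def sx)
  qed
qed

text \<open>Wherever \<open>x = y\<close> the edges \<open>[x, z]\<close> and \<open>[y, z]\<close>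
  become the same, so the quotient of the two values is small along \<open>x y\<close> even if
  neither value is.\<close>

lemma form_one_face:
  assumes e: "G_form X G 1 U e" and U: "subfunctor X U" and R: "cring R" and s: "s \<in> pts S R"
    and A: "nearby U R s {x, y, z}"
  shows "inv\<^bsub>Gam R s\<^esub> e R [x, z] \<otimes>\<^bsub>Gam R s\<^esub> e R [y, z] \<in> kern R s x y"
proof -
  have v: "e R [x, z] \<in> carrier (Gam R s)" "e R [y, z] \<in> carrier (Gam R s)"
    using G_form_value(1)[OF e R A] by simp_all
  interpret \<Gamma>: group "Gam R s" by (rule Gam_group[OF R s])
  have "res G R T f (inv\<^bsub>Gam R s\<^esub> e R [x, z] \<otimes>\<^bsub>Gam R s\<^esub> e R [y, z]) = \<one>\<^bsub>Gam T (res S R T f s)\<^esub>"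
    if T: "cring T" "f \<in> Hom R T" "res X R T f x = res X R T f y" for T f
  proof -
    interpret group_hom "Gam R s" "Gam T (res S R T f s)" "res G R T f" by (rule res_hom[OF R s T(1,2)])
    have "res G R T f (e R [y, z]) = res G R T f (e R [x, z])"
      using G_form_value(2)[OF e R A _ _ T(1,2)] T(3) by simp
    then show ?thesis using v by simp
  qed
  then show ?thesis using v by (simp add: kern_def)
qed

end

section \<open>Commuting values on the faces of a tetrahedron\<close>

context group
begin

text \<open>The properties of an edge kernel that enter the algebra. Commutativity lets products be
  read as sums, and normality keeps elements in the kernel when they are twisted by a
  section.\<close>

definition edge :: "'a set \<Rightarrow> bool" where
  "edge K \<longleftrightarrow> subgroup K G \<and> (\<forall>g\<in>K. \<forall>h\<in>K. g \<otimes> h = h \<otimes> g) \<and>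
     (\<forall>g\<in>K. \<forall>h\<in>carrier G. h \<otimes> g \<otimes> inv h \<in> K)"

lemma edgeD:
  assumes "edge K"
  shows "g \<in> K \<Longrightarrow> g \<in> carrier G" "g \<in> K \<Longrightarrow> h \<in> K \<Longrightarrow> g \<otimes> h \<in> K" "g \<in> K \<Longrightarrow> inv g \<in> K"
    "g \<in> K \<Longrightarrow> h \<in> K \<Longrightarrow> g \<otimes> h = h \<otimes> g" "g \<in> K \<Longrightarrow> h \<in> carrier G \<Longrightarrow> h \<otimes> (g \<otimes> inv h) \<in> K"
proof -
  have sub: "K \<subseteq> carrier G" using assms subgroup.subset by (auto simp: edge_def)
  then show "g \<in> K \<Longrightarrow> g \<in> carrier G" by auto
  show "g \<in> K \<Longrightarrow> h \<in> K \<Longrightarrow> g \<otimes> h \<in> K" "g \<in> K \<Longrightarrow> inv g \<in> K" "g \<in> K \<Longrightarrow> h \<in> K \<Longrightarrow> g \<otimes> h = h \<otimes> g"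
    using assms subgroup.m_closed[of K G] subgroup.m_inv_closed[of K G] by (auto simp: edge_def)
  assume g: "g \<in> K" and h: "h \<in> carrier G"
  then have "h \<otimes> g \<otimes> inv h \<in> K" using assms by (auto simp: edge_def)
  then show "h \<otimes> (g \<otimes> inv h) \<in> K" using g h sub by (simp add: m_assoc subset_iff)
qed

lemma edge_lcomm:
  assumes "edge K" "g \<in> K" "h \<in> K" "x \<in> carrier G"
  shows "g \<otimes> (h \<otimes> x) = h \<otimes> (g \<otimes> x)"
  using assms edgeD(1)[OF assms(1)] edgeD(4)[OF assms(1-3)] by (simp add: m_assoc[symmetric])

text \<open>Moving \<open>e\<close> and \<open>r\<close> past \<open>t0\<close> conjugates them,
  which keeps them in \<open>K\<close>, and \<open>mt \<otimes> inv t0\<close> splits into the two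
  given elements of \<open>K\<close>. This passes from an exact relation between arrows to the
  additive equations for \<open>gamma\<close> and for \<open>delta\<close>.\<close>

lemma transform_along_edge:
  assumes K: "edge K" and in_K: "a \<in> K" "b \<in> K" "e \<in> K" "r \<in> K"
    and t: "t0 \<in> carrier G" "t1 \<in> carrier G" "mt \<in> carrier G"
    and q: "mt \<otimes> inv t1 \<in> K" and p: "t1 \<otimes> inv t0 \<in> K"
    and E: "a \<otimes> (b \<otimes> t0) = mt \<otimes> (e \<otimes> r)"
  shows "(a \<otimes> inv (t0 \<otimes> r \<otimes> inv t0)) \<otimes> (b \<otimes> inv (t0 \<otimes> e \<otimes> inv t0)) = (t1 \<otimes> inv t0) \<otimes> (mt \<otimes> inv t1)"
proof -
  define c where "c = t0 \<otimes> e \<otimes> inv t0"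
  define d where "d = t0 \<otimes> r \<otimes> inv t0"
  define u where "u = mt \<otimes> inv t1"
  define v where "v = t1 \<otimes> inv t0"
  note in_G = edgeD(1)[OF K]
  have cd: "c \<in> K" "d \<in> K" "u \<in> K" "v \<in> K"
    using in_K t edgeD(5)[OF K] q p in_G by (auto simp: c_def d_def u_def v_def m_assoc)
  note all = in_K cd
  have car: "a \<in> carrier G" "b \<in> carrier G" "c \<in> carrier G" "d \<in> carrier G" "u \<in> carrier G" "v \<in> carrier G"
    "e \<in> carrier G" "r \<in> carrier G"
    using all in_G by auto
  have "a \<otimes> b = a \<otimes> (b \<otimes> t0) \<otimes> inv t0" using car t by (simp add: m_assoc)
  also have "\<dots> = u \<otimes> v \<otimes> c \<otimes> d"
    unfolding E u_def v_def c_def d_def using t car by (simp add: group_simps)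
  finally have ab: "a \<otimes> b = u \<otimes> v \<otimes> c \<otimes> d" .
  have "(a \<otimes> inv d) \<otimes> (b \<otimes> inv c) = (a \<otimes> b) \<otimes> (inv d \<otimes> inv c)"
    using all edgeD(3)[OF K] car edge_lcomm[OF K, of b "inv d" "inv c"] by (simp add: m_assoc)
  also have "\<dots> = u \<otimes> v" unfolding ab using car by (simp add: group_simps)
  also have "\<dots> = v \<otimes> u" using cd edgeD(4)[OF K] by blast
  finally show ?thesis unfolding c_def d_def u_def v_def .
qed

text \<open>\<open>q\<close> commutes with \<open>g\<close>, and also with the commutator of
  \<open>g\<close> and \<open>h\<close>, which lies in \<open>K\<close> by normality; so it drops
  out.\<close>

lemma commutator_absorb:
  assumes K: "edge K" and g: "g \<in> K" and q: "q \<in> K" and h: "h \<in> carrier G"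
  shows "g \<otimes> (q \<otimes> h) \<otimes> inv g \<otimes> inv (q \<otimes> h) = g \<otimes> h \<otimes> inv g \<otimes> inv h"
    "(q \<otimes> h) \<otimes> g \<otimes> inv (q \<otimes> h) \<otimes> inv g = h \<otimes> g \<otimes> inv h \<otimes> inv g"
proof -
  note in_G = edgeD(1)[OF K]
  have c: "g \<in> carrier G" "q \<in> carrier G" using g q in_G by auto
  have k: "g \<otimes> (h \<otimes> (inv g \<otimes> inv h)) \<in> K" "h \<otimes> (g \<otimes> inv h) \<in> K"
    using edgeD(2)[OF K g edgeD(5)[OF K edgeD(3)[OF K g] h]] edgeD(5)[OF K g h] by auto
  have k': "h \<otimes> (g \<otimes> (inv h \<otimes> inv g)) \<in> K"
    using edgeD(2)[OF K k(2) edgeD(3)[OF K g]] c h by (simp add: m_assoc)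
  have "g \<otimes> (q \<otimes> h) \<otimes> inv g \<otimes> inv (q \<otimes> h) = q \<otimes> (g \<otimes> (h \<otimes> (inv g \<otimes> inv h))) \<otimes> inv q"
    using edge_lcomm[OF K g q] c h by (simp add: m_assoc inv_mult_group)
  also have "\<dots> = g \<otimes> h \<otimes> inv g \<otimes> inv h"
    using edgeD(4)[OF K q k(1)] c h by (simp add: m_assoc)
  finally show "g \<otimes> (q \<otimes> h) \<otimes> inv g \<otimes> inv (q \<otimes> h) = g \<otimes> h \<otimes> inv g \<otimes> inv h" .
  have "(q \<otimes> h) \<otimes> g \<otimes> inv (q \<otimes> h) \<otimes> inv g = q \<otimes> (h \<otimes> (g \<otimes> inv h)) \<otimes> (inv q \<otimes> inv g)"
    using c h by (simp add: m_assoc inv_mult_group)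
  also have "inv q \<otimes> inv g = inv g \<otimes> inv q" by (rule edgeD(4)[OF K edgeD(3)[OF K q] edgeD(3)[OF K g]])
  also have "q \<otimes> (h \<otimes> (g \<otimes> inv h)) \<otimes> (inv g \<otimes> inv q) = q \<otimes> (h \<otimes> (g \<otimes> (inv h \<otimes> inv g))) \<otimes> inv q"
    using c h by (simp add: m_assoc)
  also have "\<dots> = h \<otimes> g \<otimes> inv h \<otimes> inv g"
    using edgeD(4)[OF K q k'] c h by (simp add: m_assoc)
  finally show "(q \<otimes> h) \<otimes> g \<otimes> inv (q \<otimes> h) \<otimes> inv g = h \<otimes> g \<otimes> inv h \<otimes> inv g" .
qed

text \<open>A set of commuting elements lies in a commutative subgroup: its double centraliser.\<close>

lemma commuting_set_in_comm_group:
  assumes A: "A \<subseteq> carrier G" and comm: "\<And>a b. a \<in> A \<Longrightarrow> b \<in> A \<Longrightarrow> a \<otimes> b = b \<otimes> a"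
  obtains H where "A \<subseteq> H" "subgroup H G" "comm_group (G\<lparr>carrier := H\<rparr>)"
proof -
  define C where "C = (\<lambda>B. {g \<in> carrier G. \<forall>b\<in>B. g \<otimes> b = b \<otimes> g})"
  have sub: "subgroup (C B) G" if B: "B \<subseteq> carrier G" for B
  proof (rule subgroupI)
    show "C B \<subseteq> carrier G" by (auto simp: C_def)
    show "C B \<noteq> {}" using B by (auto simp: C_def intro!: exI[of _ \<one>])
    fix g assume g: "g \<in> C B"
    have "inv g \<otimes> b = b \<otimes> inv g" if "b \<in> B" for b
    proof -
      have c: "g \<in> carrier G" "b \<in> carrier G" "g \<otimes> b = b \<otimes> g" using g that B by (auto simp: C_def)
      have "inv g \<otimes> b = inv g \<otimes> (b \<otimes> g) \<otimes> inv g" using c by (simp add: m_assoc)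
      also have "inv g \<otimes> (b \<otimes> g) = b" using inv_mult_cancel[OF c(1,2)] c(3) by simp
      finally show ?thesis .
    qed
    then show "inv g \<in> C B" using g by (auto simp: C_def)
    fix h assume h: "h \<in> C B"
    have "g \<otimes> h \<otimes> b = b \<otimes> (g \<otimes> h)" if "b \<in> B" for b
    proof -
      have c: "g \<in> carrier G" "h \<in> carrier G" "b \<in> carrier G" "g \<otimes> b = b \<otimes> g" "h \<otimes> b = b \<otimes> h"
        using g h that B by (auto simp: C_def)
      have "g \<otimes> h \<otimes> b = g \<otimes> b \<otimes> h" using c(1-3,5) by (simp add: m_assoc)
      also have "\<dots> = b \<otimes> (g \<otimes> h)" unfolding c(4) using c(1-3) by (simp add: m_assoc)
      finally show ?thesis .
    qed
    then show "g \<otimes> h \<in> C B" using g h by (auto simp: C_def)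
  qed
  have AC: "A \<subseteq> C A" using A comm by (auto simp: C_def)
  then have H: "C (C A) \<subseteq> C A" by (auto simp: C_def)
  have s: "subgroup (C (C A)) G" by (rule sub) (auto simp: C_def)
  show thesis
  proof (rule that[OF _ s])
    show "A \<subseteq> C (C A)" using A by (auto simp: C_def)
    have "group (G\<lparr>carrier := C (C A)\<rparr>)" by (rule subgroup.subgroup_is_group[OF s group_axioms])
    moreover have "x \<otimes> y = y \<otimes> x" if "x \<in> C (C A)" "y \<in> C (C A)" for x y
      using that H by (auto simp: C_def)
    ultimately show "comm_group (G\<lparr>carrier := C (C A)\<rparr>)"
      by (intro group.group_comm_groupI) auto
  qed
qed

end

section \<open>Covariant differentials on a tetrahedron\<close>

lemma (in comm_group) coboundary_difference:
  assumes "a \<in> carrier G" "b \<in> carrier G" "c \<in> carrier G" "d \<in> carrier G"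
    "a' \<in> carrier G" "b' \<in> carrier G" "c' \<in> carrier G" "d' \<in> carrier G"
  shows "(a \<otimes> inv a') \<otimes> inv (b \<otimes> inv b') \<otimes> (c \<otimes> inv c') \<otimes> inv (d \<otimes> inv d') =
    (a \<otimes> inv b \<otimes> c \<otimes> inv d) \<otimes> inv (a' \<otimes> inv b' \<otimes> c' \<otimes> inv d')"
  using assms by (simp add: inv_mult m_ac)

lemma (in comm_group) solve_coboundary:
  assumes "a \<in> carrier G" "b \<in> carrier G" "c \<in> carrier G" "d \<in> carrier G" "t \<in> carrier G" "w \<in> carrier G"
    and E: "d \<otimes> (t \<otimes> (b \<otimes> w)) = a \<otimes> c"
  shows "a \<otimes> inv b \<otimes> c \<otimes> inv d = w \<otimes> t"
proof -
  have "a \<otimes> inv b \<otimes> c \<otimes> inv d = (a \<otimes> c) \<otimes> (inv b \<otimes> inv d)" using assms(1-6) by (simp add: m_ac)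
  also have "\<dots> = (w \<otimes> t) \<otimes> ((b \<otimes> inv b) \<otimes> (d \<otimes> inv d))"
    unfolding E[symmetric] using assms(1-6) by (simp only: m_ac m_closed inv_closed)
  also have "\<dots> = w \<otimes> t" using assms(1-6) by simp
  finally show ?thesis .
qed

context group
begin

text \<open>The value of the twisted differential of a 2-form: \<open>a\<close>, \<open>b\<close>,
  \<open>c\<close>, \<open>d\<close> are its values on the faces opposite \<open>x0\<close>,
  \<open>x1\<close>, \<open>x2\<close>, \<open>x3\<close>, and \<open>ma\<close> is \<open>a\<close>
  transported along the edge 01. The nesting and the final \<open>\<one>\<close> reproduce the fold
  in \<open>de_rham\<close>.\<close>

definition coboundary :: "'a \<Rightarrow> 'a \<Rightarrow> 'a \<Rightarrow> 'a \<Rightarrow> 'a \<Rightarrow> 'a" where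
  "coboundary a b c d ma = (a \<otimes> (inv b \<otimes> (c \<otimes> (inv d \<otimes> \<one>)))) \<otimes> (ma \<otimes> inv a)"

definition preserves :: "'a set set \<Rightarrow> ('a \<Rightarrow> 'a) \<Rightarrow> bool" where
  "preserves \<K> u \<longleftrightarrow> u \<in> carrier Aut \<and> (\<forall>K\<in>\<K>. \<forall>g\<in>K. u g \<in> K)"

lemma preservesD:
  assumes "preserves \<K> u"
  shows "u \<in> carrier Aut" "K \<in> \<K> \<Longrightarrow> g \<in> K \<Longrightarrow> u g \<in> K"
  using assms by (auto simp: preserves_def)

end

text \<open>
  \<open>Kab\<close> is the kernel of reduction along the edge \<open>{x\<^sub>a = x\<^sub>b}\<close> of a \<open>3\<close>-simplex.  Values of \<open>2\<close>-forms
  lie in the kernels of the three edges of a face; any two faces share an edge, so all these values commute.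
\<close>

locale tetrahedron = group +
  fixes K01 K02 K03 K12 K13 K23 :: "'a set"
  assumes edges: "edge K01" "edge K02" "edge K03" "edge K12" "edge K13" "edge K23"
begin

abbreviation "F012 \<equiv> K01 \<inter> K02 \<inter> K12"
abbreviation "F013 \<equiv> K01 \<inter> K03 \<inter> K13"
abbreviation "F023 \<equiv> K02 \<inter> K03 \<inter> K23"
abbreviation "F123 \<equiv> K12 \<inter> K13 \<inter> K23"
abbreviation "faces \<equiv> F012 \<union> F013 \<union> F023 \<union> F123"
abbreviation "all_edges \<equiv> {K01, K02, K03, K12, K13, K23}"

lemma faces_carrier: "faces \<subseteq> carrier G"
  using edgeD(1)[OF edges(1)] edgeD(1)[OF edges(2)] edgeD(1)[OF edges(4)] by auto

lemma faces_commute: "g \<in> faces \<Longrightarrow> h \<in> faces \<Longrightarrow> g \<otimes> h = h \<otimes> g"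
  using edgeD(4)[OF edges(1), of g h] edgeD(4)[OF edges(2), of g h] edgeD(4)[OF edges(3), of g h]
    edgeD(4)[OF edges(4), of g h] edgeD(4)[OF edges(5), of g h] edgeD(4)[OF edges(6), of g h] by blast

lemma faces_comm_group:
  obtains H where "faces \<subseteq> H" "subgroup H G" "comm_group (G\<lparr>carrier := H\<rparr>)"
  using commuting_set_in_comm_group[OF faces_carrier faces_commute] by blast

text \<open>The bracket contributes \<open>ma \<otimes> inv a\<close>, whose second factor cancels
  the face opposite \<open>x0\<close>. What remains is the alternating product of the faces, with
  that face transported to \<open>x0\<close>.\<close>

lemma coboundary_eq:
  assumes "a \<in> F123" "ma \<in> F123" "b \<in> F023" "c \<in> F013" "d \<in> F012"
  shows "coboundary a b c d ma = ma \<otimes> inv b \<otimes> c \<otimes> inv d"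
proof -
  obtain H where H: "faces \<subseteq> H" "subgroup H G" "comm_group (G\<lparr>carrier := H\<rparr>)" by (rule faces_comm_group)
  interpret sub: subgroup H G by fact
  interpret H: comm_group "G\<lparr>carrier := H\<rparr>" by fact
  have m: "a \<in> H" "ma \<in> H" "b \<in> H" "c \<in> H" "d \<in> H" using H(1) assms by auto
  have "coboundary a b c d ma = (inv b \<otimes> (c \<otimes> (inv d \<otimes> ma))) \<otimes> (a \<otimes> inv a)"
    unfolding coboundary_def using m H.m_ac by (simp del: r_inv Units_r_inv)
  also have "\<dots> = ma \<otimes> inv b \<otimes> c \<otimes> inv d" using m H.m_ac by simp
  finally show ?thesis .
qed

lemma coboundary_difference':
  assumes "a \<in> F123" "ma \<in> F123" "b \<in> F023" "c \<in> F013" "d \<in> F012"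
    "a' \<in> F123" "ma' \<in> F123" "b' \<in> F023" "c' \<in> F013" "d' \<in> F012"
  shows "(ma \<otimes> inv ma') \<otimes> inv (b \<otimes> inv b') \<otimes> (c \<otimes> inv c') \<otimes> inv (d \<otimes> inv d') =
    (ma \<otimes> inv b \<otimes> c \<otimes> inv d) \<otimes> inv (ma' \<otimes> inv b' \<otimes> c' \<otimes> inv d')"
proof -
  obtain H where H: "faces \<subseteq> H" "subgroup H G" "comm_group (G\<lparr>carrier := H\<rparr>)" by (rule faces_comm_group)
  interpret sub: subgroup H G by fact
  interpret H: comm_group "G\<lparr>carrier := H\<rparr>" by fact
  have m: "ma \<in> H" "b \<in> H" "c \<in> H" "d \<in> H" "ma' \<in> H" "b' \<in> H" "c' \<in> H" "d' \<in> H" using H(1) assms by auto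
  show ?thesis
    using H.coboundary_difference[of ma b c d ma' b' c' d'] m m_inv_consistent[OF H(2)] by simp
qed

text \<open>Only \<open>w\<close> is not known beforehand to commute with the face values. The
  relation expresses it through them, so everything takes place in one commutative subgroup.\<close>

lemma solve_coboundary':
  assumes "a \<in> F123" "b \<in> F023" "c \<in> F013" "d \<in> F012" "t \<in> F012" "w \<in> carrier G"
    and E: "d \<otimes> (t \<otimes> (b \<otimes> w)) = a \<otimes> c"
  shows "a \<otimes> inv b \<otimes> c \<otimes> inv d = w \<otimes> t"
proof -
  obtain H where H: "faces \<subseteq> H" "subgroup H G" "comm_group (G\<lparr>carrier := H\<rparr>)" by (rule faces_comm_group)
  interpret sub: subgroup H G by fact
  interpret H: comm_group "G\<lparr>carrier := H\<rparr>" by fact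
  have m: "a \<in> H" "b \<in> H" "c \<in> H" "d \<in> H" "t \<in> H" using H(1) assms by auto
  have "w = inv (d \<otimes> t \<otimes> b) \<otimes> (a \<otimes> c)"
    unfolding E[symmetric] using assms(6) m by (simp add: group_simps)
  then have w: "w \<in> H" using m by simp
  show ?thesis
    using H.solve_coboundary[of a b c d t w] m w E m_inv_consistent[OF H(2)] by simp
qed

end

text \<open>\<open>M\<close>, \<open>M12\<close>, \<open>M02\<close> are values of \<open>m'\<close>
  on edges, \<open>m\<close> is the unprimed form on the edge 01, \<open>C\<close> stands for
  \<open>B'\<close>, and \<open>N\<close> is the unprimed fake curvature conjugated by
  \<open>r0\<close>. \<open>E012\<close> to \<open>E123\<close> are the curving relations on the
  four faces, \<open>M_r\<close> is the exact law of the connection on the edge 01, and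
  \<open>M_M\<close> compares the two transports from \<open>x2\<close> to \<open>x0\<close> across
  the face 012.\<close>

locale transformed_tetrahedron = tetrahedron +
  fixes M M12 M02 N r0 r1 m :: "'a \<Rightarrow> 'a"
    and e01 e02 e03 e12 e13 e23 :: 'a
    and B012 B013 B023 B123 C012 C013 C023 C123 n012 n013 n023 n123 :: 'a
  assumes auts: "preserves all_edges M" "preserves all_edges M12" "preserves all_edges M02"
      "preserves all_edges N" "preserves all_edges r0" "preserves all_edges r1" "preserves all_edges m"
    and es: "e01 \<in> K01" "e02 \<in> K02" "e03 \<in> K03" "e12 \<in> K12" "e13 \<in> K13" "e23 \<in> K23"
    and Bs: "B012 \<in> F012" "B013 \<in> F013" "B023 \<in> F023" "B123 \<in> F123"
    and Cs: "C012 \<in> F012" "C013 \<in> F013" "C023 \<in> F023" "C123 \<in> F123"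
    and ns: "n012 \<in> F012" "n013 \<in> F013" "n023 \<in> F023" "n123 \<in> F123"
    and E012: "C012 \<otimes> n012 \<otimes> e02 = M e12 \<otimes> e01 \<otimes> r0 B012"
    and E023: "C023 \<otimes> n023 \<otimes> e03 = M02 e23 \<otimes> e02 \<otimes> r0 B023"
    and E013: "C013 \<otimes> n013 \<otimes> e03 = M e13 \<otimes> e01 \<otimes> r0 B013"
    and E123: "C123 \<otimes> n123 \<otimes> e13 = M12 e23 \<otimes> e12 \<otimes> r1 B123"
    and M_r: "\<And>h. h \<in> carrier G \<Longrightarrow> M (r1 h) \<otimes> e01 = e01 \<otimes> r0 (m h)"
    and M_M: "\<And>h. h \<in> carrier G \<Longrightarrow> M (M12 h) \<otimes> (C012 \<otimes> n012) = (C012 \<otimes> n012) \<otimes> N (M02 h)"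
    and N_face: "\<And>h. h \<in> carrier G \<Longrightarrow> N h \<otimes> inv h \<in> F012"
    and N_fix: "\<And>h. h \<in> K02 \<Longrightarrow> N h = h"
    and M02_edge: "M02 e23 \<otimes> inv e23 \<in> K02"
    and B_last: "m B123 \<otimes> inv B012 \<in> K03"
    and n_last: "M n123 \<otimes> inv n012 \<in> K03"
begin

lemma edge_carrier:
  "g \<in> K01 \<Longrightarrow> g \<in> carrier G" "g \<in> K02 \<Longrightarrow> g \<in> carrier G" "g \<in> K03 \<Longrightarrow> g \<in> carrier G"
  "g \<in> K12 \<Longrightarrow> g \<in> carrier G" "g \<in> K13 \<Longrightarrow> g \<in> carrier G" "g \<in> K23 \<Longrightarrow> g \<in> carrier G"
  using edges edgeD(1) by blast+

lemma preserve_edge: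
  assumes "preserves all_edges u"
  shows "g \<in> K01 \<Longrightarrow> u g \<in> K01" "g \<in> K02 \<Longrightarrow> u g \<in> K02" "g \<in> K03 \<Longrightarrow> u g \<in> K03"
    "g \<in> K12 \<Longrightarrow> u g \<in> K12" "g \<in> K13 \<Longrightarrow> u g \<in> K13" "g \<in> K23 \<Longrightarrow> u g \<in> K23"
    "g \<in> F012 \<Longrightarrow> u g \<in> F012" "g \<in> F013 \<Longrightarrow> u g \<in> F013" "g \<in> F023 \<Longrightarrow> u g \<in> F023" "g \<in> F123 \<Longrightarrow> u g \<in> F123"
  using assms by (auto simp: preserves_def)

lemma car:
  "e01 \<in> carrier G" "e02 \<in> carrier G" "e03 \<in> carrier G" "e12 \<in> carrier G" "e13 \<in> carrier G" "e23 \<in> carrier G"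
  "B012 \<in> carrier G" "B013 \<in> carrier G" "B023 \<in> carrier G" "B123 \<in> carrier G"
  "C012 \<in> carrier G" "C013 \<in> carrier G" "C023 \<in> carrier G" "C123 \<in> carrier G"
  "n012 \<in> carrier G" "n013 \<in> carrier G" "n023 \<in> carrier G" "n123 \<in> carrier G"
  using es Bs Cs ns edge_carrier by auto

lemma aut_closed: "h \<in> carrier G \<Longrightarrow> M h \<in> carrier G" "h \<in> carrier G \<Longrightarrow> M12 h \<in> carrier G"
  "h \<in> carrier G \<Longrightarrow> M02 h \<in> carrier G" "h \<in> carrier G \<Longrightarrow> N h \<in> carrier G"
  "h \<in> carrier G \<Longrightarrow> r0 h \<in> carrier G" "h \<in> carrier G \<Longrightarrow> r1 h \<in> carrier G" "h \<in> carrier G \<Longrightarrow> m h \<in> carrier G"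
  using auts[THEN preservesD(1)] Aut_closed by blast+

text \<open>The bracket contains \<open>e23\<close> itself, whereas the derivation produces its
  transport \<open>M02 e23\<close>. The two differ by an element of \<open>K02\<close>, which
  \<open>N\<close> fixes and which commutes with \<open>N e23 \<otimes> inv e23\<close>.\<close>

lemma N_bracket: "N (M02 e23) \<otimes> inv (M02 e23) = N e23 \<otimes> inv e23"
proof -
  define z where "z = M02 e23 \<otimes> inv e23"
  have z: "z \<in> K02" "z \<in> carrier G" using M02_edge edge_carrier by (auto simp: z_def)
  have y: "M02 e23 = z \<otimes> e23" using car aut_closed by (simp add: z_def m_assoc)
  have Ne: "N e23 \<in> carrier G" using car aut_closed by simp
  have k: "N e23 \<otimes> inv e23 \<in> K02" using N_face[OF car(6)] by auto
  have "N (M02 e23) = z \<otimes> N e23"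
    unfolding y using Aut_mult[OF preservesD(1)[OF auts(4)] z(2) car(6)] N_fix[OF z(1)] by simp
  then have "N (M02 e23) \<otimes> inv (M02 e23) = z \<otimes> (N e23 \<otimes> inv e23) \<otimes> inv z"
    unfolding y using z car Ne by (simp add: group_simps)
  also have "\<dots> = N e23 \<otimes> inv e23"
    using edgeD(4)[OF edges(2) z(1) k] z car Ne by (simp add: m_assoc)
  finally show ?thesis .
qed

text \<open>Both sides of the relation for \<open>M(M12 e23 \<cdot> e12 \<cdot> r1 B123) \<cdot> e01\<close> are brought to the faces through \<open>x\<^sub>0\<close>.\<close>

lemma bianchi:
  "M (C123 \<otimes> n123) \<otimes> inv (C023 \<otimes> n023) \<otimes> (C013 \<otimes> n013) \<otimes> inv (C012 \<otimes> n012) =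
   r0 (coboundary B123 B023 B013 B012 (m B123)) \<otimes> (N e23 \<otimes> inv e23)"
proof -
  note c = car aut_closed
  define b012 where "b012 = C012 \<otimes> n012"
  define b013 where "b013 = C013 \<otimes> n013"
  define b023 where "b023 = C023 \<otimes> n023"
  define b123 where "b123 = C123 \<otimes> n123"
  have b: "b012 \<in> F012" "b013 \<in> F013" "b023 \<in> F023" "b123 \<in> F123"
    using Cs ns edges edgeD(2) by (auto simp: b012_def b013_def b023_def b123_def)
  have bc: "b012 \<in> carrier G" "b013 \<in> carrier G" "b023 \<in> carrier G" "b123 \<in> carrier G"
    using c by (auto simp: b012_def b013_def b023_def b123_def)
  note hom = Aut_mult[OF preservesD(1)[OF auts(1)]] Aut_mult[OF preservesD(1)[OF auts(5)]]
    Aut_map_inv[OF preservesD(1)[OF auts(5)]]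
  define y where "y = M02 e23"
  define t where "t = N e23 \<otimes> inv e23"
  define W where "W = coboundary B123 B023 B013 B012 (m B123)"
  have y: "y \<in> carrier G" using c by (simp add: y_def)
  have t: "t \<in> F012" "t \<in> carrier G" using N_face[OF car(6)] edge_carrier by (auto simp: t_def)
  have Ny: "N y = t \<otimes> y" using N_bracket c y by (simp add: y_def t_def inv_solve_right')
  have W_eq: "W = m B123 \<otimes> inv B023 \<otimes> B013 \<otimes> inv B012"
    unfolding W_def by (rule coboundary_eq[OF Bs(4) preserve_edge(10)[OF auts(7) Bs(4)] Bs(3,2,1)])
  have W: "W \<in> carrier G" using c by (simp add: W_eq)
  \<comment> \<open>The relation on the face 123 starts at \<open>x1\<close>; applying
    \<open>M\<close> brings it to \<open>x0\<close>, and \<open>M_r\<close> turns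
    \<open>M (r1 B123)\<close> into the transport under the unprimed connection.\<close>
  have "M (M12 e23) \<otimes> (M e12 \<otimes> e01) \<otimes> r0 (m B123) = M (b123) \<otimes> (M e13 \<otimes> e01)"
  proof -
    have "M (M12 e23) \<otimes> (M e12 \<otimes> e01) \<otimes> r0 (m B123) = M (M12 e23) \<otimes> (M e12 \<otimes> (e01 \<otimes> r0 (m B123)))"
      using c by (simp add: m_assoc)
    also have "\<dots> = M (M12 e23 \<otimes> e12 \<otimes> r1 B123) \<otimes> e01"
      unfolding M_r[OF car(10), symmetric] using c by (simp add: hom m_assoc)
    also have "\<dots> = M (b123) \<otimes> (M e13 \<otimes> e01)"
      unfolding E123[symmetric] b123_def[symmetric] using c bc by (simp add: hom m_assoc)
    finally show ?thesis .
  qed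
  note MM = this
  have E1: "M e12 \<otimes> e01 = b012 \<otimes> e02 \<otimes> inv (r0 B012)"
    using E012 c bc by (simp add: b012_def inv_solve_right)
  have E2: "M e13 \<otimes> e01 = b013 \<otimes> e03 \<otimes> inv (r0 B013)"
    using E013 c bc by (simp add: b013_def inv_solve_right)
  have ye: "y \<otimes> e02 = b023 \<otimes> e03 \<otimes> inv (r0 B023)"
    using E023 c bc y by (simp add: b023_def y_def inv_solve_right)
  have Mb: "M (M12 e23) \<otimes> b012 = b012 \<otimes> (t \<otimes> y)"
    using M_M[OF car(6)] Ny by (simp add: b012_def y_def)
  have "b012 \<otimes> (t \<otimes> (y \<otimes> e02)) \<otimes> inv (r0 B012) \<otimes> r0 (m B123) =
      (b012 \<otimes> (t \<otimes> y)) \<otimes> (e02 \<otimes> inv (r0 B012) \<otimes> r0 (m B123))"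
    using c bc y t by (simp add: m_assoc)
  also have "\<dots> = M (M12 e23) \<otimes> (b012 \<otimes> e02 \<otimes> inv (r0 B012)) \<otimes> r0 (m B123)"
    unfolding Mb[symmetric] using c bc by (simp add: m_assoc)
  also have "\<dots> = M b123 \<otimes> (b013 \<otimes> e03 \<otimes> inv (r0 B013))"
    unfolding E1[symmetric] E2[symmetric] by (rule MM)
  finally have eq: "b012 \<otimes> (t \<otimes> (y \<otimes> e02)) \<otimes> inv (r0 B012) \<otimes> r0 (m B123) =
      M b123 \<otimes> (b013 \<otimes> e03 \<otimes> inv (r0 B013))" .
  have "b012 \<otimes> (t \<otimes> (b023 \<otimes> (e03 \<otimes> (inv (r0 B023) \<otimes> inv (r0 B012) \<otimes> r0 (m B123) \<otimes> r0 B013)))) =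
      b012 \<otimes> (t \<otimes> (y \<otimes> e02)) \<otimes> inv (r0 B012) \<otimes> r0 (m B123) \<otimes> r0 B013"
    unfolding ye using c bc t by (simp add: m_assoc)
  also have "\<dots> = M b123 \<otimes> b013 \<otimes> e03"
    unfolding eq using c bc by (simp add: m_assoc)
  finally have eq': "b012 \<otimes> (t \<otimes> (b023 \<otimes> (e03 \<otimes> (inv (r0 B023) \<otimes> inv (r0 B012) \<otimes> r0 (m B123) \<otimes> r0 B013)))) =
      M b123 \<otimes> b013 \<otimes> e03" .
  obtain H where H: "faces \<subseteq> H" "subgroup H G" "comm_group (G\<lparr>carrier := H\<rparr>)" by (rule faces_comm_group)
  interpret sub: subgroup H G by fact
  interpret H: comm_group "G\<lparr>carrier := H\<rparr>" by fact
  have BH: "B012 \<in> H" "B013 \<in> H" "B023 \<in> H" "m B123 \<in> H"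
    using H(1) Bs preserve_edge(10)[OF auts(7) Bs(4)] by auto
  have "W = inv B023 \<otimes> inv B012 \<otimes> m B123 \<otimes> B013" unfolding W_eq using BH H.m_ac by simp
  then have rW: "inv (r0 B023) \<otimes> inv (r0 B012) \<otimes> r0 (m B123) \<otimes> r0 B013 = r0 W"
    using c by (simp add: hom)
  \<comment> \<open>The value \<open>e03\<close> of a 1-form is left on both sides and has to be
    moved past \<open>r0 W\<close> before it cancels. Regrouped, \<open>W\<close> lies in
    \<open>K03\<close>: the faces 023 and 013 contain that edge, and \<open>B_last\<close> covers
    the remaining factor.\<close>
  have "W = inv B023 \<otimes> B013 \<otimes> (m B123 \<otimes> inv B012)" unfolding W_eq using BH H.m_ac by simp
  moreover have "inv B023 \<otimes> B013 \<in> K03" using Bs edgeD(2,3)[OF edges(3)] by auto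
  ultimately have W3: "r0 W \<in> K03" using edgeD(2)[OF edges(3) _ B_last] preserve_edge(3)[OF auts(5)] by simp
  have rWc: "r0 W \<in> carrier G" using W c by simp
  have "b012 \<otimes> (t \<otimes> (b023 \<otimes> r0 W)) \<otimes> e03 = b012 \<otimes> (t \<otimes> (b023 \<otimes> (e03 \<otimes> r0 W)))"
    unfolding edgeD(4)[OF edges(3) es(3) W3] using c bc t rWc by (simp add: m_assoc)
  also have "\<dots> = M b123 \<otimes> b013 \<otimes> e03" using eq' unfolding rW .
  finally have "b012 \<otimes> (t \<otimes> (b023 \<otimes> r0 W)) = M b123 \<otimes> b013"
    using c bc t rWc by simp
  then show ?thesis
    using solve_coboundary'[OF preserve_edge(10)[OF auts(1) b(4)] b(3,2,1) t(1) rWc]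
    unfolding W_def t_def b012_def b013_def b023_def b123_def by simp
qed

text \<open>\<open>bianchi\<close> concerns the products of \<open>C\<close> and \<open>n\<close> on
  the faces. Since face values commute, the differential is additive, and the part coming from
  \<open>n\<close> moves to the other side.\<close>

lemma curvature_transformation:
  "coboundary C123 C023 C013 C012 (M C123) =
   r0 (coboundary B123 B023 B013 B012 (m B123)) \<otimes> (N e23 \<otimes> inv e23) \<otimes>
     inv (coboundary n123 n023 n013 n012 (M n123))"
proof -
  note c = car aut_closed
  note Mb = preserve_edge(10)[OF auts(1)]
  have b: "C012 \<otimes> n012 \<in> F012" "C013 \<otimes> n013 \<in> F013" "C023 \<otimes> n023 \<in> F023" "C123 \<otimes> n123 \<in> F123"
    using Cs ns edges edgeD(2) by auto
  have "(M (C123 \<otimes> n123) \<otimes> inv (M n123)) \<otimes> inv (C023 \<otimes> n023 \<otimes> inv n023) \<otimes> (C013 \<otimes> n013 \<otimes> inv n013) \<otimes>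
      inv (C012 \<otimes> n012 \<otimes> inv n012) =
    (M (C123 \<otimes> n123) \<otimes> inv (C023 \<otimes> n023) \<otimes> (C013 \<otimes> n013) \<otimes> inv (C012 \<otimes> n012)) \<otimes>
      inv (M n123 \<otimes> inv n023 \<otimes> n013 \<otimes> inv n012)"
    by (rule coboundary_difference'[OF b(4) Mb[OF b(4)] b(3,2,1) ns(4) Mb[OF ns(4)] ns(3,2,1)])
  moreover have "M (C123 \<otimes> n123) \<otimes> inv (M n123) = M C123"
    using c by (simp add: Aut_mult[OF preservesD(1)[OF auts(1)]] m_assoc)
  ultimately show ?thesis
    unfolding bianchi coboundary_eq[OF Cs(4) Mb[OF Cs(4)] Cs(3,2,1)] coboundary_eq[OF ns(4) Mb[OF ns(4)] ns(3,2,1)]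
    using c by (simp add: m_assoc)
qed

text \<open>The graded commutativity \<open>[n, e] + [e, n] = 0\<close>; both commutators are reduced to one with \<open>e03\<close>.\<close>

lemma graded_commutativity:
  "(n012 \<otimes> e23 \<otimes> inv n012 \<otimes> inv e23) \<otimes> (e01 \<otimes> M n123 \<otimes> inv e01 \<otimes> inv (M n123)) = \<one>"
proof -
  note c = car aut_closed
  define g where "g = M n123"
  have g: "g \<in> F123" "g \<in> carrier G" using preserve_edge(10)[OF auts(1) ns(4)] c by (auto simp: g_def)
  have rB: "r0 B023 \<in> F023" "r0 B013 \<in> F013" using preserve_edge(9,8)[OF auts(5)] Bs by auto
  define z where "z = M02 e23 \<otimes> inv e23"
  have z: "z \<in> K02" "z \<in> carrier G" using M02_edge edge_carrier by (auto simp: z_def)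
  have y: "M02 e23 = z \<otimes> e23" using c by (simp add: z_def m_assoc)
  define q' where "q' = inv (r0 B023) \<otimes> inv e02"
  note K2 = edgeD[OF edges(2)] and K5 = edgeD[OF edges(5)]
  have "inv (r0 B023) \<in> K02" "inv e02 \<in> K02" using rB es K2(3) by auto
  then have q': "q' \<in> K02" unfolding q'_def by (rule K2(2))
  \<comment> \<open>\<open>q\<close> and, below, \<open>p\<close> arise by solving the relations on
    the faces 023 and 013 for \<open>e23\<close> and \<open>e01\<close> in terms of
    \<open>e03\<close>. They lie in \<open>K02\<close> and \<open>K13\<close>, kernels that also
    contain \<open>n012\<close> and \<open>M n123\<close> respectively, and so they are absorbed by
    the commutators.\<close>
  define q where "q = inv z \<otimes> (C023 \<otimes> n023) \<otimes> (e03 \<otimes> (q' \<otimes> inv e03))"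
  have "inv z \<in> K02" "C023 \<otimes> n023 \<in> K02" using z Cs ns K2(2,3) by auto
  then have q: "q \<in> K02" unfolding q_def by (rule K2(2)[OF K2(2) K2(5)[OF q' car(3)]])
  have E: "z \<otimes> e23 \<otimes> e02 \<otimes> r0 B023 = C023 \<otimes> n023 \<otimes> e03" using E023 y by simp
  have "z \<otimes> e23 = (z \<otimes> e23 \<otimes> e02 \<otimes> r0 B023) \<otimes> q'"
    unfolding q'_def using c z by (simp add: group_simps)
  then have "z \<otimes> e23 = C023 \<otimes> n023 \<otimes> e03 \<otimes> q'" unfolding E .
  then have "e23 = inv z \<otimes> (C023 \<otimes> n023 \<otimes> e03 \<otimes> q')"
    using c z q' edge_carrier(2) by (simp add: inv_solve_left)
  then have e23: "e23 = q \<otimes> e03" unfolding q_def using c z q' edge_carrier(2) by (simp add: m_assoc)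
  define p where "p = inv (M e13) \<otimes> (C013 \<otimes> n013) \<otimes> (e03 \<otimes> (inv (r0 B013) \<otimes> inv e03))"
  have "inv (M e13) \<in> K13" "C013 \<otimes> n013 \<in> K13" "inv (r0 B013) \<in> K13"
    using preserve_edge(5)[OF auts(1) es(5)] rB Cs ns K5(2,3) by auto
  then have p: "p \<in> K13" unfolding p_def by (intro K5(2)[OF K5(2) K5(5)[OF _ car(3)]])
  have "M e13 \<otimes> e01 = C013 \<otimes> n013 \<otimes> e03 \<otimes> inv (r0 B013)"
    using E013 c by (simp add: inv_solve_right)
  then have "e01 = inv (M e13) \<otimes> (C013 \<otimes> n013 \<otimes> e03 \<otimes> inv (r0 B013))"
    using c by (simp add: inv_solve_left)
  then have e01: "e01 = p \<otimes> e03" unfolding p_def using c by (simp add: m_assoc)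
  define \<tau> where "\<tau> = g \<otimes> inv n012"
  have \<tau>: "\<tau> \<in> K03" using n_last by (simp add: \<tau>_def g_def)
  have g\<tau>: "g = \<tau> \<otimes> n012" using g c by (simp add: \<tau>_def m_assoc)
  have "n012 \<otimes> e23 \<otimes> inv n012 \<otimes> inv e23 = n012 \<otimes> e03 \<otimes> inv n012 \<otimes> inv e03"
    unfolding e23 using ns q by (intro commutator_absorb(1)[OF edges(2)] c) auto
  moreover have "e01 \<otimes> g \<otimes> inv e01 \<otimes> inv g = e03 \<otimes> g \<otimes> inv e03 \<otimes> inv g"
    unfolding e01 using g p by (intro commutator_absorb(2)[OF edges(5)] c) auto
  moreover have "\<dots> = e03 \<otimes> n012 \<otimes> inv e03 \<otimes> inv n012"
    unfolding g\<tau> by (rule commutator_absorb(1)[OF edges(3) es(3) \<tau> car(15)])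
  ultimately show ?thesis unfolding g_def using c by (simp add: group_simps)
qed

text \<open>Passing from \<open>N\<close> to \<open>nu\<close> multiplies the bracket by the
  commutator \<open>s\<close> of \<open>n012\<close> and \<open>e23\<close>. Passing from
  \<open>M\<close> to \<open>mu\<close> multiplies the transported \<open>n123\<close> by the same
  \<open>s\<close>, by \<open>graded_commutativity\<close>. The two changes cancel.\<close>

lemma curvature_transformation':
  assumes nu: "\<And>h. h \<in> carrier G \<Longrightarrow> nu h = N (n012 \<otimes> h \<otimes> inv n012)"
    and mu: "\<And>h. h \<in> carrier G \<Longrightarrow> e01 \<otimes> mu h \<otimes> inv e01 = M h" "mu n123 \<in> F123"
  shows "coboundary C123 C023 C013 C012 (M C123) =
    r0 (coboundary B123 B023 B013 B012 (m B123)) \<otimes> (nu e23 \<otimes> inv e23) \<otimes>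
     inv (coboundary n123 n023 n013 n012 (mu n123))"
proof -
  note c = car aut_closed
  define t where "t = N e23 \<otimes> inv e23"
  have t: "t \<in> F012" "t \<in> carrier G" using N_face[OF car(6)] edge_carrier by (auto simp: t_def)
  define s where "s = n012 \<otimes> e23 \<otimes> inv n012 \<otimes> inv e23"
  define u where "u = e01 \<otimes> M n123 \<otimes> inv e01 \<otimes> inv (M n123)"
  have su: "s \<in> carrier G" "u \<in> carrier G" using c by (auto simp: s_def u_def)
  have "s \<otimes> u = \<one>" using graded_commutativity by (simp add: s_def u_def)
  have Nn: "N n012 = n012" using N_fix ns by auto
  have "nu e23 \<otimes> inv e23 = n012 \<otimes> t \<otimes> inv n012 \<otimes> s"
    unfolding nu[OF car(6)] t_def s_def using c Nn
    by (simp add: Aut_mult[OF preservesD(1)[OF auts(4)]] Aut_map_inv[OF preservesD(1)[OF auts(4)]] group_simps)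
  also have "n012 \<otimes> t \<otimes> inv n012 = t"
    using faces_commute[of n012 t] ns t c by (simp add: m_assoc)
  finally have nus: "nu e23 \<otimes> inv e23 = t \<otimes> s" .
  have muc: "mu n123 \<in> carrier G" using mu(2) edge_carrier by auto
  have eM: "e01 \<otimes> mu n123 \<otimes> inv e01 = M n123" by (rule mu(1)[OF car(18)])
  have Mn: "M n123 \<in> F123" using preserve_edge(10)[OF auts(1) ns(4)] .
  have K: "x \<in> K01 \<Longrightarrow> e01 \<otimes> x = x \<otimes> e01" for x using edgeD(4)[OF edges(1) es(1)] .
  have "e01 \<otimes> (M n123 \<otimes> inv e01 \<otimes> inv (M n123)) \<in> K01"
  proof (rule edgeD(2)[OF edges(1) es(1)])
    show "M n123 \<otimes> inv e01 \<otimes> inv (M n123) \<in> K01"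
      using edgeD(5)[OF edges(1) edgeD(3)[OF edges(1) es(1)], of "M n123"] c by (simp add: m_assoc)
  qed
  then have "u \<in> K01" using c by (simp add: u_def m_assoc)
  then have eu: "e01 \<otimes> u = u \<otimes> e01" by (rule K)
  have "mu n123 = inv e01 \<otimes> M n123 \<otimes> e01"
    unfolding eM[symmetric] using c muc by (simp add: group_simps)
  also have "\<dots> = inv e01 \<otimes> (inv u \<otimes> e01) \<otimes> M n123"
    unfolding u_def using c by (simp add: group_simps)
  also have "inv u \<otimes> e01 = e01 \<otimes> inv u"
  proof -
    have "inv u \<otimes> (e01 \<otimes> u) \<otimes> inv u = inv u \<otimes> (u \<otimes> e01) \<otimes> inv u" using eu by simp
    then show ?thesis using su c by (simp add: group_simps)
  qed
  also have "inv e01 \<otimes> (e01 \<otimes> inv u) \<otimes> M n123 = inv u \<otimes> M n123" using c su by (simp add: group_simps)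
  also have "inv u = s" using \<open>s \<otimes> u = \<one>\<close> su inv_equality by blast
  finally have mus: "mu n123 = s \<otimes> M n123" .
  have "inv (coboundary n123 n023 n013 n012 (M n123)) =
      s \<otimes> inv (coboundary n123 n023 n013 n012 (mu n123))"
  proof -
    obtain H where H: "faces \<subseteq> H" "subgroup H G" "comm_group (G\<lparr>carrier := H\<rparr>)" by (rule faces_comm_group)
    interpret sub: subgroup H G by fact
    interpret H: comm_group "G\<lparr>carrier := H\<rparr>" by fact
    define w where "w = M n123 \<otimes> inv n023 \<otimes> n013 \<otimes> inv n012"
    have mH: "M n123 \<in> H" "mu n123 \<in> H" "n023 \<in> H" "n013 \<in> H" "n012 \<in> H" using H(1) Mn mu(2) ns by auto
    have "s = mu n123 \<otimes> inv (M n123)" unfolding mus using c su by (simp add: m_assoc)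
    then have "s \<in> H" "w \<in> H" using mH by (simp_all add: w_def)
    then have "s \<otimes> w = w \<otimes> s" "w \<in> carrier G" using H.m_comm[of s w] by simp_all
    then have "inv w = s \<otimes> inv (s \<otimes> w)" using su by (simp add: group_simps)
    moreover have "mu n123 \<otimes> inv n023 \<otimes> n013 \<otimes> inv n012 = s \<otimes> w"
      unfolding mus w_def using c su by (simp add: m_assoc)
    ultimately show ?thesis
      unfolding coboundary_eq[OF ns(4) Mn ns(3,2,1)] coboundary_eq[OF ns(4) mu(2) ns(3,2,1)]
      by (simp add: w_def)
  qed
  then show ?thesis
    unfolding curvature_transformation nus t_def[symmetric]
    using su t c muc by (simp add: m_assoc coboundary_def)
qed

end

section \<open>Arrows in the fibres of a stack\<close>

locale fibred_groupoids =
  fixes X :: "('u, 'x, 's) over_sch" and P :: "('u, 'x, 'o, 'a) fibcat"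
  assumes fibred: "fibred_in_groupoids X P"
begin

abbreviation cmp :: "'a \<Rightarrow> 'a \<Rightarrow> 'a" (infixr \<open>\<cdot>\<close> 75) where "a \<cdot> b \<equiv> Comp P a b"

definition V :: "'a set" where "V = {a. vertical P (Dom P a) (Cod P a) a}"

lemma vertical_V: "vertical P z y a \<longleftrightarrow> a \<in> V \<and> Dom P a = z \<and> Cod P a = y"
  by (auto simp: V_def vertical_def arrow_over_def)

lemma category: "category_over X P"
  using fibred by (simp add: fibred_in_groupoids_def)

lemma V_data:
  assumes "a \<in> V"
  shows "a \<in> Arr P" "Dom P a \<in> Obj P" "Cod P a \<in> Obj P" "Rng P (Dom P a) = Rng P (Cod P a)"
    "Pt P (Dom P a) = Pt P (Cod P a)" "Rhom P a = idhom (Rng P (Cod P a))" "cring (Rng P (Cod P a))"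
  using assms category by (auto simp: V_def vertical_def arrow_over_def category_over_def)

lemma V_comp:
  assumes "a \<in> V" "b \<in> V" "Dom P a = Cod P b"
  shows "a \<cdot> b \<in> V" "Dom P (a \<cdot> b) = Dom P b" "Cod P (a \<cdot> b) = Cod P a"
proof -
  note a = V_data[OF assms(1)] and b = V_data[OF assms(2)]
  have "arrow_over P (hcomp (Rng P (Cod P a)) (Rhom P b) (Rhom P a)) (Dom P b) (Cod P a) (a \<cdot> b)"
    using category a(1) b(1) assms(3) unfolding category_over_def by blast
  moreover have "hcomp (Rng P (Cod P a)) (Rhom P b) (Rhom P a) = idhom (Rng P (Cod P a))"
    using a b assms(3) hcomp_idhom[OF idhom_Hom] by simp
  ultimately show "a \<cdot> b \<in> V" "Dom P (a \<cdot> b) = Dom P b" "Cod P (a \<cdot> b) = Cod P a"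
    using a b assms(3) by (auto simp: V_def vertical_def arrow_over_def)
qed

lemma V_assoc:
  assumes "a \<in> V" "b \<in> V" "c \<in> V" "Dom P a = Cod P b" "Dom P b = Cod P c"
  shows "(a \<cdot> b) \<cdot> c = a \<cdot> b \<cdot> c"
  using category V_data(1)[OF assms(1)] V_data(1)[OF assms(2)] V_data(1)[OF assms(3)] assms(4,5)
  unfolding category_over_def by blast

text \<open>Cartesian lifting of the identity arrow of \<open>Cod P a\<close> through
  \<open>a\<close> yields the right inverse that cancellation on the right calls for.\<close>

lemma V_inverse:
  assumes "a \<in> V"
  obtains c where "c \<in> V" "Dom P c = Cod P a" "Cod P c = Dom P a" "a \<cdot> c = Ident P (Cod P a)"
proof -
  note a = V_data[OF assms]
  let ?i = "Ident P (Cod P a)"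
  have "vertical P (Cod P a) (Cod P a) ?i" using category a(3) by (simp add: category_over_def)
  then have i: "?i \<in> V" "Dom P ?i = Cod P a" "Cod P ?i = Cod P a" by (simp_all add: vertical_V)
  note i' = V_data[OF i(1)]
  have h: "idhom (Rng P (Cod P a)) \<in> Hom (Rng P (Dom P a)) (Rng P (Dom P ?i))"
    using a i idhom_Hom by simp
  have r: "Rhom P ?i = hcomp (Rng P (Cod P a)) (idhom (Rng P (Cod P a))) (Rhom P a)"
    using a i i' hcomp_idhom[OF idhom_Hom[OF a(7)]] by simp
  have "\<exists>!c. arrow_over P (idhom (Rng P (Cod P a))) (Dom P ?i) (Dom P a) c \<and> a \<cdot> c = ?i"
    using fibred a(1) i'(1) i(3) h r unfolding fibred_in_groupoids_def by metis
  then obtain c where "arrow_over P (idhom (Rng P (Cod P a))) (Dom P ?i) (Dom P a) c" "a \<cdot> c = ?i" by blast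
  then show thesis using a i by (intro that[of c]) (auto simp: V_def vertical_def arrow_over_def)
qed

lemma V_ident: "a \<in> V \<Longrightarrow> a \<cdot> Ident P (Dom P a) = a"
  using category V_data(1) by (simp add: category_over_def)

lemma V_right_cancel:
  assumes "a \<in> V" "a' \<in> V" "b \<in> V" "Dom P a = Cod P b" "Dom P a' = Cod P b" "a \<cdot> b = a' \<cdot> b"
  shows "a = a'"
proof -
  obtain c where c: "c \<in> V" "Dom P c = Cod P b" "Cod P c = Dom P b" "b \<cdot> c = Ident P (Cod P b)"
    by (rule V_inverse[OF assms(3)])
  have "a = (a \<cdot> b) \<cdot> c" using V_assoc[of a b c] V_ident[of a] assms c by simp
  also have "\<dots> = a'" unfolding assms(6) using V_assoc[of a' b c] V_ident[of a'] assms c by simp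
  finally show ?thesis .
qed

definition on_fibre :: "'u ring \<Rightarrow> 'x \<Rightarrow> 'o \<Rightarrow> bool" where
  "on_fibre R p z \<longleftrightarrow> z \<in> Obj P \<and> Rng P z = R \<and> Pt P z = p"

text \<open>A morphism between inverse images of the stack, frozen at one point: a functor from the
  fibre over \<open>p\<close> to the fibre over \<open>p'\<close>. Calculations with arrows then do
  not mention base change.\<close>

definition fibre_functor :: "'u ring \<Rightarrow> 'x \<Rightarrow> 'x \<Rightarrow> ('o \<Rightarrow> 'o) \<Rightarrow> ('a \<Rightarrow> 'a) \<Rightarrow> bool" where
  "fibre_functor R p p' Fo Fa \<longleftrightarrow> (\<forall>z. on_fibre R p z \<longrightarrow> on_fibre R p' (Fo z)) \<and>
     (\<forall>a\<in>V. on_fibre R p (Cod P a) \<longrightarrow>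
        Fa a \<in> V \<and> Dom P (Fa a) = Fo (Dom P a) \<and> Cod P (Fa a) = Fo (Cod P a) \<and>
        (\<forall>b\<in>V. Cod P b = Dom P a \<longrightarrow> Fa (a \<cdot> b) = Fa a \<cdot> Fa b))"

lemma stack_mor_fibre_functor:
  assumes F: "stack_mor P Y q q' F" and y: "y \<in> pts Y R" "res Y R R (idhom R) y = y"
  shows "fibre_functor R (q y) (q' y) (fst F y) (snd F y)"
  unfolding fibre_functor_def
proof (intro conjI allI impI ballI)
  fix z assume "on_fibre R (q y) z"
  then show "on_fibre R (q' y) (fst F y z)"
    using F y unfolding stack_mor_def by (auto simp: on_fibre_def)
next
  fix a assume aV: "a \<in> V" and f: "on_fibre R (q y) (Cod P a)"
  note a = V_data[OF aV]
  have R: "Rng P (Cod P a) = R" "Rng P (Dom P a) = R" "q y = Pt P (Cod P a)" using f a by (auto simp: on_fibre_def)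
  have s: "arrow_over P (Rhom P a) (fst F y (Dom P a)) (fst F y (Cod P a)) (snd F y a) \<and>
      (\<forall>b\<in>Arr P. Cod P b = Dom P a \<longrightarrow> snd F y (a \<cdot> b) = snd F y a \<cdot> snd F y b)"
  proof -
    have ry: "res Y (Rng P (Cod P a)) (Rng P (Dom P a)) (Rhom P a) y = y" using a(4,6) R y(2) by simp
    have "y \<in> pts Y (Rng P (Cod P a))" using y(1) R by simp
    then have "let y' = res Y (Rng P (Cod P a)) (Rng P (Dom P a)) (Rhom P a) y in
        arrow_over P (Rhom P a) (fst F y' (Dom P a)) (fst F y (Cod P a)) (snd F y a) \<and>
        (\<forall>b\<in>Arr P. Cod P b = Dom P a \<longrightarrow> snd F y (a \<cdot> b) = snd F y a \<cdot> snd F y' b)"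
      using F a(1) R(3) unfolding stack_mor_def by blast
    then show ?thesis unfolding ry by (simp add: Let_def)
  qed
  have "on_fibre R (q' y) (fst F y (Dom P a)) \<and> on_fibre R (q' y) (fst F y (Cod P a))"
    using F y f a unfolding stack_mor_def by (auto simp: on_fibre_def)
  then show "snd F y a \<in> V" "Dom P (snd F y a) = fst F y (Dom P a)" "Cod P (snd F y a) = fst F y (Cod P a)"
    using s a R by (auto simp: V_def vertical_def arrow_over_def on_fibre_def)
  fix b assume "b \<in> V" "Cod P b = Dom P a"
  then show "snd F y (a \<cdot> b) = snd F y a \<cdot> snd F y b" using s V_data(1) by blast
qed

lemma V_on_fibre: "a \<in> V \<Longrightarrow> on_fibre R p (Dom P a) \<longleftrightarrow> on_fibre R p (Cod P a)"
  using V_data[of a] by (auto simp: on_fibre_def)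

definition aut_iso :: "'g monoid \<Rightarrow> 'o \<Rightarrow> ('g \<Rightarrow> 'a) \<Rightarrow> bool" where
  "aut_iso \<Gamma> z j \<longleftrightarrow> j \<in> iso \<Gamma> (Aut_grp P z)"

lemma aut_isoD:
  assumes "aut_iso \<Gamma> z j"
  shows "h \<in> carrier \<Gamma> \<Longrightarrow> j h \<in> V" "h \<in> carrier \<Gamma> \<Longrightarrow> Dom P (j h) = z" "h \<in> carrier \<Gamma> \<Longrightarrow> Cod P (j h) = z"
    "g \<in> carrier \<Gamma> \<Longrightarrow> h \<in> carrier \<Gamma> \<Longrightarrow> j (g \<otimes>\<^bsub>\<Gamma>\<^esub> h) = j g \<cdot> j h"
    "g \<in> carrier \<Gamma> \<Longrightarrow> h \<in> carrier \<Gamma> \<Longrightarrow> j g = j h \<Longrightarrow> g = h"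
proof -
  have j: "\<forall>h\<in>carrier \<Gamma>. vertical P z z (j h)" "\<forall>g\<in>carrier \<Gamma>. \<forall>h\<in>carrier \<Gamma>. j (g \<otimes>\<^bsub>\<Gamma>\<^esub> h) = j g \<cdot> j h"
    "inj_on j (carrier \<Gamma>)"
    using assms by (auto simp: aut_iso_def iso_def hom_def Aut_grp_def bij_betw_def)
  then show "h \<in> carrier \<Gamma> \<Longrightarrow> j h \<in> V" "h \<in> carrier \<Gamma> \<Longrightarrow> Dom P (j h) = z" "h \<in> carrier \<Gamma> \<Longrightarrow> Cod P (j h) = z"
    "g \<in> carrier \<Gamma> \<Longrightarrow> h \<in> carrier \<Gamma> \<Longrightarrow> j (g \<otimes>\<^bsub>\<Gamma>\<^esub> h) = j g \<cdot> j h"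
    "g \<in> carrier \<Gamma> \<Longrightarrow> h \<in> carrier \<Gamma> \<Longrightarrow> j g = j h \<Longrightarrow> g = h"
    by (auto simp: vertical_V dest: inj_onD)
qed

lemma aut_iso_surj:
  assumes "aut_iso \<Gamma> z j" "a \<in> V" "Dom P a = z" "Cod P a = z"
  obtains h where "h \<in> carrier \<Gamma>" "a = j h"
proof -
  have "a \<in> carrier (Aut_grp P z)" using assms(2-4) by (simp add: Aut_grp_def vertical_V)
  then show thesis using assms(1) that by (auto simp: aut_iso_def iso_def bij_betw_def)
qed

lemma aut_iso_eqI:
  assumes j: "aut_iso \<Gamma> z j" and g: "g \<in> carrier \<Gamma>" "h \<in> carrier \<Gamma>"
    and b: "b \<in> V" "Cod P b = z" and eq: "j g \<cdot> b = j h \<cdot> b"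
  shows "g = h"
proof -
  have "j g = j h"
    by (rule V_right_cancel[OF aut_isoD(1)[OF j g(1)] aut_isoD(1)[OF j g(2)] b(1)])
      (use aut_isoD[OF j] g b eq in auto)
  then show ?thesis using aut_isoD(5)[OF j] g by blast
qed

text \<open>The common shape of the relations that define \<open>lam\<close>, \<open>m\<close> and
  \<open>r\<close>, and of the action of \<open>kappa\<close> read through
  \<open>del\<close>.\<close>

definition semilinear :: "'g monoid \<Rightarrow> ('g \<Rightarrow> 'a) \<Rightarrow> ('g \<Rightarrow> 'a) \<Rightarrow> ('g \<Rightarrow> 'g) \<Rightarrow> 'a \<Rightarrow> bool" where
  "semilinear \<Gamma> j j' u a \<longleftrightarrow> (\<forall>h\<in>carrier \<Gamma>. u h \<in> carrier \<Gamma> \<and> a \<cdot> j h = j' (u h) \<cdot> a)"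

text \<open>Weaker than \<open>aut_iso\<close>, so that it also covers the image of such an
  identification under \<open>eps\<close> or \<open>kappa\<close>.\<close>

definition endo :: "'g monoid \<Rightarrow> 'o \<Rightarrow> ('g \<Rightarrow> 'a) \<Rightarrow> bool" where
  "endo \<Gamma> z j \<longleftrightarrow> (\<forall>h\<in>carrier \<Gamma>. j h \<in> V \<and> Dom P (j h) = z \<and> Cod P (j h) = z)"

lemma aut_iso_endo: "aut_iso \<Gamma> z j \<Longrightarrow> endo \<Gamma> z j"
  using aut_isoD(1-3)[of \<Gamma> z j] by (simp add: endo_def)

lemma semilinear_comp:
  assumes a: "semilinear \<Gamma> j j' u a" "a \<in> V" and b: "semilinear \<Gamma> j' j'' v b" "b \<in> V" "Dom P b = Cod P a"
    and j: "endo \<Gamma> (Dom P a) j" "endo \<Gamma> (Cod P a) j'" "endo \<Gamma> (Cod P b) j''"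
  shows "semilinear \<Gamma> j j'' (\<lambda>h. v (u h)) (b \<cdot> a)"
  unfolding semilinear_def
proof (intro ballI conjI)
  fix h assume h: "h \<in> carrier \<Gamma>"
  have u: "u h \<in> carrier \<Gamma>" "a \<cdot> j h = j' (u h) \<cdot> a" using a(1) h by (auto simp: semilinear_def)
  then show vu: "v (u h) \<in> carrier \<Gamma>" using b(1) by (auto simp: semilinear_def)
  have v: "b \<cdot> j' (u h) = j'' (v (u h)) \<cdot> b" using b(1) u by (auto simp: semilinear_def)
  note J = j[unfolded endo_def]
  have "(b \<cdot> a) \<cdot> j h = b \<cdot> (j' (u h) \<cdot> a)" using V_assoc[of b a "j h"] a b J h u by simp
  also have "\<dots> = (j'' (v (u h)) \<cdot> b) \<cdot> a" using V_assoc[of b "j' (u h)" a] a b J u v by simp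
  also have "\<dots> = j'' (v (u h)) \<cdot> (b \<cdot> a)" using V_assoc[of "j'' (v (u h))" b a] a b J vu by simp
  finally show "(b \<cdot> a) \<cdot> j h = j'' (v (u h)) \<cdot> (b \<cdot> a)" .
qed

text \<open>Replacing the arrow \<open>a\<close> by \<open>j' g \<cdot> a\<close> conjugates its
  action by \<open>g\<close>. Both sides are coefficients in front of \<open>a\<close> of one and
  the same arrow, and \<open>a\<close> can be cancelled.\<close>

lemma semilinear_compare:
  assumes a: "semilinear \<Gamma> j j' u a" and b: "semilinear \<Gamma> j j' v (j' g \<cdot> a)"
    and aV: "a \<in> V" and j: "endo \<Gamma> (Dom P a) j" and j': "aut_iso \<Gamma> (Cod P a) j'"
    and \<Gamma>: "group \<Gamma>" and g: "g \<in> carrier \<Gamma>" and h: "h \<in> carrier \<Gamma>"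
  shows "v h \<otimes>\<^bsub>\<Gamma>\<^esub> g = g \<otimes>\<^bsub>\<Gamma>\<^esub> u h"
proof -
  interpret group \<Gamma> by fact
  have u: "u h \<in> carrier \<Gamma>" "a \<cdot> j h = j' (u h) \<cdot> a" using a h by (auto simp: semilinear_def)
  have v: "v h \<in> carrier \<Gamma>" "(j' g \<cdot> a) \<cdot> j h = j' (v h) \<cdot> (j' g \<cdot> a)" using b h by (auto simp: semilinear_def)
  note J = j[unfolded endo_def] and J' = aut_isoD[OF j']
  have "j' (v h \<otimes>\<^bsub>\<Gamma>\<^esub> g) \<cdot> a = j' (v h) \<cdot> (j' g \<cdot> a)"
    using V_assoc[of "j' (v h)" "j' g" a] aV J' v g by simp
  also have "\<dots> = j' g \<cdot> (a \<cdot> j h)"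
    unfolding v(2)[symmetric] using V_assoc[of "j' g" a "j h"] aV J J' g h by simp
  also have "\<dots> = j' (g \<otimes>\<^bsub>\<Gamma>\<^esub> u h) \<cdot> a"
    unfolding u(2) using V_assoc[of "j' g" "j' (u h)" a] aV J' u g by simp
  finally show ?thesis
    by (intro aut_iso_eqI[OF j' _ _ aV refl]) (use u v g in auto)
qed

lemma semilinear_functor:
  assumes F: "fibre_functor R p p' Fo Fa" and a: "semilinear \<Gamma> j j' u a" "a \<in> V" "on_fibre R p (Cod P a)"
    and j: "endo \<Gamma> (Dom P a) j" "endo \<Gamma> (Cod P a) j'"
  shows "semilinear \<Gamma> (\<lambda>h. Fa (j h)) (\<lambda>h. Fa (j' h)) u (Fa a)"
  unfolding semilinear_def
proof (intro ballI conjI)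
  fix h assume h: "h \<in> carrier \<Gamma>"
  have u: "u h \<in> carrier \<Gamma>" "a \<cdot> j h = j' (u h) \<cdot> a" using a(1) h by (auto simp: semilinear_def)
  then show "u h \<in> carrier \<Gamma>" by simp
  have "Fa a \<cdot> Fa (j h) = Fa (a \<cdot> j h)"
    using F a j h unfolding fibre_functor_def endo_def by auto
  also have "\<dots> = Fa (j' (u h)) \<cdot> Fa a"
    unfolding u(2) using F a j u unfolding fibre_functor_def endo_def by auto
  finally show "Fa a \<cdot> Fa (j h) = Fa (j' (u h)) \<cdot> Fa a" .
qed

lemma endo_functor:
  assumes "fibre_functor R p p' Fo Fa" "endo \<Gamma> z j" "on_fibre R p z"
  shows "endo \<Gamma> (Fo z) (\<lambda>h. Fa (j h))"
  using assms unfolding fibre_functor_def endo_def by auto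

text \<open>
  Here \<open>g : A \<rightarrow> y\<close>, \<open>g' : A' \<rightarrow> y'\<close>, \<open>k : B \<rightarrow> w\<close>, \<open>k' : B' \<rightarrow> w'\<close> are the trivialising arrows, and
  \<open>E\<phi>, E\<phi>', E\<chi>, E\<chi>'\<close> the images of \<open>\<phi>, \<phi>', \<chi>, \<chi>'\<close> (at the last vertex) under the connection or the
  fake curvature.
\<close>

lemma transition_equation:
  assumes j: "aut_iso \<Gamma> y' j" "endo \<Gamma> w' jw" "endo \<Gamma> y jy" "endo \<Gamma> A' jA" and \<Gamma>: "group \<Gamma>"
    and g: "vertical P A y g" and g': "vertical P A' y' g'" and k: "vertical P B w k" and k': "vertical P B' w' k'"
    and \<phi>: "vertical P w y \<phi>" and \<phi>': "vertical P w' y' \<phi>'" and \<chi>: "vertical P y y' \<chi>" and \<chi>w: "vertical P w w' \<chi>w"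
    and E: "vertical P B A E\<phi>" "vertical P B' A' E\<phi>'" "vertical P A A' E\<chi>" "vertical P B B' E\<chi>w"
    and in_G: "a \<in> carrier \<Gamma>" "ew \<in> carrier \<Gamma>" "t0 \<in> carrier \<Gamma>" "t1 \<in> carrier \<Gamma>" "e \<in> carrier \<Gamma>" "c \<in> carrier \<Gamma>"
    and 1: "g' \<cdot> E\<phi>' = j a \<cdot> (\<phi>' \<cdot> k')" and 2: "k' \<cdot> E\<chi>w = jw ew \<cdot> (\<chi>w \<cdot> k)"
    and 3: "semilinear \<Gamma> jw j l \<phi>'" and 4: "\<phi>' \<cdot> \<chi>w = j t0 \<cdot> (\<chi> \<cdot> \<phi>)"
    and 5: "E\<phi>' \<cdot> E\<chi>w = jA t1 \<cdot> (E\<chi> \<cdot> E\<phi>)" and 6: "semilinear \<Gamma> jA j m g'"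
    and 7: "g' \<cdot> E\<chi> = j e \<cdot> (\<chi> \<cdot> g)" and 8: "g \<cdot> E\<phi> = jy c \<cdot> (\<phi> \<cdot> k)" and 9: "semilinear \<Gamma> jy j r \<chi>"
  shows "a \<otimes>\<^bsub>\<Gamma>\<^esub> (l ew \<otimes>\<^bsub>\<Gamma>\<^esub> t0) = m t1 \<otimes>\<^bsub>\<Gamma>\<^esub> (e \<otimes>\<^bsub>\<Gamma>\<^esub> r c)"
proof -
  interpret group \<Gamma> by fact
  note J = aut_isoD[OF j(1)]
  note ty = g[unfolded vertical_V] g'[unfolded vertical_V] k[unfolded vertical_V] k'[unfolded vertical_V]
    \<phi>[unfolded vertical_V] \<phi>'[unfolded vertical_V] \<chi>[unfolded vertical_V] \<chi>w[unfolded vertical_V]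
    E[unfolded vertical_V] J j(2-)[unfolded endo_def, rule_format]
  have lw: "l ew \<in> carrier \<Gamma>" "\<phi>' \<cdot> jw ew = j (l ew) \<cdot> \<phi>'" using 3 in_G by (auto simp: semilinear_def)
  have m: "m t1 \<in> carrier \<Gamma>" "g' \<cdot> jA t1 = j (m t1) \<cdot> g'" using 6 in_G by (auto simp: semilinear_def)
  have r: "r c \<in> carrier \<Gamma>" "\<chi> \<cdot> jy c = j (r c) \<cdot> \<chi>" using 9 in_G by (auto simp: semilinear_def)
  \<comment> \<open>Both evaluations of the composite of \<open>g'\<close>, \<open>E\<phi>'\<close>
    and \<open>E\<chi>w\<close> take the form of an automorphism after this arrow; cancelling it
    leaves an identity in the group.\<close>
  let ?b = "\<chi> \<cdot> (\<phi> \<cdot> k)"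
  have "(g' \<cdot> E\<phi>') \<cdot> E\<chi>w = j a \<cdot> (\<phi>' \<cdot> (k' \<cdot> E\<chi>w))"
    unfolding 1 using ty in_G by (simp add: V_assoc V_comp)
  also have "\<dots> = j a \<cdot> ((\<phi>' \<cdot> jw ew) \<cdot> (\<chi>w \<cdot> k))"
    unfolding 2 using ty in_G by (simp add: V_assoc V_comp)
  also have "\<dots> = j a \<cdot> (j (l ew) \<cdot> ((\<phi>' \<cdot> \<chi>w) \<cdot> k))"
    unfolding lw(2) using ty in_G lw(1) by (simp add: V_assoc V_comp)
  also have "\<dots> = j (a \<otimes>\<^bsub>\<Gamma>\<^esub> (l ew \<otimes>\<^bsub>\<Gamma>\<^esub> t0)) \<cdot> ?b"
    unfolding 4 using ty in_G lw(1) by (simp add: V_assoc V_comp)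
  finally have L: "(g' \<cdot> E\<phi>') \<cdot> E\<chi>w = j (a \<otimes>\<^bsub>\<Gamma>\<^esub> (l ew \<otimes>\<^bsub>\<Gamma>\<^esub> t0)) \<cdot> ?b" .
  have "(g' \<cdot> E\<phi>') \<cdot> E\<chi>w = g' \<cdot> (E\<phi>' \<cdot> E\<chi>w)" using ty by (simp add: V_assoc)
  also have "\<dots> = (g' \<cdot> jA t1) \<cdot> (E\<chi> \<cdot> E\<phi>)"
    unfolding 5 using ty in_G by (simp add: V_assoc V_comp)
  also have "\<dots> = j (m t1) \<cdot> ((g' \<cdot> E\<chi>) \<cdot> E\<phi>)"
    unfolding m(2) using ty in_G m(1) by (simp add: V_assoc V_comp)
  also have "\<dots> = j (m t1) \<cdot> (j e \<cdot> (\<chi> \<cdot> (g \<cdot> E\<phi>)))"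
    unfolding 7 using ty in_G m(1) by (simp add: V_assoc V_comp)
  also have "\<dots> = j (m t1) \<cdot> (j e \<cdot> ((\<chi> \<cdot> jy c) \<cdot> (\<phi> \<cdot> k)))"
    unfolding 8 using ty in_G m(1) by (simp add: V_assoc V_comp)
  also have "\<dots> = j (m t1 \<otimes>\<^bsub>\<Gamma>\<^esub> (e \<otimes>\<^bsub>\<Gamma>\<^esub> r c)) \<cdot> ?b"
    unfolding r(2) using ty in_G m(1) r(1) by (simp add: V_assoc V_comp)
  finally have "j (a \<otimes>\<^bsub>\<Gamma>\<^esub> (l ew \<otimes>\<^bsub>\<Gamma>\<^esub> t0)) \<cdot> ?b = j (m t1 \<otimes>\<^bsub>\<Gamma>\<^esub> (e \<otimes>\<^bsub>\<Gamma>\<^esub> r c)) \<cdot> ?b"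
    unfolding L .
  then show ?thesis
    by (intro aut_iso_eqI[OF j(1)]) (use ty in_G lw(1) m(1) r(1) in \<open>simp_all add: V_comp\<close>)
qed

text \<open>
  \<open>u01\<close>, \<open>u12\<close>, \<open>u02\<close> are the trivialising arrows, \<open>Eu12\<close> is the image of \<open>u12\<close> under \<open>\<epsilon>\<^sub>0\<^sub>1\<close>,
  and \<open>ku02\<close> that of \<open>u02\<close> under \<open>\<kappa>\<close>; primes refer to the second choice.
\<close>

lemma curving_equation:
  assumes j: "aut_iso \<Gamma> y' j" "endo \<Gamma> y jy" "endo \<Gamma> A' jA" "endo \<Gamma> B' jB" and \<Gamma>: "group \<Gamma>"
    and u: "vertical P A y u01" "vertical P A' y' u01'" "vertical P C A Eu12" "vertical P C' A' Eu12'"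
    and d: "vertical P B y d" "vertical P B' y' d'" "vertical P D B ku02" "vertical P D' B' ku02'"
    and K: "vertical P C D K" "vertical P C' D' K'"
    and \<chi>: "vertical P y y' \<chi>" "vertical P A A' E\<chi>" "vertical P C C' EE\<chi>" "vertical P B B' k\<chi>" "vertical P D D' kE\<chi>"
    and in_G: "e01 \<in> carrier \<Gamma>" "e12 \<in> carrier \<Gamma>" "e02 \<in> carrier \<Gamma>" "n \<in> carrier \<Gamma>" "b \<in> carrier \<Gamma>" "b' \<in> carrier \<Gamma>"
    and 1: "u01' \<cdot> E\<chi> = j e01 \<cdot> (\<chi> \<cdot> u01)" and 2: "Eu12' \<cdot> EE\<chi> = jA e12 \<cdot> (E\<chi> \<cdot> Eu12)"
    and 3: "ku02' \<cdot> kE\<chi> = jB e02 \<cdot> (k\<chi> \<cdot> ku02)" and 4: "d' \<cdot> k\<chi> = j n \<cdot> (\<chi> \<cdot> d)"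
    and 5: "u01 \<cdot> Eu12 = jy b \<cdot> (d \<cdot> (ku02 \<cdot> K))" and 6: "u01' \<cdot> Eu12' = j b' \<cdot> (d' \<cdot> (ku02' \<cdot> K'))"
    and 7: "K' \<cdot> EE\<chi> = kE\<chi> \<cdot> K" and 8: "semilinear \<Gamma> jA j m u01'" and 9: "semilinear \<Gamma> jB j k d'"
    and 10: "semilinear \<Gamma> jy j r \<chi>"
  shows "b' \<otimes>\<^bsub>\<Gamma>\<^esub> (k e02 \<otimes>\<^bsub>\<Gamma>\<^esub> n) = m e12 \<otimes>\<^bsub>\<Gamma>\<^esub> (e01 \<otimes>\<^bsub>\<Gamma>\<^esub> r b)"
proof -
  interpret group \<Gamma> by fact
  note J = aut_isoD[OF j(1)]
  note ty = u[unfolded vertical_V] d[unfolded vertical_V] K[unfolded vertical_V] \<chi>[unfolded vertical_V]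
    J j(2-)[unfolded endo_def, rule_format]
  have m: "m e12 \<in> carrier \<Gamma>" "u01' \<cdot> jA e12 = j (m e12) \<cdot> u01'" using 8 in_G by (auto simp: semilinear_def)
  have k: "k e02 \<in> carrier \<Gamma>" "d' \<cdot> jB e02 = j (k e02) \<cdot> d'" using 9 in_G by (auto simp: semilinear_def)
  have r: "r b \<in> carrier \<Gamma>" "\<chi> \<cdot> jy b = j (r b) \<cdot> \<chi>" using 10 in_G by (auto simp: semilinear_def)
  \<comment> \<open>The arrow common to the two evaluations. Assumption 7, the naturality of
    \<open>K\<close> along \<open>\<chi>\<close>, links the side built from \<open>eps\<close> twice
    with the side built from \<open>kappa\<close> and \<open>eps\<close>.\<close>
  let ?b = "\<chi> \<cdot> (d \<cdot> (ku02 \<cdot> K))"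
  have "(u01' \<cdot> Eu12') \<cdot> EE\<chi> = u01' \<cdot> (Eu12' \<cdot> EE\<chi>)" using ty by (simp add: V_assoc)
  also have "\<dots> = (u01' \<cdot> jA e12) \<cdot> (E\<chi> \<cdot> Eu12)"
    unfolding 2 using ty in_G by (simp add: V_assoc V_comp)
  also have "\<dots> = j (m e12) \<cdot> ((u01' \<cdot> E\<chi>) \<cdot> Eu12)"
    unfolding m(2) using ty in_G m(1) by (simp add: V_assoc V_comp)
  also have "\<dots> = j (m e12) \<cdot> (j e01 \<cdot> (\<chi> \<cdot> (u01 \<cdot> Eu12)))"
    unfolding 1 using ty in_G m(1) by (simp add: V_assoc V_comp)
  also have "\<dots> = j (m e12) \<cdot> (j e01 \<cdot> ((\<chi> \<cdot> jy b) \<cdot> (d \<cdot> (ku02 \<cdot> K))))"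
    unfolding 5 using ty in_G m(1) by (simp add: V_assoc V_comp)
  also have "\<dots> = j (m e12 \<otimes>\<^bsub>\<Gamma>\<^esub> (e01 \<otimes>\<^bsub>\<Gamma>\<^esub> r b)) \<cdot> ?b"
    unfolding r(2) using ty in_G m(1) r(1) by (simp add: V_assoc V_comp)
  finally have L: "(u01' \<cdot> Eu12') \<cdot> EE\<chi> = j (m e12 \<otimes>\<^bsub>\<Gamma>\<^esub> (e01 \<otimes>\<^bsub>\<Gamma>\<^esub> r b)) \<cdot> ?b" .
  have "(u01' \<cdot> Eu12') \<cdot> EE\<chi> = j b' \<cdot> (d' \<cdot> (ku02' \<cdot> (K' \<cdot> EE\<chi>)))"
    unfolding 6 using ty in_G by (simp add: V_assoc V_comp)
  also have "\<dots> = j b' \<cdot> (d' \<cdot> ((ku02' \<cdot> kE\<chi>) \<cdot> K))"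
    unfolding 7 using ty in_G by (simp add: V_assoc V_comp)
  also have "\<dots> = j b' \<cdot> ((d' \<cdot> jB e02) \<cdot> (k\<chi> \<cdot> (ku02 \<cdot> K)))"
    unfolding 3 using ty in_G by (simp add: V_assoc V_comp)
  also have "\<dots> = j b' \<cdot> (j (k e02) \<cdot> ((d' \<cdot> k\<chi>) \<cdot> (ku02 \<cdot> K)))"
    unfolding k(2) using ty in_G k(1) by (simp add: V_assoc V_comp)
  also have "\<dots> = j (b' \<otimes>\<^bsub>\<Gamma>\<^esub> (k e02 \<otimes>\<^bsub>\<Gamma>\<^esub> n)) \<cdot> ?b"
    unfolding 4 using ty in_G k(1) by (simp add: V_assoc V_comp)
  finally have "j (b' \<otimes>\<^bsub>\<Gamma>\<^esub> (k e02 \<otimes>\<^bsub>\<Gamma>\<^esub> n)) \<cdot> ?b = j (m e12 \<otimes>\<^bsub>\<Gamma>\<^esub> (e01 \<otimes>\<^bsub>\<Gamma>\<^esub> r b)) \<cdot> ?b"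
    unfolding L by simp
  then show ?thesis
    by (intro aut_iso_eqI[OF j(1)]) (use ty in_G k(1) m(1) r(1) in \<open>simp_all add: V_comp\<close>)
qed

end

section \<open>Frames and their comparison\<close>

locale curved_gerbe = group_scheme_over S X G + fibred_groupoids X P
  for S :: "('u, 's) psh" and X :: "('u, 'x, 's) over_sch" and G :: "('u, 'g, 's) group_sch"
    and P :: "('u, 'x, 'o, 'a) fibcat" +
  fixes eps :: "('x list, 'o, 'a) fmor" and eta :: "'x \<Rightarrow> 'o \<Rightarrow> 'a"
    and K :: "'x list \<Rightarrow> 'o \<Rightarrow> 'a" and kappa :: "('x list, 'o, 'a) fmor" and tau :: "'x list \<Rightarrow> 'o \<Rightarrow> 'a"
  assumes connection: "connection X P eps eta" and curving: "curving X P eps eta K kappa tau"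
begin

lemma pts_nearby: "subfunctor X U \<Longrightarrow> cring R \<Longrightarrow> nearby U R s A \<Longrightarrow> nearby (pts X) R s A"
  using subfunctor_pts[of X U R] unfolding nearby_def by blast

lemma eps_functor:
  assumes R: "cring R" and A: "nearby (pts X) R s {x, y}"
  shows "fibre_functor R y x (fst eps [x, y]) (snd eps [x, y])"
proof -
  have s: "stack_mor P (simplex X 1 (pts X)) (\<lambda>xs. xs ! 1) (\<lambda>xs. xs ! 0) eps"
    using connection by (simp add: connection_def stack_equiv_def)
  have xs: "[x, y] \<in> pts (simplex X 1 (pts X)) R" by (rule simplex_nearby[OF A]) simp_all
  have "x \<in> pts X R" "y \<in> pts X R" using A by (auto simp: nearby_def)
  then have "res (simplex X 1 (pts X)) R R (idhom R) [x, y] = [x, y]"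
    using psh_id[OF X_psh R] by (simp add: simplex_def)
  from stack_mor_fibre_functor[OF s xs this] show ?thesis by simp
qed

lemma kappa_functor:
  assumes R: "cring R" and A: "nearby (pts X) R s {x, y, z}"
  shows "fibre_functor R x x (fst kappa [x, y, z]) (snd kappa [x, y, z])"
proof -
  have s: "stack_mor P (simplex X 2 (pts X)) (\<lambda>xs. xs ! 0) (\<lambda>xs. xs ! 0) kappa"
    using curving by (simp add: curving_def)
  have xs: "[x, y, z] \<in> pts (simplex X 2 (pts X)) R" by (rule simplex_nearby[OF A]) simp_all
  have "x \<in> pts X R" "y \<in> pts X R" "z \<in> pts X R" using A by (auto simp: nearby_def)
  then have "res (simplex X 2 (pts X)) R R (idhom R) [x, y, z] = [x, y, z]"
    using psh_id[OF X_psh R] by (simp add: simplex_def)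
  from stack_mor_fibre_functor[OF s xs this] show ?thesis by simp
qed

lemma K_natural:
  assumes R: "cring R" and A: "nearby (pts X) R s {x, y, z}"
  shows "on_fibre R z c \<Longrightarrow> vertical P (fst eps [x, y] (fst eps [y, z] c))
      (fst kappa [x, y, z] (fst eps [x, z] c)) (K [x, y, z] c)"
    "a \<in> V \<Longrightarrow> on_fibre R z (Cod P a) \<Longrightarrow>
      K [x, y, z] (Cod P a) \<cdot> snd eps [x, y] (snd eps [y, z] a) =
      snd kappa [x, y, z] (snd eps [x, z] a) \<cdot> K [x, y, z] (Dom P a)"
proof -
  have s: "nat_iso P (simplex X 2 (pts X)) (\<lambda>xs. xs ! 2)
       (mor_comp (eps_ab eps 0 1) (eps_ab eps 1 2)) (mor_comp kappa (eps_ab eps 0 2)) K"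
    using curving by (simp add: curving_def)
  have xs: "[x, y, z] \<in> pts (simplex X 2 (pts X)) R" by (rule simplex_nearby[OF A]) simp_all
  have p: "x \<in> pts X R" "y \<in> pts X R" "z \<in> pts X R" using A by (auto simp: nearby_def)
  show "vertical P (fst eps [x, y] (fst eps [y, z] c)) (fst kappa [x, y, z] (fst eps [x, z] c)) (K [x, y, z] c)"
    if "on_fibre R z c"
  proof -
    have c: "c \<in> Obj P" "[x, y, z] \<in> pts (simplex X 2 (pts X)) (Rng P c)" "[x, y, z] ! 2 = Pt P c"
      using that xs by (auto simp: on_fibre_def)
    show ?thesis
      using s[unfolded nat_iso_def, THEN conjunct1, THEN bspec, OF c(1), THEN bspec, OF c(2), THEN mp, OF c(3)]
      by (simp add: mor_comp_def eps_ab_def mor_pull_def)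
  qed
  assume a: "a \<in> V" and f: "on_fibre R z (Cod P a)"
  have r: "res (simplex X 2 (pts X)) R R (idhom R) [x, y, z] = [x, y, z]"
    using p psh_id[OF X_psh R] by (simp add: simplex_def)
  note a' = V_data[OF a]
  have Ra: "Rng P (Cod P a) = R" "Pt P (Cod P a) = z" using f by (auto simp: on_fibre_def)
  have "Comp P (K [x, y, z] (Cod P a)) (snd (mor_comp (eps_ab eps 0 1) (eps_ab eps 1 2)) [x, y, z] a) =
      Comp P (snd (mor_comp kappa (eps_ab eps 0 2)) [x, y, z] a)
        (K (res (simplex X 2 (pts X)) (Rng P (Cod P a)) (Rng P (Dom P a)) (Rhom P a) [x, y, z]) (Dom P a))"
    using s a'(1) xs Ra unfolding nat_iso_def by auto
  then show "K [x, y, z] (Cod P a) \<cdot> snd eps [x, y] (snd eps [y, z] a) =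
      snd kappa [x, y, z] (snd eps [x, z] a) \<cdot> K [x, y, z] (Dom P a)"
    using a' Ra r by (simp add: mor_comp_def eps_ab_def mor_pull_def)
qed

lemma functor_V:
  assumes "fibre_functor R p p' Fo Fa" "vertical P z y a" "on_fibre R p y"
  shows "vertical P (Fo z) (Fo y) (Fa a)"
  using assms unfolding fibre_functor_def vertical_V by auto

lemma functor_comp:
  assumes "fibre_functor R p p' Fo Fa" "vertical P z y a" "vertical P w z b" "on_fibre R p y"
  shows "Fa (a \<cdot> b) = Fa a \<cdot> Fa b"
  using assms unfolding fibre_functor_def vertical_V by auto

lemma functor_fibre: "fibre_functor R p p' Fo Fa \<Longrightarrow> on_fibre R p z \<Longrightarrow> on_fibre R p' (Fo z)"
  by (simp add: fibre_functor_def)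

text \<open>All choices over one open set together with the forms that they determine. An overlap
  then carries frames of both indices, and a change of index is treated by the same lemmas as a
  change of choices.\<close>

definition frame ::
  "('u ring \<Rightarrow> 'x set) \<Rightarrow> ('u ring \<Rightarrow> 'x \<Rightarrow> 'o) \<Rightarrow> ('u ring \<Rightarrow> 'x \<Rightarrow> 'g \<Rightarrow> 'a) \<Rightarrow> ('u ring \<Rightarrow> 'x list \<Rightarrow> 'a) \<Rightarrow>
   ('u ring \<Rightarrow> 'x list \<Rightarrow> 'a) \<Rightarrow> ('u ring \<Rightarrow> 'x list \<Rightarrow> 'g \<Rightarrow> 'g) \<Rightarrow> ('u ring \<Rightarrow> 'x list \<Rightarrow> 'g) \<Rightarrow> bool" where
  "frame U ob j gam del m B \<longleftrightarrow>
     (\<forall>R. cring R \<longrightarrow> (\<forall>p\<in>U R. on_fibre R p (ob R p) \<and> aut_iso (Gam R (str X R p)) (ob R p) (j R p))) \<and>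
     Aut_form X G 1 U m \<and> G_form X G 2 U B \<and>
     (\<forall>R. cring R \<longrightarrow> (\<forall>xs\<in>pts (simplex X 1 U) R.
        vertical P (fst eps xs (ob R (xs ! 1))) (ob R (xs ! 0)) (gam R xs) \<and>
        (\<forall>h\<in>carrier (Gam R (str X R (xs ! 1))).
           gam R xs \<cdot> snd eps xs (j R (xs ! 1) h) = j R (xs ! 0) (m R xs h) \<cdot> gam R xs))) \<and>
     (\<forall>R. cring R \<longrightarrow> (\<forall>xs\<in>pts (simplex X 2 U) R.
        vertical P (fst kappa xs (ob R (xs ! 0))) (ob R (xs ! 0)) (del R xs) \<and>
        gam R [xs ! 0, xs ! 1] \<cdot> snd eps [xs ! 0, xs ! 1] (gam R [xs ! 1, xs ! 2]) =
        j R (xs ! 0) (B R xs) \<cdot> del R xs \<cdot> snd kappa xs (gam R [xs ! 0, xs ! 2]) \<cdot> K xs (ob R (xs ! 2))))"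

lemma G_form_subset:
  assumes "G_form X G n U w" "\<And>R. cring R \<Longrightarrow> U' R \<subseteq> U R"
  shows "G_form X G n U' w"
proof -
  have "pts (simplex X n U') R \<subseteq> pts (simplex X n U) R" if "cring R" for R
    using assms(2)[OF that] by (auto simp: simplex_def)
  moreover have "res (simplex X n U') = res (simplex X n U)" by (simp add: simplex_def)
  ultimately show ?thesis
    using assms(1) unfolding G_form_def G_section_def vanishes_on_degenerate_def degen_simplex_def
    by (auto simp: subset_iff)
qed

lemma Aut_form_subset:
  assumes "Aut_form X G n U w" "\<And>R. cring R \<Longrightarrow> U' R \<subseteq> U R"
  shows "Aut_form X G n U' w"
proof -
  have "pts (simplex X n U') R \<subseteq> pts (simplex X n U) R" if "cring R" for R
    using assms(2)[OF that] by (auto simp: simplex_def)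
  moreover have "res (simplex X n U') = res (simplex X n U)" by (simp add: simplex_def)
  ultimately show ?thesis
    using assms(1) unfolding Aut_form_def Aut_section_def vanishes_on_degenerate_def degen_simplex_def
    by (auto simp: subset_iff)
qed

lemma frame_subset:
  assumes F: "frame U ob j gam del m B" and U': "\<And>R. cring R \<Longrightarrow> U' R \<subseteq> U R"
  shows "frame U' ob j gam del m B"
proof -
  have "pts (simplex X n U') R \<subseteq> pts (simplex X n U) R" if "cring R" for R n
    using U'[OF that] by (auto simp: simplex_def)
  then show ?thesis
    using F U' G_form_subset[of 2 U B U'] Aut_form_subset[of 1 U m U'] unfolding frame_def by (auto simp: subset_iff)
qed

lemma frameD:
  assumes F: "frame U ob j gam del m B" and R: "cring R"
  shows "p \<in> U R \<Longrightarrow> on_fibre R p (ob R p)" "p \<in> U R \<Longrightarrow> aut_iso (Gam R (str X R p)) (ob R p) (j R p)"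
    "Aut_form X G 1 U m" "G_form X G 2 U B"
    "nearby U R s {x, y} \<Longrightarrow> vertical P (fst eps [x, y] (ob R y)) (ob R x) (gam R [x, y])"
    "nearby U R s {x, y} \<Longrightarrow> semilinear (Gam R s) (\<lambda>h. snd eps [x, y] (j R y h)) (j R x) (m R [x, y]) (gam R [x, y])"
    "nearby U R s {x, y, z} \<Longrightarrow> vertical P (fst kappa [x, y, z] (ob R x)) (ob R x) (del R [x, y, z])"
    "nearby U R s {x, y, z} \<Longrightarrow> gam R [x, y] \<cdot> snd eps [x, y] (gam R [y, z]) =
        j R x (B R [x, y, z]) \<cdot> del R [x, y, z] \<cdot> snd kappa [x, y, z] (gam R [x, z]) \<cdot> K [x, y, z] (ob R z)"
proof -
  show "p \<in> U R \<Longrightarrow> on_fibre R p (ob R p)" "p \<in> U R \<Longrightarrow> aut_iso (Gam R (str X R p)) (ob R p) (j R p)"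
    "Aut_form X G 1 U m" "G_form X G 2 U B"
    using F R by (auto simp: frame_def)
  then have m: "Aut_form X G 1 U m" by simp
  show "vertical P (fst eps [x, y] (ob R y)) (ob R x) (gam R [x, y])"
    "semilinear (Gam R s) (\<lambda>h. snd eps [x, y] (j R y h)) (j R x) (m R [x, y]) (gam R [x, y])"
    if A: "nearby U R s {x, y}"
  proof -
    have xs: "[x, y] \<in> pts (simplex X 1 U) R" by (rule simplex_nearby[OF A]) simp_all
    have sy: "str X R y = s" using A by (simp add: nearby_def)
    have *: "vertical P (fst eps [x, y] (ob R ([x, y] ! 1))) (ob R ([x, y] ! 0)) (gam R [x, y]) \<and>
        (\<forall>h\<in>carrier (Gam R (str X R ([x, y] ! 1))).
           gam R [x, y] \<cdot> snd eps [x, y] (j R ([x, y] ! 1) h) = j R ([x, y] ! 0) (m R [x, y] h) \<cdot> gam R [x, y])"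
      using F R xs unfolding frame_def by blast
    then show "vertical P (fst eps [x, y] (ob R y)) (ob R x) (gam R [x, y])" by simp
    have "m R [x, y] h \<in> carrier (Gam R s)" if "h \<in> carrier (Gam R s)" for h
      using Aut_form_value(1)[OF m R A, of "[x, y]"] that by (auto simp: AutoGroup_carrier bij_betw_def)
    then show "semilinear (Gam R s) (\<lambda>h. snd eps [x, y] (j R y h)) (j R x) (m R [x, y]) (gam R [x, y])"
      using * sy by (simp add: semilinear_def)
  qed
  show "vertical P (fst kappa [x, y, z] (ob R x)) (ob R x) (del R [x, y, z])"
    "gam R [x, y] \<cdot> snd eps [x, y] (gam R [y, z]) =
        j R x (B R [x, y, z]) \<cdot> del R [x, y, z] \<cdot> snd kappa [x, y, z] (gam R [x, z]) \<cdot> K [x, y, z] (ob R z)"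
    if A: "nearby U R s {x, y, z}"
  proof -
    have xs: "[x, y, z] \<in> pts (simplex X 2 U) R" by (rule simplex_nearby[OF A]) simp_all
    have "vertical P (fst kappa [x, y, z] (ob R ([x, y, z] ! 0))) (ob R ([x, y, z] ! 0)) (del R [x, y, z]) \<and>
        gam R [[x, y, z] ! 0, [x, y, z] ! 1] \<cdot> snd eps [[x, y, z] ! 0, [x, y, z] ! 1] (gam R [[x, y, z] ! 1, [x, y, z] ! 2]) =
        j R ([x, y, z] ! 0) (B R [x, y, z]) \<cdot> del R [x, y, z] \<cdot> snd kappa [x, y, z] (gam R [[x, y, z] ! 0, [x, y, z] ! 2]) \<cdot>
          K [x, y, z] (ob R ([x, y, z] ! 2))"
      using F R xs unfolding frame_def by blast
    then show "vertical P (fst kappa [x, y, z] (ob R x)) (ob R x) (del R [x, y, z])"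
      "gam R [x, y] \<cdot> snd eps [x, y] (gam R [y, z]) =
        j R x (B R [x, y, z]) \<cdot> del R [x, y, z] \<cdot> snd kappa [x, y, z] (gam R [x, z]) \<cdot> K [x, y, z] (ob R z)"
      by simp_all
  qed
qed

definition fake_curvature ::
  "('u ring \<Rightarrow> 'x list \<Rightarrow> 'g \<Rightarrow> 'g) \<Rightarrow> ('u ring \<Rightarrow> 'x list \<Rightarrow> 'g) \<Rightarrow> 'u ring \<Rightarrow> 's \<Rightarrow> 'x \<Rightarrow> 'x \<Rightarrow> 'x \<Rightarrow> 'g \<Rightarrow> 'g" where
  "fake_curvature m B R s x y z =
     m R [x, y] \<otimes>\<^bsub>AutoGroup (Gam R s)\<^esub> m R [y, z] \<otimes>\<^bsub>AutoGroup (Gam R s)\<^esub> m R [z, x] \<otimes>\<^bsub>AutoGroup (Gam R s)\<^esub>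
       inv\<^bsub>AutoGroup (Gam R s)\<^esub> (group.inner (Gam R s) (B R [x, y, z]))"

text \<open>The loop of \<open>m\<close> and conjugation by \<open>B\<close> are each small along
  all three edges; for the outer edge \<open>x z\<close> this rests on the alternation
  results.\<close>

lemma fake_curvature_NT:
  assumes U: "infinitesimally_stable X U" and R: "cring R" and s: "s \<in> pts S R"
    and m: "Aut_form X G 1 U m" and B: "G_form X G 2 U B" and A: "nearby U R s {x, y, z}"
  shows "fake_curvature m B R s x y z \<in> NT R s x y" "fake_curvature m B R s x y z \<in> NT R s y z"
    "fake_curvature m B R s x y z \<in> NT R s x z"
  unfolding fake_curvature_def
  by (intro NT_mult[OF R s] NT_inv[OF R s] NT_inner[OF R s] curvature_NT[OF U R s m A]
      form_two_kern[OF U R s B A])+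

text \<open>Let \<open>F\<close> be the loop of \<open>m\<close> around the triangle. Composed with
  \<open>m(x, z)\<close> it gives \<open>m(x, y) m(y, z)\<close>, because \<open>m(z, x)\<close>
  undoes \<open>m(x, z)\<close>; and \<open>F\<close> fixes \<open>B\<close>, an element of an edge
  kernel. What remains is conjugation by \<open>B\<close>.\<close>

lemma fake_curvature_apply:
  assumes U: "infinitesimally_stable X U" and R: "cring R" and s: "s \<in> pts S R"
    and m: "Aut_form X G 1 U m" and B: "G_form X G 2 U B" and A: "nearby U R s {x, y, z}"
    and h: "h \<in> carrier (Gam R s)"
  shows "m R [x, y] (m R [y, z] h) \<otimes>\<^bsub>Gam R s\<^esub> B R [x, y, z] =
    B R [x, y, z] \<otimes>\<^bsub>Gam R s\<^esub> fake_curvature m B R s x y z (m R [x, z] h)"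
proof -
  interpret group "Gam R s" by (rule Gam_group[OF R s])
  interpret A: group Aut by (rule Aut_group)
  let ?b = "B R [x, y, z]"
  have mc: "m R [u, v] \<in> carrier Aut" if "u \<in> {x, y, z}" "v \<in> {x, y, z}" for u v
    using Aut_form_value(1)[OF m R A, of "[u, v]"] that by simp
  define F where "F = m R [x, y] \<otimes>\<^bsub>Aut\<^esub> m R [y, z] \<otimes>\<^bsub>Aut\<^esub> m R [z, x]"
  have F: "F \<in> NT R s x y" "F \<in> carrier Aut"
    using curvature_NT(1)[OF U R s m A] mc by (simp_all add: F_def)
  have bk: "?b \<in> kern R s x y" by (rule form_two_kern(1)[OF U R s B A])
  have b: "?b \<in> carrier (Gam R s)" by (rule kern_closed[OF R s bk])
  have xy: "near X R x y" using A by (simp add: nearby_def)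
  have Fb: "F ?b = ?b" by (rule NT_fixes[OF R s xy F(1) bk])
  have mh: "m R [x, z] h \<in> carrier (Gam R s)" "m R [y, z] h \<in> carrier (Gam R s)"
    using Aut_closed[OF mc h] by simp_all
  have ret: "m R [z, x] (m R [x, z] h) = h"
    by (rule Aut_form_one_return[OF U R s m nearby_mono[OF A] h]) auto
  have Fm: "F (m R [x, z] h) = m R [x, y] (m R [y, z] h)"
    unfolding F_def using mc mh h ret by (simp add: Aut_comp Aut_closed)
  have ib: "inner ?b \<in> carrier Aut" by (rule inner_Aut[OF b])
  define k where "k = (inv\<^bsub>Aut\<^esub> inner ?b) (m R [x, z] h)"
  have kc: "k \<in> carrier (Gam R s)" unfolding k_def using Aut_closed[OF A.inv_closed[OF ib] mh(1)] .
  have "inner ?b k = m R [x, z] h" unfolding k_def by (rule Aut_inv_apply(1)[OF ib mh(1)])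
  then have mk: "m R [x, z] h = ?b \<otimes>\<^bsub>Gam R s\<^esub> k \<otimes>\<^bsub>Gam R s\<^esub> inv\<^bsub>Gam R s\<^esub> ?b" using kc by (simp add: inner_apply)
  have "fake_curvature m B R s x y z (m R [x, z] h) = F k"
    unfolding fake_curvature_def F_def[symmetric] k_def using F ib mh by (simp add: Aut_comp)
  moreover have "F (m R [x, z] h) = ?b \<otimes>\<^bsub>Gam R s\<^esub> F k \<otimes>\<^bsub>Gam R s\<^esub> inv\<^bsub>Gam R s\<^esub> ?b"
    unfolding mk using b kc F(2) Fb by (simp add: Aut_mult Aut_map_inv)
  ultimately show ?thesis
    unfolding Fm[symmetric] using b Aut_closed[OF F(2) kc] by (simp add: m_assoc)
qed

text \<open>Read through \<open>\<delta>\<close>, the action of \<open>\<kappa>\<close> on automorphisms is the form \<open>\<nu>\<close>.\<close>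

lemma fake_curvature_semilinear:
  assumes U: "infinitesimally_stable X U" and F: "frame U ob j gam del m B"
    and R: "cring R" and s: "s \<in> pts S R" and A: "nearby U R s {x, y, z}"
  shows "semilinear (Gam R s) (\<lambda>h. snd kappa [x, y, z] (j R x h)) (j R x)
    (fake_curvature m B R s x y z) (del R [x, y, z])"
proof -
  interpret group "Gam R s" by (rule Gam_group[OF R s])
  have sub: "subfunctor X U" using U by (simp add: infinitesimally_stable_def)
  note A' = pts_nearby[OF sub R A]
  have A2: "nearby U R s {u, v}" "nearby (pts X) R s {u, v}" if "u \<in> {x, y, z}" "v \<in> {x, y, z}" for u v
    using nearby_mono[OF A, of "{u, v}"] nearby_mono[OF A', of "{u, v}"] that by auto
  have p: "x \<in> U R" "y \<in> U R" "z \<in> U R" and st: "str X R x = s" "str X R y = s" "str X R z = s"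
    using A by (auto simp: nearby_def)
  note fr = frameD[OF F R]
  note m = fr(3) and B = fr(4)
  have j: "aut_iso (Gam R s) (ob R x) (j R x)" "aut_iso (Gam R s) (ob R y) (j R y)" "aut_iso (Gam R s) (ob R z) (j R z)"
    using fr(2)[OF p(1)] fr(2)[OF p(2)] fr(2)[OF p(3)] st by simp_all
  note je = j[THEN aut_iso_endo]
  note fib = fr(1)[OF p(1)] fr(1)[OF p(2)] fr(1)[OF p(3)]
  have exy: "fibre_functor R y x (fst eps [x, y]) (snd eps [x, y])"
    and eyz: "fibre_functor R z y (fst eps [y, z]) (snd eps [y, z])"
    and exz: "fibre_functor R z x (fst eps [x, z]) (snd eps [x, z])"
    by (rule eps_functor[OF R A2(2)]; simp)+
  note ka = kappa_functor[OF R A']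
  have gxy: "vertical P (fst eps [x, y] (ob R y)) (ob R x) (gam R [x, y])"
    "semilinear (Gam R s) (\<lambda>h. snd eps [x, y] (j R y h)) (j R x) (m R [x, y]) (gam R [x, y])"
    and gyz: "vertical P (fst eps [y, z] (ob R z)) (ob R y) (gam R [y, z])"
    "semilinear (Gam R s) (\<lambda>h. snd eps [y, z] (j R z h)) (j R y) (m R [y, z]) (gam R [y, z])"
    and gxz: "vertical P (fst eps [x, z] (ob R z)) (ob R x) (gam R [x, z])"
    "semilinear (Gam R s) (\<lambda>h. snd eps [x, z] (j R z h)) (j R x) (m R [x, z]) (gam R [x, z])"
    using fr(5,6)[OF A2(1)] by simp_all
  note d = fr(7)[OF A] and curv = fr(8)[OF A]
  note Kt = K_natural(1)[OF R A' fib(3)]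
  note e_yz = endo_functor[OF eyz je(3) fib(3)]
  note f_yz = functor_fibre[OF eyz fib(3)]
  note e_xyz = endo_functor[OF exy e_yz f_yz]
  note e_xz = endo_functor[OF exz je(3) fib(3)]
  note f_xz = functor_fibre[OF exz fib(3)]
  note e_kxz = endo_functor[OF ka e_xz f_xz]
  note e_kx = endo_functor[OF ka je(1) fib(1)]
  note e_xy = endo_functor[OF exy je(2) fib(2)]
  have Eg: "vertical P (fst eps [x, y] (fst eps [y, z] (ob R z))) (fst eps [x, y] (ob R y)) (snd eps [x, y] (gam R [y, z]))"
    by (rule functor_V[OF exy gyz(1) fib(2)])
  have kg: "vertical P (fst kappa [x, y, z] (fst eps [x, z] (ob R z))) (fst kappa [x, y, z] (ob R x))
      (snd kappa [x, y, z] (gam R [x, z]))"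
    by (rule functor_V[OF ka gxz(1) fib(1)])
  note ty = gxy(1)[unfolded vertical_V] gyz(1)[unfolded vertical_V] gxz(1)[unfolded vertical_V] d[unfolded vertical_V]
    Kt[unfolded vertical_V] Eg[unfolded vertical_V] kg[unfolded vertical_V]
  have sE: "semilinear (Gam R s) (\<lambda>h. snd eps [x, y] (snd eps [y, z] (j R z h))) (\<lambda>h. snd eps [x, y] (j R y h))
      (m R [y, z]) (snd eps [x, y] (gam R [y, z]))"
    by (rule semilinear_functor[OF exy gyz(2)]) (use ty fib e_yz je in auto)
  have L: "semilinear (Gam R s) (\<lambda>h. snd eps [x, y] (snd eps [y, z] (j R z h))) (j R x)
      (\<lambda>h. m R [x, y] (m R [y, z] h)) (gam R [x, y] \<cdot> snd eps [x, y] (gam R [y, z]))"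
    by (rule semilinear_comp[OF sE _ gxy(2)]) (use ty e_xyz e_xy je in auto)
  \<comment> \<open>Through \<open>del\<close> the functor \<open>kappa\<close> acts on
    \<open>G\<close> by some map \<open>k\<close>, since \<open>j\<close> is onto the automorphisms
    of the object. Comparing the actions of both sides of the curving relation then identifies
    \<open>k\<close> with the fake curvature.\<close>
  define k where "k = (\<lambda>h. SOME g. g \<in> carrier (Gam R s) \<and>
    del R [x, y, z] \<cdot> snd kappa [x, y, z] (j R x h) = j R x g \<cdot> del R [x, y, z])"
  have sk: "semilinear (Gam R s) (\<lambda>h. snd kappa [x, y, z] (j R x h)) (j R x) k (del R [x, y, z])"
    unfolding semilinear_def
  proof
    fix h assume h: "h \<in> carrier (Gam R s)"
    let ?d = "del R [x, y, z]" and ?a = "snd kappa [x, y, z] (j R x h)"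
    have a: "?a \<in> V" "Dom P ?a = fst kappa [x, y, z] (ob R x)" "Cod P ?a = fst kappa [x, y, z] (ob R x)"
      using e_kx h by (auto simp: endo_def)
    obtain c where c: "c \<in> V" "Dom P c = Cod P ?d" "Cod P c = Dom P ?d" "?d \<cdot> c = Ident P (Cod P ?d)"
      using V_inverse[of ?d] ty by blast
    have "\<exists>g. g \<in> carrier (Gam R s) \<and> ?d \<cdot> ?a = j R x g \<cdot> ?d"
    proof -
      have "?d \<cdot> (?a \<cdot> c) \<in> V" "Dom P (?d \<cdot> (?a \<cdot> c)) = ob R x" "Cod P (?d \<cdot> (?a \<cdot> c)) = ob R x"
        using a c ty by (auto simp: V_comp)
      then obtain g where g: "g \<in> carrier (Gam R s)" "?d \<cdot> (?a \<cdot> c) = j R x g"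
        by (rule aut_iso_surj[OF j(1)])
      have "?d \<cdot> ?a = j R x g \<cdot> ?d"
      proof (rule V_right_cancel[of _ _ c])
        have "(j R x g \<cdot> ?d) \<cdot> c = j R x g \<cdot> Ident P (ob R x)"
          using V_assoc[of "j R x g" ?d c] aut_isoD[OF j(1) g(1)] c ty by simp
        also have "\<dots> = j R x g" using V_ident[of "j R x g"] aut_isoD[OF j(1) g(1)] by simp
        finally show "(?d \<cdot> ?a) \<cdot> c = (j R x g \<cdot> ?d) \<cdot> c"
          using V_assoc[of ?d ?a c] a c ty g by simp
      qed (use a c ty aut_isoD[OF j(1) g(1)] in \<open>auto simp: V_comp\<close>)
      then show ?thesis using g by blast
    qed
    from someI_ex[OF this] show "k h \<in> carrier (Gam R s) \<and> ?d \<cdot> ?a = j R x (k h) \<cdot> ?d"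
      unfolding k_def by blast
  qed
  have sK: "semilinear (Gam R s) (\<lambda>h. snd eps [x, y] (snd eps [y, z] (j R z h)))
      (\<lambda>h. snd kappa [x, y, z] (snd eps [x, z] (j R z h))) (\<lambda>h. h) (K [x, y, z] (ob R z))"
    unfolding semilinear_def
  proof
    fix h assume h: "h \<in> carrier (Gam R s)"
    show "h \<in> carrier (Gam R s) \<and> K [x, y, z] (ob R z) \<cdot> snd eps [x, y] (snd eps [y, z] (j R z h)) =
        snd kappa [x, y, z] (snd eps [x, z] (j R z h)) \<cdot> K [x, y, z] (ob R z)"
      using K_natural(2)[OF R A', of "j R z h"] aut_isoD(1-3)[OF j(3) h] fib(3) h by simp
  qed
  have skg: "semilinear (Gam R s) (\<lambda>h. snd kappa [x, y, z] (snd eps [x, z] (j R z h)))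
      (\<lambda>h. snd kappa [x, y, z] (j R x h)) (m R [x, z]) (snd kappa [x, y, z] (gam R [x, z]))"
    by (rule semilinear_functor[OF ka gxz(2)]) (use ty fib e_xz je in auto)
  have s1: "semilinear (Gam R s) (\<lambda>h. snd eps [x, y] (snd eps [y, z] (j R z h)))
      (\<lambda>h. snd kappa [x, y, z] (j R x h)) (\<lambda>h. m R [x, z] h)
      (snd kappa [x, y, z] (gam R [x, z]) \<cdot> K [x, y, z] (ob R z))"
    by (rule semilinear_comp[OF sK _ skg]) (use ty e_xyz e_kxz e_kx in auto)
  have s2: "semilinear (Gam R s) (\<lambda>h. snd eps [x, y] (snd eps [y, z] (j R z h))) (j R x) (\<lambda>h. k (m R [x, z] h))
      (del R [x, y, z] \<cdot> snd kappa [x, y, z] (gam R [x, z]) \<cdot> K [x, y, z] (ob R z))"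
    by (rule semilinear_comp[OF s1 _ sk]) (use ty e_xyz e_kx je in \<open>auto simp: V_comp\<close>)
  have bc: "B R [x, y, z] \<in> carrier (Gam R s)" by (rule G_form_value(1)[OF B R A]) simp_all
  have cmp: "m R [x, y] (m R [y, z] h) \<otimes>\<^bsub>Gam R s\<^esub> B R [x, y, z] = B R [x, y, z] \<otimes>\<^bsub>Gam R s\<^esub> k (m R [x, z] h)"
    if "h \<in> carrier (Gam R s)" for h
    by (rule semilinear_compare[OF s2 L[unfolded curv]])
      (use ty e_xyz j bc that group_axioms in \<open>auto simp: V_comp\<close>)
  have mxz: "m R [x, z] \<in> carrier Aut" by (rule Aut_form_value(1)[OF m R A]) simp_all
  have nuA: "fake_curvature m B R s x y z \<in> carrier Aut"
    using NA_Aut[OF R s NT_NA[OF R s fake_curvature_NT(1)[OF U R s m B A]]] .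
  have "k h = fake_curvature m B R s x y z h" if h: "h \<in> carrier (Gam R s)" for h
  proof -
    \<comment> \<open>\<open>m R [x, z]\<close> is bijective, so maps that agree on its values agree
      everywhere.\<close>
    define h' where "h' = (inv\<^bsub>Aut\<^esub> (m R [x, z])) h"
    have h': "h' \<in> carrier (Gam R s)" "m R [x, z] h' = h"
      unfolding h'_def using Aut_inv_apply(1)[OF mxz h] Aut_closed[OF group.inv_closed[OF Aut_group mxz] h] by auto
    have "B R [x, y, z] \<otimes>\<^bsub>Gam R s\<^esub> k h = B R [x, y, z] \<otimes>\<^bsub>Gam R s\<^esub> fake_curvature m B R s x y z h"
      using cmp[OF h'(1)] fake_curvature_apply[OF U R s m B A h'(1)] h'(2) by simp
    then show ?thesis using bc sk h Aut_closed[OF nuA h] by (simp add: semilinear_def)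
  qed
  then show ?thesis using sk Aut_closed[OF nuA] by (simp add: semilinear_def)
qed

end

section \<open>Two frames compared along an arrow\<close>

context curved_gerbe
begin

text \<open>The action of \<open>g' \<cdot> Fa \<chi>p\<close> on automorphisms is computed in two
  ways. With \<open>eps\<close> as the functor this becomes the exact law for the connection form,
  with \<open>kappa\<close> the one for the fake curvature.\<close>

lemma semilinear_transform:
  assumes \<Gamma>: "group \<Gamma>" and F: "fibre_functor R p x Fo Fa"
    and fib: "on_fibre R p yp" "on_fibre R p yp'" "on_fibre R x y" "on_fibre R x y'"
    and j: "aut_iso \<Gamma> yp jp" "aut_iso \<Gamma> yp' jp'" "aut_iso \<Gamma> y j" "aut_iso \<Gamma> y' j'"
    and g: "vertical P (Fo yp) y g" "semilinear \<Gamma> (\<lambda>h. Fa (jp h)) j m g"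
    and g': "vertical P (Fo yp') y' g'" "semilinear \<Gamma> (\<lambda>h. Fa (jp' h)) j' m' g'"
    and \<chi>: "vertical P y y' \<chi>" "semilinear \<Gamma> j j' r \<chi>"
    and \<chi>p: "vertical P yp yp' \<chi>p" "semilinear \<Gamma> jp jp' rp \<chi>p"
    and e: "e \<in> carrier \<Gamma>" "g' \<cdot> Fa \<chi>p = j' e \<cdot> \<chi> \<cdot> g" and h: "h \<in> carrier \<Gamma>"
  shows "m' (rp h) \<otimes>\<^bsub>\<Gamma>\<^esub> e = e \<otimes>\<^bsub>\<Gamma>\<^esub> r (m h)"
proof -
  note je = j[THEN aut_iso_endo]
  note E = functor_V[OF F \<chi>p(1) fib(2)]
  note ty = g(1)[unfolded vertical_V] g'(1)[unfolded vertical_V] \<chi>(1)[unfolded vertical_V]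
    \<chi>p(1)[unfolded vertical_V] E[unfolded vertical_V]
  note ep = endo_functor[OF F je(1) fib(1)] and ep' = endo_functor[OF F je(2) fib(2)]
  have 1: "semilinear \<Gamma> (\<lambda>h. Fa (jp h)) (\<lambda>h. Fa (jp' h)) rp (Fa \<chi>p)"
    by (rule semilinear_functor[OF F \<chi>p(2)]) (use ty fib je in auto)
  have 2: "semilinear \<Gamma> (\<lambda>h. Fa (jp h)) j' (\<lambda>h. m' (rp h)) (g' \<cdot> Fa \<chi>p)"
    by (rule semilinear_comp[OF 1 _ g'(2)]) (use ty ep ep' je in auto)
  have 3: "semilinear \<Gamma> (\<lambda>h. Fa (jp h)) j' (\<lambda>h. r (m h)) (\<chi> \<cdot> g)"
    by (rule semilinear_comp[OF g(2) _ \<chi>(2)]) (use ty ep je in auto)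
  show ?thesis
    by (rule semilinear_compare[OF 3 2[unfolded e(2)]]) (use ty ep j \<Gamma> e h in \<open>auto simp: V_comp\<close>)
qed

text \<open>Applying the functor to the relation that defines \<open>theta\<close> supplies
  assumption 5 of \<open>transition_equation\<close>. The functor \<open>eps\<close> leads to the
  equation for \<open>gamma\<close>, \<open>kappa\<close> to that for \<open>delta\<close>.\<close>

lemma transition_functor:
  assumes \<Gamma>: "group \<Gamma>" and F: "fibre_functor R p x Fo Fa"
    and fib: "on_fibre R p yp'" "on_fibre R p yp"
    and j: "aut_iso \<Gamma> y' j" "aut_iso \<Gamma> w' jw" "aut_iso \<Gamma> y jy" "aut_iso \<Gamma> yp' jp"
    and g: "vertical P (Fo yp) y g" and g': "vertical P (Fo yp') y' g'" "semilinear \<Gamma> (\<lambda>h. Fa (jp h)) j m g'"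
    and k: "vertical P (Fo wp) w k" and k': "vertical P (Fo wp') w' k'"
    and \<phi>: "vertical P w y \<phi>" and \<phi>': "vertical P w' y' \<phi>'" and \<chi>: "vertical P y y' \<chi>" and \<chi>w: "vertical P w w' \<chi>w"
    and \<phi>p: "vertical P wp yp \<phi>p" and \<phi>p': "vertical P wp' yp' \<phi>p'" and \<chi>p: "vertical P yp yp' \<chi>p"
    and \<chi>wp: "vertical P wp wp' \<chi>wp"
    and in_G: "a \<in> carrier \<Gamma>" "ew \<in> carrier \<Gamma>" "t0 \<in> carrier \<Gamma>" "t1 \<in> carrier \<Gamma>" "e \<in> carrier \<Gamma>" "c \<in> carrier \<Gamma>"
    and 1: "g' \<cdot> Fa \<phi>p' = j a \<cdot> \<phi>' \<cdot> k'" and 2: "k' \<cdot> Fa \<chi>wp = jw ew \<cdot> \<chi>w \<cdot> k"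
    and 3: "semilinear \<Gamma> jw j l \<phi>'" and 4: "\<phi>' \<cdot> \<chi>w = j t0 \<cdot> \<chi> \<cdot> \<phi>"
    and 5: "\<phi>p' \<cdot> \<chi>wp = jp t1 \<cdot> \<chi>p \<cdot> \<phi>p"
    and 7: "g' \<cdot> Fa \<chi>p = j e \<cdot> \<chi> \<cdot> g" and 8: "g \<cdot> Fa \<phi>p = jy c \<cdot> \<phi> \<cdot> k" and 9: "semilinear \<Gamma> jy j r \<chi>"
  shows "a \<otimes>\<^bsub>\<Gamma>\<^esub> (l ew \<otimes>\<^bsub>\<Gamma>\<^esub> t0) = m t1 \<otimes>\<^bsub>\<Gamma>\<^esub> (e \<otimes>\<^bsub>\<Gamma>\<^esub> r c)"
proof -
  have fw: "on_fibre R p wp'"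
    using V_on_fibre[of \<phi>p' R p] \<phi>p' fib by (auto simp: vertical_V)
  have jt: "vertical P yp' yp' (jp t1)" using aut_isoD(1-3)[OF j(4) in_G(4)] by (simp add: vertical_V)
  have c: "vertical P wp yp' (\<chi>p \<cdot> \<phi>p)" using \<chi>p \<phi>p by (simp add: vertical_V V_comp)
  have "Fa \<phi>p' \<cdot> Fa \<chi>wp = Fa (\<phi>p' \<cdot> \<chi>wp)" using functor_comp[OF F \<phi>p' \<chi>wp fib(1)] by simp
  also have "\<dots> = Fa (jp t1) \<cdot> Fa \<chi>p \<cdot> Fa \<phi>p"
    unfolding 5 using functor_comp[OF F jt c fib(1)] functor_comp[OF F \<chi>p \<phi>p fib(1)] by simp
  finally have e5: "Fa \<phi>p' \<cdot> Fa \<chi>wp = Fa (jp t1) \<cdot> Fa \<chi>p \<cdot> Fa \<phi>p" .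
  show ?thesis
    by (rule transition_equation[OF j(1) aut_iso_endo[OF j(2)] aut_iso_endo[OF j(3)]
        endo_functor[OF F aut_iso_endo[OF j(4)] fib(1)] \<Gamma> g g'(1) k k' \<phi> \<phi>' \<chi> \<chi>w
        functor_V[OF F \<phi>p fib(2)] functor_V[OF F \<phi>p' fib(1)] functor_V[OF F \<chi>p fib(1)]
        functor_V[OF F \<chi>wp fw] in_G 1 2 3 4 e5 g'(2) 7 8 9])
qed

text \<open>Satisfied by \<open>chi\<close> with \<open>r\<close> and \<open>e\<close>, and equally
  by a transition arrow \<open>phi i j\<close> with \<open>lam i j\<close> and
  \<open>gamma i j\<close>. The curving component is left out; on each simplex it is determined by
  the remaining data.\<close>

definition comparison where
  "comparison U ob j gam ob' j' gam' chi r e \<longleftrightarrow>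
     (\<forall>R. cring R \<longrightarrow> (\<forall>p\<in>U R. vertical P (ob R p) (ob' R p) (chi R p) \<and>
        (\<forall>h\<in>carrier (Gam R (str X R p)). chi R p \<cdot> j R p h = j' R p (r R p h) \<cdot> chi R p))) \<and>
     Aut_section X G (sub X U) (\<lambda>p. p) r \<and> G_form X G 1 U e \<and>
     (\<forall>R. cring R \<longrightarrow> (\<forall>xs\<in>pts (simplex X 1 U) R.
        gam' R xs \<cdot> snd eps xs (chi R (xs ! 1)) = j' R (xs ! 0) (e R xs) \<cdot> chi R (xs ! 0) \<cdot> gam R xs))"

lemma comparison_subset:
  assumes C: "comparison U ob j gam ob' j' gam' chi r e" and U': "\<And>R. cring R \<Longrightarrow> U' R \<subseteq> U R"
  shows "comparison U' ob j gam ob' j' gam' chi r e"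
proof -
  have "pts (simplex X n U') R \<subseteq> pts (simplex X n U) R" if "cring R" for R n
    using U'[OF that] by (auto simp: simplex_def)
  moreover have "Aut_section X G (sub X U') (\<lambda>p. p) r"
    using C U' unfolding comparison_def Aut_section_def by (auto simp: sub_def subset_iff)
  ultimately show ?thesis
    using C U' G_form_subset[of 1 U e U'] unfolding comparison_def by (auto simp: subset_iff)
qed

context
  fixes U ob j gam del m B ob' j' gam' del' m' B' chi r e
  assumes U: "infinitesimally_stable X U"
    and F: "frame U ob j gam del m B" and F': "frame U ob' j' gam' del' m' B'"
    and C: "comparison U ob j gam ob' j' gam' chi r e"
begin

lemma C_sub: "subfunctor X U" using U by (simp add: infinitesimally_stable_def)

lemma comparisonD:
  assumes R: "cring R" and s: "s \<in> pts S R"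
  shows "nearby U R s A \<Longrightarrow> p \<in> A \<Longrightarrow> vertical P (ob R p) (ob' R p) (chi R p)"
    "nearby U R s A \<Longrightarrow> p \<in> A \<Longrightarrow> r R p \<in> NA R s"
    "nearby U R s A \<Longrightarrow> p \<in> A \<Longrightarrow> semilinear (Gam R s) (j R p) (j' R p) (r R p) (chi R p)"
    "G_form X G 1 U e"
    "nearby U R s {x, y} \<Longrightarrow> gam' R [x, y] \<cdot> snd eps [x, y] (chi R y) = j' R x (e R [x, y]) \<cdot> chi R x \<cdot> gam R [x, y]"
proof -
  interpret group "Gam R s" by (rule Gam_group[OF R s])
  show "vertical P (ob R p) (ob' R p) (chi R p)" "r R p \<in> NA R s"
    "semilinear (Gam R s) (j R p) (j' R p) (r R p) (chi R p)"
    if A: "nearby U R s A" "p \<in> A"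
  proof -
    have p: "p \<in> U R" "str X R p = s" using A by (auto simp: nearby_def)
    have v: "vertical P (ob R p) (ob' R p) (chi R p) \<and>
        (\<forall>h\<in>carrier (Gam R (str X R p)). chi R p \<cdot> j R p h = j' R p (r R p h) \<cdot> chi R p)"
      and sec: "Aut_section X G (sub X U) (\<lambda>p. p) r"
      using C R p unfolding comparison_def by blast+
    show "vertical P (ob R p) (ob' R p) (chi R p)" using v by simp
    show na: "r R p \<in> NA R s" by (rule Aut_section_NA[OF sec C_sub R s p])
    show "semilinear (Gam R s) (j R p) (j' R p) (r R p) (chi R p)"
      using v p Aut_closed[OF NA_Aut[OF R s na]] by (simp add: semilinear_def)
  qed
  show "G_form X G 1 U e" using C by (simp add: comparison_def)
  assume A: "nearby U R s {x, y}"
  have xs: "[x, y] \<in> pts (simplex X 1 U) R" by (rule simplex_nearby[OF A]) simp_all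
  have "gam' R [x, y] \<cdot> snd eps [x, y] (chi R ([x, y] ! 1)) =
      j' R ([x, y] ! 0) (e R [x, y]) \<cdot> chi R ([x, y] ! 0) \<cdot> gam R [x, y]"
    using C R xs unfolding comparison_def by blast
  then show "gam' R [x, y] \<cdot> snd eps [x, y] (chi R y) = j' R x (e R [x, y]) \<cdot> chi R x \<cdot> gam R [x, y]" by simp
qed

lemma frame_aut_iso:
  assumes R: "cring R" and A: "nearby U R s A" and p: "p \<in> A"
  shows "on_fibre R p (ob R p)" "on_fibre R p (ob' R p)"
    "aut_iso (Gam R s) (ob R p) (j R p)" "aut_iso (Gam R s) (ob' R p) (j' R p)"
  using frameD(1,2)[OF F R, of p] frameD(1,2)[OF F' R, of p] nearbyD(1,3)[OF A p] by auto

lemma connection_form_exact: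
  assumes R: "cring R" and s: "s \<in> pts S R" and A: "nearby U R s {x, y}" and h: "h \<in> carrier (Gam R s)"
  shows "m' R [x, y] (r R y h) \<otimes>\<^bsub>Gam R s\<^esub> e R [x, y] = e R [x, y] \<otimes>\<^bsub>Gam R s\<^esub> r R x (m R [x, y] h)"
proof -
  note f = frame_aut_iso[OF R A] and c = comparisonD(1-3)[OF R s A]
  have ec: "e R [x, y] \<in> carrier (Gam R s)" by (rule G_form_value(1)[OF comparisonD(4)[OF R s] R A]) simp_all
  show ?thesis
    by (rule semilinear_transform[OF Gam_group[OF R s] eps_functor[OF R pts_nearby[OF C_sub R A]]
        f(1)[of y] f(2)[of y] f(1)[of x] f(2)[of x] f(3)[of y] f(4)[of y] f(3)[of x] f(4)[of x]
        frameD(5,6)[OF F R A] frameD(5,6)[OF F' R A] c(1)[of x] c(3)[of x] c(1)[of y] c(3)[of y]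
        ec comparisonD(5)[OF R s A] h]) simp_all
qed

lemma fake_curvature_exact:
  assumes R: "cring R" and s: "s \<in> pts S R" and A: "nearby U R s {x, y, z}" and h: "h \<in> carrier (Gam R s)"
    and n: "n \<in> carrier (Gam R s)"
      "del' R [x, y, z] \<cdot> snd kappa [x, y, z] (chi R x) = j' R x n \<cdot> chi R x \<cdot> del R [x, y, z]"
  shows "fake_curvature m' B' R s x y z (r R x h) \<otimes>\<^bsub>Gam R s\<^esub> n =
    n \<otimes>\<^bsub>Gam R s\<^esub> r R x (fake_curvature m B R s x y z h)"
proof -
  note f = frame_aut_iso[OF R A, of x, simplified] and c = comparisonD(1-3)[OF R s A, of x, simplified]
  show ?thesis
    by (rule semilinear_transform[OF Gam_group[OF R s] kappa_functor[OF R pts_nearby[OF C_sub R A]]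
        f(1,2,1,2,3,4,3,4) frameD(7)[OF F R A] fake_curvature_semilinear[OF U F R s A]
        frameD(7)[OF F' R A] fake_curvature_semilinear[OF U F' R s A] c(1,3,1,3) n h])
qed

text \<open>Naturality of \<open>K\<close> along \<open>chi\<close> compares the two curving
  relations. The fake curvature enters because \<open>del'\<close> has to be moved past the image
  under \<open>kappa\<close> of the automorphism given by \<open>e R [x, z]\<close>.\<close>

lemma curving_form_exact:
  assumes R: "cring R" and s: "s \<in> pts S R" and A: "nearby U R s {x, y, z}"
    and n: "n \<in> carrier (Gam R s)"
      "del' R [x, y, z] \<cdot> snd kappa [x, y, z] (chi R x) = j' R x n \<cdot> chi R x \<cdot> del R [x, y, z]"
  shows "B' R [x, y, z] \<otimes>\<^bsub>Gam R s\<^esub> (fake_curvature m' B' R s x y z (e R [x, z]) \<otimes>\<^bsub>Gam R s\<^esub> n) =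
    m' R [x, y] (e R [y, z]) \<otimes>\<^bsub>Gam R s\<^esub> (e R [x, y] \<otimes>\<^bsub>Gam R s\<^esub> r R x (B R [x, y, z]))"
proof -
  note A' = pts_nearby[OF C_sub R A]
  have A2: "nearby U R s {u, v}" "nearby (pts X) R s {u, v}" if "u \<in> {x, y, z}" "v \<in> {x, y, z}" for u v
    using nearby_mono[OF A, of "{u, v}"] nearby_mono[OF A', of "{u, v}"] that by auto
  note fx = frame_aut_iso[OF R A, of x, simplified] and fy = frame_aut_iso[OF R A, of y, simplified]
    and fz = frame_aut_iso[OF R A, of z, simplified]
  note cx = comparisonD(1-3)[OF R s A, of x, simplified] and cy = comparisonD(1-3)[OF R s A, of y, simplified]
    and cz = comparisonD(1-3)[OF R s A, of z, simplified]
  have exy: "fibre_functor R y x (fst eps [x, y]) (snd eps [x, y])"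
    and eyz: "fibre_functor R z y (fst eps [y, z]) (snd eps [y, z])"
    and exz: "fibre_functor R z x (fst eps [x, z]) (snd eps [x, z])"
    by (rule eps_functor[OF R A2(2)]; simp)+
  note ka = kappa_functor[OF R A']
  have gxy: "vertical P (fst eps [x, y] (ob R y)) (ob R x) (gam R [x, y])"
    and gyz: "vertical P (fst eps [y, z] (ob R z)) (ob R y) (gam R [y, z])"
    and gxz: "vertical P (fst eps [x, z] (ob R z)) (ob R x) (gam R [x, z])"
    using frameD(5)[OF F R A2(1)] by simp_all
  have gxy': "vertical P (fst eps [x, y] (ob' R y)) (ob' R x) (gam' R [x, y])"
    "semilinear (Gam R s) (\<lambda>h. snd eps [x, y] (j' R y h)) (j' R x) (m' R [x, y]) (gam' R [x, y])"
    and gyz': "vertical P (fst eps [y, z] (ob' R z)) (ob' R y) (gam' R [y, z])"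
    and gxz': "vertical P (fst eps [x, z] (ob' R z)) (ob' R x) (gam' R [x, z])"
    using frameD(5,6)[OF F' R A2(1)] by simp_all
  have ev: "e R [x, y] \<in> carrier (Gam R s)" "e R [y, z] \<in> carrier (Gam R s)" "e R [x, z] \<in> carrier (Gam R s)"
    by (rule G_form_value(1)[OF comparisonD(4)[OF R s] R A]; simp)+
  have bv: "B R [x, y, z] \<in> carrier (Gam R s)" "B' R [x, y, z] \<in> carrier (Gam R s)"
    using G_form_value(1)[OF frameD(4)[OF F R] R A] G_form_value(1)[OF frameD(4)[OF F' R] R A] by simp_all
  note eq_xy = comparisonD(5)[OF R s A2(1), of x y] and eq_yz = comparisonD(5)[OF R s A2(1), of y z]
    and eq_xz = comparisonD(5)[OF R s A2(1), of x z]
  have jy: "vertical P (ob' R y) (ob' R y) (j' R y (e R [y, z]))" and jx: "vertical P (ob' R x) (ob' R x) (j' R x (e R [x, z]))"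
    using aut_isoD(1-3)[OF fy(4) ev(2)] aut_isoD(1-3)[OF fx(4) ev(3)] by (simp_all add: vertical_V)
  have Ez: "vertical P (fst eps [y, z] (ob R z)) (fst eps [y, z] (ob' R z)) (snd eps [y, z] (chi R z))"
    by (rule functor_V[OF eyz cz(1) fz(2)])
  have Ez': "vertical P (fst eps [x, z] (ob R z)) (fst eps [x, z] (ob' R z)) (snd eps [x, z] (chi R z))"
    by (rule functor_V[OF exz cz(1) fz(2)])
  have cg: "vertical P (fst eps [y, z] (ob R z)) (ob' R y) (chi R y \<cdot> gam R [y, z])"
    "vertical P (fst eps [x, z] (ob R z)) (ob' R x) (chi R x \<cdot> gam R [x, z])"
    using cy(1) cx(1) gyz gxz by (simp_all add: vertical_V V_comp)
  have 2: "snd eps [x, y] (gam' R [y, z]) \<cdot> snd eps [x, y] (snd eps [y, z] (chi R z)) =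
      snd eps [x, y] (j' R y (e R [y, z])) \<cdot> snd eps [x, y] (chi R y) \<cdot> snd eps [x, y] (gam R [y, z])"
    using functor_comp[OF exy gyz' Ez fy(2)] functor_comp[OF exy jy cg(1) fy(2)] functor_comp[OF exy cy(1) gyz fy(2)]
      eq_yz by simp
  have 3: "snd kappa [x, y, z] (gam' R [x, z]) \<cdot> snd kappa [x, y, z] (snd eps [x, z] (chi R z)) =
      snd kappa [x, y, z] (j' R x (e R [x, z])) \<cdot> snd kappa [x, y, z] (chi R x) \<cdot> snd kappa [x, y, z] (gam R [x, z])"
    using functor_comp[OF ka gxz' Ez' fx(2)] functor_comp[OF ka jx cg(2) fx(2)] functor_comp[OF ka cx(1) gxz fx(2)]
      eq_xz by simp
  have 7: "K [x, y, z] (ob' R z) \<cdot> snd eps [x, y] (snd eps [y, z] (chi R z)) =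
      snd kappa [x, y, z] (snd eps [x, z] (chi R z)) \<cdot> K [x, y, z] (ob R z)"
    using K_natural(2)[OF R A', of "chi R z"] cz(1) fz(2) by (simp add: vertical_V)
  show ?thesis
    by (rule curving_equation[OF fx(4) aut_iso_endo[OF fx(3)]
        endo_functor[OF exy aut_iso_endo[OF fy(4)] fy(2)] endo_functor[OF ka aut_iso_endo[OF fx(4)] fx(2)]
        Gam_group[OF R s] gxy gxy'(1) functor_V[OF exy gyz fy(1)] functor_V[OF exy gyz' fy(2)]
        frameD(7)[OF F R A] frameD(7)[OF F' R A] functor_V[OF ka gxz fx(1)] functor_V[OF ka gxz' fx(2)]
        K_natural(1)[OF R A' fz(1)] K_natural(1)[OF R A' fz(2)] cx(1) functor_V[OF exy cy(1) fy(2)]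
        functor_V[OF exy Ez functor_fibre[OF eyz fz(2)]] functor_V[OF ka cx(1) fx(2)]
        functor_V[OF ka Ez' functor_fibre[OF exz fz(2)]] ev(1,2,3) n(1) bv
        _ 2 3 n(2) frameD(8)[OF F R A] frameD(8)[OF F' R A] 7 gxy'(2) fake_curvature_semilinear[OF U F' R s A] cx(3)])
      (use eq_xy in simp)
qed

end

end

section \<open>From exact relations to transformation formulas\<close>

context group
begin

text \<open>\<open>K\<close> will be the kernel of the edge 01. The values \<open>e02\<close> and
  \<open>e12\<close> need not lie in it, but \<open>inv e02 \<otimes> me \<otimes> e01\<close> does,
  being assembled from quotients that do. So the whole relation, and with it \<open>n\<close>, lives
  in one commutative group and can be solved.\<close>

lemma curving_form_algebra:
  assumes K: "edge K" and in_K: "b \<in> K" "b' \<in> K" "e01 \<in> K" "inv e02 \<otimes> e12 \<in> K" "me \<otimes> inv e12 \<in> K"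
    and car: "e02 \<in> carrier G" "e12 \<in> carrier G" "me \<in> carrier G" "n \<in> carrier G"
    and comm: "b' \<otimes> e02 = e02 \<otimes> b'" and E: "b' \<otimes> (e02 \<otimes> n) = me \<otimes> (e01 \<otimes> b)"
  shows "n \<in> K" "n = b \<otimes> inv b' \<otimes> (inv e02 \<otimes> me \<otimes> e01)" "b' = b \<otimes> (inv e02 \<otimes> me \<otimes> e01) \<otimes> inv n"
proof -
  define c where "c = inv e02 \<otimes> me \<otimes> e01"
  note in_G = edgeD(1)[OF K]
  have cK: "b \<in> carrier G" "b' \<in> carrier G" "e01 \<in> carrier G" using in_K in_G by auto
  have "inv e12 \<otimes> ((me \<otimes> inv e12) \<otimes> inv (inv e12)) \<in> K"
    using edgeD(5)[OF K in_K(5), of "inv e12"] car by simp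
  then have "(inv e02 \<otimes> e12) \<otimes> (inv e12 \<otimes> ((me \<otimes> inv e12) \<otimes> inv (inv e12))) \<otimes> e01 \<in> K"
    using edgeD(2)[OF K edgeD(2)[OF K in_K(4)] in_K(3)] by blast
  then have c: "c \<in> K" using car cK by (simp add: c_def group_simps)
  then have cc: "c \<in> carrier G" using in_G by blast
  have "e02 \<otimes> (b' \<otimes> n) = me \<otimes> (e01 \<otimes> b)"
    using E comm car cK by (simp add: m_assoc[symmetric])
  then have "b' \<otimes> n = inv e02 \<otimes> (me \<otimes> (e01 \<otimes> b))" using car cK by (simp add: inv_solve_left)
  also have "\<dots> = c \<otimes> b" using car cK by (simp add: c_def m_assoc)
  finally have bn: "b' \<otimes> n = c \<otimes> b" .
  then have n: "n = inv b' \<otimes> (c \<otimes> b)" using inv_solve_left[of n b' "c \<otimes> b"] car cK cc by simp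
  have nK: "inv b' \<in> K" "c \<otimes> b \<in> K" using edgeD(2,3)[OF K] in_K c by auto
  then show nin: "n \<in> K" using edgeD(2)[OF K] n by simp
  have "n = (c \<otimes> b) \<otimes> inv b'" using n edgeD(4)[OF K nK] by simp
  also have "c \<otimes> b = b \<otimes> c" using edgeD(4)[OF K c in_K(1)] .
  also have "b \<otimes> c \<otimes> inv b' = b \<otimes> (inv b' \<otimes> c)" using edgeD(4)[OF K c nK(1)] cK cc by (simp add: m_assoc)
  finally show "n = b \<otimes> inv b' \<otimes> (inv e02 \<otimes> me \<otimes> e01)" using cK cc unfolding c_def[symmetric] by (simp add: m_assoc)
  have "b' = c \<otimes> b \<otimes> inv n" using bn cK cc car inv_solve_right by simp
  then show "b' = b \<otimes> (inv e02 \<otimes> me \<otimes> e01) \<otimes> inv n"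
    unfolding c_def[symmetric] using edgeD(4)[OF K c in_K(1)] by simp
qed

text \<open>The relation says that \<open>m'\<close> is \<open>\<mu>\<close> followed by conjugation
  by \<open>e\<close>. Because \<open>m'\<close> fixes \<open>e\<close>, so does
  \<open>\<mu>\<close>, and the two factors may be interchanged. With \<open>r0 = r1\<close> the
  same computation serves the fake curvature.\<close>

lemma connection_form_algebra:
  assumes u: "m' \<in> carrier Aut" "m \<in> carrier Aut" "r0 \<in> carrier Aut" "r1 \<in> carrier Aut" and e: "e \<in> carrier G" "m' e = e"
    and E: "\<And>h. h \<in> carrier G \<Longrightarrow> m' (r1 h) \<otimes> e = e \<otimes> r0 (m h)"
  defines "\<mu> \<equiv> r0 \<otimes>\<^bsub>Aut\<^esub> m \<otimes>\<^bsub>Aut\<^esub> inv\<^bsub>Aut\<^esub> r0 \<otimes>\<^bsub>Aut\<^esub> (r0 \<otimes>\<^bsub>Aut\<^esub> inv\<^bsub>Aut\<^esub> r1)"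
  shows "\<mu> \<in> carrier Aut" "\<And>h. h \<in> carrier G \<Longrightarrow> e \<otimes> \<mu> h \<otimes> inv e = m' h" "m' = \<mu> \<otimes>\<^bsub>Aut\<^esub> inner e"
proof -
  interpret A: group Aut by (rule Aut_group)
  show \<mu>: "\<mu> \<in> carrier Aut" using u by (simp add: \<mu>_def)
  have eq: "\<mu> = r0 \<otimes>\<^bsub>Aut\<^esub> (m \<otimes>\<^bsub>Aut\<^esub> inv\<^bsub>Aut\<^esub> r1)"
    using u by (simp add: \<mu>_def A.group_simps)
  show conj: "e \<otimes> \<mu> h \<otimes> inv e = m' h" if h: "h \<in> carrier G" for h
  proof -
    define k where "k = (inv\<^bsub>Aut\<^esub> r1) h"
    have k: "k \<in> carrier G" "r1 k = h"
      using Aut_closed[OF A.inv_closed[OF u(4)] h] Aut_inv_apply(1)[OF u(4) h] by (simp_all add: k_def)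
    have "\<mu> h = r0 (m k)" unfolding eq k_def using u h by (simp add: Aut_comp Aut_closed)
    then have "m' h \<otimes> e = e \<otimes> \<mu> h" using E[OF k(1)] k(2) by simp
    moreover have "m' h \<in> carrier G" "\<mu> h \<in> carrier G" using Aut_closed u \<mu> h by blast+
    ultimately show ?thesis using e by (simp add: inv_solve_right')
  qed
  have \<mu>c: "\<mu> h \<in> carrier G" if "h \<in> carrier G" for h using Aut_closed[OF \<mu> that] .
  have \<mu>e: "\<mu> e = e"
  proof -
    have "\<mu> e = inv e \<otimes> (e \<otimes> \<mu> e \<otimes> inv e) \<otimes> e" using \<mu>c[OF e(1)] e(1) by (simp add: group_simps)
    also have "\<dots> = e" unfolding conj[OF e(1)] e(2) using e(1) by simp
    finally show ?thesis .
  qed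
  show "m' = \<mu> \<otimes>\<^bsub>Aut\<^esub> inner e"
  proof (rule Aut_eqI[OF u(1)])
    show "\<mu> \<otimes>\<^bsub>Aut\<^esub> inner e \<in> carrier Aut" using \<mu> inner_Aut[OF e(1)] by simp
    fix h assume h: "h \<in> carrier G"
    show "m' h = (\<mu> \<otimes>\<^bsub>Aut\<^esub> inner e) h"
      unfolding conj[OF h, symmetric] using h e(1) \<mu>e \<mu> inner_Aut[OF e(1)]
      by (simp add: Aut_comp inner_apply Aut_mult Aut_map_inv)
  qed
qed

end

context group_scheme_over
begin

lemma kern_edge:
  assumes R: "cring R" and s: "s \<in> pts S R" and xy: "near X R x y"
  shows "group.edge (Gam R s) (kern R s x y)"
proof -
  interpret group "Gam R s" by (rule Gam_group[OF R s])
  show ?thesis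
    unfolding edge_def
    using kern_subgroup[OF R s] kern_commute[OF R s xy] kern_conj[OF R s] by blast
qed

text \<open>Wherever \<open>x0 = x3\<close> the face \<open>[x1, x2, x3]\<close> is a cyclic
  rotation of \<open>[x0, x1, x2]\<close>, so \<open>b\<close> takes the same value on both, and
  \<open>m R [x0, x1]\<close> fixes that value as an element of the kernel of its edge.\<close>

lemma twisted_form_two_last:
  assumes U: "infinitesimally_stable X U" and b: "G_form X G 2 U b" and m: "Aut_form X G 1 U m"
    and R: "cring R" and s: "s \<in> pts S R" and A: "nearby U R s {x0, x1, x2, x3}"
  shows "m R [x0, x1] (b R [x1, x2, x3]) \<otimes>\<^bsub>Gam R s\<^esub> inv\<^bsub>Gam R s\<^esub> b R [x0, x1, x2] \<in> kern R s x0 x3"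
proof -
  have sub: "subfunctor X U" using U by (simp add: infinitesimally_stable_def)
  have v: "b R [x1, x2, x3] \<in> carrier (Gam R s)" "b R [x0, x1, x2] \<in> carrier (Gam R s)"
    using G_form_value(1)[OF b R A] by simp_all
  have mc: "m R [x0, x1] \<in> carrier (AutoGroup (Gam R s))" using Aut_form_value(1)[OF m R A] by simp
  interpret \<Gamma>: group "Gam R s" by (rule Gam_group[OF R s])
  have mb: "m R [x0, x1] (b R [x1, x2, x3]) \<in> carrier (Gam R s)" by (rule \<Gamma>.Aut_closed[OF mc v(1)])
  have "res G R T f (m R [x0, x1] (b R [x1, x2, x3]) \<otimes>\<^bsub>Gam R s\<^esub> inv\<^bsub>Gam R s\<^esub> b R [x0, x1, x2]) = \<one>\<^bsub>Gam T (res S R T f s)\<^esub>"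
    if T: "cring T" "f \<in> Hom R T" "res X R T f x0 = res X R T f x3" for T f
  proof -
    interpret group_hom "Gam R s" "Gam T (res S R T f s)" "res G R T f" by (rule res_hom[OF R s T(1,2)])
    let ?x = "res X R T f"
    have sT: "res S R T f s \<in> pts S T" by (rule psh_closed[OF S_psh R T(1,2) s])
    have A': "nearby U T (res S R T f s) {?x x0, ?x x1, ?x x2}"
      by (rule nearby_mono[OF nearby_res[OF sub R T(1,2) A]]) auto
    have "b T [?x x1, ?x x2, ?x x0] = b T [?x x0, ?x x1, ?x x2]"
      by (rule form_two_cyclic[OF U T(1) sT b A'])
    then have "res G R T f (b R [x1, x2, x3]) = res G R T f (b R [x0, x1, x2])"
      using G_form_value(2)[OF b R A _ _ T(1,2)] T(3) by simp
    moreover have "m T [?x x0, ?x x1] (b T [?x x0, ?x x1, ?x x2]) = b T [?x x0, ?x x1, ?x x2]"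
    proof (rule NT_fixes[OF T(1) sT])
      show "near X T (?x x0) (?x x1)" using A' by (simp add: nearby_def)
      show "m T [?x x0, ?x x1] \<in> NT T (res S R T f s) (?x x0) (?x x1)"
        by (rule Aut_form_one_NT[OF sub T(1) sT m nearby_mono[OF A']]) auto
      show "b T [?x x0, ?x x1, ?x x2] \<in> kern T (res S R T f s) (?x x0) (?x x1)"
        by (rule form_two_kern(1)[OF U T(1) sT b A'])
    qed
    ultimately have "res G R T f (m R [x0, x1] (b R [x1, x2, x3])) = res G R T f (b R [x0, x1, x2])"
      using Aut_form_value(2)[OF m R A _ _ T(1,2) v(1), of "[x0, x1]"]
        G_form_value(2)[OF b R A _ _ T(1,2), of "[x0, x1, x2]"] by simp
    then show ?thesis using v mb by simp
  qed
  then show ?thesis using v mb by (simp add: kern_def)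
qed

end

context curved_gerbe
begin

context
  fixes U ob j gam del m B ob' j' gam' del' m' B' chi r e R s
  assumes U: "infinitesimally_stable X U"
    and F: "frame U ob j gam del m B" and F': "frame U ob' j' gam' del' m' B'"
    and C: "comparison U ob j gam ob' j' gam' chi r e"
    and R: "cring R" and s: "s \<in> pts S R"
begin

interpretation \<Gamma>: group "Gam R s" by (rule Gam_group[OF R s])

lemma e_form: "G_form X G 1 U e" using C by (simp add: comparison_def)
lemma frame_forms: "Aut_form X G 1 U m" "G_form X G 2 U B" "Aut_form X G 1 U m'" "G_form X G 2 U B'"
  using F F' by (simp_all add: frame_def)
lemma U_subfunctor: "subfunctor X U" using U by (simp add: infinitesimally_stable_def)

lemma r_NA:
  assumes "nearby U R s A" "p \<in> A"
  shows "r R p \<in> NA R s" "r R p \<in> carrier \<Gamma>.Aut"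
  using comparisonD(2)[OF U F F' C R s assms] NA_Aut[OF R s] by auto

lemma e_kern: "nearby U R s {x, y} \<Longrightarrow> e R [x, y] \<in> kern R s x y"
  by (rule form_one_kern[OF U R s e_form])

lemma m'_NT: "nearby U R s {x, y} \<Longrightarrow> m' R [x, y] \<in> NT R s x y"
  by (rule Aut_form_one_NT[OF U_subfunctor R s frame_forms(3)])

lemma connection_form_change:
  assumes A: "nearby U R s {x, y}"
  defines "\<mu> \<equiv> r R x \<otimes>\<^bsub>\<Gamma>.Aut\<^esub> m R [x, y] \<otimes>\<^bsub>\<Gamma>.Aut\<^esub> inv\<^bsub>\<Gamma>.Aut\<^esub> r R x \<otimes>\<^bsub>\<Gamma>.Aut\<^esub> (r R x \<otimes>\<^bsub>\<Gamma>.Aut\<^esub> inv\<^bsub>\<Gamma>.Aut\<^esub> r R y)"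
  shows "\<mu> \<in> NA R s" "\<And>h. h \<in> carrier (Gam R s) \<Longrightarrow>
      e R [x, y] \<otimes>\<^bsub>Gam R s\<^esub> \<mu> h \<otimes>\<^bsub>Gam R s\<^esub> inv\<^bsub>Gam R s\<^esub> e R [x, y] = m' R [x, y] h"
    "m' R [x, y] = \<mu> \<otimes>\<^bsub>\<Gamma>.Aut\<^esub> \<Gamma>.inner (e R [x, y])"
proof -
  note r = r_NA[OF A]
  have mc: "m R [x, y] \<in> NA R s" "m' R [x, y] \<in> NA R s"
    using Aut_form_NA[OF U_subfunctor R s frame_forms(1) A] Aut_form_NA[OF U_subfunctor R s frame_forms(3) A]
    by simp_all
  show "\<mu> \<in> NA R s" unfolding \<mu>_def using r mc NA_mult[OF R s] NA_inv[OF R s] by simp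
  have e: "e R [x, y] \<in> carrier (Gam R s)" "m' R [x, y] (e R [x, y]) = e R [x, y]"
    using kern_closed[OF R s e_kern[OF A]] NT_fixes[OF R s _ m'_NT[OF A] e_kern[OF A]] A by (auto simp: nearby_def)
  note * = \<Gamma>.connection_form_algebra[OF mc(2,1)[THEN NA_Aut[OF R s]] r(2)[of x] r(2)[of y] e
      connection_form_exact[OF U F F' C R s A]]
  show "\<And>h. h \<in> carrier (Gam R s) \<Longrightarrow>
      e R [x, y] \<otimes>\<^bsub>Gam R s\<^esub> \<mu> h \<otimes>\<^bsub>Gam R s\<^esub> inv\<^bsub>Gam R s\<^esub> e R [x, y] = m' R [x, y] h"
    "m' R [x, y] = \<mu> \<otimes>\<^bsub>\<Gamma>.Aut\<^esub> \<Gamma>.inner (e R [x, y])"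
    unfolding \<mu>_def using *(2,3) by simp_all
qed

context
  fixes x y z n
  assumes A: "nearby U R s {x, y, z}" and n: "n \<in> carrier (Gam R s)"
    "del' R [x, y, z] \<cdot> snd kappa [x, y, z] (chi R x) = j' R x n \<cdot> chi R x \<cdot> del R [x, y, z]"
begin

lemma nears: "near X R x y" "near X R y z" "near X R x z"
  using A by (auto simp: nearby_def)

lemma nearby_pairs: "nearby U R s {x, y}" "nearby U R s {y, z}" "nearby U R s {x, z}"
  using nearby_mono[OF A] by auto

abbreviation "\<nu> \<equiv> fake_curvature m B R s x y z"
abbreviation "\<nu>' \<equiv> fake_curvature m' B' R s x y z"

lemma nu'_fixes_e: "\<nu>' (e R [x, z]) = e R [x, z]"
  by (rule NT_fixes[OF R s nears(3) fake_curvature_NT(3)[OF U R s frame_forms(3,4) A] e_kern[OF nearby_pairs(3)]])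

lemma e_values: "e R [x, y] \<in> carrier (Gam R s)" "e R [y, z] \<in> carrier (Gam R s)" "e R [x, z] \<in> carrier (Gam R s)"
  using nearby_pairs[THEN e_kern] kern_closed[OF R s] by blast+

lemma m'_e_closed: "m' R [x, y] (e R [y, z]) \<in> carrier (Gam R s)"
  using \<Gamma>.Aut_closed[OF NA_Aut[OF R s NT_NA[OF R s m'_NT[OF nearby_pairs(1)]]] e_values(2)] .

lemma rB_kern: "r R x (B R [x, y, z]) \<in> kern R s x y" "r R x (B R [x, y, z]) \<in> kern R s x z"
  using form_two_kern[OF U R s frame_forms(2) A] NA_kern[OF R s r_NA(1)[OF A]] by simp_all

text \<open>The fake curvature disappears from the exact relation: it is small along the edge
  \<open>x z\<close>, and \<open>e R [x, z]\<close> lies in the kernel of that edge.\<close>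

lemma curving_relation:
  "B' R [x, y, z] \<otimes>\<^bsub>Gam R s\<^esub> (e R [x, z] \<otimes>\<^bsub>Gam R s\<^esub> n) =
    m' R [x, y] (e R [y, z]) \<otimes>\<^bsub>Gam R s\<^esub> (e R [x, y] \<otimes>\<^bsub>Gam R s\<^esub> r R x (B R [x, y, z]))"
  using curving_form_exact[OF U F F' C R s A n] unfolding nu'_fixes_e .

text \<open>\<open>c\<close> is the value of the twisted differential of the negative of
  \<open>e\<close>. The second clause solves for \<open>n\<close>; applied to transition arrows this
  solution is the expression that defines \<open>delta\<close>.\<close>

lemma curving_form_change:
  defines "c \<equiv> inv\<^bsub>Gam R s\<^esub> e R [x, y] \<otimes>\<^bsub>Gam R s\<^esub> m' R [x, y] (inv\<^bsub>Gam R s\<^esub> e R [y, z]) \<otimes>\<^bsub>Gam R s\<^esub>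
    inv\<^bsub>Gam R s\<^esub> (inv\<^bsub>Gam R s\<^esub> e R [x, z])"
  shows "n \<in> kern R s x y"
    "n = r R x (B R [x, y, z]) \<otimes>\<^bsub>Gam R s\<^esub> inv\<^bsub>Gam R s\<^esub> B' R [x, y, z] \<otimes>\<^bsub>Gam R s\<^esub> inv\<^bsub>Gam R s\<^esub> c"
    "B' R [x, y, z] = r R x (B R [x, y, z]) \<otimes>\<^bsub>Gam R s\<^esub> inv\<^bsub>Gam R s\<^esub> c \<otimes>\<^bsub>Gam R s\<^esub> inv\<^bsub>Gam R s\<^esub> n"
proof -
  note ev = e_values
  note me = m'_e_closed
  have m'A: "m' R [x, y] \<in> carrier \<Gamma>.Aut" by (rule NA_Aut[OF R s NT_NA[OF R s m'_NT[OF nearby_pairs(1)]]])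
  have c: "inv\<^bsub>Gam R s\<^esub> c = inv\<^bsub>Gam R s\<^esub> e R [x, z] \<otimes>\<^bsub>Gam R s\<^esub> m' R [x, y] (e R [y, z]) \<otimes>\<^bsub>Gam R s\<^esub> e R [x, y]"
    unfolding c_def using ev me by (simp add: \<Gamma>.Aut_map_inv[OF m'A] \<Gamma>.group_simps)
  note B'k = form_two_kern[OF U R s frame_forms(4) A]
  have comm: "B' R [x, y, z] \<otimes>\<^bsub>Gam R s\<^esub> e R [x, z] = e R [x, z] \<otimes>\<^bsub>Gam R s\<^esub> B' R [x, y, z]"
    by (rule kern_commute[OF R s nears(3) B'k(3) e_kern[OF nearby_pairs(3)]])
  note * = \<Gamma>.curving_form_algebra[OF kern_edge[OF R s nears(1)] rB_kern(1) B'k(1) e_kern[OF nearby_pairs(1)]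
      form_one_face[OF e_form U_subfunctor R s A]
      NT_displacement[OF R s m'_NT[OF nearby_pairs(1)] ev(2)] ev(3,2) me n(1) comm curving_relation]
  show "n \<in> kern R s x y"
    "n = r R x (B R [x, y, z]) \<otimes>\<^bsub>Gam R s\<^esub> inv\<^bsub>Gam R s\<^esub> B' R [x, y, z] \<otimes>\<^bsub>Gam R s\<^esub> inv\<^bsub>Gam R s\<^esub> c"
    "B' R [x, y, z] = r R x (B R [x, y, z]) \<otimes>\<^bsub>Gam R s\<^esub> inv\<^bsub>Gam R s\<^esub> c \<otimes>\<^bsub>Gam R s\<^esub> inv\<^bsub>Gam R s\<^esub> n"
    unfolding c by (rule *)+
qed

text \<open>The exact law has the shape of the one for the connection, except that both comparison
  automorphisms are taken at \<open>x\<close>; the correction term built from them is then the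
  identity.\<close>

lemma fake_curvature_change:
  "\<nu>' = r R x \<otimes>\<^bsub>\<Gamma>.Aut\<^esub> \<nu> \<otimes>\<^bsub>\<Gamma>.Aut\<^esub> inv\<^bsub>\<Gamma>.Aut\<^esub> r R x \<otimes>\<^bsub>\<Gamma>.Aut\<^esub> \<Gamma>.inner n"
proof -
  interpret Au: group \<Gamma>.Aut by (rule \<Gamma>.Aut_group)
  have \<nu>A: "\<nu>' \<in> carrier \<Gamma>.Aut" "\<nu> \<in> carrier \<Gamma>.Aut"
    using fake_curvature_NT(1)[OF U R s frame_forms(3,4) A] fake_curvature_NT(1)[OF U R s frame_forms(1,2) A]
      NT_NA[OF R s] NA_Aut[OF R s] by blast+
  have rA: "r R x \<in> carrier \<Gamma>.Aut" using r_NA(2)[OF A] by simp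
  have \<nu>n: "\<nu>' n = n"
    by (rule NT_fixes[OF R s nears(1) fake_curvature_NT(1)[OF U R s frame_forms(3,4) A] curving_form_change(1)])
  have "\<nu>' = r R x \<otimes>\<^bsub>\<Gamma>.Aut\<^esub> \<nu> \<otimes>\<^bsub>\<Gamma>.Aut\<^esub> inv\<^bsub>\<Gamma>.Aut\<^esub> r R x \<otimes>\<^bsub>\<Gamma>.Aut\<^esub>
      (r R x \<otimes>\<^bsub>\<Gamma>.Aut\<^esub> inv\<^bsub>\<Gamma>.Aut\<^esub> r R x) \<otimes>\<^bsub>\<Gamma>.Aut\<^esub> \<Gamma>.inner n"
    by (rule \<Gamma>.connection_form_algebra(3)[OF \<nu>A rA rA n(1) \<nu>n fake_curvature_exact[OF U F F' C R s A _ n]])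
  then show ?thesis using \<nu>A rA by simp
qed

end

end

end

section \<open>Transition data under a change of choices\<close>

context curved_gerbe
begin

text \<open>Two arrows of a fibre with the same source and target differ by an automorphism of the
  target. Thus a transition arrow, for which no form \<open>n\<close> is given, still has a curving
  component.\<close>

lemma exists_curving_comparison:
  assumes U: "infinitesimally_stable X U"
    and F: "frame U ob j gam del m B" and F': "frame U ob' j' gam' del' m' B'"
    and C: "comparison U ob j gam ob' j' gam' chi r e"
    and R: "cring R" and s: "s \<in> pts S R" and A: "nearby U R s {x, y, z}"
  obtains n where "n \<in> carrier (Gam R s)"
    "del' R [x, y, z] \<cdot> snd kappa [x, y, z] (chi R x) = j' R x n \<cdot> chi R x \<cdot> del R [x, y, z]"
proof -
  note f = frame_aut_iso[OF U F F' C R A, of x, simplified] and c = comparisonD(1)[OF U F F' C R s A, of x, simplified]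
  note d = frameD(7)[OF F R A] frameD(7)[OF F' R A]
  have k: "vertical P (fst kappa [x, y, z] (ob R x)) (fst kappa [x, y, z] (ob' R x)) (snd kappa [x, y, z] (chi R x))"
    by (rule functor_V[OF kappa_functor[OF R pts_nearby[OF C_sub[OF U F F' C] R A]] c f(2)])
  note ty = d[unfolded vertical_V] k[unfolded vertical_V] c[unfolded vertical_V]
  let ?a = "del' R [x, y, z] \<cdot> snd kappa [x, y, z] (chi R x)" and ?b = "chi R x \<cdot> del R [x, y, z]"
  have a: "?a \<in> V" "Dom P ?a = fst kappa [x, y, z] (ob R x)" "Cod P ?a = ob' R x"
    and b: "?b \<in> V" "Dom P ?b = fst kappa [x, y, z] (ob R x)" "Cod P ?b = ob' R x"
    using ty by (simp_all add: V_comp)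
  obtain b' where b': "b' \<in> V" "Dom P b' = Cod P ?b" "Cod P b' = Dom P ?b" "?b \<cdot> b' = Ident P (Cod P ?b)"
    by (rule V_inverse[OF b(1)])
  have "?a \<cdot> b' \<in> V" "Dom P (?a \<cdot> b') = ob' R x" "Cod P (?a \<cdot> b') = ob' R x"
    using a b b' by (simp_all add: V_comp)
  then obtain n where n: "n \<in> carrier (Gam R s)" "?a \<cdot> b' = j' R x n" by (rule aut_iso_surj[OF f(4)])
  have "?a = j' R x n \<cdot> ?b"
  proof (rule V_right_cancel[OF a(1) _ b'(1)])
    note jn = aut_isoD(1-3)[OF f(4) n(1)]
    show "j' R x n \<cdot> ?b \<in> V" "Dom P (j' R x n \<cdot> ?b) = Cod P b'" using jn b b' by (simp_all add: V_comp)
    show "Dom P ?a = Cod P b'" using a b b' by simp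
    have "(j' R x n \<cdot> ?b) \<cdot> b' = j' R x n \<cdot> Ident P (ob' R x)"
      using V_assoc[OF jn(1) b(1) b'(1)] jn b b' by simp
    then show "?a \<cdot> b' = (j' R x n \<cdot> ?b) \<cdot> b'" using n V_ident[OF jn(1)] jn by simp
  qed
  then show thesis using that n(1) by blast
qed

context
  fixes U ob1 j1 gam1 del1 m1 B1 ob1' j1' gam1' del1' m1' B1' chi1 r1 e1
    ob2 j2 gam2 del2 m2 B2 ob2' j2' gam2' del2' m2' B2' chi2 r2 e2
    phi lam c phi' lam' c' theta R s
  assumes U: "infinitesimally_stable X U"
    and F1: "frame U ob1 j1 gam1 del1 m1 B1" and F1': "frame U ob1' j1' gam1' del1' m1' B1'"
    and F2: "frame U ob2 j2 gam2 del2 m2 B2" and F2': "frame U ob2' j2' gam2' del2' m2' B2'"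
    and C1: "comparison U ob1 j1 gam1 ob1' j1' gam1' chi1 r1 e1"
    and C2: "comparison U ob2 j2 gam2 ob2' j2' gam2' chi2 r2 e2"
    and T: "comparison U ob2 j2 gam2 ob1 j1 gam1 phi lam c"
    and T': "comparison U ob2' j2' gam2' ob1' j1' gam1' phi' lam' c'"
    and theta: "G_section X G (sub X U) (\<lambda>p. p) theta"
      "\<forall>R p. cring R \<longrightarrow> p \<in> U R \<longrightarrow> phi' R p \<cdot> chi2 R p = j1' R p (theta R p) \<cdot> chi1 R p \<cdot> phi R p"
    and R: "cring R" and s: "s \<in> pts S R"
begin

interpretation \<Gamma>: group "Gam R s" by (rule Gam_group[OF R s])

lemma transition_change:
  assumes A: "nearby U R s {x, y}"
  shows "(c' R [x, y] \<otimes>\<^bsub>Gam R s\<^esub> inv\<^bsub>Gam R s\<^esub> (theta R x \<otimes>\<^bsub>Gam R s\<^esub> r1 R x (c R [x, y]) \<otimes>\<^bsub>Gam R s\<^esub> inv\<^bsub>Gam R s\<^esub> theta R x)) \<otimes>\<^bsub>Gam R s\<^esub>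
    (lam' R x (e2 R [x, y]) \<otimes>\<^bsub>Gam R s\<^esub> inv\<^bsub>Gam R s\<^esub> (theta R x \<otimes>\<^bsub>Gam R s\<^esub> e1 R [x, y] \<otimes>\<^bsub>Gam R s\<^esub> inv\<^bsub>Gam R s\<^esub> theta R x)) =
    (theta R y \<otimes>\<^bsub>Gam R s\<^esub> inv\<^bsub>Gam R s\<^esub> theta R x) \<otimes>\<^bsub>Gam R s\<^esub>
    (m1' R [x, y] (theta R y) \<otimes>\<^bsub>Gam R s\<^esub> inv\<^bsub>Gam R s\<^esub> theta R y)"
proof -
  have sub: "subfunctor X U" using U by (simp add: infinitesimally_stable_def)
  have A': "nearby U R s {y, x}" using A by (simp add: insert_commute)
  have xy: "near X R x y" and p: "x \<in> U R" "y \<in> U R" using A by (auto simp: nearby_def)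
  note f1 = frame_aut_iso[OF U F1 F1' C1 R A] and f2 = frame_aut_iso[OF U F2 F2' C2 R A]
  note d1 = comparisonD[OF U F1 F1' C1 R s] and d2 = comparisonD[OF U F2 F2' C2 R s]
    and dT = comparisonD[OF U F2 F1 T R s] and dT' = comparisonD[OF U F2' F1' T' R s]
  have th: "theta R x \<in> carrier (Gam R s)" "theta R y \<in> carrier (Gam R s)"
    "theta R y \<otimes>\<^bsub>Gam R s\<^esub> inv\<^bsub>Gam R s\<^esub> theta R x \<in> kern R s x y"
    using G_section_value[OF theta(1) sub R s A] G_section_value(1)[OF theta(1) sub R s A'] by simp_all
  have k: "c R [x, y] \<in> kern R s x y" "c' R [x, y] \<in> kern R s x y" "e1 R [x, y] \<in> kern R s x y" "e2 R [x, y] \<in> kern R s x y"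
    using form_one_kern[OF U R s _ A] d1(4) d2(4) dT(4) dT'(4) by blast+
  note kc = k[THEN kern_closed[OF R s]]
  note m = Aut_form_one_NT[OF sub R s frameD(3)[OF F1' R] A]
  have mt: "m1' R [x, y] (theta R y) \<in> carrier (Gam R s)"
    using \<Gamma>.Aut_closed[OF NA_Aut[OF R s NT_NA[OF R s m]] th(2)] .
  have E: "c' R [x, y] \<otimes>\<^bsub>Gam R s\<^esub> (lam' R x (e2 R [x, y]) \<otimes>\<^bsub>Gam R s\<^esub> theta R x) =
      m1' R [x, y] (theta R y) \<otimes>\<^bsub>Gam R s\<^esub> (e1 R [x, y] \<otimes>\<^bsub>Gam R s\<^esub> r1 R x (c R [x, y]))"
    by (rule transition_functor[OF Gam_group[OF R s] eps_functor[OF R pts_nearby[OF sub R A]]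
        f1(2)[of y] f1(1)[of y] f1(4)[of x] f2(4)[of x] f1(3)[of x] f1(4)[of y]
        frameD(5)[OF F1 R A] frameD(5,6)[OF F1' R A] frameD(5)[OF F2 R A] frameD(5)[OF F2' R A]
        dT(1)[OF A] dT'(1)[OF A] d1(1)[OF A] d2(1)[OF A] dT(1)[OF A] dT'(1)[OF A] d1(1)[OF A] d2(1)[OF A]
        kc(2,4) th(1,2) kc(3,1) dT'(5)[OF A] d2(5)[OF A] dT'(3)[OF A] theta(2)[rule_format, OF R p(1)] theta(2)[rule_format, OF R p(2)]
        d1(5)[OF A] dT(5)[OF A] d1(3)[OF A]]) simp_all
  show ?thesis
    by (rule \<Gamma>.transform_along_edge[OF kern_edge[OF R s xy] k(2) NA_kern[OF R s dT'(2)[OF A] k(4)] k(3)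
        NA_kern[OF R s d1(2)[OF A] k(1)] th(1,2) mt NT_displacement[OF R s m th(2)] th(3) E]) simp_all
qed

lemma curving_transition_change:
  fixes x y z n1 n2
  assumes A: "nearby U R s {x, y, z}"
    and n1: "n1 \<in> carrier (Gam R s)"
      "del1' R [x, y, z] \<cdot> snd kappa [x, y, z] (chi1 R x) = j1' R x n1 \<cdot> chi1 R x \<cdot> del1 R [x, y, z]"
    and n2: "n2 \<in> carrier (Gam R s)"
      "del2' R [x, y, z] \<cdot> snd kappa [x, y, z] (chi2 R x) = j2' R x n2 \<cdot> chi2 R x \<cdot> del2 R [x, y, z]"
  defines "d \<equiv> lam R x (B2 R [x, y, z]) \<otimes>\<^bsub>Gam R s\<^esub> inv\<^bsub>Gam R s\<^esub> B1 R [x, y, z] \<otimes>\<^bsub>Gam R s\<^esub> inv\<^bsub>Gam R s\<^esub>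
      (inv\<^bsub>Gam R s\<^esub> c R [x, y] \<otimes>\<^bsub>Gam R s\<^esub> m1 R [x, y] (inv\<^bsub>Gam R s\<^esub> c R [y, z]) \<otimes>\<^bsub>Gam R s\<^esub> inv\<^bsub>Gam R s\<^esub> (inv\<^bsub>Gam R s\<^esub> c R [x, z]))"
    and "d' \<equiv> lam' R x (B2' R [x, y, z]) \<otimes>\<^bsub>Gam R s\<^esub> inv\<^bsub>Gam R s\<^esub> B1' R [x, y, z] \<otimes>\<^bsub>Gam R s\<^esub> inv\<^bsub>Gam R s\<^esub>
      (inv\<^bsub>Gam R s\<^esub> c' R [x, y] \<otimes>\<^bsub>Gam R s\<^esub> m1' R [x, y] (inv\<^bsub>Gam R s\<^esub> c' R [y, z]) \<otimes>\<^bsub>Gam R s\<^esub> inv\<^bsub>Gam R s\<^esub> (inv\<^bsub>Gam R s\<^esub> c' R [x, z]))"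
  shows "(d' \<otimes>\<^bsub>Gam R s\<^esub> inv\<^bsub>Gam R s\<^esub> (theta R x \<otimes>\<^bsub>Gam R s\<^esub> r1 R x d \<otimes>\<^bsub>Gam R s\<^esub> inv\<^bsub>Gam R s\<^esub> theta R x)) \<otimes>\<^bsub>Gam R s\<^esub>
    (lam' R x n2 \<otimes>\<^bsub>Gam R s\<^esub> inv\<^bsub>Gam R s\<^esub> (theta R x \<otimes>\<^bsub>Gam R s\<^esub> n1 \<otimes>\<^bsub>Gam R s\<^esub> inv\<^bsub>Gam R s\<^esub> theta R x)) =
    fake_curvature m1' B1' R s x y z (theta R z) \<otimes>\<^bsub>Gam R s\<^esub> inv\<^bsub>Gam R s\<^esub> theta R z"
proof -
  have sub: "subfunctor X U" using U by (simp add: infinitesimally_stable_def)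
  have Axz: "nearby U R s {x, z}" "nearby U R s {z, x}" and Axy: "nearby U R s {x, y}" using nearby_mono[OF A] by auto
  have xy: "near X R x y" and xz: "near X R x z" and p: "x \<in> U R" using A by (auto simp: nearby_def)
  note f1 = frame_aut_iso[OF U F1 F1' C1 R A] and f2 = frame_aut_iso[OF U F2 F2' C2 R A]
  note d1 = comparisonD[OF U F1 F1' C1 R s] and d2 = comparisonD[OF U F2 F2' C2 R s]
    and dT = comparisonD[OF U F2 F1 T R s] and dT' = comparisonD[OF U F2' F1' T' R s]
  have th: "theta R x \<in> carrier (Gam R s)" "theta R z \<in> carrier (Gam R s)"
    "theta R z \<otimes>\<^bsub>Gam R s\<^esub> inv\<^bsub>Gam R s\<^esub> theta R x \<in> kern R s x z"
    using G_section_value[OF theta(1) sub R s Axz(1)] G_section_value(1)[OF theta(1) sub R s Axz(2)] by simp_all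
  obtain D where D: "D \<in> carrier (Gam R s)"
    "del1 R [x, y, z] \<cdot> snd kappa [x, y, z] (phi R x) = j1 R x D \<cdot> phi R x \<cdot> del2 R [x, y, z]"
    by (rule exists_curving_comparison[OF U F2 F1 T R s A])
  obtain D' where D': "D' \<in> carrier (Gam R s)"
    "del1' R [x, y, z] \<cdot> snd kappa [x, y, z] (phi' R x) = j1' R x D' \<cdot> phi' R x \<cdot> del2' R [x, y, z]"
    by (rule exists_curving_comparison[OF U F2' F1' T' R s A])
  \<comment> \<open>The curving components of the transition arrows are the values of
    \<open>delta\<close> and of its primed analogue, by the formula that solves for
    \<open>n\<close>.\<close>
  have "D = d" unfolding d_def by (rule curving_form_change(2)[OF U F2 F1 T R s A D])
  have "D' = d'" unfolding d'_def by (rule curving_form_change(2)[OF U F2' F1' T' R s A D'])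
  have k: "D \<in> kern R s x y" "D' \<in> kern R s x y" "n1 \<in> kern R s x y" "n2 \<in> kern R s x y"
    by (rule curving_form_change(1)[OF U F2 F1 T R s A D], rule curving_form_change(1)[OF U F2' F1' T' R s A D'],
        rule curving_form_change(1)[OF U F1 F1' C1 R s A n1], rule curving_form_change(1)[OF U F2 F2' C2 R s A n2])
  let ?\<nu> = "fake_curvature m1' B1' R s x y z"
  note nu = fake_curvature_NT[OF U R s frameD(3,4)[OF F1' R] A]
  have nuA: "?\<nu> \<in> carrier \<Gamma>.Aut" by (rule NA_Aut[OF R s NT_NA[OF R s nu(1)]])
  have mt: "?\<nu> (theta R x) \<in> carrier (Gam R s)" "?\<nu> (theta R z) \<in> carrier (Gam R s)"
    using \<Gamma>.Aut_closed[OF nuA] th by simp_all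
  \<comment> \<open>\<open>kappa\<close> does not change the base vertex, so \<open>theta\<close>
    occurs at \<open>x\<close> throughout, whereas the relation for \<open>eps\<close> involves it
    at \<open>x\<close> and at \<open>y\<close>.\<close>
  have E: "D' \<otimes>\<^bsub>Gam R s\<^esub> (lam' R x n2 \<otimes>\<^bsub>Gam R s\<^esub> theta R x) =
      ?\<nu> (theta R x) \<otimes>\<^bsub>Gam R s\<^esub> (n1 \<otimes>\<^bsub>Gam R s\<^esub> r1 R x D)"
    by (rule transition_functor[OF Gam_group[OF R s] kappa_functor[OF R pts_nearby[OF sub R A]]
        f1(2)[of x] f1(1)[of x] f1(4)[of x] f2(4)[of x] f1(3)[of x] f1(4)[of x]
        frameD(7)[OF F1 R A] frameD(7)[OF F1' R A] fake_curvature_semilinear[OF U F1' R s A]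
        frameD(7)[OF F2 R A] frameD(7)[OF F2' R A]
        dT(1)[OF A] dT'(1)[OF A] d1(1)[OF A] d2(1)[OF A] dT(1)[OF A] dT'(1)[OF A] d1(1)[OF A] d2(1)[OF A]
        D'(1) n2(1) th(1,1) n1(1) D(1) D'(2) n2(2) dT'(3)[OF A] theta(2)[rule_format, OF R p] theta(2)[rule_format, OF R p]
        n1(2) D(2) d1(3)[OF A]]) simp_all
  have one: "theta R x \<otimes>\<^bsub>Gam R s\<^esub> inv\<^bsub>Gam R s\<^esub> theta R x \<in> kern R s x y"
    using subgroup.one_closed[OF kern_subgroup[OF R s]] th by simp
  have "(D' \<otimes>\<^bsub>Gam R s\<^esub> inv\<^bsub>Gam R s\<^esub> (theta R x \<otimes>\<^bsub>Gam R s\<^esub> r1 R x D \<otimes>\<^bsub>Gam R s\<^esub> inv\<^bsub>Gam R s\<^esub> theta R x)) \<otimes>\<^bsub>Gam R s\<^esub>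
    (lam' R x n2 \<otimes>\<^bsub>Gam R s\<^esub> inv\<^bsub>Gam R s\<^esub> (theta R x \<otimes>\<^bsub>Gam R s\<^esub> n1 \<otimes>\<^bsub>Gam R s\<^esub> inv\<^bsub>Gam R s\<^esub> theta R x)) =
    (theta R x \<otimes>\<^bsub>Gam R s\<^esub> inv\<^bsub>Gam R s\<^esub> theta R x) \<otimes>\<^bsub>Gam R s\<^esub> (?\<nu> (theta R x) \<otimes>\<^bsub>Gam R s\<^esub> inv\<^bsub>Gam R s\<^esub> theta R x)"
    by (rule \<Gamma>.transform_along_edge[OF kern_edge[OF R s xy] k(2) NA_kern[OF R s dT'(2)[OF A] k(4)] k(3)
        NA_kern[OF R s d1(2)[OF A] k(1)] th(1,1) mt(1) NT_displacement[OF R s nu(1) th(1)] one E]) simp_all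
  also have "\<dots> = ?\<nu> (theta R x) \<otimes>\<^bsub>Gam R s\<^esub> inv\<^bsub>Gam R s\<^esub> theta R x" using th mt by simp
  \<comment> \<open>A bracket with a 2-form evaluates the section at the last vertex. Moving
    \<open>theta\<close> from \<open>x\<close> to \<open>z\<close> changes it by an element of the
    kernel of the edge \<open>x z\<close>, which the fake curvature fixes and which commutes with
    the bracket.\<close>
  also have "\<dots> = ?\<nu> (theta R z) \<otimes>\<^bsub>Gam R s\<^esub> inv\<^bsub>Gam R s\<^esub> theta R z"
  proof -
    define u where "u = theta R z \<otimes>\<^bsub>Gam R s\<^esub> inv\<^bsub>Gam R s\<^esub> theta R x"
    define w where "w = ?\<nu> (theta R x) \<otimes>\<^bsub>Gam R s\<^esub> inv\<^bsub>Gam R s\<^esub> theta R x"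
    have u: "u \<in> kern R s x z" "u \<in> carrier (Gam R s)" using th by (simp_all add: u_def)
    have w: "w \<in> kern R s x z" "w \<in> carrier (Gam R s)"
      using NT_displacement[OF R s nu(3) th(1)] th mt by (simp_all add: w_def)
    have tz: "theta R z = u \<otimes>\<^bsub>Gam R s\<^esub> theta R x" using th by (simp add: u_def \<Gamma>.m_assoc)
    have "?\<nu> (theta R z) = u \<otimes>\<^bsub>Gam R s\<^esub> ?\<nu> (theta R x)"
      unfolding tz using \<Gamma>.Aut_mult[OF nuA u(2) th(1)] NT_fixes[OF R s xz nu(3) u(1)] by simp
    then have "?\<nu> (theta R z) \<otimes>\<^bsub>Gam R s\<^esub> inv\<^bsub>Gam R s\<^esub> theta R z = u \<otimes>\<^bsub>Gam R s\<^esub> w \<otimes>\<^bsub>Gam R s\<^esub> inv\<^bsub>Gam R s\<^esub> u"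
      unfolding tz w_def using u th mt by (simp add: \<Gamma>.group_simps)
    also have "\<dots> = w" using kern_commute[OF R s xz u(1) w(1)] u w by (simp add: \<Gamma>.m_assoc)
    finally show ?thesis unfolding w_def by simp
  qed
  finally show ?thesis unfolding \<open>D = d\<close> \<open>D' = d'\<close> .
qed

end

end

section \<open>The curvature 3-form under a change of choices\<close>

context curved_gerbe
begin

context
  fixes U ob j gam del m B ob' j' gam' del' m' B' chi r e n R s x0 x1 x2 x3
  assumes U: "infinitesimally_stable X U"
    and F: "frame U ob j gam del m B" and F': "frame U ob' j' gam' del' m' B'"
    and C: "comparison U ob j gam ob' j' gam' chi r e"
    and n: "G_form X G 2 U n"
      "\<forall>R s x y z. cring R \<longrightarrow> s \<in> pts S R \<longrightarrow> nearby U R s {x, y, z} \<longrightarrow>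
        del' R [x, y, z] \<cdot> snd kappa [x, y, z] (chi R x) = j' R x (n R [x, y, z]) \<cdot> chi R x \<cdot> del R [x, y, z]"
    and R: "cring R" and s: "s \<in> pts S R" and A: "nearby U R s {x0, x1, x2, x3}"
begin

interpretation \<Gamma>: group "Gam R s" by (rule Gam_group[OF R s])
interpretation Au: group \<Gamma>.Aut by (rule \<Gamma>.Aut_group)

abbreviation "N012 \<equiv> r R x0 \<otimes>\<^bsub>\<Gamma>.Aut\<^esub> fake_curvature m B R s x0 x1 x2 \<otimes>\<^bsub>\<Gamma>.Aut\<^esub> inv\<^bsub>\<Gamma>.Aut\<^esub> r R x0"

text \<open>The assumptions of the locale are the exact laws on single edges and faces together with
  the memberships of form values in edge kernels. The second clause links the two fake curvatures
  that occur in the two versions of the equation for \<open>omega\<close>.\<close>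

lemma curvature_form_tetrahedron:
  "transformed_tetrahedron (Gam R s)
    (kern R s x0 x1) (kern R s x0 x2) (kern R s x0 x3) (kern R s x1 x2) (kern R s x1 x3) (kern R s x2 x3)
    (m' R [x0, x1]) (m' R [x1, x2]) (m' R [x0, x2]) N012 (r R x0) (r R x1) (m R [x0, x1])
    (e R [x0, x1]) (e R [x0, x2]) (e R [x0, x3]) (e R [x1, x2]) (e R [x1, x3]) (e R [x2, x3])
    (B R [x0, x1, x2]) (B R [x0, x1, x3]) (B R [x0, x2, x3]) (B R [x1, x2, x3])
    (B' R [x0, x1, x2]) (B' R [x0, x1, x3]) (B' R [x0, x2, x3]) (B' R [x1, x2, x3])
    (n R [x0, x1, x2]) (n R [x0, x1, x3]) (n R [x0, x2, x3]) (n R [x1, x2, x3])"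
  "h \<in> carrier (Gam R s) \<Longrightarrow> fake_curvature m' B' R s x0 x1 x2 h =
    N012 (n R [x0, x1, x2] \<otimes>\<^bsub>Gam R s\<^esub> h \<otimes>\<^bsub>Gam R s\<^esub> inv\<^bsub>Gam R s\<^esub> n R [x0, x1, x2])"
proof -
  have sub: "subfunctor X U" using U by (simp add: infinitesimally_stable_def)
  have A3: "nearby U R s {u, v, w}" if "u \<in> {x0, x1, x2, x3}" "v \<in> {x0, x1, x2, x3}" "w \<in> {x0, x1, x2, x3}" for u v w
    by (rule nearby_mono[OF A]) (use that in auto)
  have A2: "nearby U R s {u, v}" if "u \<in> {x0, x1, x2, x3}" "v \<in> {x0, x1, x2, x3}" for u v
    by (rule nearby_mono[OF A]) (use that in auto)
  have nr: "near X R u v" if "u \<in> {x0, x1, x2, x3}" "v \<in> {x0, x1, x2, x3}" for u v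
    using A that by (auto simp: nearby_def)
  note fm = frame_forms[OF U F F' C R s]
  have na: "m R [u, v] \<in> NA R s" "m' R [u, v] \<in> NA R s" if "u \<in> {x0, x1, x2, x3}" "v \<in> {x0, x1, x2, x3}" for u v
    using Aut_form_NA[OF sub R s fm(1) A, where xs = "[u, v]"] Aut_form_NA[OF sub R s fm(3) A, where xs = "[u, v]"] that by auto
  have rna: "r R u \<in> NA R s" if "u \<in> {x0, x1, x2, x3}" for u
    by (rule r_NA(1)[OF U F F' C R s A that])
  note Bk = form_two_kern[OF U R s fm(2)] and Ck = form_two_kern[OF U R s fm(4)] and nk = form_two_kern[OF U R s n(1)]
  note ek = e_kern[OF U F F' C R s]
  have nc: "n R [u, v, w] \<in> carrier (Gam R s)" if "nearby U R s {u, v, w}" for u v w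
    using kern_closed[OF R s nk(1)[OF that]] .
  have E: "B' R [u, v, w] \<otimes>\<^bsub>Gam R s\<^esub> n R [u, v, w] \<otimes>\<^bsub>Gam R s\<^esub> e R [u, w] =
      m' R [u, v] (e R [v, w]) \<otimes>\<^bsub>Gam R s\<^esub> e R [u, v] \<otimes>\<^bsub>Gam R s\<^esub> r R u (B R [u, v, w])"
    if a: "nearby U R s {u, v, w}" for u v w
  proof -
    have uw: "nearby U R s {u, w}" "near X R u w" using nearby_mono[OF a] a by (auto simp: nearby_def)
    have "n R [u, v, w] \<otimes>\<^bsub>Gam R s\<^esub> e R [u, w] = e R [u, w] \<otimes>\<^bsub>Gam R s\<^esub> n R [u, v, w]"
      by (rule kern_commute[OF R s uw(2) nk(3)[OF a] ek[OF uw(1)]])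
    then show ?thesis
      using curving_relation[OF U F F' C R s a nc[OF a] n(2)[rule_format, OF R s a]] e_values[OF U F F' C R s a nc[OF a] n(2)[rule_format, OF R s a]]
        m'_e_closed[OF U F F' C R s a nc[OF a] n(2)[rule_format, OF R s a]] nc[OF a] kern_closed[OF R s Ck(1)[OF a]]
        kern_closed[OF R s rB_kern(1)[OF U F F' C R s a nc[OF a] n(2)[rule_format, OF R s a]]]
      by (simp add: \<Gamma>.m_assoc)
  qed
  have a012: "nearby U R s {x0, x1, x2}" by (rule A3) simp_all
  let ?n = "n R [x0, x1, x2]" and ?\<nu> = "fake_curvature m' B' R s x0 x1 x2"
  note nuT = fake_curvature_NT[OF U R s fm(3,4) a012]
  have nuA: "?\<nu> \<in> carrier \<Gamma>.Aut" by (rule NA_Aut[OF R s NT_NA[OF R s nuT(1)]])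
  have nA: "\<Gamma>.inner ?n \<in> carrier \<Gamma>.Aut" by (rule \<Gamma>.inner_Aut[OF nc[OF a012]])
  have r0A: "r R x0 \<in> carrier \<Gamma>.Aut" by (rule NA_Aut[OF R s rna]) simp
  have "fake_curvature m B R s x0 x1 x2 \<in> carrier \<Gamma>.Aut"
    by (rule NA_Aut[OF R s NT_NA[OF R s fake_curvature_NT(1)[OF U R s fm(1,2) a012]]])
  then have NA: "N012 \<in> carrier \<Gamma>.Aut" using r0A by simp
  have nuN: "?\<nu> = N012 \<otimes>\<^bsub>\<Gamma>.Aut\<^esub> \<Gamma>.inner ?n"
    by (rule fake_curvature_change[OF U F F' C R s a012 nc[OF a012] n(2)[rule_format, OF R s a012]])
  \<comment> \<open>Solving for \<open>N012\<close> presents it as a product of automorphisms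
    already known to be small along the three edges of the face.\<close>
  have N: "N012 = ?\<nu> \<otimes>\<^bsub>\<Gamma>.Aut\<^esub> inv\<^bsub>\<Gamma>.Aut\<^esub> \<Gamma>.inner ?n"
    unfolding nuN using NA nA by (simp only: Au.m_assoc Au.r_inv Au.r_one Au.inv_closed)
  have NT: "N012 \<in> NT R s x0 x1" "N012 \<in> NT R s x1 x2" "N012 \<in> NT R s x0 x2"
    unfolding N by (intro NT_mult[OF R s] NT_inv[OF R s] NT_inner[OF R s] nuT nk[OF a012])+
  have Nn: "N012 ?n = ?n" by (rule NT_fixes[OF R s nr NT(1) nk(1)[OF a012]]) simp_all
  show nuh: "?\<nu> h = N012 (?n \<otimes>\<^bsub>Gam R s\<^esub> h \<otimes>\<^bsub>Gam R s\<^esub> inv\<^bsub>Gam R s\<^esub> ?n)" if h: "h \<in> carrier (Gam R s)" for h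
    unfolding nuN using \<Gamma>.Aut_comp[OF NA nA h] h by (simp add: \<Gamma>.inner_apply)
  have pres: "\<Gamma>.preserves {kern R s x0 x1, kern R s x0 x2, kern R s x0 x3, kern R s x1 x2, kern R s x1 x3, kern R s x2 x3} u"
    if "u \<in> NA R s" for u
    using NA_Aut[OF R s that] NA_kern[OF R s that] by (auto simp: \<Gamma>.preserves_def)
  show "transformed_tetrahedron (Gam R s)
    (kern R s x0 x1) (kern R s x0 x2) (kern R s x0 x3) (kern R s x1 x2) (kern R s x1 x3) (kern R s x2 x3)
    (m' R [x0, x1]) (m' R [x1, x2]) (m' R [x0, x2]) N012 (r R x0) (r R x1) (m R [x0, x1])
    (e R [x0, x1]) (e R [x0, x2]) (e R [x0, x3]) (e R [x1, x2]) (e R [x1, x3]) (e R [x2, x3])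
    (B R [x0, x1, x2]) (B R [x0, x1, x3]) (B R [x0, x2, x3]) (B R [x1, x2, x3])
    (B' R [x0, x1, x2]) (B' R [x0, x1, x3]) (B' R [x0, x2, x3]) (B' R [x1, x2, x3])
    (n R [x0, x1, x2]) (n R [x0, x1, x3]) (n R [x0, x2, x3]) (n R [x1, x2, x3])"
  proof (intro transformed_tetrahedron.intro tetrahedron.intro tetrahedron_axioms.intro transformed_tetrahedron_axioms.intro)
    show "group (Gam R s)" by (rule Gam_group[OF R s])
    show "\<Gamma>.edge (kern R s x0 x1)" "\<Gamma>.edge (kern R s x0 x2)" "\<Gamma>.edge (kern R s x0 x3)"
      "\<Gamma>.edge (kern R s x1 x2)" "\<Gamma>.edge (kern R s x1 x3)" "\<Gamma>.edge (kern R s x2 x3)"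
      by (rule kern_edge[OF R s nr]; simp)+
    let ?all = "{kern R s x0 x1, kern R s x0 x2, kern R s x0 x3, kern R s x1 x2, kern R s x1 x3, kern R s x2 x3}"
    show "\<Gamma>.preserves ?all (m' R [x0, x1])" "\<Gamma>.preserves ?all (m' R [x1, x2])" "\<Gamma>.preserves ?all (m' R [x0, x2])"
      "\<Gamma>.preserves ?all (m R [x0, x1])" "\<Gamma>.preserves ?all (r R x0)" "\<Gamma>.preserves ?all (r R x1)"
      by (rule pres, rule na rna; simp)+
    show "\<Gamma>.preserves ?all N012" by (rule pres[OF NT_NA[OF R s NT(1)]])
    show "e R [x0, x1] \<in> kern R s x0 x1" "e R [x0, x2] \<in> kern R s x0 x2" "e R [x0, x3] \<in> kern R s x0 x3"
      "e R [x1, x2] \<in> kern R s x1 x2" "e R [x1, x3] \<in> kern R s x1 x3" "e R [x2, x3] \<in> kern R s x2 x3"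
      by (rule ek[OF A2]; simp)+
    show "B R [x0, x1, x2] \<in> kern R s x0 x1 \<inter> kern R s x0 x2 \<inter> kern R s x1 x2"
      "B R [x0, x1, x3] \<in> kern R s x0 x1 \<inter> kern R s x0 x3 \<inter> kern R s x1 x3"
      "B R [x0, x2, x3] \<in> kern R s x0 x2 \<inter> kern R s x0 x3 \<inter> kern R s x2 x3"
      "B R [x1, x2, x3] \<in> kern R s x1 x2 \<inter> kern R s x1 x3 \<inter> kern R s x2 x3"
      by (intro IntI Bk A3; simp)+
    show "B' R [x0, x1, x2] \<in> kern R s x0 x1 \<inter> kern R s x0 x2 \<inter> kern R s x1 x2"
      "B' R [x0, x1, x3] \<in> kern R s x0 x1 \<inter> kern R s x0 x3 \<inter> kern R s x1 x3"
      "B' R [x0, x2, x3] \<in> kern R s x0 x2 \<inter> kern R s x0 x3 \<inter> kern R s x2 x3"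
      "B' R [x1, x2, x3] \<in> kern R s x1 x2 \<inter> kern R s x1 x3 \<inter> kern R s x2 x3"
      by (intro IntI Ck A3; simp)+
    show "n R [x0, x1, x2] \<in> kern R s x0 x1 \<inter> kern R s x0 x2 \<inter> kern R s x1 x2"
      "n R [x0, x1, x3] \<in> kern R s x0 x1 \<inter> kern R s x0 x3 \<inter> kern R s x1 x3"
      "n R [x0, x2, x3] \<in> kern R s x0 x2 \<inter> kern R s x0 x3 \<inter> kern R s x2 x3"
      "n R [x1, x2, x3] \<in> kern R s x1 x2 \<inter> kern R s x1 x3 \<inter> kern R s x2 x3"
      by (intro IntI nk A3; simp)+
    show "B' R [x0, x1, x2] \<otimes>\<^bsub>Gam R s\<^esub> n R [x0, x1, x2] \<otimes>\<^bsub>Gam R s\<^esub> e R [x0, x2] =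
        m' R [x0, x1] (e R [x1, x2]) \<otimes>\<^bsub>Gam R s\<^esub> e R [x0, x1] \<otimes>\<^bsub>Gam R s\<^esub> r R x0 (B R [x0, x1, x2])"
      "B' R [x0, x2, x3] \<otimes>\<^bsub>Gam R s\<^esub> n R [x0, x2, x3] \<otimes>\<^bsub>Gam R s\<^esub> e R [x0, x3] =
        m' R [x0, x2] (e R [x2, x3]) \<otimes>\<^bsub>Gam R s\<^esub> e R [x0, x2] \<otimes>\<^bsub>Gam R s\<^esub> r R x0 (B R [x0, x2, x3])"
      "B' R [x0, x1, x3] \<otimes>\<^bsub>Gam R s\<^esub> n R [x0, x1, x3] \<otimes>\<^bsub>Gam R s\<^esub> e R [x0, x3] =
        m' R [x0, x1] (e R [x1, x3]) \<otimes>\<^bsub>Gam R s\<^esub> e R [x0, x1] \<otimes>\<^bsub>Gam R s\<^esub> r R x0 (B R [x0, x1, x3])"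
      "B' R [x1, x2, x3] \<otimes>\<^bsub>Gam R s\<^esub> n R [x1, x2, x3] \<otimes>\<^bsub>Gam R s\<^esub> e R [x1, x3] =
        m' R [x1, x2] (e R [x2, x3]) \<otimes>\<^bsub>Gam R s\<^esub> e R [x1, x2] \<otimes>\<^bsub>Gam R s\<^esub> r R x1 (B R [x1, x2, x3])"
      by (rule E, rule A3; simp)+
    show "m' R [x0, x1] (r R x1 h) \<otimes>\<^bsub>Gam R s\<^esub> e R [x0, x1] = e R [x0, x1] \<otimes>\<^bsub>Gam R s\<^esub> r R x0 (m R [x0, x1] h)"
      if "h \<in> carrier (Gam R s)" for h
      by (rule connection_form_exact[OF U F F' C R s A2 that]) simp_all
    show "m' R [x0, x1] (m' R [x1, x2] h) \<otimes>\<^bsub>Gam R s\<^esub> (B' R [x0, x1, x2] \<otimes>\<^bsub>Gam R s\<^esub> n R [x0, x1, x2]) =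
        B' R [x0, x1, x2] \<otimes>\<^bsub>Gam R s\<^esub> n R [x0, x1, x2] \<otimes>\<^bsub>Gam R s\<^esub> N012 (m' R [x0, x2] h)"
      if h: "h \<in> carrier (Gam R s)" for h
    proof -
      have mc: "m' R [u, v] k \<in> carrier (Gam R s)" if "k \<in> carrier (Gam R s)" "u \<in> {x0, x1, x2, x3}" "v \<in> {x0, x1, x2, x3}" for u v k
        using \<Gamma>.Aut_closed[OF NA_Aut[OF R s na(2)[OF that(2,3)]] that(1)] .
      have bc: "B' R [x0, x1, x2] \<in> carrier (Gam R s)" "?n \<in> carrier (Gam R s)"
        using kern_closed[OF R s Ck(1)[OF a012]] nc[OF a012] by auto
      have k: "m' R [x0, x2] h \<in> carrier (Gam R s)" "m' R [x0, x1] (m' R [x1, x2] h) \<in> carrier (Gam R s)"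
        using mc h by simp_all
      have Nk: "N012 (m' R [x0, x2] h) \<in> carrier (Gam R s)" by (rule \<Gamma>.Aut_closed[OF NA k(1)])
      have "?\<nu> (m' R [x0, x2] h) = ?n \<otimes>\<^bsub>Gam R s\<^esub> N012 (m' R [x0, x2] h) \<otimes>\<^bsub>Gam R s\<^esub> inv\<^bsub>Gam R s\<^esub> ?n"
        unfolding nuh[OF k(1)] using \<Gamma>.Aut_mult[OF NA] \<Gamma>.Aut_map_inv[OF NA] bc k Nn by simp
      moreover have "m' R [x0, x1] (m' R [x1, x2] h) \<otimes>\<^bsub>Gam R s\<^esub> (B' R [x0, x1, x2] \<otimes>\<^bsub>Gam R s\<^esub> ?n) =
          (m' R [x0, x1] (m' R [x1, x2] h) \<otimes>\<^bsub>Gam R s\<^esub> B' R [x0, x1, x2]) \<otimes>\<^bsub>Gam R s\<^esub> ?n"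
        using bc k by (simp add: \<Gamma>.m_assoc)
      ultimately show ?thesis
        unfolding fake_curvature_apply[OF U R s fm(3,4) a012 h] using bc Nk by (simp add: \<Gamma>.m_assoc)
    qed
    show "N012 h \<otimes>\<^bsub>Gam R s\<^esub> inv\<^bsub>Gam R s\<^esub> h \<in> kern R s x0 x1 \<inter> kern R s x0 x2 \<inter> kern R s x1 x2"
      if "h \<in> carrier (Gam R s)" for h
      by (intro IntI NT_displacement[OF R s _ that] NT)
    show "N012 h = h" if "h \<in> kern R s x0 x2" for h
      by (rule NT_fixes[OF R s nr NT(3) that]) simp_all
    show "m' R [x0, x2] (e R [x2, x3]) \<otimes>\<^bsub>Gam R s\<^esub> inv\<^bsub>Gam R s\<^esub> e R [x2, x3] \<in> kern R s x0 x2"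
      by (rule NT_displacement[OF R s m'_NT[OF U F F' C R s A2] kern_closed[OF R s ek[OF A2]]]) simp_all
    show "m R [x0, x1] (B R [x1, x2, x3]) \<otimes>\<^bsub>Gam R s\<^esub> inv\<^bsub>Gam R s\<^esub> B R [x0, x1, x2] \<in> kern R s x0 x3"
      by (rule twisted_form_two_last[OF U fm(2,1) R s A])
    show "m' R [x0, x1] (n R [x1, x2, x3]) \<otimes>\<^bsub>Gam R s\<^esub> inv\<^bsub>Gam R s\<^esub> n R [x0, x1, x2] \<in> kern R s x0 x3"
      by (rule twisted_form_two_last[OF U n(1) fm(3) R s A])
  qed
qed

lemma curvature_form_change:
  "\<Gamma>.coboundary (B' R [x1, x2, x3]) (B' R [x0, x2, x3]) (B' R [x0, x1, x3]) (B' R [x0, x1, x2]) (m' R [x0, x1] (B' R [x1, x2, x3])) =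
   r R x0 (\<Gamma>.coboundary (B R [x1, x2, x3]) (B R [x0, x2, x3]) (B R [x0, x1, x3]) (B R [x0, x1, x2]) (m R [x0, x1] (B R [x1, x2, x3])))
     \<otimes>\<^bsub>Gam R s\<^esub> (N012 (e R [x2, x3]) \<otimes>\<^bsub>Gam R s\<^esub> inv\<^bsub>Gam R s\<^esub> e R [x2, x3]) \<otimes>\<^bsub>Gam R s\<^esub>
     inv\<^bsub>Gam R s\<^esub> (\<Gamma>.coboundary (n R [x1, x2, x3]) (n R [x0, x2, x3]) (n R [x0, x1, x3]) (n R [x0, x1, x2]) (m' R [x0, x1] (n R [x1, x2, x3])))"
  by (rule transformed_tetrahedron.curvature_transformation[OF curvature_form_tetrahedron(1)])

text \<open>Here the bracket uses the primed fake curvature, and \<open>\<mu>\<close>, which is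
  \<open>m'\<close> without its inner part, differentiates \<open>n\<close>. The required relation
  between \<open>\<mu>\<close> and \<open>m'\<close> is the law of the connection on the edge
  \<open>x0 x1\<close>.\<close>

lemma curvature_form_change':
  defines "\<mu> \<equiv> r R x0 \<otimes>\<^bsub>\<Gamma>.Aut\<^esub> m R [x0, x1] \<otimes>\<^bsub>\<Gamma>.Aut\<^esub> inv\<^bsub>\<Gamma>.Aut\<^esub> r R x0 \<otimes>\<^bsub>\<Gamma>.Aut\<^esub> (r R x0 \<otimes>\<^bsub>\<Gamma>.Aut\<^esub> inv\<^bsub>\<Gamma>.Aut\<^esub> r R x1)"
  shows "\<Gamma>.coboundary (B' R [x1, x2, x3]) (B' R [x0, x2, x3]) (B' R [x0, x1, x3]) (B' R [x0, x1, x2]) (m' R [x0, x1] (B' R [x1, x2, x3])) =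
   r R x0 (\<Gamma>.coboundary (B R [x1, x2, x3]) (B R [x0, x2, x3]) (B R [x0, x1, x3]) (B R [x0, x1, x2]) (m R [x0, x1] (B R [x1, x2, x3])))
     \<otimes>\<^bsub>Gam R s\<^esub> (fake_curvature m' B' R s x0 x1 x2 (e R [x2, x3]) \<otimes>\<^bsub>Gam R s\<^esub> inv\<^bsub>Gam R s\<^esub> e R [x2, x3]) \<otimes>\<^bsub>Gam R s\<^esub>
     inv\<^bsub>Gam R s\<^esub> (\<Gamma>.coboundary (n R [x1, x2, x3]) (n R [x0, x2, x3]) (n R [x0, x1, x3]) (n R [x0, x1, x2]) (\<mu> (n R [x1, x2, x3])))"
proof -
  have A2: "nearby U R s {x0, x1}" and A3: "nearby U R s {x1, x2, x3}" using nearby_mono[OF A] by auto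
  note \<mu> = connection_form_change(1,2)[OF U F F' C R s A2]
  have "\<mu> (n R [x1, x2, x3]) \<in> kern R s x1 x2 \<inter> kern R s x1 x3 \<inter> kern R s x2 x3"
    unfolding \<mu>_def by (intro IntI NA_kern[OF R s \<mu>(1)] form_two_kern[OF U R s n(1) A3])
  then show ?thesis
    by (intro transformed_tetrahedron.curvature_transformation'[OF curvature_form_tetrahedron(1) curvature_form_tetrahedron(2)])
      (use \<mu>(2) in \<open>simp_all add: \<mu>_def\<close>)
qed

end

end

section \<open>The comparison equations\<close>

lemma infinitesimally_stable_inter2:
  assumes "infinitesimally_stable X (U i)" "infinitesimally_stable X (U l)"
  shows "infinitesimally_stable X (inter2 U i l)"
  using assms unfolding infinitesimally_stable_def subfunctor_def inter2_def by blast

lemma length_eq_2_3_4: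
  "length xs = Suc 1 \<Longrightarrow> \<exists>x y. xs = [x, y]" "length xs = Suc 2 \<Longrightarrow> \<exists>x y z. xs = [x, y, z]"
  "length xs = Suc 3 \<Longrightarrow> \<exists>x y z w. xs = [x, y, z, w]"
  by (auto simp: numeral_eq_Suc length_Suc_conv)

context group_scheme_over
begin

text \<open>A simplex is nonempty, so \<open>s\<close> can be taken to be the image of its first
  vertex; closeness makes it the image of every other vertex.\<close>

lemma form_eqI:
  assumes U: "subfunctor X U"
    and eq: "\<And>R s xs. cring R \<Longrightarrow> s \<in> pts S R \<Longrightarrow> length xs = Suc n \<Longrightarrow> nearby U R s (set xs) \<Longrightarrow> \<omega> R xs = \<omega>' R xs"
  shows "form_eq X n U \<omega> \<omega>'"
  unfolding form_eq_def
proof (intro allI impI ballI)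
  fix R xs assume R: "cring R" and "xs \<in> pts (simplex X n U) R"
  then have xs: "length xs = Suc n" "set xs \<subseteq> U R" "\<forall>x\<in>set xs. \<forall>y\<in>set xs. near X R x y"
    by (simp_all add: simplex_iff)
  have h: "hd xs \<in> set xs" using xs(1) by (cases xs) auto
  then have "str X R (hd xs) \<in> pts S R"
    using scheme_over_str(1)[OF X_over R] subfunctor_pts[OF U R] xs(2) by blast
  moreover have "nearby U R (str X R (hd xs)) (set xs)"
    using xs h unfolding nearby_def near_def by blast
  ultimately show "\<omega> R xs = \<omega>' R xs" using eq[OF R _ xs(1)] by blast
qed

lemma form_eq_degree:
  assumes U: "subfunctor X U"
  shows "(\<And>R s x y. cring R \<Longrightarrow> s \<in> pts S R \<Longrightarrow> nearby U R s {x, y} \<Longrightarrow> \<omega> R [x, y] = \<omega>' R [x, y]) \<Longrightarrow>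
      form_eq X 1 U \<omega> \<omega>'"
    "(\<And>R s x y z. cring R \<Longrightarrow> s \<in> pts S R \<Longrightarrow> nearby U R s {x, y, z} \<Longrightarrow> \<omega> R [x, y, z] = \<omega>' R [x, y, z]) \<Longrightarrow>
      form_eq X 2 U \<omega> \<omega>'"
    "(\<And>R s x y z w. cring R \<Longrightarrow> s \<in> pts S R \<Longrightarrow> nearby U R s {x, y, z, w} \<Longrightarrow> \<omega> R [x, y, z, w] = \<omega>' R [x, y, z, w]) \<Longrightarrow>
      form_eq X 3 U \<omega> \<omega>'"
  subgoal by (rule form_eqI[OF U]) (use length_eq_2_3_4(1) in fastforce)
  subgoal by (rule form_eqI[OF U]) (use length_eq_2_3_4(2) in fastforce)
  subgoal by (rule form_eqI[OF U]) (use length_eq_2_3_4(3) in fastforce)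
  done

lemma form_values:
  assumes "nearby U R s A" "x \<in> A"
  shows "G_val X G R (x # xs) = Gam R s" "Aut_val X G R (x # xs) = AutoGroup (Gam R s)"
  using assms by (simp_all add: G_val_def Aut_val_def G_at_def nearby_def)

text \<open>In degree 2 the fold runs over the four faces, and the bracket with a 1-form pairs the
  edge \<open>[x0, x1]\<close> with the face \<open>[x1, x2, x3]\<close>.\<close>

lemma twisted_d_two:
  assumes A: "nearby U R s {x0, x1, x2, x3}" and R: "cring R" and s: "s \<in> pts S R"
  shows "twisted_d (G_val X G) 2 m B R [x0, x1, x2, x3] =
    group.coboundary (Gam R s) (B R [x1, x2, x3]) (B R [x0, x2, x3]) (B R [x0, x1, x3]) (B R [x0, x1, x2])
      (m R [x0, x1] (B R [x1, x2, x3]))"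
proof -
  interpret group "Gam R s" by (rule Gam_group[OF R s])
  have "[0..<4] = [0, 1, 2, 3]" by (simp add: upt_rec)
  then show ?thesis
    using form_values[OF A, of x0]
    by (simp add: twisted_d_def fadd_def de_rham_def bracket_def face_def coboundary_def)
qed

lemma inner_form_value:
  assumes A: "nearby U R s A" "x \<in> A" and R: "cring R" and s: "s \<in> pts S R"
  shows "inner_form (G_val X G) w R (x # xs) = group.inner (Gam R s) (w R (x # xs))"
  using form_values[OF A] group.inner_def[OF Gam_group[OF R s]] by (simp add: inner_form_def)

end

context curved_gerbe
begin

lemma frame_of_choices:
  assumes lc: "local_choices X P eps eta kappa tau I U x phi gam del"
    and ld: "local_data X G P eps K kappa I U j x phi gam del lam g m gamma B nu delta omega"
    and j: "Aut_iso X G P (sub X (U i)) (\<lambda>p. p) (x i) (j i)" and i: "i \<in> I"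
  shows "frame (U i) (fst (x i)) (j i) (gam i) (del i) (m i) (B i)"
proof -
  have 1: "on_fibre R p (fst (x i) R p)" "aut_iso (Gam R (str X R p)) (fst (x i) R p) (j i R p)"
    if "cring R" "p \<in> U i R" for R p
    using lc i that j unfolding local_choices_def sect_obj_def Aut_iso_def
    by (auto simp: on_fibre_def aut_iso_def G_at_def sub_def)
  have 2: "vertical P (fst eps xs (fst (x i) R (xs ! 1))) (fst (x i) R (xs ! 0)) (gam i R xs)"
    if "cring R" "xs \<in> pts (simplex X 1 (U i)) R" for R xs
    using lc i that unfolding local_choices_def sect_arrow_def by (auto simp: mor_app_def sect_pull_def)
  have 3: "vertical P (fst kappa xs (fst (x i) R (xs ! 0))) (fst (x i) R (xs ! 0)) (del i R xs)"
    if "cring R" "xs \<in> pts (simplex X 2 (U i)) R" for R xs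
    using lc i that unfolding local_choices_def sect_arrow_def by (auto simp: mor_app_def sect_pull_def)
  show ?thesis
    unfolding frame_def
    using 1 2 3 ld i unfolding local_data_def Let_def G_at_def by simp
qed

text \<open>The relations that define \<open>lam i l\<close> and \<open>gamma i l\<close> are those
  of a comparison along \<open>phi i l\<close>, leading from the frame of index \<open>l\<close> to
  the frame of index \<open>i\<close>.\<close>

lemma comparison_of_transition:
  assumes lc: "local_choices X P eps eta kappa tau I U x phi gam del"
    and ld: "local_data X G P eps K kappa I U j x phi gam del lam g m gamma B nu delta omega"
    and il: "i \<in> I" "l \<in> I"
  shows "comparison (inter2 U i l) (fst (x l)) (j l) (gam l) (fst (x i)) (j i) (gam i) (phi i l) (lam i l) (gamma i l)"
proof -
  have 1: "vertical P (fst (x l) R p) (fst (x i) R p) (phi i l R p)" if "cring R" "p \<in> inter2 U i l R" for R p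
    using lc il that unfolding local_choices_def sect_arrow_def by (auto simp: sub_def)
  show ?thesis
    unfolding comparison_def using 1 ld il unfolding local_data_def Let_def G_at_def by simp
qed

lemma comparison_of_arrows:
  assumes \<chi>: "sect_arrow P (sub X (U i)) (x i) (x' i) (chi i)"
    and cd: "comparison_data X G P eps kappa I U j phi gam del j' phi' gam' del' chi r theta e n"
    and i: "i \<in> I"
  shows "comparison (U i) (fst (x i)) (j i) (gam i) (fst (x' i)) (j' i) (gam' i) (chi i) (r i) (e i)"
    "nearby (U i) R s {p, q, w} \<Longrightarrow> cring R \<Longrightarrow> del' i R [p, q, w] \<cdot> snd kappa [p, q, w] (chi i R p) =
      j' i R p (n i R [p, q, w]) \<cdot> chi i R p \<cdot> del i R [p, q, w]"
proof -
  have 1: "vertical P (fst (x i) R p) (fst (x' i) R p) (chi i R p)" if "cring R" "p \<in> U i R" for R p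
    using \<chi> that unfolding sect_arrow_def by (auto simp: sub_def)
  show "comparison (U i) (fst (x i)) (j i) (gam i) (fst (x' i)) (j' i) (gam' i) (chi i) (r i) (e i)"
    unfolding comparison_def using 1 cd i unfolding comparison_data_def Let_def G_at_def by simp
  assume A: "nearby (U i) R s {p, q, w}" and R: "cring R"
  have xs: "[p, q, w] \<in> pts (simplex X 2 (U i)) R" by (rule simplex_nearby[OF A]) simp_all
  have "\<forall>R. cring R \<longrightarrow> (\<forall>xs\<in>pts (simplex X 2 (U i)) R.
           del' i R xs \<cdot> snd kappa xs (chi i R (xs ! 0)) =
           j' i R (xs ! 0) (n i R xs) \<cdot> chi i R (xs ! 0) \<cdot> del i R xs)"
    using cd i unfolding comparison_data_def by blast
  then show "del' i R [p, q, w] \<cdot> snd kappa [p, q, w] (chi i R p) =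
      j' i R p (n i R [p, q, w]) \<cdot> chi i R p \<cdot> del i R [p, q, w]"
    using R xs by fastforce
qed

end

theorem mainTheorem2:
  fixes S :: "('u, 's) psh"
    and X :: "('u, 'x, 's) over_sch"
    and G :: "('u, 'g, 's) group_sch"
    and J :: "'u ring \<Rightarrow> 'u sieve set"
    and P :: "('u, 'x, 'o, 'a) fibcat"
    and iota :: "('u ring \<Rightarrow> 'x set) \<Rightarrow> ('u, 'x, 'o, 'a) sect \<Rightarrow> 'u ring \<Rightarrow> 'x \<Rightarrow> 'g \<Rightarrow> 'a"
    and I :: "'i set"
    and U :: "'i \<Rightarrow> 'u ring \<Rightarrow> 'x set"
  assumes "infinite (UNIV :: 'u set)"
    and "is_scheme S" and "two_three_invertible S"
    and "smooth_scheme S X"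
    and "flat_group_scheme S G"
    and "grothendieck_topology J" and "\<And>R. cring R \<Longrightarrow> zariski R \<subseteq> J R"
    and "connected_gerbe J X G P iota"
    and "connection X P eps eta"
    and "curving X P eps eta K kappa tau"
    and "open_cover X I U"
    and "local_choices X P eps eta kappa tau I U x phi gam del"
    and "local_choices X P eps eta kappa tau I U x' phi' gam' del'"
    and "local_data X G P eps K kappa I U (\<lambda>i. iota (U i) (x i)) x phi gam del
           lam g m gamma B nu delta omega"
    and "local_data X G P eps K kappa I U (\<lambda>i. iota (U i) (x' i)) x' phi' gam' del'
           lam' g' m' gamma' B' nu' delta' omega'"
    and "\<And>i. i \<in> I \<Longrightarrow> sect_arrow P (sub X (U i)) (x i) (x' i) (chi i)"
    and "comparison_data X G P eps kappa I U
           (\<lambda>i. iota (U i) (x i)) phi gam del (\<lambda>i. iota (U i) (x' i)) phi' gam' del'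
           chi r theta e n"
  shows "let M = G_val X G; A = Aut_val X G;
             mu = (\<lambda>i. conj_form A (r i) (m i) \<boxplus>\<^bsub>A\<^esub> u_du_inv A (r i)) in
    (\<forall>i\<in>I. form_eq X 1 (U i) (m' i)
       (conj_form A (r i) (m i) \<boxplus>\<^bsub>A\<^esub> u_du_inv A (r i) \<boxplus>\<^bsub>A\<^esub> inner_form M (e i))) \<and>
    (\<forall>i\<in>I. \<forall>j\<in>I. form_eq X 1 (inter2 U i j)
       ((gamma' i j \<boxminus>\<^bsub>M\<^esub> conj_form M (theta i j) (act_form (r i) (gamma i j))) \<boxplus>\<^bsub>M\<^esub>
        (act_form (lam' i j) (e j) \<boxminus>\<^bsub>M\<^esub> conj_form M (theta i j) (e i)))
       (dlog_right M (theta i j) \<boxplus>\<^bsub>M\<^esub> bracket M 1 (m' i) (zero_form (theta i j)))) \<and>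
    (\<forall>i\<in>I. form_eq X 2 (U i) (B' i)
       (act_form (r i) (B i) \<boxminus>\<^bsub>M\<^esub> twisted_d1 M (m' i) (fneg M (e i)) \<boxminus>\<^bsub>M\<^esub> n i)) \<and>
    (\<forall>i\<in>I. form_eq X 2 (U i) (nu' i)
       (conj_form A (r i) (nu i) \<boxplus>\<^bsub>A\<^esub> inner_form M (n i))) \<and>
    (\<forall>i\<in>I. \<forall>j\<in>I. form_eq X 2 (inter2 U i j)
       ((delta' i j \<boxminus>\<^bsub>M\<^esub> conj_form M (theta i j) (act_form (r i) (delta i j))) \<boxplus>\<^bsub>M\<^esub>
        (act_form (lam' i j) (n j) \<boxminus>\<^bsub>M\<^esub> conj_form M (theta i j) (n i)))
       (bracket M 2 (nu' i) (zero_form (theta i j)))) \<and>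
    (\<forall>i\<in>I. form_eq X 3 (U i) (omega' i)
       (act_form (r i) (omega i) \<boxplus>\<^bsub>M\<^esub> bracket M 2 (conj_form A (r i) (nu i)) (e i)
          \<boxminus>\<^bsub>M\<^esub> twisted_d M 2 (m' i) (n i))) \<and>
    (\<forall>i\<in>I. form_eq X 3 (U i) (omega' i)
       (act_form (r i) (omega i) \<boxplus>\<^bsub>M\<^esub> bracket M 2 (nu' i) (e i)
          \<boxminus>\<^bsub>M\<^esub> twisted_d M 2 (mu i) (n i)))"
proof -
  interpret curved_gerbe S X G P eps eta K kappa tau
  proof
    show "infinite (UNIV :: 'u set)" "is_scheme S" "connection X P eps eta" "curving X P eps eta K kappa tau"
      by (fact assms)+
    show "scheme_over S X" "group_scheme S G" "fibred_in_groupoids X P"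
      using assms by (simp_all add: smooth_scheme_def flat_group_scheme_def connected_gerbe_def gerbe_def stack_def)
  qed
  note lc = assms(12) and lc' = assms(13) and ld = assms(14) and ld' = assms(15) and cd = assms(17)
  have opn: "open_sub X (U i)" if "i \<in> I" for i using assms(11) that by (simp add: open_cover_def)
  have U: "infinitesimally_stable X (U i)" if "i \<in> I" for i by (rule open_sub_stable[OF X_psh opn[OF that]])
  have U2: "infinitesimally_stable X (inter2 U i l)" if "i \<in> I" "l \<in> I" for i l
    by (rule infinitesimally_stable_inter2[OF U U]) (use that in auto)
  have Us: "subfunctor X (U i)" if "i \<in> I" for i using U[OF that] by (simp add: infinitesimally_stable_def)
  have U2s: "subfunctor X (inter2 U i l)" if "i \<in> I" "l \<in> I" for i l
    using U2[OF that] by (simp add: infinitesimally_stable_def)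
  have int1: "inter2 U i l R \<subseteq> U i R" and int2: "inter2 U i l R \<subseteq> U l R" for i l R by (auto simp: inter2_def)
  have iota: "Aut_iso X G P (sub X (U i)) (\<lambda>p. p) \<sigma> (iota (U i) \<sigma>)"
    if "i \<in> I" "sect_obj P (sub X (U i)) (\<lambda>p. p) \<sigma>" for i \<sigma>
    using assms(8) opn[OF that(1)] that(2) unfolding connected_gerbe_def gerbe_def by blast
  have ji: "Aut_iso X G P (sub X (U i)) (\<lambda>p. p) (x i) (iota (U i) (x i))"
    "Aut_iso X G P (sub X (U i)) (\<lambda>p. p) (x' i) (iota (U i) (x' i))" if "i \<in> I" for i
    using iota[OF that] lc lc' that by (auto simp: local_choices_def)
  have F: "frame (U i) (fst (x i)) (iota (U i) (x i)) (gam i) (del i) (m i) (B i)"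
    and F': "frame (U i) (fst (x' i)) (iota (U i) (x' i)) (gam' i) (del' i) (m' i) (B' i)" if "i \<in> I" for i
    using frame_of_choices[OF lc ld ji(1)] frame_of_choices[OF lc' ld' ji(2)] that by simp_all
  have C: "comparison (U i) (fst (x i)) (iota (U i) (x i)) (gam i) (fst (x' i)) (iota (U i) (x' i)) (gam' i) (chi i) (r i) (e i)"
    if "i \<in> I" for i
    by (rule comparison_of_arrows(1)[OF assms(16) cd]) (use that in simp_all)
  have Cn: "\<forall>R s p q w. cring R \<longrightarrow> s \<in> pts S R \<longrightarrow> nearby (U i) R s {p, q, w} \<longrightarrow> del' i R [p, q, w] \<cdot> snd kappa [p, q, w] (chi i R p) =
      iota (U i) (x' i) R p (n i R [p, q, w]) \<cdot> chi i R p \<cdot> del i R [p, q, w]"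
    if "i \<in> I" for i
    by (intro allI impI, rule comparison_of_arrows(2)[OF assms(16) cd]) (use that in simp_all)
  \<comment> \<open>On an overlap the frames of both indices and both families of comparison arrows
    are used; restriction merely shrinks the set of simplices.\<close>
  note F_1 = frame_subset[OF F int1] and F_2 = frame_subset[OF F int2]
  note F_1' = frame_subset[OF F' int1] and F_2' = frame_subset[OF F' int2]
  note C_1 = comparison_subset[OF C int1] and C_2 = comparison_subset[OF C int2]
  note T = comparison_of_transition[OF lc ld] and T' = comparison_of_transition[OF lc' ld']
  have n: "G_form X G 2 (U i) (n i)" if "i \<in> I" for i using cd that by (simp add: comparison_data_def)
  have theta: "G_section X G (sub X (inter2 U i l)) (\<lambda>p. p) (theta i l)"
    "\<forall>R p. cring R \<longrightarrow> p \<in> inter2 U i l R \<longrightarrow>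
      phi' i l R p \<cdot> chi l R p = iota (U i) (x' i) R p (theta i l R p) \<cdot> chi i R p \<cdot> phi i l R p"
    if "i \<in> I" "l \<in> I" for i l
    using cd that by (simp_all add: comparison_data_def)
  have nu: "nu i = curvature (Aut_val X G) (m i) \<boxminus>\<^bsub>Aut_val X G\<^esub> inner_form (G_val X G) (B i)"
    "nu' i = curvature (Aut_val X G) (m' i) \<boxminus>\<^bsub>Aut_val X G\<^esub> inner_form (G_val X G) (B' i)"
    and omega: "omega i = twisted_d (G_val X G) 2 (m i) (B i)" "omega' i = twisted_d (G_val X G) 2 (m' i) (B' i)"
    if "i \<in> I" for i
    using ld ld' that by (simp_all add: local_data_def Let_def)
  have delta: "delta i l = act_form (lam i l) (B l) \<boxminus>\<^bsub>G_val X G\<^esub> B i \<boxminus>\<^bsub>G_val X G\<^esub>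
      twisted_d1 (G_val X G) (m i) (fneg (G_val X G) (gamma i l))"
    "delta' i l = act_form (lam' i l) (B' l) \<boxminus>\<^bsub>G_val X G\<^esub> B' i \<boxminus>\<^bsub>G_val X G\<^esub>
      twisted_d1 (G_val X G) (m' i) (fneg (G_val X G) (gamma' i l))"
    if "i \<in> I" "l \<in> I" for i l
    using ld ld' that by (simp_all add: local_data_def Let_def)
  \<comment> \<open>The open set \<open>V\<close> is left free so that the formula can be used on
    \<open>U i\<close> and on overlaps alike.\<close>
  have nu_value: "nu i R [p, q, w] = fake_curvature (m i) (B i) R s p q w"
    "nu' i R [p, q, w] = fake_curvature (m' i) (B' i) R s p q w"
    if "i \<in> I" "cring R" "s \<in> pts S R" "nearby V R s A" "p \<in> A" for i R s V A p q w
    using form_values[OF that(4,5)] inner_form_value[OF that(4,5,2,3)]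
    by (simp_all add: nu[OF that(1)] fsub_def fadd_def fneg_def curvature_def fake_curvature_def)
  note form_ops = fadd_def fsub_def fneg_def conj_form_def act_form_def u_du_inv_def dlog_right_def bracket_def zero_form_def
    twisted_d1_def
  have 1: "form_eq X 1 (U i) (m' i) (conj_form (Aut_val X G) (r i) (m i) \<boxplus>\<^bsub>Aut_val X G\<^esub>
      u_du_inv (Aut_val X G) (r i) \<boxplus>\<^bsub>Aut_val X G\<^esub> inner_form (G_val X G) (e i))" if i: "i \<in> I" for i
  proof (rule form_eq_degree(1)[OF Us[OF i]])
    fix R s p q assume R: "cring R" and s: "s \<in> pts S R" and A: "nearby (U i) R s {p, q}"
    show "m' i R [p, q] = (conj_form (Aut_val X G) (r i) (m i) \<boxplus>\<^bsub>Aut_val X G\<^esub>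
      u_du_inv (Aut_val X G) (r i) \<boxplus>\<^bsub>Aut_val X G\<^esub> inner_form (G_val X G) (e i)) R [p, q]"
      using connection_form_change(3)[OF U[OF i] F[OF i] F'[OF i] C[OF i] R s A]
        form_values[OF A, of p] inner_form_value[OF A _ R s, of p] by (simp add: form_ops)
  qed
  have 2: "form_eq X 1 (inter2 U i j)
       ((gamma' i j \<boxminus>\<^bsub>G_val X G\<^esub> conj_form (G_val X G) (theta i j) (act_form (r i) (gamma i j))) \<boxplus>\<^bsub>G_val X G\<^esub>
        (act_form (lam' i j) (e j) \<boxminus>\<^bsub>G_val X G\<^esub> conj_form (G_val X G) (theta i j) (e i)))
       (dlog_right (G_val X G) (theta i j) \<boxplus>\<^bsub>G_val X G\<^esub> bracket (G_val X G) 1 (m' i) (zero_form (theta i j)))"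
    if i: "i \<in> I" and j: "j \<in> I" for i j
  proof (rule form_eq_degree(1)[OF U2s[OF i j]])
    fix R s p q assume R: "cring R" and s: "s \<in> pts S R" and A: "nearby (inter2 U i j) R s {p, q}"
    show "((gamma' i j \<boxminus>\<^bsub>G_val X G\<^esub> conj_form (G_val X G) (theta i j) (act_form (r i) (gamma i j))) \<boxplus>\<^bsub>G_val X G\<^esub>
        (act_form (lam' i j) (e j) \<boxminus>\<^bsub>G_val X G\<^esub> conj_form (G_val X G) (theta i j) (e i))) R [p, q] =
       (dlog_right (G_val X G) (theta i j) \<boxplus>\<^bsub>G_val X G\<^esub> bracket (G_val X G) 1 (m' i) (zero_form (theta i j))) R [p, q]"
      using transition_change[OF U2[OF i j] F_1[OF i] F_1'[OF i] F_2[OF j] F_2'[OF j] C_1[OF i] C_2[OF j]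
          T[OF i j] T'[OF i j] theta[OF i j] R s A] form_values[OF A, of p] by (simp add: form_ops)
  qed
  have 3: "form_eq X 2 (U i) (B' i)
       (act_form (r i) (B i) \<boxminus>\<^bsub>G_val X G\<^esub> twisted_d1 (G_val X G) (m' i) (fneg (G_val X G) (e i)) \<boxminus>\<^bsub>G_val X G\<^esub> n i)"
    and 4: "form_eq X 2 (U i) (nu' i) (conj_form (Aut_val X G) (r i) (nu i) \<boxplus>\<^bsub>Aut_val X G\<^esub> inner_form (G_val X G) (n i))"
    if i: "i \<in> I" for i
  proof -
    note v = curving_form_change(3)[OF U[OF i] F[OF i] F'[OF i] C[OF i]]
      fake_curvature_change[OF U[OF i] F[OF i] F'[OF i] C[OF i]]
    show "form_eq X 2 (U i) (B' i)
       (act_form (r i) (B i) \<boxminus>\<^bsub>G_val X G\<^esub> twisted_d1 (G_val X G) (m' i) (fneg (G_val X G) (e i)) \<boxminus>\<^bsub>G_val X G\<^esub> n i)"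
    proof (rule form_eq_degree(2)[OF Us[OF i]])
      fix R s p q w assume R: "cring R" and s: "s \<in> pts S R" and A: "nearby (U i) R s {p, q, w}"
      have nv: "n i R [p, q, w] \<in> carrier (Gam R s)" by (rule G_form_value(1)[OF n[OF i] R A]) simp_all
      \<comment> \<open>\<open>twisted_d1\<close> of a negated form inverts in the groups attached
        to the single edges, so these have to be identified with \<open>Gam R s\<close> as
        well.\<close>
      have v1: "G_val X G R [p, q] = Gam R s" "G_val X G R [q, w] = Gam R s" "G_val X G R [p, w] = Gam R s"
        "G_val X G R [p, q, w] = Gam R s" using form_values[OF A] by simp_all
      show "B' i R [p, q, w] = (act_form (r i) (B i) \<boxminus>\<^bsub>G_val X G\<^esub>
          twisted_d1 (G_val X G) (m' i) (fneg (G_val X G) (e i)) \<boxminus>\<^bsub>G_val X G\<^esub> n i) R [p, q, w]"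
        using v(1)[OF R s A nv Cn[OF i, rule_format, OF R s A]] v1 by (simp add: form_ops)
    qed
    show "form_eq X 2 (U i) (nu' i)
        (conj_form (Aut_val X G) (r i) (nu i) \<boxplus>\<^bsub>Aut_val X G\<^esub> inner_form (G_val X G) (n i))"
    proof (rule form_eq_degree(2)[OF Us[OF i]])
      fix R s p q w assume R: "cring R" and s: "s \<in> pts S R" and A: "nearby (U i) R s {p, q, w}"
      have nv: "n i R [p, q, w] \<in> carrier (Gam R s)" by (rule G_form_value(1)[OF n[OF i] R A]) simp_all
      show "nu' i R [p, q, w] =
          (conj_form (Aut_val X G) (r i) (nu i) \<boxplus>\<^bsub>Aut_val X G\<^esub> inner_form (G_val X G) (n i)) R [p, q, w]"
        using v(2)[OF R s A nv Cn[OF i, rule_format, OF R s A]] form_values[OF A, of p] inner_form_value[OF A _ R s, of p]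
          nu_value[OF i R s A, of p] by (simp add: form_ops)
    qed
  qed
  have 5: "form_eq X 2 (inter2 U i j)
       ((delta' i j \<boxminus>\<^bsub>G_val X G\<^esub> conj_form (G_val X G) (theta i j) (act_form (r i) (delta i j))) \<boxplus>\<^bsub>G_val X G\<^esub>
        (act_form (lam' i j) (n j) \<boxminus>\<^bsub>G_val X G\<^esub> conj_form (G_val X G) (theta i j) (n i)))
       (bracket (G_val X G) 2 (nu' i) (zero_form (theta i j)))"
    if i: "i \<in> I" and j: "j \<in> I" for i j
  proof (rule form_eq_degree(2)[OF U2s[OF i j]])
    fix R s p q w assume R: "cring R" and s: "s \<in> pts S R" and A: "nearby (inter2 U i j) R s {p, q, w}"
    have A1: "nearby (U i) R s {p, q, w}" and A2: "nearby (U j) R s {p, q, w}"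
      using A by (auto simp: nearby_def inter2_def)
    have nv: "n i R [p, q, w] \<in> carrier (Gam R s)" "n j R [p, q, w] \<in> carrier (Gam R s)"
      using G_form_value(1)[OF n[OF i] R A1] G_form_value(1)[OF n[OF j] R A2] by simp_all
    have v1: "G_val X G R [p, q] = Gam R s" "G_val X G R [q, w] = Gam R s" "G_val X G R [p, w] = Gam R s"
      "G_val X G R [p, q, w] = Gam R s" using form_values[OF A] by simp_all
    have nuv: "nu' i R [p, q, w] = fake_curvature (m' i) (B' i) R s p q w" by (rule nu_value(2)[OF i R s A]) simp
    note w = curving_transition_change[OF U2[OF i j] F_1[OF i] F_1'[OF i] F_2[OF j] F_2'[OF j]
        C_1[OF i] C_2[OF j] T[OF i j] T'[OF i j] theta[OF i j] R s A]
    note v = w[OF nv(1), OF Cn[OF i, rule_format, OF R s A1], OF nv(2), OF Cn[OF j, rule_format, OF R s A2]]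
    show "((delta' i j \<boxminus>\<^bsub>G_val X G\<^esub> conj_form (G_val X G) (theta i j) (act_form (r i) (delta i j))) \<boxplus>\<^bsub>G_val X G\<^esub>
        (act_form (lam' i j) (n j) \<boxminus>\<^bsub>G_val X G\<^esub> conj_form (G_val X G) (theta i j) (n i))) R [p, q, w] =
       (bracket (G_val X G) 2 (nu' i) (zero_form (theta i j))) R [p, q, w]"
      using v by (simp add: form_ops delta[OF i j] v1 nuv)
  qed
  have 6: "form_eq X 3 (U i) (omega' i)
       (act_form (r i) (omega i) \<boxplus>\<^bsub>G_val X G\<^esub> bracket (G_val X G) 2 (conj_form (Aut_val X G) (r i) (nu i)) (e i)
          \<boxminus>\<^bsub>G_val X G\<^esub> twisted_d (G_val X G) 2 (m' i) (n i))"
    and 7: "form_eq X 3 (U i) (omega' i)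
       (act_form (r i) (omega i) \<boxplus>\<^bsub>G_val X G\<^esub> bracket (G_val X G) 2 (nu' i) (e i)
          \<boxminus>\<^bsub>G_val X G\<^esub> twisted_d (G_val X G) 2
            (conj_form (Aut_val X G) (r i) (m i) \<boxplus>\<^bsub>Aut_val X G\<^esub> u_du_inv (Aut_val X G) (r i)) (n i))" if i: "i \<in> I" for i
  proof -
    \<comment> \<open>Both versions are read off on one tetrahedron: the first from the conjugated
      fake curvature and \<open>m'\<close>, the second from the primed fake curvature and
      \<open>m'\<close> without its inner part.\<close>
    have val: "omega' i R [p, q, w, z] = (act_form (r i) (omega i) \<boxplus>\<^bsub>G_val X G\<^esub>
          bracket (G_val X G) 2 (conj_form (Aut_val X G) (r i) (nu i)) (e i)
          \<boxminus>\<^bsub>G_val X G\<^esub> twisted_d (G_val X G) 2 (m' i) (n i)) R [p, q, w, z] \<and>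
        omega' i R [p, q, w, z] = (act_form (r i) (omega i) \<boxplus>\<^bsub>G_val X G\<^esub> bracket (G_val X G) 2 (nu' i) (e i)
          \<boxminus>\<^bsub>G_val X G\<^esub> twisted_d (G_val X G) 2
            (conj_form (Aut_val X G) (r i) (m i) \<boxplus>\<^bsub>Aut_val X G\<^esub> u_du_inv (Aut_val X G) (r i)) (n i)) R [p, q, w, z]"
      if R: "cring R" and s: "s \<in> pts S R" and A: "nearby (U i) R s {p, q, w, z}" for R s p q w z
      using curvature_form_change[OF U[OF i] F[OF i] F'[OF i] C[OF i] n[OF i] Cn[OF i] R s A]
        curvature_form_change'[OF U[OF i] F[OF i] F'[OF i] C[OF i] n[OF i] Cn[OF i] R s A]
        form_values[OF A, of p] nu_value[OF i R s A, of p]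
      by (simp add: omega[OF i] twisted_d_two[OF A R s] fadd_def fsub_def fneg_def act_form_def bracket_def
          conj_form_def u_du_inv_def)
    show "form_eq X 3 (U i) (omega' i)
       (act_form (r i) (omega i) \<boxplus>\<^bsub>G_val X G\<^esub> bracket (G_val X G) 2 (conj_form (Aut_val X G) (r i) (nu i)) (e i)
          \<boxminus>\<^bsub>G_val X G\<^esub> twisted_d (G_val X G) 2 (m' i) (n i))"
      by (rule form_eq_degree(3)[OF Us[OF i]]) (use val in blast)
    show "form_eq X 3 (U i) (omega' i)
       (act_form (r i) (omega i) \<boxplus>\<^bsub>G_val X G\<^esub> bracket (G_val X G) 2 (nu' i) (e i)
          \<boxminus>\<^bsub>G_val X G\<^esub> twisted_d (G_val X G) 2
            (conj_form (Aut_val X G) (r i) (m i) \<boxplus>\<^bsub>Aut_val X G\<^esub> u_du_inv (Aut_val X G) (r i)) (n i))"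
      by (rule form_eq_degree(3)[OF Us[OF i]]) (use val in blast)
  qed
  show ?thesis
    unfolding Let_def by (intro conjI ballI 1 2 3 4 5 6 7)
qed

end
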